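(* Let $m>0$ and let $\alpha,\beta$ be any real numbers. Then the following relations hold. First, $$\left\||x|^{\beta-1}|D_x|^{\beta}e^{it|D_x|^2}\varphi\right\|_{L^2(\mathbb{R}_t\times\mathbb{R}^n_x)}=\sqrt{\frac m2}\,\left\||x|^{\beta-1}|D_x|^{m/2+\beta-1}e^{it|D_x|^m}\varphi\right\|_{L^2(\mathbb{R}_t\times\mathbb{R}^n_x)},$$ where the left and the right hand sides are finite for the same values of the parameters at the same time. Second, for $\alpha\leq m/2$, $$\left\|\langle x\rangle^{\alpha-m/2}|D_x|^\alpha e^{it|D_x|^m}\varphi(x)\right\|_{L^2(\mathbb{R}_t\times\mathbb{R}^n_x)}\leq\left\||x|^{\alpha-m/2}|D_x|^\alpha e^{it|D_x|^m}\varphi(x)\right\|_{L^2(\mathbb{R}_t\times\mathbb{R}^n_x)}\leq\sup_{\lambda>0}\left\|\langle x\rangle^{\alpha-m/2}|D_x|^\alpha e^{it|D_x|^m}\varphi_\lambda(x)\right\|_{L^2(\mathbb{R}_t\times\mathbb{R}^n_x)},$$ where $\varphi_\lambda(x)=\lambda^{n/2}\varphi(\lambda x)$. Finally, the operator norms of the operators $\langle x\rangle^{\alpha-m/2}|D_x|^\alpha e^{it|D_x|^m}$ and $|x|^{\alpha-m/2}|D_x|^\alpha e^{it|D_x|^m}$ as mappings from $L^2(\mathbb{R}^n)$ to $L^2(\mathbb{R}_t\times\mathbb{R}^n_x)$ are equal.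
   Context: Notation: $\langle x\rangle=(1+|x|^2)^{1/2}$; $D_x=(D_1,\ldots,D_n)$ with $D_j=\frac1i\frac{\partial}{\partial x_j}$; $|D_x|^s$ and $e^{it|D_x|^m}$ are the Fourier multipliers on $\mathbb{R}^n$ with symbols $|\xi|^s$ and $e^{it|\xi|^m}$. The operators in the last assertion send $\varphi$ to the function of $(t,x)$ given by the corresponding expression applied to $\varphi$. The function $\varphi$ on $\mathbb{R}^n$ is an arbitrary initial datum (the paper does not specify its class). *)

theory Defs
  imports "HOL-Analysis.Analysis"
begin

text \<open>
  The space \<open>\<real>\<^sup>n\<close> is an arbitrary Euclidean space \<open>'a\<close> with \<open>n = DIM('a)\<close>. Functions stand for their
  classes modulo null sets, so the values \<open>0 powr s = 0\<close> of the symbols and weights at the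
  origin are immaterial.
\<close>

text \<open>Coinductively: all iterated partial derivatives exist and are differentiable and rapidly
  decreasing.\<close>

coinductive schwartz :: "('a::euclidean_space \<Rightarrow> complex) \<Rightarrow> bool" where
  "\<lbrakk>\<And>x. \<psi> differentiable (at x);
    \<And>N::nat. bounded (range (\<lambda>x. (1 + (norm x)\<^sup>2) ^ N *\<^sub>R \<psi> x));
    \<And>b. b \<in> Basis \<Longrightarrow> schwartz (\<lambda>x. frechet_derivative \<psi> (at x) b)\<rbrakk>
   \<Longrightarrow> schwartz \<psi>"

definition fourier_integral :: "('a::euclidean_space \<Rightarrow> complex) \<Rightarrow> 'a \<Rightarrow> complex" where
  "fourier_integral \<psi> \<xi> = (LINT x|lborel. cis (- (x \<bullet> \<xi>)) * \<psi> x)"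

text \<open>Functions that define a tempered distribution by integration.\<close>

definition tempered :: "('a::euclidean_space \<Rightarrow> complex) \<Rightarrow> bool" where
  "tempered f \<longleftrightarrow> f \<in> borel_measurable lborel \<and>
     (\<exists>N::nat. integrable lborel (\<lambda>x. f x /\<^sub>R (1 + (norm x)\<^sup>2) ^ N))"

text \<open>\<open>g\<close> is the Fourier transform of \<open>f\<close> in the sense of tempered distributions. Every
  \<open>f \<in> L\<^sup>2\<close> has such a \<open>g\<close>; in general \<open>g\<close> is unique up to a null set if it exists.\<close>

definition has_fourier :: "('a::euclidean_space \<Rightarrow> complex) \<Rightarrow> ('a \<Rightarrow> complex) \<Rightarrow> bool" where
  "has_fourier f g \<longleftrightarrow> tempered f \<and> tempered g \<and>
     (\<forall>\<psi>. schwartz \<psi> \<longrightarrow>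
        (LINT \<xi>|lborel. g \<xi> * \<psi> \<xi>) = (LINT x|lborel. f x * fourier_integral \<psi> x))"

text \<open>With \<open>D = - i \<partial>\<close> the multiplier \<open>a(D)\<close> multiplies Fourier transforms by \<open>a(\<xi>)\<close>.
  \<open>has_multiplier a \<phi> f\<close> says that the distribution \<open>a(D)\<phi>\<close> is the function \<open>f\<close>.\<close>

definition has_multiplier ::
    "('a::euclidean_space \<Rightarrow> complex) \<Rightarrow> ('a \<Rightarrow> complex) \<Rightarrow> ('a \<Rightarrow> complex) \<Rightarrow> bool" where
  "has_multiplier a \<phi> f \<longleftrightarrow> (\<exists>g. has_fourier \<phi> g \<and> has_fourier f (\<lambda>\<xi>. a \<xi> * g \<xi>))"

text \<open>The data for which \<open>|D|\<^sup>s \<phi>\<close>, and hence \<open>|D|\<^sup>s exp(i t |D|\<^sup>m) \<phi>\<close>, makes sense as a tempered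
  distribution: no integrability beyond that is required of the product \<open>|\<xi>|\<^sup>s g\<close>, so that for
  \<open>\<phi> \<in> L\<^sup>2\<close> the only condition is integrability of \<open>|\<xi>|\<^sup>s g\<close> near the origin (automatic if
  \<open>s > - n/2\<close>).\<close>

definition abs_D_defined :: "real \<Rightarrow> ('a::euclidean_space \<Rightarrow> complex) \<Rightarrow> bool" where
  "abs_D_defined s \<phi> \<longleftrightarrow>
     (\<exists>g. has_fourier \<phi> g \<and> tempered (\<lambda>\<xi>. of_real (norm \<xi> powr s) * g \<xi>))"

text \<open>The family of distributions \<open>|D|\<^sup>s exp(i t |D|\<^sup>m) \<phi>\<close> is given by the function \<open>u\<close> of \<open>(t, x)\<close>.\<close>

definition is_evolution ::
    "real \<Rightarrow> real \<Rightarrow> ('a::euclidean_space \<Rightarrow> complex) \<Rightarrow> (real \<times> 'a \<Rightarrow> complex) \<Rightarrow> bool" where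
  "is_evolution s m \<phi> u \<longleftrightarrow> u \<in> borel_measurable lborel \<and>
     (AE t in lborel. has_multiplier
        (\<lambda>\<xi>. of_real (norm \<xi> powr s) * cis (t * norm \<xi> powr m)) \<phi> (\<lambda>x. u (t, x)))"

definition L2_norm :: "'b measure \<Rightarrow> ('b \<Rightarrow> complex) \<Rightarrow> ennreal" where
  "L2_norm M f = (let I = (\<integral>\<^sup>+ z. ennreal ((norm (f z))\<^sup>2) \<partial>M)
                  in if I = \<infinity> then \<infinity> else ennreal (sqrt (enn2real I)))"

text \<open>The \<open>L\<^sup>2(\<real>\<^sub>t \<times> \<real>\<^sup>n\<^sub>x)\<close> norm of \<open>w(x) |D|\<^sup>s exp(i t |D|\<^sup>m) \<phi>\<close>. Since \<open>u\<close> is unique up to a null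
  set, the infimum only serves to assign \<open>\<infinity>\<close> to distributions that are not functions.\<close>

definition evolution_norm ::
    "('a::euclidean_space \<Rightarrow> real) \<Rightarrow> real \<Rightarrow> real \<Rightarrow> ('a \<Rightarrow> complex) \<Rightarrow> ennreal" where
  "evolution_norm w s m \<phi> =
     (INF u \<in> {u. is_evolution s m \<phi> u}.
        L2_norm lborel (\<lambda>(t, x). of_real (w x) * u (t, x)))"

text \<open>Norm of the operator from \<open>L\<^sup>2(\<real>\<^sup>n)\<close> to \<open>L\<^sup>2(\<real>\<^sub>t \<times> \<real>\<^sup>n\<^sub>x)\<close>, \<open>\<infinity>\<close> if unbounded. Its domain is all of
  \<open>L\<^sup>2(\<real>\<^sup>n)\<close> if \<open>s > - n/2\<close> and a dense subspace otherwise.\<close>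

definition evolution_opnorm ::
    "('a::euclidean_space \<Rightarrow> real) \<Rightarrow> real \<Rightarrow> real \<Rightarrow> ennreal" where
  "evolution_opnorm w s m =
     (SUP \<phi> \<in> {\<phi>. \<phi> \<in> borel_measurable lborel \<and> L2_norm lborel \<phi> \<le> 1 \<and> abs_D_defined s \<phi>}.
        evolution_norm w s m \<phi>)"

definition abs_weight :: "real \<Rightarrow> 'a::euclidean_space \<Rightarrow> real" where
  "abs_weight \<gamma> x = norm x powr \<gamma>"

definition jap_weight :: "real \<Rightarrow> 'a::euclidean_space \<Rightarrow> real" where
  "jap_weight \<gamma> x = sqrt (1 + (norm x)\<^sup>2) powr \<gamma>"

definition dilate :: "real \<Rightarrow> ('a::euclidean_space \<Rightarrow> complex) \<Rightarrow> 'a \<Rightarrow> complex" where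
  "dilate l \<phi> x = of_real (l powr (real DIM('a) / 2)) * \<phi> (l *\<^sub>R x)"

end

theory Submission
  imports Defs "HOL-Probability.Probability" "HOL-Real_Asymp.Real_Asymp"
begin

text \<open>Let \<open>g\<close> be the Fourier transform of \<open>\<phi>\<close>, and fix a point \<open>x\<close>. As a function of \<open>t\<close>, the evolution
  \<open>|D|\<^sup>s exp(i t |D|\<^sup>m) \<phi>\<close> at \<open>x\<close> is up to a constant the integral of \<open>r\<^sup>s f(r) exp(i t r\<^sup>m)\<close> over
  \<open>r > 0\<close>, where \<open>f(r)\<close> is the integral of \<open>g(\<xi>) exp(i x \<bullet> \<xi>)\<close> over the sphere \<open>|\<xi>| = r\<close>. In the variable
  \<open>\<tau> = r\<^sup>m\<close> this is a Fourier integral on the line, so Plancherel in \<open>t\<close> turns its square norm into a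
  constant times \<open>1/m\<close> times the integral of \<open>r powr (2 s - m + 1) * |f(r)|\<^sup>2\<close>. The parameters enter only through
  the factor \<open>1/m\<close> and the difference \<open>s - m/2\<close>. Multiplying by a weight in \<open>x\<close> and integrating, the
  weighted norms of two evolutions with the same \<open>s - m/2\<close> have the ratio of the square roots of the
  \<open>m\<close>. This is the first identity (\<open>radial_plancherel\<close>, \<open>radial_isometry\<close>, \<open>evolution_norm_transfer\<close>).

  The computation needs absolutely convergent integrals, and a datum is only a tempered function.
  It is therefore made after multiplying \<open>g\<close> by \<open>exp(- e |\<xi>| powr (2 m) / 2)\<close>. On an evolution of order \<open>m\<close>
  this cutoff acts as convolution in time with a Gaussian of variance \<open>e\<close>, hence does not increase
  any norm with a weight in \<open>x\<close> (\<open>time_mollified_evolution\<close>, \<open>regularized_energy_le\<close>). By the radial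
  formula and \<open>(1 - c)\<^sup>2 + c\<^sup>2 \<le> 1\<close> for \<open>0 \<le> c \<le> 1\<close>, the energy of the difference of two
  regularizations is at most the difference of their energies
  (\<open>regularized_energy_superadditive\<close>). These energies increase to a finite limit as \<open>e\<close> decreases
  to 0, so the regularizations of the evolution with the other parameters form a Cauchy sequence in the weighted
  space. When the exponent of the weight is \<open>\<gamma> \<le> 0\<close>, that space consists of tempered functions, and
  the limit is the other evolution (\<open>evolution_transfer_nonincreasing_weight\<close>).

  For \<open>\<gamma> > 0\<close> a finite norm forces \<open>g = 0\<close> almost everywhere
  (\<open>growing_weight_finite_energy_imp_zero\<close>). Indeed \<open>(1 - exp(- |x|\<^sup>2 / 2))\<^sup>k \<le> |x| powr \<gamma>\<close> if
  \<open>\<gamma> \<le> 2 k\<close>, so the product of the evolution with the left-hand side is square integrable. Its transform is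
  \<open>|\<xi>|\<^sup>s g(\<xi>) exp(i t |\<xi>|\<^sup>m)\<close> plus a combination of mollifications of this function in \<open>\<xi>\<close>. At a fixed \<open>\<xi>\<close>
  the mollifications have mean square 0 over long times, since they are oscillatory integrals in \<open>t\<close>, and so does a square integrable
  function of \<open>t\<close>; but the first term has constant modulus.

  The second chain of inequalities holds because \<open>\<langle>x\<rangle> powr \<gamma> \<le> |x| powr \<gamma>\<close> for \<open>\<gamma> \<le> 0\<close>, and because the
  norm of the evolution of \<open>\<phi>\<^sub>\<lambda>\<close> with weight \<open>\<langle>x\<rangle> powr \<gamma>\<close>, \<open>\<gamma> = \<alpha> - m/2\<close>, is the norm of the evolution of \<open>\<phi>\<close> with
  weight \<open>(\<lambda>\<^sup>2 + |x|\<^sup>2) powr (\<gamma>/2)\<close>, which tends to \<open>|x| powr \<gamma>\<close> as \<open>\<lambda> \<rightarrow> 0\<close>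
  (\<open>energy_dilate\<close>, \<open>abs_weight_norm_le_SUP_dilations\<close>). Dilations preserve the unit ball of \<open>L\<^sup>2\<close>, so
  the operator norms agree if \<open>\<alpha> \<le> m/2\<close> (\<open>opnorm_weights_agree\<close>); if \<open>\<alpha> > m/2\<close> both are infinite, as
  the evolution of a Gaussian shows (\<open>growing_weight_opnorm_infinite\<close>).

  Tempered distributional transforms are handled by testing with translated Gaussians alone:
  the relation between a function and its transform \<open>g\<close> is equivalent to a formula for all the
  Gaussian mollifications of \<open>g\<close> (\<open>has_fourier_mollify\<close>, \<open>has_fourierI\<close>). Uniqueness in both directions then follows from the
  almost everywhere convergence of mollifications (\<open>mollify_AE_subsequence\<close>) and from Plancherel's
  theorem for integrable functions (\<open>plancherel\<close>).\<close>

section \<open>Square integrals and quadratic weights\<close>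

abbreviation sq_integral :: "('a::euclidean_space \<Rightarrow> complex) \<Rightarrow> ennreal" where
  "sq_integral f \<equiv> (\<integral>\<^sup>+x. ennreal ((norm (f x))\<^sup>2) \<partial>lborel)"

abbreviation weighted_sq_integral :: "real \<Rightarrow> ('a::euclidean_space \<Rightarrow> complex) \<Rightarrow> ennreal" where
  "weighted_sq_integral \<gamma> f \<equiv> (\<integral>\<^sup>+x. ennreal ((norm x powr \<gamma> * norm (f x))\<^sup>2) \<partial>lborel)"

abbreviation bsq :: "'a::real_normed_vector \<Rightarrow> real" where
  "bsq x \<equiv> 1 + (norm x)\<^sup>2"

lemma bsq_pos [simp]: "0 < bsq x"
  by (simp add: add_pos_nonneg)

lemma bsq_nz [simp]: "bsq x \<noteq> 0"
  using bsq_pos[of x] by linarith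

lemma bsq_mono: "norm x \<le> norm y \<Longrightarrow> bsq x \<le> bsq y"
  by (simp add: power_mono)

text \<open>Peetre's inequality, through which a Gaussian centred at one point is bounded by polynomial
  weights at another.\<close>

lemma bsq_triangle: "bsq (x + y) \<le> 2 * bsq x * bsq y"
proof -
  have "(norm (x + y))\<^sup>2 \<le> (norm x + norm y)\<^sup>2"
    by (simp add: norm_triangle_ineq power_mono)
  also have "\<dots> \<le> 2 * (norm x)\<^sup>2 + 2 * (norm y)\<^sup>2"
    using sum_squares_bound[of "norm x" "norm y"] by (simp add: power2_eq_square algebra_simps)
  finally have "(norm (x + y))\<^sup>2 \<le> 2 * (norm x)\<^sup>2 + 2 * (norm y)\<^sup>2" .
  moreover have "0 \<le> 2 * (norm x)\<^sup>2 * (norm y)\<^sup>2" by simp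
  ultimately have "(norm (x + y))\<^sup>2 \<le> 1 + (2 * (norm x)\<^sup>2 + 2 * (norm y)\<^sup>2 + 2 * (norm x)\<^sup>2 * (norm y)\<^sup>2)"
    by linarith
  then show ?thesis by (simp add: algebra_simps)
qed

lemma bsq_triangle_power: "bsq (x + y) ^ N \<le> 2 ^ N * bsq x ^ N * bsq y ^ N"
proof -
  have "bsq (x + y) ^ N \<le> (2 * bsq x * bsq y) ^ N"
    by (intro power_mono bsq_triangle) (simp add: add_nonneg_nonneg)
  then show ?thesis by (simp only: power_mult_distrib)
qed

lemma bsq_power_ge_1: "1 \<le> bsq x ^ N"
  by (simp add: one_le_power)

lemma bsq_power_pos [simp]: "0 < bsq x ^ N"
  by simp

section \<open>Affine substitution\<close>

lemma cis_measurable [measurable]: "cis \<in> borel_measurable borel"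
  by (intro borel_measurable_continuous_onI continuous_intros)

lemma complex_of_real_measurable [measurable]: "complex_of_real \<in> borel_measurable borel"
  by (intro borel_measurable_continuous_onI continuous_intros)

lemma
  fixes f :: "'a::euclidean_space \<Rightarrow> 'b::{banach, second_countable_topology}"
  assumes c: "c \<noteq> 0" and [measurable]: "f \<in> borel_measurable borel"
  shows lborel_integral_affine:
      "(LINT x|lborel. f x) = \<bar>c\<bar> ^ DIM('a) *\<^sub>R (LINT x|lborel. f (t + c *\<^sub>R x))"
    and lborel_integrable_affine:
      "integrable lborel (\<lambda>x. f (t + c *\<^sub>R x)) \<longleftrightarrow> integrable lborel f"
proof -
  have "(LINT x|lborel. f x) = (LINT x|density (distr lborel borel (\<lambda>x. t + c *\<^sub>R x)) (\<lambda>_. \<bar>c\<bar>^DIM('a)). f x)"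
    using lborel_affine[OF c, of t] by simp
  also have "\<dots> = (LINT x|distr lborel borel (\<lambda>x. t + c *\<^sub>R x). (\<bar>c\<bar>^DIM('a)) *\<^sub>R f x)"
    by (rule integral_density) auto
  also have "\<dots> = (LINT x|lborel. (\<bar>c\<bar>^DIM('a)) *\<^sub>R f (t + c *\<^sub>R x))"
    by (rule integral_distr) auto
  finally show "(LINT x|lborel. f x) = \<bar>c\<bar> ^ DIM('a) *\<^sub>R (LINT x|lborel. f (t + c *\<^sub>R x))"
    by simp
  have "integrable lborel f \<longleftrightarrow> integrable (density (distr lborel borel (\<lambda>x. t + c *\<^sub>R x)) (\<lambda>_. \<bar>c\<bar>^DIM('a))) f"
    using lborel_affine[OF c, of t] by simp
  also have "\<dots> \<longleftrightarrow> integrable (distr lborel borel (\<lambda>x. t + c *\<^sub>R x)) (\<lambda>x. (\<bar>c\<bar>^DIM('a)) *\<^sub>R f x)"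
    by (rule integrable_density) auto
  also have "\<dots> \<longleftrightarrow> integrable lborel (\<lambda>x. (\<bar>c\<bar>^DIM('a)) *\<^sub>R f (t + c *\<^sub>R x))"
    by (rule integrable_distr_eq) auto
  also have "\<dots> \<longleftrightarrow> integrable lborel (\<lambda>x. f (t + c *\<^sub>R x))"
    using c integrable_scaleR_right[of "inverse (\<bar>c\<bar>^DIM('a))" lborel "\<lambda>x. (\<bar>c\<bar>^DIM('a)) *\<^sub>R f (t + c *\<^sub>R x)"]
    by (auto simp: scaleR_scaleR)
  finally show "integrable lborel (\<lambda>x. f (t + c *\<^sub>R x)) \<longleftrightarrow> integrable lborel f" by simp
qed

lemma lborel_nn_integral_affine:
  fixes f :: "'a::euclidean_space \<Rightarrow> ennreal"
  assumes c: "c \<noteq> 0" and [measurable]: "f \<in> borel_measurable borel"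
  shows "(\<integral>\<^sup>+x. f x \<partial>lborel) = ennreal (\<bar>c\<bar> ^ DIM('a)) * (\<integral>\<^sup>+x. f (t + c *\<^sub>R x) \<partial>lborel)"
proof -
  have "(\<integral>\<^sup>+x. f x \<partial>lborel) = (\<integral>\<^sup>+x. f x \<partial>density (distr lborel borel (\<lambda>x. t + c *\<^sub>R x)) (\<lambda>_. \<bar>c\<bar>^DIM('a)))"
    using lborel_affine[OF c, of t] by simp
  then show ?thesis
    by (simp add: nn_integral_density nn_integral_distr nn_integral_cmult)
qed

lemma
  fixes f :: "'a::euclidean_space \<Rightarrow> 'b::{banach, second_countable_topology}"
  assumes [measurable]: "f \<in> borel_measurable borel"
  shows lborel_integral_translate: "(LINT x|lborel. f (x + t)) = (LINT x|lborel. f x)"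
    and lborel_integrable_translate: "integrable lborel (\<lambda>x. f (x + t)) \<longleftrightarrow> integrable lborel f"
    and lborel_integral_reflect: "(LINT x|lborel. f (t - x)) = (LINT x|lborel. f x)"
  using lborel_integral_affine[of 1 f t] lborel_integrable_affine[of 1 f t]
    lborel_integral_affine[of "-1" f t]
  by (simp_all add: add.commute)

lemma
  fixes f :: "'a::euclidean_space \<Rightarrow> ennreal"
  assumes [measurable]: "f \<in> borel_measurable borel"
  shows lborel_nn_integral_translate: "(\<integral>\<^sup>+x. f (x + t) \<partial>lborel) = (\<integral>\<^sup>+x. f x \<partial>lborel)"
    and lborel_nn_integral_reflect: "(\<integral>\<^sup>+x. f (t - x) \<partial>lborel) = (\<integral>\<^sup>+x. f x \<partial>lborel)"
  using lborel_nn_integral_affine[of 1 f t] lborel_nn_integral_affine[of "-1" f t]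
  by (simp_all add: add.commute)

section \<open>The Gaussian kernel\<close>

text \<open>Lebesgue measure is the image of a product measure over the basis, so Fubini applies to
  products of functions of one coordinate each.\<close>

lemma
  fixes f :: "'a::euclidean_space \<Rightarrow> real \<Rightarrow> 'b::{real_normed_field, banach, second_countable_topology}"
  assumes f: "\<And>b. b \<in> Basis \<Longrightarrow> integrable lborel (f b)"
  shows lborel_integral_prod: "(LINT x|lborel. (\<Prod>b\<in>Basis. f b (x \<bullet> b))) = (\<Prod>b\<in>Basis. (LINT x|lborel. f b x))"
    and lborel_integrable_prod: "integrable lborel (\<lambda>x. (\<Prod>b\<in>Basis. f b (x \<bullet> b)))"
proof -
  interpret product_sigma_finite "\<lambda>b::'a. lborel :: real measure" ..
  have [measurable]: "f b \<in> borel_measurable borel" if "b \<in> Basis" for b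
    using borel_measurable_integrable[OF f[OF that]] by simp
  have eq: "(\<Prod>b\<in>Basis. f b ((\<Sum>i\<in>Basis. w i *\<^sub>R i) \<bullet> b)) = (\<Prod>b\<in>Basis. f b (w b))" for w
    by (intro prod.cong) simp_all
  have "(LINT x|lborel. (\<Prod>b\<in>Basis. f b (x \<bullet> b))) = (LINT w|(\<Pi>\<^sub>M b\<in>Basis. lborel). (\<Prod>b\<in>Basis. f b (w b)))"
    by (subst lborel_eq, subst integral_distr) (simp_all add: eq)
  also have "\<dots> = (\<Prod>b\<in>Basis. (LINT x|lborel. f b x))"
    by (rule product_integral_prod) (auto intro: f)
  finally show "(LINT x|lborel. (\<Prod>b\<in>Basis. f b (x \<bullet> b))) = (\<Prod>b\<in>Basis. (LINT x|lborel. f b x))" .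
  have "integrable (\<Pi>\<^sub>M b\<in>Basis. lborel) (\<lambda>w. (\<Prod>b\<in>Basis. f b (w b)))"
    by (rule product_integrable_prod) (auto intro: f)
  then show "integrable lborel (\<lambda>x. (\<Prod>b\<in>Basis. f b (x \<bullet> b)))"
    by (subst lborel_eq, subst integrable_distr_eq) (simp_all add: eq)
qed

text \<open>The density of the centred normal distribution with covariance \<open>\<epsilon>\<close> times the identity, that
  is, the heat kernel at time \<open>\<epsilon>/2\<close>.\<close>

definition heat_kernel :: "real \<Rightarrow> 'a::euclidean_space \<Rightarrow> real" where
  "heat_kernel \<epsilon> x = (1 / sqrt (2 * pi * \<epsilon>)) ^ DIM('a) * exp (- (norm x)\<^sup>2 / (2 * \<epsilon>))"

lemma heat_kernel_measurable [measurable]: "heat_kernel \<epsilon> \<in> borel_measurable borel"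
  unfolding heat_kernel_def by measurable

lemma heat_kernel_minus [simp]: "heat_kernel \<epsilon> (- x) = heat_kernel \<epsilon> x"
  by (simp add: heat_kernel_def)

lemma heat_kernel_commute: "heat_kernel \<epsilon> (x - y) = heat_kernel \<epsilon> (y - x)"
  by (metis heat_kernel_minus minus_diff_eq)

lemma heat_kernel_nonneg [simp]: "0 \<le> \<epsilon> \<Longrightarrow> 0 \<le> heat_kernel \<epsilon> x"
  by (simp add: heat_kernel_def)

lemma heat_kernel_scale:
  fixes x :: "'a::euclidean_space"
  assumes "0 < \<epsilon>"
  shows "heat_kernel \<epsilon> (sqrt \<epsilon> *\<^sub>R x) = heat_kernel 1 x / sqrt \<epsilon> ^ DIM('a)"
  using assms by (simp add: heat_kernel_def power_mult_distrib real_sqrt_mult power_one_over field_simps)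

lemma heat_kernel_1_prod: "heat_kernel 1 x = (\<Prod>b\<in>Basis. std_normal_density (x \<bullet> b))"
proof -
  have "(norm x)\<^sup>2 = (\<Sum>b\<in>Basis. (x \<bullet> b)\<^sup>2)"
    unfolding power2_norm_eq_inner by (subst euclidean_inner) (simp add: power2_eq_square)
  then have "exp (- (norm x)\<^sup>2 / 2) = (\<Prod>b\<in>Basis. exp (- (x \<bullet> b)\<^sup>2 / 2))"
    by (simp add: exp_sum[symmetric] sum_negf sum_divide_distrib)
  then show ?thesis
    by (simp add: heat_kernel_def std_normal_density_def prod.distrib power_one_over prod_dividef)
qed

text \<open>The Gaussian splits into coordinates, and the transform of each factor is the
  characteristic function of the standard normal distribution.\<close>

lemma heat_kernel_1_fourier:
  fixes y :: "'a::euclidean_space"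
  shows "integrable lborel (\<lambda>x. cis (x \<bullet> y) * of_real (heat_kernel 1 x))"
    and "(LINT x|lborel. cis (x \<bullet> y) * of_real (heat_kernel 1 x)) = of_real (exp (- (norm y)\<^sup>2 / 2))"
proof -
  define f where "f b s = cis (s * (y \<bullet> b)) * complex_of_real (std_normal_density s)" for b s
  have eq: "cis (x \<bullet> y) * of_real (heat_kernel 1 x) = (\<Prod>b\<in>Basis. f b (x \<bullet> b))" for x
  proof -
    have "cis (x \<bullet> y) = (\<Prod>b\<in>Basis. cis ((x \<bullet> b) * (y \<bullet> b)))"
      by (subst euclidean_inner) (simp add: cis_conv_exp sum_distrib_left exp_sum[symmetric])
    then show ?thesis
      by (simp add: f_def heat_kernel_1_prod prod.distrib)
  qed
  have int: "integrable lborel (f b)" for b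
  proof -
    have "integrable lborel (\<lambda>s. complex_of_real (std_normal_density s))"
      using integrable_normal_density[of 1 0] by (intro integrable_of_real) simp
    then show ?thesis
      unfolding f_def
      by (rule Bochner_Integration.integrable_bound) (auto simp: norm_mult f_def)
  qed
  have val: "(LINT s|lborel. f b s) = of_real (exp (- (y \<bullet> b)\<^sup>2 / 2))" for b
  proof -
    have "(LINT s|lborel. f b s) = (LINT s|density lborel std_normal_density. iexp ((y \<bullet> b) * s))"
      unfolding f_def by (subst integral_density) (auto simp: cis_conv_exp scaleR_conv_of_real mult_ac)
    also have "\<dots> = of_real (exp (- (y \<bullet> b)\<^sup>2 / 2))"
      using char_std_normal_distribution by (simp add: char_def fun_eq_iff)
    finally show ?thesis .
  qed
  show "integrable lborel (\<lambda>x. cis (x \<bullet> y) * of_real (heat_kernel 1 x))"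
    unfolding eq by (rule lborel_integrable_prod) (rule int)
  have "(LINT x|lborel. cis (x \<bullet> y) * of_real (heat_kernel 1 x)) = (\<Prod>b\<in>Basis. complex_of_real (exp (- (y \<bullet> b)\<^sup>2 / 2)))"
    unfolding eq by (subst lborel_integral_prod) (auto simp: int val)
  also have "\<dots> = of_real (exp (- (norm y)\<^sup>2 / 2))"
  proof -
    have "(norm y)\<^sup>2 = (\<Sum>b\<in>Basis. (y \<bullet> b)\<^sup>2)"
      unfolding power2_norm_eq_inner by (subst euclidean_inner) (simp add: power2_eq_square)
    then show ?thesis
      by (simp add: of_real_prod[symmetric] exp_sum[symmetric] sum_negf sum_divide_distrib del: of_real_prod)
  qed
  finally show "(LINT x|lborel. cis (x \<bullet> y) * of_real (heat_kernel 1 x)) = of_real (exp (- (norm y)\<^sup>2 / 2))" .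
qed

lemma
  fixes y :: "'a::euclidean_space"
  assumes e: "0 < \<epsilon>"
  shows heat_kernel_fourier_integrable: "integrable lborel (\<lambda>x. cis (x \<bullet> y) * of_real (heat_kernel \<epsilon> x))"
    and heat_kernel_fourier: "(LINT x|lborel. cis (x \<bullet> y) * of_real (heat_kernel \<epsilon> x)) = of_real (exp (- \<epsilon> * (norm y)\<^sup>2 / 2))"
proof -
  define f where "f x = cis (x \<bullet> y) * complex_of_real (heat_kernel \<epsilon> x)" for x :: 'a
  have c: "sqrt \<epsilon> \<noteq> 0" using e by simp
  have [measurable]: "f \<in> borel_measurable borel" unfolding f_def by measurable
  have eq: "f (0 + sqrt \<epsilon> *\<^sub>R x) = inverse (sqrt \<epsilon> ^ DIM('a)) *\<^sub>R (cis (x \<bullet> (sqrt \<epsilon> *\<^sub>R y)) * of_real (heat_kernel 1 x))" for x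
    using e by (simp add: f_def heat_kernel_scale scaleR_conv_of_real divide_simps)
  show "integrable lborel (\<lambda>x. cis (x \<bullet> y) * of_real (heat_kernel \<epsilon> x))"
  proof -
    have "integrable lborel (\<lambda>x. f (0 + sqrt \<epsilon> *\<^sub>R x))"
      unfolding eq by (intro integrable_scaleR_right heat_kernel_1_fourier(1))
    then have "integrable lborel f"
      using lborel_integrable_affine[OF c, of f 0] by simp
    then show ?thesis unfolding f_def .
  qed
  have "(LINT x|lborel. f x) = (LINT x|lborel. cis (x \<bullet> (sqrt \<epsilon> *\<^sub>R y)) * of_real (heat_kernel 1 x))"
    using lborel_integral_affine[OF c, of f 0] c e unfolding eq by simp
  also have "\<dots> = of_real (exp (- (norm (sqrt \<epsilon> *\<^sub>R y))\<^sup>2 / 2))"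
    by (rule heat_kernel_1_fourier(2))
  also have "(norm (sqrt \<epsilon> *\<^sub>R y))\<^sup>2 = \<epsilon> * (norm y)\<^sup>2"
    using e by (simp add: power_mult_distrib)
  finally show "(LINT x|lborel. cis (x \<bullet> y) * of_real (heat_kernel \<epsilon> x)) = of_real (exp (- \<epsilon> * (norm y)\<^sup>2 / 2))"
    unfolding f_def by simp
qed

lemma
  assumes "0 < \<epsilon>"
  shows heat_kernel_integrable: "integrable lborel (heat_kernel \<epsilon> :: 'a::euclidean_space \<Rightarrow> real)"
    and heat_kernel_integral: "(LINT x|lborel. heat_kernel \<epsilon> (x::'a)) = 1"
proof -
  have "integrable lborel (\<lambda>x::'a. complex_of_real (heat_kernel \<epsilon> x))"
    using heat_kernel_fourier_integrable[OF assms, of 0] by simp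
  then show "integrable lborel (heat_kernel \<epsilon> :: 'a::euclidean_space \<Rightarrow> real)"
    by (simp add: complex_of_real_integrable_eq)
  have "complex_of_real (LINT x|lborel. heat_kernel \<epsilon> (x::'a)) = of_real 1"
    using heat_kernel_fourier[OF assms, of "0::'a"] by simp
  then show "(LINT x|lborel. heat_kernel \<epsilon> (x::'a)) = 1"
    by (simp only: of_real_eq_iff)
qed

lemma heat_kernel_nn_integral:
  assumes "0 < \<epsilon>"
  shows "(\<integral>\<^sup>+x. ennreal (heat_kernel \<epsilon> (x::'a::euclidean_space)) \<partial>lborel) = 1"
  using assms by (subst nn_integral_eq_integral) (auto simp: heat_kernel_integrable heat_kernel_integral)

lemma heat_kernel_nn_integral_shift:
  assumes "0 < \<epsilon>"
  shows "(\<integral>\<^sup>+x. ennreal (heat_kernel \<epsilon> (x - (y::'a::euclidean_space))) \<partial>lborel) = 1"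
    and "(\<integral>\<^sup>+x. ennreal (heat_kernel \<epsilon> (y - x)) \<partial>lborel) = 1"
  using lborel_nn_integral_translate[of "\<lambda>x. ennreal (heat_kernel \<epsilon> x)" "-y"]
    lborel_nn_integral_reflect[of "\<lambda>x. ennreal (heat_kernel \<epsilon> x)" "y"] heat_kernel_nn_integral[OF assms, where 'a='a]
  by simp_all

section \<open>Tempered and rapidly decreasing functions\<close>

lemma power_over_fact_le_exp:
  fixes x :: real
  assumes "0 \<le> x"
  shows "x ^ k / fact k \<le> exp x"
  using sum_le_suminf[OF summable_exp[of x], of "{k}"] assms
  by (simp add: exp_def divide_inverse scaleR_conv_of_real mult.commute)

text \<open>For \<open>r \<ge> 1\<close> every power of \<open>r\<close> is at most a power of \<open>r powr q\<close>, which a single term of the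
  exponential series dominates.\<close>

lemma exp_beats_power:
  fixes q \<epsilon> :: real
  assumes "0 < q" "0 < \<epsilon>"
  obtains C where "0 < C" "\<And>r. 0 \<le> r \<Longrightarrow> (1 + r\<^sup>2) ^ N * exp (- \<epsilon> * r powr q) \<le> C"
proof -
  \<comment> \<open>This choice gives \<open>r ^ (2 N) \<le> (r powr q) ^ k\<close> for \<open>r \<ge> 1\<close>.\<close>
  obtain k :: nat where k: "2 * real N / q \<le> real k"
    using real_arch_simple by blast
  define C where "C = 2 ^ N * (1 + fact k / \<epsilon> ^ k)"
  have C: "2 ^ N \<le> C" "2 ^ N * (fact k / \<epsilon> ^ k) \<le> C"
    using assms unfolding C_def by (auto intro!: mult_left_mono simp: field_simps)
  have "(1 + r\<^sup>2) ^ N * exp (- \<epsilon> * r powr q) \<le> C" if r: "0 \<le> r" for r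
  proof (cases "r \<le> 1")
    case True
    have "(1 + r\<^sup>2) ^ N \<le> 2 ^ N"
      using True r by (intro power_mono) (auto simp: power_le_one)
    moreover have "exp (- \<epsilon> * r powr q) \<le> 1" using assms by simp
    ultimately have "(1 + r\<^sup>2) ^ N * exp (- \<epsilon> * r powr q) \<le> 2 ^ N * 1"
      by (intro mult_mono) auto
    then show ?thesis using C by simp
  next
    case False
    then have r1: "1 < r" by simp
    have "(1 + r\<^sup>2) ^ N \<le> (2 * r\<^sup>2) ^ N"
      using r1 by (intro power_mono) auto
    also have "\<dots> = 2 ^ N * r ^ (2 * N)"
      by (simp only: power_mult_distrib power_mult)
    also have "r ^ (2 * N) = r powr (2 * real N)"
      using r1 powr_realpow[of r "2 * N"] by simp
    also have "r powr (2 * real N) = (r powr q) powr (2 * real N / q)"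
      using assms r1 by (simp add: powr_powr)
    also have "\<dots> \<le> (r powr q) powr (real k)"
      using k r1 assms by (intro powr_mono) (auto simp: ge_one_powr_ge_zero)
    also have "\<dots> = (r powr q) ^ k" using r1 by (simp add: powr_realpow)
    finally have 1: "(1 + r\<^sup>2) ^ N \<le> 2 ^ N * (r powr q) ^ k" by simp
    have "(\<epsilon> * r powr q) ^ k / fact k \<le> exp (\<epsilon> * r powr q)"
      using assms by (intro power_over_fact_le_exp) auto
    then have 2: "(r powr q) ^ k * exp (- \<epsilon> * r powr q) \<le> fact k / \<epsilon> ^ k"
      using assms by (simp add: exp_minus field_simps power_mult_distrib)
    have "(1 + r\<^sup>2) ^ N * exp (- \<epsilon> * r powr q) \<le> 2 ^ N * (r powr q) ^ k * exp (- \<epsilon> * r powr q)"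
      using 1 by (intro mult_right_mono) auto
    also have "\<dots> \<le> 2 ^ N * (fact k / \<epsilon> ^ k)"
      using mult_left_mono[OF 2, of "2 ^ N"] by (simp add: mult.assoc)
    finally show ?thesis using C by simp
  qed
  moreover have "0 < C" using C(1) by (rule less_le_trans[rotated]) simp
  ultimately show ?thesis using that by blast
qed

text \<open>Each factor \<open>bsq x\<close> dominates \<open>1 + (x \<bullet> b)\<^sup>2\<close>, so one factor per basis vector suffices to
  compare with a product of one-dimensional Cauchy densities.\<close>

lemma weight_integrable:
  assumes N: "DIM('a) \<le> N"
  shows "integrable lborel (\<lambda>x::'a::euclidean_space. 1 / bsq x ^ N)"
proof -
  have 1: "integrable lborel (\<lambda>s::real. inverse (1 + s\<^sup>2))"
    using integrable_inverse_1_plus_square by (simp add: set_integrable_def einterval_def)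
  have int: "integrable lborel (\<lambda>x::'a. \<Prod>b\<in>Basis. inverse (1 + (x \<bullet> b)\<^sup>2))"
    by (rule lborel_integrable_prod) (rule 1)
  show ?thesis
  proof (rule Bochner_Integration.integrable_bound[OF int])
    have "(\<Prod>b\<in>Basis. 1 + (x \<bullet> b)\<^sup>2) \<le> bsq x ^ N" for x :: 'a
    proof -
      have "(\<Prod>b\<in>Basis. 1 + (x \<bullet> b)\<^sup>2) \<le> (\<Prod>b\<in>(Basis::'a set). bsq x)"
        by (intro prod_mono conjI) (auto simp: Basis_le_norm intro!: power_mono abs_le_square_iff[THEN iffD1])
      also have "\<dots> \<le> bsq x ^ N"
        using N by (auto intro!: power_increasing)
      finally show ?thesis .
    qed
    moreover have "0 < (\<Prod>b\<in>Basis. 1 + (x \<bullet> b)\<^sup>2)" for x :: 'a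
      by (intro prod_pos) (simp add: add_pos_nonneg)
    ultimately have "1 / bsq x ^ N \<le> (\<Prod>b\<in>Basis. inverse (1 + (x \<bullet> b)\<^sup>2))" for x :: 'a
      using prod_inversef[of "\<lambda>b. 1 + (x \<bullet> b)\<^sup>2" Basis] by (simp add: inverse_eq_divide o_def frac_le)
    then show "AE x::'a in lborel. norm (1 / bsq x ^ N) \<le> norm (\<Prod>b\<in>Basis. inverse (1 + (x \<bullet> b)\<^sup>2))"
      by (auto intro!: AE_I2 order_trans[OF _ abs_ge_self])
  qed measurable
qed

lemma tempered_exponent_mono:
  fixes f :: "'a::euclidean_space \<Rightarrow> complex"
  assumes f: "integrable lborel (\<lambda>x. f x /\<^sub>R bsq x ^ N)" and meas [measurable]: "f \<in> borel_measurable borel"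
    and N: "N \<le> M"
  shows "integrable lborel (\<lambda>x. f x /\<^sub>R bsq x ^ M)"
proof (rule Bochner_Integration.integrable_bound[OF f])
  show "AE x in lborel. norm (f x /\<^sub>R bsq x ^ M) \<le> norm (f x /\<^sub>R bsq x ^ N)"
  proof (intro AE_I2)
    fix x :: 'a
    have "bsq x ^ N \<le> bsq x ^ M" using N by (intro power_increasing) auto
    then have "inverse (bsq x ^ M) \<le> inverse (bsq x ^ N)" by (intro le_imp_inverse_le) auto
    then show "norm (f x /\<^sub>R bsq x ^ M) \<le> norm (f x /\<^sub>R bsq x ^ N)"
      by (simp add: mult_right_mono)
  qed
qed measurable

lemma tempered_measurable: "tempered f \<Longrightarrow> f \<in> borel_measurable borel"
  by (simp add: tempered_def)

text \<open>The polynomial weight of a tempered function can be enlarged, in particular beyond the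
  dimension, where the weight itself is integrable.\<close>

lemma tempered_exponent:
  fixes f :: "'a::euclidean_space \<Rightarrow> complex"
  assumes "tempered f"
  obtains N where "M \<le> N" "integrable lborel (\<lambda>x. f x /\<^sub>R bsq x ^ N)"
proof -
  obtain N where "integrable lborel (\<lambda>x. f x /\<^sub>R bsq x ^ N)" "f \<in> borel_measurable borel"
    using assms by (auto simp: tempered_def)
  then show ?thesis using that[of "max M N"] tempered_exponent_mono[where f=f and N=N and M="max M N"] by auto
qed

text \<open>The decay of Schwartz functions without their smoothness: this is what makes pairings with
  tempered functions converge.\<close>

definition rapidly_decreasing :: "('a::euclidean_space \<Rightarrow> complex) \<Rightarrow> bool" where
  "rapidly_decreasing \<psi> \<longleftrightarrow> \<psi> \<in> borel_measurable borel \<and> (\<forall>N. \<exists>C. \<forall>x. bsq x ^ N * norm (\<psi> x) \<le> C)"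

lemma rapidly_decreasing_bound:
  assumes "rapidly_decreasing \<psi>"
  obtains C where "0 < C" "\<And>x. norm (\<psi> x) \<le> C / bsq x ^ N"
proof -
  obtain C where C: "\<And>x. bsq x ^ N * norm (\<psi> x) \<le> C"
    using assms unfolding rapidly_decreasing_def by blast
  have "norm (\<psi> x) \<le> max C 1 / bsq x ^ N" for x
    using C[of x] by (simp add: field_simps max_def)
  then show ?thesis using that[of "max C 1"] by auto
qed

lemma tempered_rapidly_decreasing_integrable:
  assumes "tempered f" "rapidly_decreasing \<psi>"
  shows "integrable lborel (\<lambda>x. f x * \<psi> x)"
proof -
  have [measurable]: "f \<in> borel_measurable borel" "\<psi> \<in> borel_measurable borel"
    using assms by (auto simp: tempered_def rapidly_decreasing_def)
  obtain N where N: "integrable lborel (\<lambda>x. f x /\<^sub>R bsq x ^ N)"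
    using assms(1) by (auto simp: tempered_def)
  obtain C where C: "0 < C" "\<And>x. norm (\<psi> x) \<le> C / bsq x ^ N"
    using rapidly_decreasing_bound[OF assms(2)] by blast
  show ?thesis
  proof (rule Bochner_Integration.integrable_bound)
    show "integrable lborel (\<lambda>x. C *\<^sub>R (f x /\<^sub>R bsq x ^ N))"
      using N by (intro integrable_scaleR_right)
    show "AE x in lborel. norm (f x * \<psi> x) \<le> norm (C *\<^sub>R (f x /\<^sub>R bsq x ^ N))"
    proof (intro AE_I2)
      fix x
      have "norm (f x * \<psi> x) \<le> norm (f x) * (C / bsq x ^ N)"
        unfolding norm_mult by (intro mult_left_mono C) auto
      then show "norm (f x * \<psi> x) \<le> norm (C *\<^sub>R (f x /\<^sub>R bsq x ^ N))"
        using C(1) by (simp add: divide_inverse mult_ac)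
    qed
  qed measurable
qed

lemma rapidly_decreasing_integrable:
  assumes "rapidly_decreasing \<psi>"
  shows "integrable lborel \<psi>"
proof -
  have "tempered (\<lambda>x::'a. 1)"
    using weight_integrable[of "DIM('a)", where 'a='a]
    unfolding tempered_def by (auto intro!: exI[of _ "DIM('a)"] simp: scaleR_conv_of_real of_real_inverse[symmetric] inverse_eq_divide
       simp del: of_real_inverse of_real_divide intro!: integrable_of_real)
  from tempered_rapidly_decreasing_integrable[OF this assms] show ?thesis by simp
qed

lemma integrable_tempered: "integrable lborel f \<Longrightarrow> tempered f"
  unfolding tempered_def by (auto intro!: exI[of _ 0])

text \<open>Uniform in the centre \<open>y\<close>, with polynomial loss: this allows Fubini for a tempered
  function of \<open>x\<close> against a rapidly decreasing function of \<open>y\<close>.\<close>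

lemma heat_kernel_decay:
  assumes "0 < \<epsilon>"
  obtains C where "0 < C" "\<And>x y::'a::euclidean_space. bsq x ^ N * heat_kernel \<epsilon> (x - y) \<le> C * bsq y ^ N"
proof -
  obtain C0 where C0: "0 < C0" "\<And>r. 0 \<le> r \<Longrightarrow> (1 + r\<^sup>2) ^ N * exp (- (1 / (2 * \<epsilon>)) * r powr 2) \<le> C0"
    using exp_beats_power[of 2 "1 / (2 * \<epsilon>)" N] assms by auto
  define A where "A = (1 / sqrt (2 * pi * \<epsilon>)) ^ DIM('a)"
  have A: "0 < A" using assms by (simp add: A_def)
  have *: "bsq z ^ N * heat_kernel \<epsilon> z \<le> A * C0" for z :: 'a
  proof -
    have "heat_kernel \<epsilon> z = A * exp (- (1 / (2 * \<epsilon>)) * norm z powr 2)"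
      by (simp add: heat_kernel_def A_def)
    then show ?thesis
      using mult_left_mono[OF C0(2)[of "norm z"], of A] A by (simp add: mult_ac)
  qed
  have "bsq x ^ N * heat_kernel \<epsilon> (x - y) \<le> (2 ^ N * (A * C0)) * bsq y ^ N" for x y :: 'a
  proof -
    have "bsq x ^ N * heat_kernel \<epsilon> (x - y) \<le> (2 ^ N * bsq (x - y) ^ N * bsq y ^ N) * heat_kernel \<epsilon> (x - y)"
      using bsq_triangle_power[of "x - y" y N] assms by (intro mult_right_mono) auto
    also have "\<dots> = 2 ^ N * bsq y ^ N * (bsq (x - y) ^ N * heat_kernel \<epsilon> (x - y))"
      by (simp add: mult_ac)
    also have "\<dots> \<le> 2 ^ N * bsq y ^ N * (A * C0)"
      using * by (intro mult_left_mono) (auto simp: zero_le_power)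
    finally show ?thesis by (simp add: mult_ac)
  qed
  then show ?thesis using that[of "2 ^ N * (A * C0)"] A C0(1) by auto
qed

lemma heat_kernel_rapidly_decreasing:
  assumes "0 < \<epsilon>"
  shows "rapidly_decreasing (\<lambda>x. complex_of_real (heat_kernel \<epsilon> (x - y)))"
proof -
  have "\<exists>C. \<forall>x. bsq x ^ N * norm (complex_of_real (heat_kernel \<epsilon> (x - y))) \<le> C" for N
  proof -
    obtain C where "\<And>x y::'a. bsq x ^ N * heat_kernel \<epsilon> (x - y) \<le> C * bsq y ^ N"
      using heat_kernel_decay[OF assms, of N, where 'a='a] by blast
    then show ?thesis using assms by (auto intro!: exI[of _ "C * bsq y ^ N"])
  qed
  then show ?thesis by (simp add: rapidly_decreasing_def)
qed

lemma exp_power_rapidly_decreasing: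
  assumes "0 < q" "0 < \<epsilon>"
  shows "rapidly_decreasing (\<lambda>x::'a::euclidean_space. complex_of_real (exp (- \<epsilon> * norm x powr q)))"
proof -
  have "\<exists>C. \<forall>x::'a. bsq x ^ N * norm (complex_of_real (exp (- \<epsilon> * norm x powr q))) \<le> C" for N
  proof -
    obtain C where "\<And>r. 0 \<le> r \<Longrightarrow> (1 + r\<^sup>2) ^ N * exp (- \<epsilon> * r powr q) \<le> C"
      using exp_beats_power[OF assms, of N] by blast
    then show ?thesis by (auto intro!: exI[of _ C])
  qed
  then show ?thesis by (simp add: rapidly_decreasing_def)
qed

lemma rapidly_decreasing_mult_bounded:
  assumes "rapidly_decreasing \<psi>" and [measurable]: "g \<in> borel_measurable borel"
    and "\<And>x. norm (g x) \<le> B"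
  shows "rapidly_decreasing (\<lambda>x. g x * \<psi> x)"
proof -
  have [measurable]: "\<psi> \<in> borel_measurable borel" using assms by (simp add: rapidly_decreasing_def)
  have "\<exists>C. \<forall>x. bsq x ^ N * norm (g x * \<psi> x) \<le> C" for N
  proof -
    obtain C where C: "0 < C" "\<And>x. norm (\<psi> x) \<le> C / bsq x ^ N"
      using rapidly_decreasing_bound[OF assms(1)] by blast
    have "bsq x ^ N * norm (g x * \<psi> x) \<le> B * C" for x
    proof -
      have "norm (g x * \<psi> x) \<le> B * (C / bsq x ^ N)"
        unfolding norm_mult using assms(3)[of x] C order_trans[OF norm_ge_zero assms(3)[of x]] by (intro mult_mono) auto
      then show ?thesis by (simp add: field_simps)
    qed
    then show ?thesis by blast
  qed
  then show ?thesis by (simp add: rapidly_decreasing_def)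
qed

text \<open>By scaling the moment is that of \<open>sqrt \<epsilon> *\<^sub>R z\<close> under the Gaussian of variance 1, which
  grows with \<open>\<epsilon>\<close>; so its value at \<open>\<epsilon> = 1\<close> is a uniform bound.\<close>

lemma heat_kernel_moment:
  obtains C where "0 \<le> C"
    "\<And>\<epsilon>. 0 < \<epsilon> \<Longrightarrow> \<epsilon> \<le> 1 \<Longrightarrow> (\<integral>\<^sup>+z. ennreal (bsq z ^ N * heat_kernel \<epsilon> (z::'a::euclidean_space)) \<partial>lborel) \<le> ennreal C"
proof -
  have int: "integrable lborel (\<lambda>z::'a. bsq z ^ N * heat_kernel 1 z)"
  proof -
    \<comment> \<open>\<open>DIM\<close> further powers are reserved for the integrability of the majorant.\<close>
    obtain C where C: "0 < C" "\<And>x. norm (complex_of_real (heat_kernel 1 (x - (0::'a)))) \<le> C / bsq x ^ (N + DIM('a))"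
      using rapidly_decreasing_bound[OF heat_kernel_rapidly_decreasing[of 1 "0::'a"]] by (metis zero_less_one)
    have int: "integrable lborel (\<lambda>x::'a. C *\<^sub>R (1 / bsq x ^ DIM('a)))"
      by (intro integrable_scaleR_right weight_integrable) simp
    show ?thesis
    proof (rule Bochner_Integration.integrable_bound[OF int])
      show "AE x::'a in lborel. norm (bsq x ^ N * heat_kernel 1 x) \<le> norm (C *\<^sub>R (1 / bsq x ^ DIM('a)))"
        using C by (auto intro!: AE_I2 simp: abs_mult power_add field_simps)
    qed measurable
  qed
  define C where "C = (LINT z|lborel. bsq z ^ N * heat_kernel 1 (z::'a))"
  have C0: "0 \<le> C" unfolding C_def by (intro Bochner_Integration.integral_nonneg) (auto simp: zero_le_power)
  have "(\<integral>\<^sup>+z. ennreal (bsq z ^ N * heat_kernel \<epsilon> (z::'a)) \<partial>lborel) \<le> ennreal C" if e: "0 < \<epsilon>" "\<epsilon> \<le> 1" for \<epsilon>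
  proof -
    have "(\<integral>\<^sup>+z. ennreal (bsq z ^ N * heat_kernel \<epsilon> (z::'a)) \<partial>lborel)
        = ennreal (sqrt \<epsilon> ^ DIM('a)) * (\<integral>\<^sup>+z. ennreal (bsq (sqrt \<epsilon> *\<^sub>R z) ^ N * heat_kernel \<epsilon> (sqrt \<epsilon> *\<^sub>R (z::'a))) \<partial>lborel)"
      using e lborel_nn_integral_affine[of "sqrt \<epsilon>" "\<lambda>z::'a. ennreal (bsq z ^ N * heat_kernel \<epsilon> z)" 0] by simp
    also have "\<dots> = (\<integral>\<^sup>+z. ennreal (bsq (sqrt \<epsilon> *\<^sub>R z) ^ N * heat_kernel 1 (z::'a)) \<partial>lborel)"
      using e by (subst nn_integral_cmult[symmetric]) (auto simp: heat_kernel_scale ennreal_mult[symmetric] zero_le_power intro!: nn_integral_cong)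
    also have "\<dots> \<le> (\<integral>\<^sup>+z. ennreal (bsq z ^ N * heat_kernel 1 (z::'a)) \<partial>lborel)"
    proof (intro nn_integral_mono ennreal_leI mult_right_mono power_mono bsq_mono)
      show "norm (sqrt \<epsilon> *\<^sub>R z) \<le> norm z" for z :: 'a
        using e by (simp add: mult_left_le_one_le)
    qed (auto simp: add_nonneg_nonneg)
    also have "\<dots> = ennreal C"
      unfolding C_def by (intro nn_integral_eq_integral int AE_I2) (auto simp: zero_le_power)
    finally show ?thesis .
  qed
  then show ?thesis using that C0 by blast
qed

section \<open>Mollification\<close>

definition mollify :: "real \<Rightarrow> ('a::euclidean_space \<Rightarrow> complex) \<Rightarrow> 'a \<Rightarrow> complex" where
  "mollify \<epsilon> f x = (LINT y|lborel. f y * of_real (heat_kernel \<epsilon> (y - x)))"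

lemma mollify_integrable:
  assumes "tempered f" "0 < \<epsilon>"
  shows "integrable lborel (\<lambda>y. f y * of_real (heat_kernel \<epsilon> (y - x)))"
  by (intro tempered_rapidly_decreasing_integrable heat_kernel_rapidly_decreasing assms)

lemma mollify_measurable [measurable]:
  assumes [measurable]: "f \<in> borel_measurable borel"
  shows "mollify \<epsilon> f \<in> borel_measurable borel"
  unfolding mollify_def[abs_def] by measurable

text \<open>After the substitution \<open>y = x + sqrt \<epsilon> *\<^sub>R z\<close> the kernel is fixed and dominated convergence
  applies.\<close>

lemma mollify_at_continuity_point:
  fixes g :: "'a::euclidean_space \<Rightarrow> complex"
  assumes [measurable]: "g \<in> borel_measurable borel" and B: "\<And>x. norm (g x) \<le> B" and cont: "isCont g x"
    and e: "\<And>k. 0 < e k" "e \<longlonglongrightarrow> 0"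
  shows "(\<lambda>k. mollify (e k) g x) \<longlonglongrightarrow> g x"
proof -
  have eq: "mollify (e k) g x = (LINT z|lborel. g (x + sqrt (e k) *\<^sub>R z) * of_real (heat_kernel 1 z))" for k
  proof -
    have "mollify (e k) g x = \<bar>sqrt (e k)\<bar> ^ DIM('a) *\<^sub>R
        (LINT z|lborel. g (x + sqrt (e k) *\<^sub>R z) * of_real (heat_kernel (e k) (x + sqrt (e k) *\<^sub>R z - x)))"
      unfolding mollify_def using e(1)[of k]
      by (intro lborel_integral_affine) auto
    also have "\<dots> = (LINT z|lborel. g (x + sqrt (e k) *\<^sub>R z) * of_real (heat_kernel 1 z))"
      using e(1)[of k]
      by (subst integral_scaleR_right[symmetric])
         (auto simp: heat_kernel_scale scaleR_conv_of_real intro!: Bochner_Integration.integral_cong)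
    finally show ?thesis .
  qed
  have "(\<lambda>k. LINT z|lborel. g (x + sqrt (e k) *\<^sub>R z) * of_real (heat_kernel 1 z))
      \<longlonglongrightarrow> (LINT z|lborel. g x * of_real (heat_kernel 1 (z::'a)))"
  proof (rule integral_dominated_convergence)
    show "integrable lborel (\<lambda>z::'a. B * heat_kernel 1 z)"
      by (intro integrable_mult_right heat_kernel_integrable) simp
    show "AE z in lborel. (\<lambda>k. g (x + sqrt (e k) *\<^sub>R z) * of_real (heat_kernel 1 z)) \<longlonglongrightarrow> g x * of_real (heat_kernel 1 z)"
    proof (intro AE_I2 tendsto_mult tendsto_const)
      fix z :: 'a
      have "(\<lambda>k. x + sqrt (e k) *\<^sub>R z) \<longlonglongrightarrow> x + sqrt 0 *\<^sub>R z"
        by (intro tendsto_intros e)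
      then show "(\<lambda>k. g (x + sqrt (e k) *\<^sub>R z)) \<longlonglongrightarrow> g x"
        using isCont_tendsto_compose[OF cont] by simp
    qed
    show "AE z in lborel. norm (g (x + sqrt (e k) *\<^sub>R z) * of_real (heat_kernel 1 z)) \<le> B * heat_kernel 1 z" for k
      using B by (auto intro!: AE_I2 mult_right_mono simp: norm_mult)
  qed measurable
  also have "(LINT z|lborel. g x * of_real (heat_kernel 1 (z::'a))) = g x"
    by (simp add: heat_kernel_integral)
  finally show ?thesis unfolding eq .
qed

lemma norm_integral_le_nn_integral:
  fixes f :: "'b \<Rightarrow> 'c::{banach, second_countable_topology}"
  shows "ennreal (norm (integral\<^sup>L M f)) \<le> (\<integral>\<^sup>+x. ennreal (norm (f x)) \<partial>M)"
proof (cases "integrable M f")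
  case True
  then show ?thesis by (rule integral_norm_bound_ennreal)
qed (simp add: not_integrable_integral_eq)

lemma tendsto_zero_ennreal_le:
  fixes f g :: "nat \<Rightarrow> ennreal"
  assumes "\<And>k. f k \<le> g k" "g \<longlonglongrightarrow> 0"
  shows "f \<longlonglongrightarrow> 0"
  by (rule tendsto_sandwich[OF _ _ tendsto_const assms(2), of f]) (auto simp: assms(1))

text \<open>Tempered functions are those in some \<open>L\<^sup>1(poly_measure N)\<close>. The measure is finite for large
  \<open>N\<close>, which puts all indicators into \<open>L\<^sup>1\<close> and allows induction over Borel sets.\<close>

definition poly_measure :: "nat \<Rightarrow> 'a::euclidean_space measure" where
  "poly_measure N = density lborel (\<lambda>x. ennreal (1 / bsq x ^ N))"

lemma sets_poly_measure [simp, measurable_cong]: "sets (poly_measure N) = sets borel"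
  by (simp add: poly_measure_def)

lemma space_poly_measure [simp]: "space (poly_measure N) = UNIV"
  by (simp add: poly_measure_def)

lemma poly_measure_finite:
  assumes "DIM('a) \<le> N"
  shows "finite_measure (poly_measure N :: 'a::euclidean_space measure)"
proof
  have "emeasure (poly_measure N :: 'a measure) UNIV = (\<integral>\<^sup>+x. ennreal (1 / bsq (x::'a) ^ N) \<partial>lborel)"
    unfolding poly_measure_def by (subst emeasure_density) auto
  also have "\<dots> < \<infinity>"
    using weight_integrable[OF assms] by (subst nn_integral_eq_integral) auto
  finally show "emeasure (poly_measure N :: 'a measure) (space (poly_measure N)) \<noteq> \<infinity>"
    by simp
qed

lemma integrable_poly_measure:
  fixes f :: "'a::euclidean_space \<Rightarrow> complex"
  assumes [measurable]: "f \<in> borel_measurable borel"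
  shows "integrable (poly_measure N) f \<longleftrightarrow> integrable lborel (\<lambda>x. f x /\<^sub>R bsq x ^ N)"
  unfolding poly_measure_def by (subst integrable_density) (auto simp: inverse_eq_divide)

lemma poly_measure_tempered:
  fixes f :: "'a::euclidean_space \<Rightarrow> complex"
  assumes "integrable (poly_measure N) f"
  shows "tempered f"
proof -
  have [measurable]: "f \<in> borel_measurable borel"
    using borel_measurable_integrable[OF assms] by (simp add: measurable_cong_sets[OF sets_poly_measure refl])
  show ?thesis
    using assms by (auto simp: tempered_def integrable_poly_measure)
qed

lemma AE_poly_measure:
  "(AE x::'a::euclidean_space in poly_measure N. P x) \<longleftrightarrow> (AE x in lborel. P x)"
  unfolding poly_measure_def by (subst AE_density) auto

text \<open>Moving the weight from \<open>x\<close> to \<open>y\<close> by Peetre's inequality costs \<open>bsq (y - x) ^ N\<close>, a moment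
  of the kernel that is bounded uniformly for \<open>\<epsilon> \<le> 1\<close>.\<close>

lemma mollify_poly_measure_bound:
  obtains C where "\<And>\<epsilon> (f::'a::euclidean_space \<Rightarrow> complex). 0 < \<epsilon> \<Longrightarrow> \<epsilon> \<le> 1 \<Longrightarrow> f \<in> borel_measurable borel \<Longrightarrow>
    (\<integral>\<^sup>+x. norm (mollify \<epsilon> f x) \<partial>poly_measure N) \<le> ennreal C * (\<integral>\<^sup>+x. norm (f x) \<partial>poly_measure N)"
proof -
  obtain M where M: "0 \<le> M"
    "\<And>\<epsilon>. 0 < \<epsilon> \<Longrightarrow> \<epsilon> \<le> 1 \<Longrightarrow> (\<integral>\<^sup>+z. ennreal (bsq z ^ N * heat_kernel \<epsilon> (z::'a)) \<partial>lborel) \<le> ennreal M"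
    using heat_kernel_moment[of N, where 'a='a] by blast
  have "(\<integral>\<^sup>+x. norm (mollify \<epsilon> f x) \<partial>poly_measure N) \<le> ennreal (2 ^ N * M) * (\<integral>\<^sup>+x. norm (f x) \<partial>poly_measure N)"
    if e: "0 < \<epsilon>" "\<epsilon> \<le> 1" and [measurable]: "f \<in> borel_measurable borel" for \<epsilon> and f :: "'a \<Rightarrow> complex"
  proof -
    have "(\<integral>\<^sup>+x. norm (mollify \<epsilon> f x) \<partial>poly_measure N)
        = (\<integral>\<^sup>+x. ennreal (1 / bsq x ^ N) * norm (mollify \<epsilon> f x) \<partial>lborel)"
      unfolding poly_measure_def by (subst nn_integral_density) auto
    also have "\<dots> \<le> (\<integral>\<^sup>+x. ennreal (1 / bsq x ^ N) * (\<integral>\<^sup>+y. norm (f y) * heat_kernel \<epsilon> (y - x) \<partial>lborel) \<partial>lborel)"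
    proof (intro nn_integral_mono mult_left_mono)
      fix x :: 'a
      show "ennreal (norm (mollify \<epsilon> f x)) \<le> (\<integral>\<^sup>+y. norm (f y) * heat_kernel \<epsilon> (y - x) \<partial>lborel)"
        unfolding mollify_def using norm_integral_le_nn_integral[of lborel "\<lambda>y. f y * of_real (heat_kernel \<epsilon> (y - x))"] e
        by (simp add: norm_mult)
    qed simp
    also have "\<dots> = (\<integral>\<^sup>+x. (\<integral>\<^sup>+y. ennreal (norm (f y) * (1 / bsq x ^ N * heat_kernel \<epsilon> (y - x))) \<partial>lborel) \<partial>lborel)"
      using e by (subst nn_integral_cmult[symmetric]) (auto simp: ennreal_mult[symmetric] mult_ac)
    also have "\<dots> = (\<integral>\<^sup>+y. (\<integral>\<^sup>+x. ennreal (norm (f y) * (1 / bsq x ^ N * heat_kernel \<epsilon> (y - x))) \<partial>lborel) \<partial>lborel)"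
      by (rule lborel_pair.Fubini'[symmetric]) measurable
    also have "\<dots> \<le> (\<integral>\<^sup>+y. ennreal (2 ^ N * M) * (ennreal (1 / bsq y ^ N) * ennreal (norm (f y))) \<partial>lborel)"
    proof (intro nn_integral_mono)
      fix y :: 'a
      have "(\<integral>\<^sup>+x. ennreal (norm (f y) * (1 / bsq x ^ N * heat_kernel \<epsilon> (y - x))) \<partial>lborel)
          \<le> (\<integral>\<^sup>+x. ennreal (norm (f y) * 2 ^ N / bsq y ^ N) * ennreal (bsq (y - x) ^ N * heat_kernel \<epsilon> (y - x)) \<partial>lborel)"
      proof (intro nn_integral_mono)
        fix x :: 'a
        have "bsq y ^ N \<le> 2 ^ N * bsq (y - x) ^ N * bsq x ^ N"
          using bsq_triangle_power[of "y - x" x N] by simp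
        then have "1 / bsq x ^ N \<le> 2 ^ N / bsq y ^ N * bsq (y - x) ^ N"
          by (simp add: field_simps)
        then have "norm (f y) * (1 / bsq x ^ N * heat_kernel \<epsilon> (y - x))
            \<le> norm (f y) * (2 ^ N / bsq y ^ N * bsq (y - x) ^ N * heat_kernel \<epsilon> (y - x))"
          using e by (intro mult_left_mono mult_right_mono) auto
        then show "ennreal (norm (f y) * (1 / bsq x ^ N * heat_kernel \<epsilon> (y - x)))
           \<le> ennreal (norm (f y) * 2 ^ N / bsq y ^ N) * ennreal (bsq (y - x) ^ N * heat_kernel \<epsilon> (y - x))"
          using e by (subst ennreal_mult[symmetric]) (auto intro!: ennreal_leI simp: mult_ac zero_le_power)
      qed
      also have "\<dots> = ennreal (norm (f y) * 2 ^ N / bsq y ^ N) * (\<integral>\<^sup>+x. ennreal (bsq (y - x) ^ N * heat_kernel \<epsilon> (y - x)) \<partial>lborel)"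
        by (intro nn_integral_cmult) measurable
      also have "(\<integral>\<^sup>+x. ennreal (bsq (y - x) ^ N * heat_kernel \<epsilon> (y - x)) \<partial>lborel) = (\<integral>\<^sup>+x. ennreal (bsq x ^ N * heat_kernel \<epsilon> (x::'a)) \<partial>lborel)"
        by (rule lborel_nn_integral_reflect[of "\<lambda>x. ennreal (bsq x ^ N * heat_kernel \<epsilon> x)"]) measurable
      also have "ennreal (norm (f y) * 2 ^ N / bsq y ^ N) * \<dots> \<le> ennreal (norm (f y) * 2 ^ N / bsq y ^ N) * ennreal M"
        by (intro mult_left_mono M(2) e) simp
      also have "\<dots> = ennreal (2 ^ N * M) * (ennreal (1 / bsq y ^ N) * ennreal (norm (f y)))"
        using M(1) by (simp add: ennreal_mult[symmetric] zero_le_power mult_ac)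
      finally show "(\<integral>\<^sup>+x. ennreal (norm (f y) * (1 / bsq x ^ N * heat_kernel \<epsilon> (y - x))) \<partial>lborel)
          \<le> ennreal (2 ^ N * M) * (ennreal (1 / bsq y ^ N) * ennreal (norm (f y)))" .
    qed
    also have "\<dots> = ennreal (2 ^ N * M) * (\<integral>\<^sup>+x. norm (f x) \<partial>poly_measure N)"
      unfolding poly_measure_def by (subst nn_integral_cmult) (auto simp: nn_integral_density)
    finally show ?thesis .
  qed
  then show ?thesis using that by blast
qed

lemma mollify_add:
  assumes "tempered f" "tempered g" "0 < \<epsilon>"
  shows "mollify \<epsilon> (\<lambda>x. f x + g x) x = mollify \<epsilon> f x + mollify \<epsilon> g x"
  unfolding mollify_def
  by (subst Bochner_Integration.integral_add[symmetric])
     (auto simp: distrib_right intro!: mollify_integrable assms)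

lemma mollify_diff:
  assumes "tempered f" "tempered g" "0 < \<epsilon>"
  shows "mollify \<epsilon> (\<lambda>x. f x - g x) x = mollify \<epsilon> f x - mollify \<epsilon> g x"
  unfolding mollify_def
  by (subst Bochner_Integration.integral_diff[symmetric])
     (auto simp: left_diff_distrib intro!: mollify_integrable assms)

lemma mollify_const: "0 < \<epsilon> \<Longrightarrow> mollify \<epsilon> (\<lambda>_. c) x = c"
proof -
  assume e: "0 < \<epsilon>"
  have "mollify \<epsilon> (\<lambda>_. c) x = c * of_real (LINT y|lborel. heat_kernel \<epsilon> (y - x))"
    unfolding mollify_def by simp
  also have "(LINT y|lborel. heat_kernel \<epsilon> (y - x)) = (LINT y|lborel. heat_kernel \<epsilon> (y::'a))"
    using lborel_integral_translate[of "heat_kernel \<epsilon> :: 'a \<Rightarrow> real" "- x"] by simp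
  finally show ?thesis using e by (simp add: heat_kernel_integral)
qed

text \<open>The mollifications of an integrable function converge in \<open>L\<^sup>1(poly_measure N)\<close>. The class of
  functions for which they do contains indicators of boxes, is closed under \<open>L\<^sup>1\<close> limits because
  mollification is uniformly bounded, and therefore contains all indicators and all integrable functions.\<close>

abbreviation mollify_error :: "nat \<Rightarrow> (nat \<Rightarrow> real) \<Rightarrow> ('a::euclidean_space \<Rightarrow> complex) \<Rightarrow> nat \<Rightarrow> ennreal" where
  "mollify_error N e f k \<equiv> (\<integral>\<^sup>+x. norm (mollify (e k) f x - f x) \<partial>poly_measure N)"

context
  fixes N :: nat and e :: "nat \<Rightarrow> real"
  assumes e: "\<And>k. 0 < e k" "\<And>k. e k \<le> 1" "e \<longlonglongrightarrow> 0"
begin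

private lemma e_pos [simp]: "0 < e k" by (rule e)

private lemma meas_poly:
  "integrable (poly_measure N) f \<Longrightarrow> f \<in> borel_measurable borel" for f :: "'a::euclidean_space \<Rightarrow> complex"
  by (drule borel_measurable_integrable) (simp add: measurable_cong_sets[OF sets_poly_measure refl])

private lemma mollify_error_add:
  fixes f g :: "'a::euclidean_space \<Rightarrow> complex"
  assumes f: "integrable (poly_measure N) f" and g: "integrable (poly_measure N) g"
  shows "mollify_error N e (\<lambda>x. f x + g x) k \<le> mollify_error N e f k + mollify_error N e g k"
proof -
  have [measurable]: "f \<in> borel_measurable borel" "g \<in> borel_measurable borel"
    using f g by (auto intro: meas_poly)
  have "mollify_error N e (\<lambda>x. f x + g x) k
      \<le> (\<integral>\<^sup>+x. ennreal (norm (mollify (e k) f x - f x)) + ennreal (norm (mollify (e k) g x - g x)) \<partial>poly_measure N)"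
  proof (intro nn_integral_mono)
    fix x :: 'a
    have "norm (mollify (e k) f x + mollify (e k) g x - (f x + g x)) \<le> norm (mollify (e k) f x - f x) + norm (mollify (e k) g x - g x)"
      using norm_triangle_ineq[of "mollify (e k) f x - f x" "mollify (e k) g x - g x"] by (simp add: algebra_simps)
    then show "ennreal (norm (mollify (e k) (\<lambda>x. f x + g x) x - (f x + g x)))
       \<le> ennreal (norm (mollify (e k) f x - f x)) + ennreal (norm (mollify (e k) g x - g x))"
      using f g by (simp add: mollify_add poly_measure_tempered ennreal_plus[symmetric] ennreal_leI del: ennreal_plus)
  qed
  also have "\<dots> = mollify_error N e f k + mollify_error N e g k"
    by (intro nn_integral_add) measurable
  finally show ?thesis .
qed

text \<open>The three-epsilon argument for a uniformly bounded sequence of operators.\<close>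

private lemma mollify_error_closed:
  fixes f :: "'a::euclidean_space \<Rightarrow> complex"
  assumes s: "\<And>i. integrable (poly_measure N) (s i)" "\<And>i. mollify_error N e (s i) \<longlonglongrightarrow> 0"
    and f: "integrable (poly_measure N) f"
    and lim: "(\<lambda>i. \<integral>\<^sup>+x. norm (f x - s i x) \<partial>poly_measure N) \<longlonglongrightarrow> 0"
  shows "mollify_error N e f \<longlonglongrightarrow> 0"
proof -
  have [measurable]: "f \<in> borel_measurable borel" "s i \<in> borel_measurable borel" for i
    using f s by (auto intro: meas_poly)
  obtain C where C: "\<And>\<epsilon> (f::'a \<Rightarrow> complex). 0 < \<epsilon> \<Longrightarrow> \<epsilon> \<le> 1 \<Longrightarrow> f \<in> borel_measurable borel \<Longrightarrow>
    (\<integral>\<^sup>+x. norm (mollify \<epsilon> f x) \<partial>poly_measure N) \<le> ennreal C * (\<integral>\<^sup>+x. norm (f x) \<partial>poly_measure N)"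
    using mollify_poly_measure_bound[of N, where 'a='a] by blast
  define d where "d i = (\<integral>\<^sup>+x. norm (f x - s i x) \<partial>poly_measure N)" for i
  have bound: "mollify_error N e f k \<le> (ennreal C * d i + d i) + mollify_error N e (s i) k" for i k
  proof -
    have int: "integrable (poly_measure N) (\<lambda>x. f x - s i x)"
      by (intro Bochner_Integration.integrable_diff f s)
    have "mollify_error N e f k = mollify_error N e (\<lambda>x. (f x - s i x) + s i x) k" by simp
    also have "\<dots> \<le> mollify_error N e (\<lambda>x. f x - s i x) k + mollify_error N e (s i) k"
      by (rule mollify_error_add[OF int s(1)])
    also have "mollify_error N e (\<lambda>x. f x - s i x) k
        \<le> (\<integral>\<^sup>+x. ennreal (norm (mollify (e k) (\<lambda>x. f x - s i x) x)) + ennreal (norm (f x - s i x)) \<partial>poly_measure N)"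
      by (intro nn_integral_mono) (simp add: ennreal_plus[symmetric] norm_triangle_ineq4 ennreal_leI del: ennreal_plus)
    also have "\<dots> = (\<integral>\<^sup>+x. norm (mollify (e k) (\<lambda>x. f x - s i x) x) \<partial>poly_measure N) + d i"
      unfolding d_def by (intro nn_integral_add) measurable
    also have "(\<integral>\<^sup>+x. norm (mollify (e k) (\<lambda>x. f x - s i x) x) \<partial>poly_measure N) \<le> ennreal C * d i"
      unfolding d_def by (intro C e) measurable
    finally show ?thesis by (simp add: add_mono)
  qed
  have d0: "(\<lambda>i. ennreal C * d i + d i) \<longlonglongrightarrow> 0"
  proof -
    have "(\<lambda>i. ennreal C * d i + d i) \<longlonglongrightarrow> ennreal C * 0 + 0"
      using lim unfolding d_def[symmetric] by (intro tendsto_add ennreal_tendsto_cmult) auto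
    then show ?thesis by simp
  qed
  show ?thesis
  proof (rule order_tendstoI)
    fix a :: ennreal assume a: "0 < a"
    obtain r where r: "0 < r" "r < a" using dense[OF a] by blast
    have "eventually (\<lambda>i. ennreal C * d i + d i < min r 1) sequentially"
      using order_tendstoD(2)[OF d0, of "min r 1"] r by simp
    then obtain i where i: "ennreal C * d i + d i < min r 1"
      by (auto simp: eventually_sequentially)
    have "(\<lambda>k. (ennreal C * d i + d i) + mollify_error N e (s i) k) \<longlonglongrightarrow> (ennreal C * d i + d i) + 0"
      by (intro tendsto_add tendsto_const s)
    moreover have "(ennreal C * d i + d i) + 0 < a"
      using i r by (auto intro: less_trans)
    ultimately have "eventually (\<lambda>k. (ennreal C * d i + d i) + mollify_error N e (s i) k < a) sequentially"
      by (rule order_tendstoD(2))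
    then show "eventually (\<lambda>k. mollify_error N e f k < a) sequentially"
      by (rule eventually_mono) (rule le_less_trans[OF bound])
  qed simp
qed

context
  assumes N: "DIM('a::euclidean_space) \<le> N"
begin

private lemma bounded_integrable:
  fixes f :: "'a \<Rightarrow> complex"
  assumes [measurable]: "f \<in> borel_measurable borel" and "\<And>x. norm (f x) \<le> B"
  shows "integrable (poly_measure N) f"
proof -
  interpret finite_measure "poly_measure N :: 'a measure" by (rule poly_measure_finite[OF N])
  show ?thesis using assms by (intro integrable_const_bound[of _ B]) auto
qed

text \<open>The indicator is continuous off the boundary of the box, a null set.\<close>

private lemma mollify_error_box: "mollify_error N e (indicator (box a b :: 'a set)) \<longlonglongrightarrow> 0"
proof -
  interpret finite_measure "poly_measure N :: 'a measure" by (rule poly_measure_finite[OF N])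
  define g :: "'a \<Rightarrow> complex" where "g = indicator (box a b)"
  have [measurable]: "g \<in> borel_measurable borel" unfolding g_def by measurable
  have g1: "norm (g x) \<le> 1" for x by (simp add: g_def indicator_def)
  have "(\<lambda>k. \<integral>\<^sup>+x. norm (g x - mollify (e k) g x) \<partial>poly_measure N) \<longlonglongrightarrow> 0"
  proof (rule nn_integral_dominated_convergence_norm[where w="\<lambda>_. 1"])
    have "norm (mollify (e k) g x) \<le> 1" for k x
    proof -
      have "ennreal (norm (mollify (e k) g x)) \<le> (\<integral>\<^sup>+y. norm (g y * of_real (heat_kernel (e k) (y - x))) \<partial>lborel)"
        unfolding mollify_def by (rule norm_integral_le_nn_integral)
      also have "\<dots> \<le> (\<integral>\<^sup>+y. heat_kernel (e k) (y - x) \<partial>lborel)"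
        using g1 e(1)[THEN less_imp_le]
        by (intro nn_integral_mono ennreal_leI) (auto simp: norm_mult mult_left_le_one_le)
      also have "\<dots> = ennreal 1" by (simp add: heat_kernel_nn_integral_shift)
      finally show ?thesis by simp
    qed
    then show "AE x in poly_measure N. norm (mollify (e k) g x) \<le> 1" for k
      by simp
    show "(\<integral>\<^sup>+(x::'a). ennreal 1 \<partial>poly_measure N) < \<infinity>"
      by (simp add: emeasure_eq_measure)
    have "negligible (cbox a b - box a b)" by (rule negligible_frontier_interval)
    then have "AE x in lebesgue. x \<notin> cbox a b - box a b"
      unfolding negligible_iff_null_sets by (rule AE_not_in)
    then have "AE x in lborel. x \<notin> cbox a b - box a b"
      unfolding AE_completion_iff .
    then show "AE x in poly_measure N. (\<lambda>k. mollify (e k) g x) \<longlonglongrightarrow> g x"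
      unfolding AE_poly_measure
    proof eventually_elim
      case (elim x)
      have "isCont g x"
      proof (cases "x \<in> box a b")
        case True
        have "eventually (\<lambda>y. y \<in> box a b) (nhds x)"
          using True by (intro eventually_nhds_in_open) auto
        then have "eventually (\<lambda>y. g y = 1) (nhds x)"
          by eventually_elim (simp add: g_def)
        then show ?thesis by (subst isCont_cong) auto
      next
        case False
        then have "x \<in> - cbox a b" using elim by auto
        then have "eventually (\<lambda>y. y \<in> - cbox a b) (nhds x)"
          by (intro eventually_nhds_in_open) auto
        then have "eventually (\<lambda>y. g y = 0) (nhds x)"
          by eventually_elim (use box_subset_cbox[of a b] in \<open>auto simp: g_def indicator_def\<close>)
        then show ?thesis by (subst isCont_cong) auto
      qed
      then show ?case by (intro mollify_at_continuity_point[where B=1] g1 e) auto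
    qed
  qed auto
  then show ?thesis by (simp add: g_def norm_minus_commute)
qed

text \<open>Borel sets are generated by boxes, which are stable under intersection.\<close>

private lemma mollify_error_indicator:
  fixes A :: "'a set"
  assumes "A \<in> sets borel"
  shows "mollify_error N e (indicator A) \<longlonglongrightarrow> 0"
proof -
  let ?G = "range (\<lambda>(a, b). box a b :: 'a set)"
  have sets: "sigma_sets UNIV ?G = sets borel"
    by (simp add: borel_eq_box)
  have "Int_stable ?G" "?G \<subseteq> Pow UNIV" "A \<in> sigma_sets UNIV ?G"
    using assms by (auto simp: Int_stable_def box_Int_box sets)
  then show ?thesis
  proof (induction rule: sigma_sets_induct_disjoint)
    case (basic A)
    then show ?case using mollify_error_box by auto
  next
    case empty
    have "(indicator {} :: 'a \<Rightarrow> complex) = (\<lambda>_. 0)" by auto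
    then show ?case by (simp add: mollify_const)
  next
    case (compl A)
    have [measurable]: "A \<in> sets borel" using compl sets by auto
    have "mollify_error N e (indicator (UNIV - A) :: 'a \<Rightarrow> complex) k = mollify_error N e (indicator A :: 'a \<Rightarrow> complex) k" for k
    proof -
      have eq: "(indicator (UNIV - A) :: 'a \<Rightarrow> complex) = (\<lambda>x. 1 - indicator A x)"
        by (auto simp: fun_eq_iff indicator_def)
      have "tempered (\<lambda>x::'a. 1)" "tempered (indicator A :: 'a \<Rightarrow> complex)"
        by (rule poly_measure_tempered[OF bounded_integrable[where B=1]]; auto simp: indicator_def)+
      then have "mollify (e k) (indicator (UNIV - A)) x - indicator (UNIV - A) x
          = - (mollify (e k) (indicator A) x - indicator A x)" for x
        unfolding eq by (simp add: mollify_diff mollify_const)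
      then show ?thesis by (simp only: norm_minus_cancel)
    qed
    then show ?case using compl by simp
  next
    case (union A)
    have [measurable]: "A i \<in> sets borel" for i using union sets by auto
    define s :: "nat \<Rightarrow> 'a \<Rightarrow> complex" where "s n = (\<lambda>x. \<Sum>i<n. indicator (A i) x)" for n
    have s_eq: "s n = indicator (\<Union>i<n. A i)" for n
      unfolding s_def using union(1)
      by (intro ext indicator_UN_disjoint[symmetric]) (auto simp: disjoint_family_on_def)
    have [measurable]: "s n \<in> borel_measurable borel" for n unfolding s_def by measurable
    have s_int: "integrable (poly_measure N) (s n)" for n
      by (rule bounded_integrable[where B=1]) (auto simp: s_eq indicator_def)
    have u_int: "integrable (poly_measure N) (indicator (\<Union>i. A i) :: 'a \<Rightarrow> complex)"
      by (rule bounded_integrable[where B=1]) (auto simp: indicator_def)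
    show ?case
    proof (rule mollify_error_closed[OF s_int _ u_int])
      show "mollify_error N e (s n) \<longlonglongrightarrow> 0" for n
      proof (induction n)
        case 0
        have "mollify_error N e (s 0 :: 'a \<Rightarrow> complex) k = 0" for k
          by (simp add: s_def mollify_const)
        then show ?case by simp
      next
        case (Suc n)
        have ai: "integrable (poly_measure N) (indicator (A n) :: 'a \<Rightarrow> complex)"
          by (rule bounded_integrable[where B=1]) (auto simp: indicator_def)
        have "mollify_error N e (s (Suc n)) k \<le> mollify_error N e (s n) k + mollify_error N e (indicator (A n)) k" for k
          using mollify_error_add[OF s_int[of n] ai, of k] by (simp add: s_def add.commute)
        moreover have "(\<lambda>k. mollify_error N e (s n) k + mollify_error N e (indicator (A n)) k) \<longlonglongrightarrow> 0"
          using tendsto_add[OF Suc union(3)[of n]] by simp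
        ultimately show ?case by (rule tendsto_zero_ennreal_le)
      qed
      interpret finite_measure "poly_measure N :: 'a measure" by (rule poly_measure_finite[OF N])
      show "(\<lambda>n. \<integral>\<^sup>+x. norm (indicator (\<Union>i. A i) x - s n x) \<partial>poly_measure N) \<longlonglongrightarrow> 0"
      proof (rule nn_integral_dominated_convergence_norm[where w="\<lambda>_. 1"])
        show "(\<integral>\<^sup>+(x::'a). ennreal 1 \<partial>poly_measure N) < \<infinity>"
          by (simp add: emeasure_eq_measure)
        show "AE x in poly_measure N. (\<lambda>n. s n x) \<longlonglongrightarrow> indicator (\<Union>i. A i) x"
        proof (intro AE_I2)
          fix x
          have "(\<lambda>n. indicator (\<Union>i<n. A i) x :: complex) \<longlonglongrightarrow> indicator (\<Union>i. A i) x"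
            by (rule LIMSEQ_indicator_UN)
          then show "(\<lambda>n. s n x) \<longlonglongrightarrow> indicator (\<Union>i. A i) x" by (simp add: s_eq)
        qed
      qed (auto simp: s_eq indicator_def)
    qed
  qed
qed

lemma mollify_error_tendsto:
  fixes f :: "'a \<Rightarrow> complex"
  assumes "integrable (poly_measure N) f"
  shows "mollify_error N e f \<longlonglongrightarrow> 0"
  using assms
proof (induction rule: integrable_induct)
  case (base A c)
  then have [measurable]: "A \<in> sets borel" by simp
  have "mollify (e k) (\<lambda>x. indicator A x *\<^sub>R c) x - indicator A x *\<^sub>R c = (mollify (e k) (indicator A) x - indicator A x) * c" for k x
  proof -
    have "mollify (e k) (\<lambda>x. indicator A x *\<^sub>R c) x = mollify (e k) (indicator A) x * c"
      unfolding mollify_def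
      by (subst integral_mult_left_zero[symmetric]) (auto simp: scaleR_conv_of_real indicator_def mult_ac intro!: Bochner_Integration.integral_cong)
    then show ?thesis by (simp add: scaleR_conv_of_real indicator_def algebra_simps)
  qed
  then have "mollify_error N e (\<lambda>x. indicator A x *\<^sub>R c) k = ennreal (norm c) * mollify_error N e (indicator A) k" for k
    by (subst nn_integral_cmult[symmetric]) (auto simp: norm_mult ennreal_mult mult.commute)
  moreover have "(\<lambda>k. ennreal (norm c) * mollify_error N e (indicator A :: 'a \<Rightarrow> complex) k) \<longlonglongrightarrow> ennreal (norm c) * 0"
    by (intro ennreal_tendsto_cmult mollify_error_indicator) auto
  ultimately show ?case by simp
next
  case (add f g)
  have "(\<lambda>k. mollify_error N e f k + mollify_error N e g k) \<longlonglongrightarrow> 0"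
    using tendsto_add[OF add.IH] by simp
  then show ?case
    by (rule tendsto_zero_ennreal_le[rotated]) (rule mollify_error_add[OF add.hyps])
next
  case (lim f s)
  show ?case
  proof (rule mollify_error_closed[OF lim.hyps(1) lim.IH lim.hyps(4)])
    have f2: "integrable (poly_measure N) (\<lambda>x. 2 * norm (f x))"
      using lim.hyps(4) by (intro integrable_mult_right integrable_norm)
    show "(\<lambda>i. \<integral>\<^sup>+x. norm (f x - s i x) \<partial>poly_measure N) \<longlonglongrightarrow> 0"
    proof (rule nn_integral_dominated_convergence_norm[where w="\<lambda>x. 2 * norm (f x)"])
      show "(\<integral>\<^sup>+x. ennreal (2 * norm (f x)) \<partial>poly_measure N) < \<infinity>"
        using f2 by (subst nn_integral_eq_integral) auto
    qed (use lim.hyps in \<open>auto intro!: AE_I2 borel_measurable_integrable\<close>)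
  qed
qed

end

end

text \<open>Convergence in \<open>L\<^sup>1\<close> gives convergence almost everywhere along a subsequence, which is all
  that uniqueness arguments need.\<close>

lemma mollify_AE_subsequence:
  fixes f :: "'a::euclidean_space \<Rightarrow> complex"
  assumes "tempered f"
  obtains e where "\<And>k. 0 < e k" "\<And>k. e k \<le> 1" "e \<longlonglongrightarrow> 0"
    "AE x in lborel. (\<lambda>k. mollify (e k) f x) \<longlonglongrightarrow> f x"
proof -
  obtain N where N: "DIM('a) \<le> N" "integrable lborel (\<lambda>x. f x /\<^sub>R bsq x ^ N)"
    using tempered_exponent[OF assms] by blast
  have [measurable]: "f \<in> borel_measurable borel" by (rule tempered_measurable[OF assms])
  have f: "integrable (poly_measure N) f" using N by (simp add: integrable_poly_measure)
  define e :: "nat \<Rightarrow> real" where "e k = 1 / (k + 1)" for k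
  have e: "0 < e k" "e k \<le> 1" "e \<longlonglongrightarrow> 0" for k
  proof -
    show "0 < e k" "e k \<le> 1" by (auto simp: e_def)
    show "e \<longlonglongrightarrow> 0" unfolding e_def[abs_def] using LIMSEQ_inverse_real_of_nat by (simp add: inverse_eq_divide add.commute)
  qed
  have lim: "mollify_error N e f \<longlonglongrightarrow> 0"
    by (rule mollify_error_tendsto[OF e N(1) f])
  obtain C where C: "\<And>\<epsilon> (f::'a \<Rightarrow> complex). 0 < \<epsilon> \<Longrightarrow> \<epsilon> \<le> 1 \<Longrightarrow> f \<in> borel_measurable borel \<Longrightarrow>
    (\<integral>\<^sup>+x. norm (mollify \<epsilon> f x) \<partial>poly_measure N) \<le> ennreal C * (\<integral>\<^sup>+x. norm (f x) \<partial>poly_measure N)"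
    using mollify_poly_measure_bound[of N, where 'a='a] by blast
  have mint: "integrable (poly_measure N) (mollify (e k) f)" for k
  proof (rule integrableI_bounded)
    have "(\<integral>\<^sup>+x. norm (mollify (e k) f x) \<partial>poly_measure N) \<le> ennreal C * (\<integral>\<^sup>+x. norm (f x) \<partial>poly_measure N)"
      by (intro C e) simp
    also have "\<dots> < \<infinity>"
      using f by (auto simp: integrable_iff_bounded ennreal_mult_less_top)
    finally show "(\<integral>\<^sup>+x. norm (mollify (e k) f x) \<partial>poly_measure N) < \<infinity>" .
  qed measurable
  have dint: "integrable (poly_measure N) (\<lambda>x. mollify (e k) f x - f x)" for k
    by (intro Bochner_Integration.integrable_diff mint f)
  have "ennreal (LINT x|poly_measure N. norm (mollify (e k) f x - f x)) = mollify_error N e f k" for k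
    by (intro nn_integral_eq_integral[symmetric] integrable_norm dint) auto
  then have "(\<lambda>k. ennreal (LINT x|poly_measure N. norm (mollify (e k) f x - f x))) \<longlonglongrightarrow> ennreal 0"
    using lim by simp
  then have "(\<lambda>k. LINT x|poly_measure N. norm (mollify (e k) f x - f x)) \<longlonglongrightarrow> 0"
    by (subst (asm) tendsto_ennreal_iff) (auto intro!: Bochner_Integration.integral_nonneg)
  then obtain r where r: "strict_mono r" "AE x in poly_measure N. (\<lambda>k. mollify (e (r k)) f x - f x) \<longlonglongrightarrow> 0"
    using tendsto_L1_AE_subseq[of "poly_measure N" "\<lambda>k x. mollify (e k) f x - f x", OF dint] by blast
  show ?thesis
  proof (rule that[of "e \<circ> r"])
    show "(e \<circ> r) \<longlonglongrightarrow> 0" using e(3) r(1) by (rule LIMSEQ_subseq_LIMSEQ)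
    show "AE x in lborel. (\<lambda>k. mollify ((e \<circ> r) k) f x) \<longlonglongrightarrow> f x"
      using r(2) unfolding AE_poly_measure by eventually_elim (simp add: LIM_zero_iff)
  qed (auto simp: e)
qed

text \<open>Fatou's lemma in the form in which bounds pass to limits.\<close>

lemma nn_integral_le_of_AE_tendsto:
  assumes [measurable]: "\<And>k. u k \<in> borel_measurable M"
    and lim: "AE x in M. (\<lambda>k. u k x) \<longlonglongrightarrow> (v x :: ennreal)"
    and le: "\<And>k. (\<integral>\<^sup>+x. u k x \<partial>M) \<le> B"
  shows "(\<integral>\<^sup>+x. v x \<partial>M) \<le> B"
proof -
  have "(\<integral>\<^sup>+x. v x \<partial>M) = (\<integral>\<^sup>+x. liminf (\<lambda>k. u k x) \<partial>M)"
    using lim by (intro nn_integral_cong_AE, eventually_elim) (simp add: lim_imp_Liminf)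
  also have "\<dots> \<le> liminf (\<lambda>k. \<integral>\<^sup>+x. u k x \<partial>M)"
    by (rule nn_integral_liminf) measurable
  also have "\<dots> \<le> B"
    by (rule Liminf_le) (auto simp: le)
  finally show ?thesis .
qed

lemma (in pair_sigma_finite) integrable_pair_mult:
  fixes f g :: "_ \<Rightarrow> complex"
  assumes f: "integrable M1 f" and g: "integrable M2 g"
  shows "integrable (M1 \<Otimes>\<^sub>M M2) (\<lambda>p. f (fst p) * g (snd p))"
    and "(LINT p|(M1 \<Otimes>\<^sub>M M2). f (fst p) * g (snd p)) = (LINT x|M1. f x) * (LINT y|M2. g y)"
proof -
  have [measurable]: "f \<in> borel_measurable M1" "g \<in> borel_measurable M2" using f g by auto
  show int: "integrable (M1 \<Otimes>\<^sub>M M2) (\<lambda>p. f (fst p) * g (snd p))"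
  proof (rule Fubini_integrable)
    show "integrable M1 (\<lambda>x. LINT y|M2. norm (f (fst (x, y)) * g (snd (x, y))))"
      using f by (simp add: norm_mult)
  qed (use g in auto)
  show "(LINT p|(M1 \<Otimes>\<^sub>M M2). f (fst p) * g (snd p)) = (LINT x|M1. f x) * (LINT y|M2. g y)"
    by (subst integral_fst'[OF int, symmetric]) simp
qed

lemma cnj_measurable [measurable]: "cnj \<in> borel_measurable borel"
  by (intro borel_measurable_continuous_onI continuous_intros)

section \<open>Gaussian averages of oscillatory integrals and the Plancherel theorem\<close>

text \<open>Expanding the square and integrating in \<open>t\<close> first leaves the Fourier transform of the
  Gaussian. With \<open>\<theta> x = - x\<close> and Lebesgue measure this is the main step towards Plancherel's theorem; with
  \<open>\<theta> \<xi> = norm \<xi> powr m\<close> it is Wiener's computation of the mean square of an oscillatory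
  integral.\<close>

lemma gaussian_average_oscillatory:
  fixes F :: "'b \<Rightarrow> complex" and \<theta> :: "'b \<Rightarrow> 'a::euclidean_space"
  assumes M: "sigma_finite_measure M" and F: "integrable M F"
    and [measurable]: "\<theta> \<in> borel_measurable M" and R: "0 < R"
  defines "A \<equiv> \<lambda>t. LINT x|M. F x * cis (t \<bullet> \<theta> x)"
  shows "(\<integral>\<^sup>+t. ennreal (heat_kernel R t * (norm (A t))\<^sup>2) \<partial>lborel)
    = ennreal (Re (LINT p|(M \<Otimes>\<^sub>M M). F (fst p) * cnj (F (snd p)) * of_real (exp (- R * (norm (\<theta> (fst p) - \<theta> (snd p)))\<^sup>2 / 2))))"
proof -
  interpret M: sigma_finite_measure M by fact
  interpret MM: pair_sigma_finite M M ..
  interpret L: pair_sigma_finite "lborel :: 'a measure" "M \<Otimes>\<^sub>M M" ..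
  have [measurable]: "F \<in> borel_measurable M" using F by auto
  define G where "G p = F (fst p) * cnj (F (snd p))" for p
  define \<Theta> where "\<Theta> p = \<theta> (fst p) - \<theta> (snd p)" for p
  have [measurable]: "G \<in> borel_measurable (M \<Otimes>\<^sub>M M)"
    unfolding G_def by measurable
  have [measurable]: "\<Theta> \<in> borel_measurable (M \<Otimes>\<^sub>M M)"
    unfolding \<Theta>_def by measurable
  have Fc: "integrable M (\<lambda>x. F x * cis (t \<bullet> \<theta> x))" for t
    by (rule Bochner_Integration.integrable_bound[OF F]) (auto simp: norm_mult)
  have G: "integrable (M \<Otimes>\<^sub>M M) G"
    unfolding G_def using MM.integrable_pair_mult(1)[OF F, of "\<lambda>x. cnj (F x)"] F by simp
  have sq: "of_real ((norm (A t))\<^sup>2) = (LINT p|(M \<Otimes>\<^sub>M M). G p * cis (t \<bullet> \<Theta> p))" for t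
  proof -
    have cF: "integrable M (\<lambda>x. cnj (F x * cis (t \<bullet> \<theta> x)))"
      by (rule Bochner_Integration.integrable_bound[OF Fc[of t]]) (auto simp: norm_mult)
    have "of_real ((norm (A t))\<^sup>2) = A t * cnj (A t)"
      by (simp only: complex_norm_square)
    also have "cnj (A t) = (LINT x|M. cnj (F x * cis (t \<bullet> \<theta> x)))"
      unfolding A_def using Bochner_Integration.integral_cnj[of M "\<lambda>x. F x * cis (t \<bullet> \<theta> x)"] by simp
    also have "A t * \<dots> = (LINT p|(M \<Otimes>\<^sub>M M). F (fst p) * cis (t \<bullet> \<theta> (fst p)) * cnj (F (snd p) * cis (t \<bullet> \<theta> (snd p))))"
      unfolding A_def by (rule MM.integrable_pair_mult(2)[OF Fc[of t] cF, symmetric])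
    also have "\<dots> = (LINT p|(M \<Otimes>\<^sub>M M). G p * cis (t \<bullet> \<Theta> p))"
      by (intro Bochner_Integration.integral_cong)
         (auto simp: G_def \<Theta>_def cis_cnj cis_mult[symmetric] inner_add_right diff_conv_add_uminus simp del: add_uminus_conv_diff)
    finally show ?thesis .
  qed
  define H where "H q = of_real (heat_kernel R (fst q)) * (G (snd q) * cis (fst q \<bullet> \<Theta> (snd q)))" for q
  have intH: "integrable (lborel \<Otimes>\<^sub>M (M \<Otimes>\<^sub>M M)) H"
  proof (rule Bochner_Integration.integrable_bound)
    show "integrable ((lborel :: 'a measure) \<Otimes>\<^sub>M (M \<Otimes>\<^sub>M M)) (\<lambda>q. complex_of_real (heat_kernel R (fst q)) * G (snd q))"
      by (rule L.integrable_pair_mult(1)[OF integrable_of_real[OF heat_kernel_integrable[OF R]] G])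
    show "H \<in> borel_measurable (lborel \<Otimes>\<^sub>M M \<Otimes>\<^sub>M M)" unfolding H_def by measurable
  qed (auto simp: H_def norm_mult)
  have eq: "complex_of_real (heat_kernel R t * (norm (A t))\<^sup>2) = (LINT p|(M \<Otimes>\<^sub>M M). H (t, p))" for t
    by (simp add: H_def sq[symmetric])
  have int: "integrable lborel (\<lambda>t. complex_of_real (heat_kernel R t * (norm (A t))\<^sup>2))"
    unfolding eq by (rule L.integrable_fst'[OF intH])
  have "complex_of_real (LINT t|lborel. heat_kernel R t * (norm (A t))\<^sup>2) = (LINT t|lborel. LINT p|(M \<Otimes>\<^sub>M M). H (t, p))"
    by (simp only: eq[symmetric] integral_complex_of_real)
  also have "\<dots> = (LINT p|(M \<Otimes>\<^sub>M M). LINT t|lborel. H (t, p))"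
    using L.Fubini_integral[of "\<lambda>t p. H (t, p)"] intH by simp
  also have "\<dots> = (LINT p|(M \<Otimes>\<^sub>M M). G p * of_real (exp (- R * (norm (\<Theta> p))\<^sup>2 / 2)))"
  proof (intro Bochner_Integration.integral_cong refl)
    fix p
    have "(LINT t|lborel. H (t, p)) = (LINT t|lborel. G p * (cis (t \<bullet> \<Theta> p) * of_real (heat_kernel R t)))"
      by (simp add: H_def mult_ac)
    also have "\<dots> = G p * of_real (exp (- R * (norm (\<Theta> p))\<^sup>2 / 2))"
      using heat_kernel_fourier[OF R, of "\<Theta> p"] by simp
    finally show "(LINT t|lborel. H (t, p)) = G p * of_real (exp (- R * (norm (\<Theta> p))\<^sup>2 / 2))" .
  qed
  finally have val: "complex_of_real (LINT t|lborel. heat_kernel R t * (norm (A t))\<^sup>2)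
    = (LINT p|(M \<Otimes>\<^sub>M M). G p * of_real (exp (- R * (norm (\<Theta> p))\<^sup>2 / 2)))" .
  have "(\<integral>\<^sup>+t. ennreal (heat_kernel R t * (norm (A t))\<^sup>2) \<partial>lborel) = ennreal (LINT t|lborel. heat_kernel R t * (norm (A t))\<^sup>2)"
    using int[unfolded complex_of_real_integrable_eq] R by (intro nn_integral_eq_integral) auto
  also have "(LINT t|lborel. heat_kernel R t * (norm (A t))\<^sup>2) = Re (LINT p|(M \<Otimes>\<^sub>M M). G p * of_real (exp (- R * (norm (\<Theta> p))\<^sup>2 / 2)))"
    by (simp only: val[symmetric] Re_complex_of_real)
  finally show ?thesis by (simp only: G_def \<Theta>_def)
qed

lemma gaussian_eq_heat_kernel:
  fixes x :: "'a::euclidean_space"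
  assumes "0 < \<eta>"
  shows "exp (- \<eta> * (norm x)\<^sup>2 / 2) = (sqrt (2 * pi / \<eta>)) ^ DIM('a) * heat_kernel (1 / \<eta>) x"
proof -
  have "sqrt (2 * pi / \<eta>) * (1 / sqrt (2 * pi * (1 / \<eta>))) = 1"
    using assms by simp
  then have "(sqrt (2 * pi / \<eta>)) ^ DIM('a) * (1 / sqrt (2 * pi * (1 / \<eta>))) ^ DIM('a) = 1"
    by (metis power_mult_distrib power_one)
  moreover have "- (norm x)\<^sup>2 / (2 * (1 / \<eta>)) = - \<eta> * (norm x)\<^sup>2 / 2" using assms by simp
  ultimately show ?thesis
    unfolding heat_kernel_def by (metis mult.assoc mult_1)
qed

lemma
  fixes z :: "'a::euclidean_space"
  assumes e: "0 < \<eta>"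
  shows gaussian_fourier_integrable: "integrable lborel (\<lambda>\<xi>. cis (\<xi> \<bullet> z) * of_real (exp (- \<eta> * (norm \<xi>)\<^sup>2 / 2)))"
    and gaussian_fourier: "(LINT \<xi>|lborel. cis (\<xi> \<bullet> z) * of_real (exp (- \<eta> * (norm \<xi>)\<^sup>2 / 2))) = of_real ((2 * pi) ^ DIM('a) * heat_kernel \<eta> z)"
proof -
  define c where "c = (sqrt (2 * pi / \<eta>)) ^ DIM('a)"
  have eq: "cis (\<xi> \<bullet> z) * of_real (exp (- \<eta> * (norm \<xi>)\<^sup>2 / 2)) = of_real c * (cis (\<xi> \<bullet> z) * of_real (heat_kernel (1 / \<eta>) \<xi>))" for \<xi>
    by (simp only: gaussian_eq_heat_kernel[OF e] c_def of_real_mult mult_ac)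
  have e': "0 < 1 / \<eta>" using e by simp
  show "integrable lborel (\<lambda>\<xi>. cis (\<xi> \<bullet> z) * of_real (exp (- \<eta> * (norm \<xi>)\<^sup>2 / 2)))"
    unfolding eq by (intro integrable_mult_right heat_kernel_fourier_integrable e')
  have "(LINT \<xi>|lborel. cis (\<xi> \<bullet> z) * of_real (exp (- \<eta> * (norm \<xi>)\<^sup>2 / 2))) = of_real c * of_real (exp (- (1 / \<eta>) * (norm z)\<^sup>2 / 2))"
    unfolding eq using heat_kernel_fourier[OF e', of z] by simp
  also have "\<dots> = of_real (c * (c * heat_kernel \<eta> z * (\<eta> ^ DIM('a))))"
  proof -
    have s: "sqrt (2 * pi / (1 / \<eta>)) = \<eta> * sqrt (2 * pi / \<eta>)"
    proof -
      have "2 * pi / (1 / \<eta>) = \<eta>\<^sup>2 * (2 * pi / \<eta>)" using e by (simp add: power2_eq_square)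
      then show ?thesis using e by (simp only: real_sqrt_mult real_sqrt_abs abs_of_pos)
    qed
    have "exp (- (1 / \<eta>) * (norm z)\<^sup>2 / 2) = (sqrt (2 * pi / (1 / \<eta>))) ^ DIM('a) * heat_kernel (1 / (1 / \<eta>)) z"
      by (rule gaussian_eq_heat_kernel[OF e'])
    also have "\<dots> = c * heat_kernel \<eta> z * (\<eta> ^ DIM('a))"
      unfolding s by (simp add: c_def power_mult_distrib)
    finally show ?thesis by (simp only: of_real_mult)
  qed
  also have "c * (c * heat_kernel \<eta> z * (\<eta> ^ DIM('a))) = (2 * pi) ^ DIM('a) * heat_kernel \<eta> z"
  proof -
    have "c * c * \<eta> ^ DIM('a) = (sqrt (2 * pi / \<eta>) * sqrt (2 * pi / \<eta>) * \<eta>) ^ DIM('a)"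
      by (simp only: c_def power_mult_distrib)
    also have "sqrt (2 * pi / \<eta>) * sqrt (2 * pi / \<eta>) * \<eta> = 2 * pi" using e by simp
    finally show ?thesis by (simp add: mult_ac)
  qed
  finally show "(LINT \<xi>|lborel. cis (\<xi> \<bullet> z) * of_real (exp (- \<eta> * (norm \<xi>)\<^sup>2 / 2))) = of_real ((2 * pi) ^ DIM('a) * heat_kernel \<eta> z)" .
qed

lemma fourier_integral_measurable [measurable]:
  assumes [measurable]: "f \<in> borel_measurable borel"
  shows "fourier_integral f \<in> borel_measurable borel"
  unfolding fourier_integral_def[abs_def] by measurable

lemma norm_fourier_integral_le:
  "norm (fourier_integral f \<xi>) \<le> (LINT x|lborel. norm (f x))"
proof -
  have "norm (fourier_integral f \<xi>) \<le> (LINT x|lborel. norm (cis (- (x \<bullet> \<xi>)) * f x))"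
    unfolding fourier_integral_def by (rule integral_norm_bound)
  then show ?thesis by (simp add: norm_mult)
qed

text \<open>Fourier inversion with a Gaussian convergence factor.\<close>

lemma mollify_eq_fourier:
  fixes f :: "'a::euclidean_space \<Rightarrow> complex"
  assumes f: "integrable lborel f" and e: "0 < \<eta>"
  shows "of_real ((2 * pi) ^ DIM('a)) * mollify \<eta> f x
    = (LINT \<xi>|lborel. fourier_integral f \<xi> * (cis (\<xi> \<bullet> x) * of_real (exp (- \<eta> * (norm \<xi>)\<^sup>2 / 2))))"
proof -
  have [measurable]: "f \<in> borel_measurable borel" using f by auto
  define G where "G y \<xi> = cis (- (y \<bullet> \<xi>)) * f y * (cis (\<xi> \<bullet> x) * complex_of_real (exp (- \<eta> * (norm \<xi>)\<^sup>2 / 2)))" for y \<xi> :: 'a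
  have int: "integrable (lborel \<Otimes>\<^sub>M lborel) (case_prod G)"
  proof (rule Bochner_Integration.integrable_bound)
    show "integrable (lborel \<Otimes>\<^sub>M lborel) (\<lambda>p. f (fst p) * (cis (snd p \<bullet> x) * complex_of_real (exp (- \<eta> * (norm (snd p))\<^sup>2 / 2))))"
      by (intro lborel_pair.integrable_pair_mult f gaussian_fourier_integrable e)
    show "case_prod G \<in> borel_measurable (lborel \<Otimes>\<^sub>M lborel)" unfolding G_def by measurable
  qed (auto simp: G_def norm_mult)
  have "(LINT \<xi>|lborel. fourier_integral f \<xi> * (cis (\<xi> \<bullet> x) * of_real (exp (- \<eta> * (norm \<xi>)\<^sup>2 / 2))))
    = (LINT \<xi>|lborel. LINT y|lborel. G y \<xi>)"
    unfolding fourier_integral_def G_def by simp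
  also have "\<dots> = (LINT y|lborel. LINT \<xi>|lborel. G y \<xi>)"
    by (rule lborel_pair.Fubini_integral[OF int])
  also have "\<dots> = (LINT y|lborel. f y * of_real ((2 * pi) ^ DIM('a) * heat_kernel \<eta> (y - x)))"
  proof (intro Bochner_Integration.integral_cong refl)
    fix y
    have "(LINT \<xi>|lborel. G y \<xi>) = (LINT \<xi>|lborel. f y * (cis (\<xi> \<bullet> (x - y)) * of_real (exp (- \<eta> * (norm \<xi>)\<^sup>2 / 2))))"
      by (intro Bochner_Integration.integral_cong refl)
         (simp add: G_def inner_add_right inner_commute cis_mult[symmetric] diff_conv_add_uminus mult_ac del: add_uminus_conv_diff)
    also have "\<dots> = f y * of_real ((2 * pi) ^ DIM('a) * heat_kernel \<eta> (x - y))"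
      using gaussian_fourier[OF e, of "x - y"] by simp
    finally show "(LINT \<xi>|lborel. G y \<xi>) = f y * of_real ((2 * pi) ^ DIM('a) * heat_kernel \<eta> (y - x))"
      by (simp only: heat_kernel_commute[of \<eta> y x])
  qed
  also have "\<dots> = of_real ((2 * pi) ^ DIM('a)) * mollify \<eta> f x"
    unfolding mollify_def by (subst integral_mult_right_zero[symmetric]) (simp add: mult_ac)
  finally show ?thesis ..
qed

text \<open>Schur's test: by \<open>2 a b \<le> a\<^sup>2 + b\<^sup>2\<close> the double integral splits into two, in each of which the
  kernel integrates to 1.\<close>

lemma nn_integral_gaussian_pair_le:
  fixes f :: "'a::euclidean_space \<Rightarrow> complex"
  assumes [measurable]: "f \<in> borel_measurable borel" and e: "0 < \<eta>"
  shows "(\<integral>\<^sup>+p. norm (f (fst p) * cnj (f (snd p))) * heat_kernel \<eta> (fst p - snd p) \<partial>(lborel \<Otimes>\<^sub>M lborel))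
    \<le> (\<integral>\<^sup>+x. (norm (f x))\<^sup>2 \<partial>lborel)"
proof -
  let ?I = "\<integral>\<^sup>+x. (norm (f x))\<^sup>2 \<partial>lborel"
  have "(\<integral>\<^sup>+p. norm (f (fst p) * cnj (f (snd p))) * heat_kernel \<eta> (fst p - snd p) \<partial>(lborel \<Otimes>\<^sub>M lborel))
     \<le> (\<integral>\<^sup>+p. ennreal (1/2) * (ennreal ((norm (f (fst p)))\<^sup>2 * heat_kernel \<eta> (fst p - snd p))
          + ennreal ((norm (f (snd p)))\<^sup>2 * heat_kernel \<eta> (fst p - snd p))) \<partial>(lborel \<Otimes>\<^sub>M lborel))"
  proof (intro nn_integral_mono)
    fix p
    have "norm (f (fst p) * cnj (f (snd p))) \<le> ((norm (f (fst p)))\<^sup>2 + (norm (f (snd p)))\<^sup>2) / 2"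
      using sum_squares_bound[of "norm (f (fst p))" "norm (f (snd p))"] by (simp add: norm_mult)
    then have "norm (f (fst p) * cnj (f (snd p))) * heat_kernel \<eta> (fst p - snd p)
      \<le> ((norm (f (fst p)))\<^sup>2 + (norm (f (snd p)))\<^sup>2) / 2 * heat_kernel \<eta> (fst p - snd p)"
      using e by (intro mult_right_mono) auto
    also have "\<dots> = 1/2 * ((norm (f (fst p)))\<^sup>2 * heat_kernel \<eta> (fst p - snd p) + (norm (f (snd p)))\<^sup>2 * heat_kernel \<eta> (fst p - snd p))"
      by (simp add: field_simps)
    finally show "ennreal (norm (f (fst p) * cnj (f (snd p))) * heat_kernel \<eta> (fst p - snd p))
      \<le> ennreal (1/2) * (ennreal ((norm (f (fst p)))\<^sup>2 * heat_kernel \<eta> (fst p - snd p)) + ennreal ((norm (f (snd p)))\<^sup>2 * heat_kernel \<eta> (fst p - snd p)))"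
      using e by (subst ennreal_plus[symmetric], simp, simp, subst ennreal_mult[symmetric]) (auto intro: ennreal_leI)
  qed
  also have "\<dots> = ennreal (1/2) * ((\<integral>\<^sup>+p. ennreal ((norm (f (fst p)))\<^sup>2 * heat_kernel \<eta> (fst p - snd p)) \<partial>(lborel \<Otimes>\<^sub>M lborel))
      + (\<integral>\<^sup>+p. ennreal ((norm (f (snd p)))\<^sup>2 * heat_kernel \<eta> (fst p - snd p)) \<partial>(lborel \<Otimes>\<^sub>M lborel)))"
    by (subst nn_integral_cmult, measurable, subst nn_integral_add) auto
  also have "(\<integral>\<^sup>+p. ennreal ((norm (f (fst p)))\<^sup>2 * heat_kernel \<eta> (fst p - snd p)) \<partial>(lborel \<Otimes>\<^sub>M lborel)) = ?I"
  proof -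
    have "(\<integral>\<^sup>+p. ennreal ((norm (f (fst p)))\<^sup>2 * heat_kernel \<eta> (fst p - snd p)) \<partial>(lborel \<Otimes>\<^sub>M lborel))
      = (\<integral>\<^sup>+x. \<integral>\<^sup>+y. ennreal ((norm (f x))\<^sup>2) * ennreal (heat_kernel \<eta> (x - y)) \<partial>lborel \<partial>lborel)"
      using e by (subst lborel.nn_integral_fst[symmetric]) (auto simp: ennreal_mult)
    also have "\<dots> = ?I"
      using e by (simp add: nn_integral_cmult heat_kernel_nn_integral_shift)
    finally show ?thesis .
  qed
  also have "(\<integral>\<^sup>+p. ennreal ((norm (f (snd p)))\<^sup>2 * heat_kernel \<eta> (fst p - snd p)) \<partial>(lborel \<Otimes>\<^sub>M lborel)) = ?I"
  proof -
    have "(\<integral>\<^sup>+p. ennreal ((norm (f (snd p)))\<^sup>2 * heat_kernel \<eta> (fst p - snd p)) \<partial>(lborel \<Otimes>\<^sub>M lborel))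
      = (\<integral>\<^sup>+y. \<integral>\<^sup>+x. ennreal ((norm (f y))\<^sup>2) * ennreal (heat_kernel \<eta> (x - y)) \<partial>lborel \<partial>lborel)"
      using e by (subst lborel_pair.nn_integral_snd[symmetric]) (auto simp: ennreal_mult)
    also have "\<dots> = ?I"
      using e by (simp add: nn_integral_cmult heat_kernel_nn_integral_shift)
    finally show ?thesis .
  qed
  also have "ennreal (1/2) * (?I + ?I) = ?I"
  proof -
    have "ennreal (1/2) * (?I + ?I) = (ennreal (1/2) + ennreal (1/2)) * ?I"
      by (simp only: distrib_left distrib_right)
    also have "ennreal (1/2) + ennreal (1/2) = 1" by (subst ennreal_plus[symmetric]) auto
    finally show ?thesis by simp
  qed
  finally show ?thesis .
qed

text \<open>The square integral with a factor \<open>exp (- \<eta> |\<xi>|\<^sup>2 / 2)\<close> is a Gaussian average of an oscillatory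
  integral, so it is a double integral of \<open>f\<close> against the heat kernel; then \<open>\<eta> \<rightarrow> 0\<close>.\<close>

lemma plancherel_le:
  fixes f :: "'a::euclidean_space \<Rightarrow> complex"
  assumes f: "integrable lborel f"
  shows "(\<integral>\<^sup>+\<xi>. (norm (fourier_integral f \<xi>))\<^sup>2 \<partial>lborel) \<le> ennreal ((2 * pi) ^ DIM('a)) * (\<integral>\<^sup>+x. (norm (f x))\<^sup>2 \<partial>lborel)"
proof -
  have [measurable]: "f \<in> borel_measurable borel" using f by auto
  let ?I = "\<integral>\<^sup>+x. (norm (f x))\<^sup>2 \<partial>lborel"
  have bound: "(\<integral>\<^sup>+\<xi>. ennreal (exp (- \<eta> * (norm \<xi>)\<^sup>2 / 2) * (norm (fourier_integral f \<xi>))\<^sup>2) \<partial>lborel) \<le> ennreal ((2 * pi) ^ DIM('a)) * ?I"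
    if e: "0 < \<eta>" for \<eta>
  proof -
    \<comment> \<open>The factor turns the heat kernel of variance \<open>1/\<eta>\<close> into the convergence factor.\<close>
    define c where "c = (sqrt (2 * pi / \<eta>)) ^ DIM('a)"
    have c: "0 \<le> c" using e by (simp add: c_def)
    have e': "0 < 1 / \<eta>" using e by simp
    have A: "fourier_integral f \<xi> = (LINT x|lborel. f x * cis (\<xi> \<bullet> (- x)))" for \<xi>
      unfolding fourier_integral_def by (simp add: mult.commute inner_commute)
    have h: "c * exp (- (1 / \<eta>) * (norm z)\<^sup>2 / 2) = (2 * pi) ^ DIM('a) * heat_kernel \<eta> z" for z :: 'a
    proof -
      have "complex_of_real (c * exp (- (1 / \<eta>) * (norm z)\<^sup>2 / 2)) = of_real c * (LINT \<xi>|lborel. cis (\<xi> \<bullet> z) * of_real (heat_kernel (1 / \<eta>) \<xi>))"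
        by (simp only: heat_kernel_fourier[OF e'] of_real_mult)
      also have "\<dots> = (LINT \<xi>|lborel. cis (\<xi> \<bullet> z) * of_real (exp (- \<eta> * (norm \<xi>)\<^sup>2 / 2)))"
        by (subst integral_mult_right_zero[symmetric]) (simp only: gaussian_eq_heat_kernel[OF e] c_def of_real_mult mult_ac)
      also have "\<dots> = of_real ((2 * pi) ^ DIM('a) * heat_kernel \<eta> z)" by (rule gaussian_fourier[OF e])
      finally show ?thesis by (simp only: of_real_eq_iff)
    qed
    have "(\<integral>\<^sup>+\<xi>. ennreal (exp (- \<eta> * (norm \<xi>)\<^sup>2 / 2) * (norm (fourier_integral f \<xi>))\<^sup>2) \<partial>lborel)
      = (\<integral>\<^sup>+\<xi>. ennreal c * ennreal (heat_kernel (1 / \<eta>) \<xi> * (norm (LINT x|lborel. f x * cis (\<xi> \<bullet> (- x))))\<^sup>2) \<partial>lborel)"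
      using c e by (intro nn_integral_cong) (simp only: A gaussian_eq_heat_kernel[OF e] c_def[symmetric] ennreal_mult'[symmetric] mult.assoc)
    also have "\<dots> = ennreal c * (\<integral>\<^sup>+\<xi>. ennreal (heat_kernel (1 / \<eta>) \<xi> * (norm (LINT x|lborel. f x * cis (\<xi> \<bullet> (- x))))\<^sup>2) \<partial>lborel)"
      by (intro nn_integral_cmult) measurable
    also have "\<dots> = ennreal c * ennreal (Re (LINT p|(lborel \<Otimes>\<^sub>M lborel). f (fst p) * cnj (f (snd p)) * of_real (exp (- (1 / \<eta>) * (norm (- fst p - - snd p))\<^sup>2 / 2))))"
      by (subst gaussian_average_oscillatory[OF _ f _ e']) (auto intro: lborel.sigma_finite_measure_axioms)
    also have "\<dots> \<le> ennreal c * (\<integral>\<^sup>+p. norm (f (fst p) * cnj (f (snd p)) * of_real (exp (- (1 / \<eta>) * (norm (- fst p - - snd p))\<^sup>2 / 2))) \<partial>(lborel \<Otimes>\<^sub>M lborel))"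
      by (intro mult_left_mono order_trans[OF ennreal_leI[OF complex_Re_le_cmod] norm_integral_le_nn_integral]) auto
    also have "\<dots> = (\<integral>\<^sup>+p. ennreal ((2 * pi) ^ DIM('a)) * ennreal (norm (f (fst p) * cnj (f (snd p))) * heat_kernel \<eta> (fst p - snd p)) \<partial>(lborel \<Otimes>\<^sub>M lborel))"
    proof (subst nn_integral_cmult[symmetric], measurable, intro nn_integral_cong)
      fix p :: "'a \<times> 'a"
      have "c * norm (f (fst p) * cnj (f (snd p)) * of_real (exp (- (1 / \<eta>) * (norm (- fst p - - snd p))\<^sup>2 / 2)))
         = norm (f (fst p) * cnj (f (snd p))) * (c * exp (- (1 / \<eta>) * (norm (fst p - snd p))\<^sup>2 / 2))"
        by (simp add: norm_mult norm_minus_commute)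
      also have "\<dots> = (2 * pi) ^ DIM('a) * (norm (f (fst p) * cnj (f (snd p))) * heat_kernel \<eta> (fst p - snd p))"
        by (simp only: h mult_ac)
      finally show "ennreal c * ennreal (norm (f (fst p) * cnj (f (snd p)) * of_real (exp (- (1 / \<eta>) * (norm (- fst p - - snd p))\<^sup>2 / 2))))
        = ennreal ((2 * pi) ^ DIM('a)) * ennreal (norm (f (fst p) * cnj (f (snd p))) * heat_kernel \<eta> (fst p - snd p))"
        using c e by (simp only: ennreal_mult'[symmetric] zero_le_power pi_ge_zero)
           (simp add: ennreal_mult'[symmetric])
    qed
    also have "\<dots> = ennreal ((2 * pi) ^ DIM('a)) * (\<integral>\<^sup>+p. ennreal (norm (f (fst p) * cnj (f (snd p))) * heat_kernel \<eta> (fst p - snd p)) \<partial>(lborel \<Otimes>\<^sub>M lborel))"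
      by (intro nn_integral_cmult) measurable
    also have "\<dots> \<le> ennreal ((2 * pi) ^ DIM('a)) * ?I"
      by (intro mult_left_mono nn_integral_gaussian_pair_le e) auto
    finally show ?thesis .
  qed
  show ?thesis
  proof (rule nn_integral_le_of_AE_tendsto)
    show "(\<integral>\<^sup>+\<xi>. ennreal (exp (- inverse (real (Suc k)) * (norm \<xi>)\<^sup>2 / 2) * (norm (fourier_integral f \<xi>))\<^sup>2) \<partial>lborel)
      \<le> ennreal ((2 * pi) ^ DIM('a)) * ?I" for k
      by (rule bound) simp
    have "(\<lambda>k. exp (- inverse (real (Suc k)) * (norm \<xi>)\<^sup>2 / 2) * (norm (fourier_integral f \<xi>))\<^sup>2) \<longlonglongrightarrow> exp (- 0 * (norm \<xi>)\<^sup>2 / 2) * (norm (fourier_integral f \<xi>))\<^sup>2" for \<xi>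
      by (intro tendsto_intros LIMSEQ_inverse_real_of_nat) simp
    then show "AE \<xi> in lborel. (\<lambda>k. ennreal (exp (- inverse (real (Suc k)) * (norm \<xi>)\<^sup>2 / 2) * (norm (fourier_integral f \<xi>))\<^sup>2)) \<longlonglongrightarrow> ennreal ((norm (fourier_integral f \<xi>))\<^sup>2)"
      by (intro AE_I2 tendsto_ennrealI) simp
  qed measurable
qed

text \<open>Up to reflection and a constant, the mollification of \<open>f\<close> is the transform of the damped transform of
  \<open>f\<close>, so the opposite inequality follows by applying \<open>plancherel_le\<close> to the latter and letting
  the mollification converge to \<open>f\<close>.\<close>

lemma plancherel_ge:
  fixes f :: "'a::euclidean_space \<Rightarrow> complex"
  assumes f: "integrable lborel f"
  shows "ennreal ((2 * pi) ^ DIM('a)) * (\<integral>\<^sup>+x. (norm (f x))\<^sup>2 \<partial>lborel) \<le> (\<integral>\<^sup>+\<xi>. (norm (fourier_integral f \<xi>))\<^sup>2 \<partial>lborel)"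
proof -
  have [measurable]: "f \<in> borel_measurable borel" using f by auto
  let ?J = "\<integral>\<^sup>+\<xi>. (norm (fourier_integral f \<xi>))\<^sup>2 \<partial>lborel"
  define D where "D = (2 * pi) ^ DIM('a)"
  have D: "0 < D" by (simp add: D_def)
  have bound: "(\<integral>\<^sup>+x. ennreal (D * (norm (mollify \<eta> f x))\<^sup>2) \<partial>lborel) \<le> ?J" if e: "0 < \<eta>" for \<eta>
  proof -
    define g where "g \<xi> = fourier_integral f \<xi> * of_real (exp (- \<eta> * (norm \<xi>)\<^sup>2 / 2))" for \<xi>
    have [measurable]: "g \<in> borel_measurable borel" unfolding g_def by measurable
    have g: "integrable lborel g"
    proof (rule Bochner_Integration.integrable_bound)
      show "integrable lborel (\<lambda>\<xi>::'a. of_real (LINT x|lborel. norm (f x)) * (cis (\<xi> \<bullet> 0) * of_real (exp (- \<eta> * (norm \<xi>)\<^sup>2 / 2))))"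
        by (intro integrable_mult_right gaussian_fourier_integrable e)
      show "AE \<xi> in lborel. norm (g \<xi>) \<le> norm (of_real (LINT x|lborel. norm (f x)) * (cis (\<xi> \<bullet> 0) * of_real (exp (- \<eta> * (norm \<xi>)\<^sup>2 / 2))))"
        by (auto intro!: AE_I2 mult_right_mono norm_fourier_integral_le order_trans[OF _ abs_ge_self] simp: g_def norm_mult)
    qed measurable
    have eq: "of_real D * mollify \<eta> f x = fourier_integral g (- x)" for x
      unfolding D_def mollify_eq_fourier[OF f e] fourier_integral_def[of g] g_def by (simp add: mult_ac)
    have "(\<integral>\<^sup>+x. ennreal (D * (norm (mollify \<eta> f x))\<^sup>2) \<partial>lborel) = (\<integral>\<^sup>+x. ennreal (1 / D) * ennreal ((norm (fourier_integral g (0 - x)))\<^sup>2) \<partial>lborel)"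
    proof (intro nn_integral_cong)
      fix x
      have "D * (norm (mollify \<eta> f x))\<^sup>2 = 1 / D * (norm (of_real D * mollify \<eta> f x))\<^sup>2"
        using D by (simp add: norm_mult power2_eq_square)
      then show "ennreal (D * (norm (mollify \<eta> f x))\<^sup>2) = ennreal (1 / D) * ennreal ((norm (fourier_integral g (0 - x)))\<^sup>2)"
        using D by (simp add: eq ennreal_mult[symmetric])
    qed
    also have "\<dots> = ennreal (1 / D) * sq_integral (fourier_integral g)"
      using lborel_nn_integral_reflect[of "\<lambda>x. ennreal ((norm (fourier_integral g x))\<^sup>2)" 0]
      by (simp add: nn_integral_cmult)
    also have "\<dots> \<le> ennreal (1 / D) * (ennreal D * sq_integral g)"
      unfolding D_def by (intro mult_left_mono plancherel_le g) auto
    also have "\<dots> = sq_integral g"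
      using D by (simp add: mult.assoc[symmetric] ennreal_mult[symmetric])
    also have "\<dots> \<le> ?J"
    proof (intro nn_integral_mono ennreal_leI power_mono)
      show "norm (g \<xi>) \<le> norm (fourier_integral f \<xi>)" for \<xi>
        using e by (simp add: g_def norm_mult mult_left_le)
    qed auto
    finally show ?thesis .
  qed
  obtain e where e: "\<And>k. 0 < e k" "AE x in lborel. (\<lambda>k. mollify (e k) f x) \<longlonglongrightarrow> f x"
    using mollify_AE_subsequence[OF integrable_tempered[OF f]] by metis
  have "(\<integral>\<^sup>+x. ennreal (D * (norm (f x))\<^sup>2) \<partial>lborel) \<le> ?J"
  proof (rule nn_integral_le_of_AE_tendsto)
    show "(\<integral>\<^sup>+x. ennreal (D * (norm (mollify (e k) f x))\<^sup>2) \<partial>lborel) \<le> ?J" for k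
      by (rule bound[OF e(1)])
    show "AE x in lborel. (\<lambda>k. ennreal (D * (norm (mollify (e k) f x))\<^sup>2)) \<longlonglongrightarrow> ennreal (D * (norm (f x))\<^sup>2)"
      using e(2) by eventually_elim (intro tendsto_ennrealI tendsto_intros)
  qed measurable
  then show ?thesis using D unfolding D_def[symmetric]
    by (simp add: ennreal_mult nn_integral_cmult)
qed

theorem plancherel:
  fixes f :: "'a::euclidean_space \<Rightarrow> complex"
  assumes f: "integrable lborel f"
  shows "(\<integral>\<^sup>+\<xi>. (norm (fourier_integral f \<xi>))\<^sup>2 \<partial>lborel) = ennreal ((2 * pi) ^ DIM('a)) * (\<integral>\<^sup>+x. (norm (f x))\<^sup>2 \<partial>lborel)"
  by (intro antisym plancherel_le plancherel_ge f)

lemma fourier_integral_injective: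
  fixes f :: "'a::euclidean_space \<Rightarrow> complex"
  assumes f: "integrable lborel f" and "\<And>\<xi>. fourier_integral f \<xi> = 0"
  shows "AE x in lborel. f x = 0"
proof -
  have [measurable]: "f \<in> borel_measurable borel" using f by auto
  have "ennreal ((2 * pi) ^ DIM('a)) * (\<integral>\<^sup>+x. (norm (f x))\<^sup>2 \<partial>lborel) = 0"
    using plancherel[OF f] assms(2) by simp
  then have "(\<integral>\<^sup>+x. (norm (f x))\<^sup>2 \<partial>lborel) = 0" by simp
  then show ?thesis by (subst (asm) nn_integral_0_iff_AE) auto
qed

section \<open>Schwartz functions\<close>

lemma schwartz_differentiable: "schwartz \<psi> \<Longrightarrow> \<psi> differentiable (at x)"
  by (erule schwartz.cases) auto

lemma schwartz_directional_derivative: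
  "schwartz \<psi> \<Longrightarrow> b \<in> Basis \<Longrightarrow> schwartz (\<lambda>x. frechet_derivative \<psi> (at x) b)"
  by (erule schwartz.cases) auto

lemma schwartz_continuous: "schwartz \<psi> \<Longrightarrow> isCont \<psi> x"
  using schwartz_differentiable differentiable_imp_continuous_within by blast

lemma schwartz_rapidly_decreasing:
  assumes "schwartz (\<psi> :: 'a::euclidean_space \<Rightarrow> complex)"
  shows "rapidly_decreasing \<psi>"
proof -
  have "\<exists>C. \<forall>x. bsq x ^ N * norm (\<psi> x) \<le> C" for N
  proof -
    have "bounded (range (\<lambda>x. bsq x ^ N *\<^sub>R \<psi> x))"
      using assms by (rule schwartz.cases) auto
    then obtain B where "\<And>x. norm (bsq x ^ N *\<^sub>R \<psi> x) \<le> B"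
      by (auto simp: bounded_iff)
    then show ?thesis by (auto intro!: exI[of _ B] simp: abs_of_pos)
  qed
  moreover have "\<psi> \<in> borel_measurable borel"
    using schwartz_continuous[OF assms] by (intro borel_measurable_continuous_onI continuous_at_imp_continuous_on) auto
  ultimately show ?thesis by (simp add: rapidly_decreasing_def)
qed

text \<open>The difference quotients of \<open>F\<close> have integral 0 by translation invariance, and they are
  dominated by the mean value theorem and the decay of the derivative.\<close>

lemma integral_directional_derivative_eq_0:
  fixes F :: "'a::euclidean_space \<Rightarrow> complex"
  assumes deriv: "\<And>x. (F has_derivative F' x) (at x)"
    and F: "integrable lborel F" and G: "rapidly_decreasing (\<lambda>x. F' x b)"
  shows "(LINT x|lborel. F' x b) = 0"
proof -
  have [measurable]: "F \<in> borel_measurable borel" "(\<lambda>x. F' x b) \<in> borel_measurable borel"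
    using F G by (auto simp: rapidly_decreasing_def)
  define s where "s k = inverse (real (Suc k))" for k
  have s: "0 < s k" "s k \<le> 1" "s \<longlonglongrightarrow> 0" for k
    unfolding s_def[abs_def] using LIMSEQ_inverse_real_of_nat by (auto simp: inverse_eq_divide)
  define Q where "Q k x = (F (x + s k *\<^sub>R b) - F x) /\<^sub>R s k" for k x
  have [measurable]: "Q k \<in> borel_measurable borel" for k unfolding Q_def by measurable
  obtain C where C: "0 < C" "\<And>x. norm (F' x b) \<le> C / bsq x ^ DIM('a)"
    using rapidly_decreasing_bound[OF G] by blast
  define D where "D = C * (2 ^ DIM('a) * bsq b ^ DIM('a))"
  have D: "norm (F' (x + r *\<^sub>R b) b) \<le> D / bsq x ^ DIM('a)" if r: "0 \<le> r" "r \<le> 1" for x r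
  proof -
    have "bsq x ^ DIM('a) \<le> 2 ^ DIM('a) * bsq (x + r *\<^sub>R b) ^ DIM('a) * bsq (- (r *\<^sub>R b)) ^ DIM('a)"
      using bsq_triangle_power[of "x + r *\<^sub>R b" "- (r *\<^sub>R b)" "DIM('a)"] by simp
    also have "\<dots> \<le> 2 ^ DIM('a) * bsq (x + r *\<^sub>R b) ^ DIM('a) * bsq b ^ DIM('a)"
      using r by (intro mult_left_mono power_mono bsq_mono) (auto simp: mult_left_le_one_le)
    finally have "C / bsq (x + r *\<^sub>R b) ^ DIM('a) \<le> D / bsq x ^ DIM('a)"
      using C(1) by (simp add: D_def field_simps)
    then show ?thesis using C(2)[of "x + r *\<^sub>R b"] by linarith
  qed
  have along: "((\<lambda>r. F (x + r *\<^sub>R b)) has_derivative (\<lambda>h. h *\<^sub>R F' (x + r *\<^sub>R b) b)) (at r)" for x r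
  proof -
    have "((\<lambda>r. x + r *\<^sub>R b) has_derivative (\<lambda>h. h *\<^sub>R b)) (at r)"
      by (auto intro!: derivative_eq_intros)
    from has_derivative_compose[OF this deriv]
    have "((\<lambda>r. F (x + r *\<^sub>R b)) has_derivative (\<lambda>h. F' (x + r *\<^sub>R b) (h *\<^sub>R b))) (at r)" .
    moreover have "F' (x + r *\<^sub>R b) (h *\<^sub>R b) = h *\<^sub>R F' (x + r *\<^sub>R b) b" for h
      using linear_scale[OF has_derivative_linear[OF deriv]] by blast
    ultimately show ?thesis by simp
  qed
  have "(\<lambda>k. LINT x|lborel. Q k x) \<longlonglongrightarrow> (LINT x|lborel. F' x b)"
  proof (rule integral_dominated_convergence)
    show "integrable lborel (\<lambda>x::'a. D * (1 / bsq x ^ DIM('a)))"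
      by (intro integrable_mult_right weight_integrable) simp
    show "AE x in lborel. norm (Q k x) \<le> D * (1 / bsq x ^ DIM('a))" for k
    proof (intro AE_I2)
      fix x :: 'a
      have "continuous_on {0..s k} (\<lambda>r. F (x + r *\<^sub>R b))"
        using along by (intro continuous_at_imp_continuous_on ballI has_derivative_continuous) blast
      then obtain r where r: "r \<in> {0<..<s k}"
        "norm (F (x + s k *\<^sub>R b) - F (x + 0 *\<^sub>R b)) \<le> norm ((s k - 0) *\<^sub>R F' (x + r *\<^sub>R b) b)"
        using mvt_general[of 0 "s k" "\<lambda>r. F (x + r *\<^sub>R b)" "\<lambda>r h. h *\<^sub>R F' (x + r *\<^sub>R b) b"] s(1) along by blast
      then have "norm (Q k x) \<le> norm (F' (x + r *\<^sub>R b) b)"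
        using s(1)[of k] unfolding Q_def norm_scaleR by (simp add: field_simps)
      also have "\<dots> \<le> D / bsq x ^ DIM('a)" using r s(2)[of k] by (intro D) auto
      finally show "norm (Q k x) \<le> D * (1 / bsq x ^ DIM('a))" by simp
    qed
    show "AE x in lborel. (\<lambda>k. Q k x) \<longlonglongrightarrow> F' x b"
    proof (intro AE_I2)
      fix x :: 'a
      have lim: "(\<lambda>h. norm (F (x + h *\<^sub>R b) - F x - h *\<^sub>R F' x b) / norm h) \<midarrow>0\<rightarrow> 0"
        using along[of x 0] unfolding has_derivative_at by simp
      have "filterlim s (at 0) sequentially"
        using s by (intro filterlim_atI) (auto simp: less_imp_neq[symmetric])
      from filterlim_compose[OF lim this]
      have "(\<lambda>k. norm (F (x + s k *\<^sub>R b) - F x - s k *\<^sub>R F' x b) / norm (s k)) \<longlonglongrightarrow> 0" .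
      moreover have "norm (F (x + s k *\<^sub>R b) - F x - s k *\<^sub>R F' x b) / norm (s k) = norm (Q k x - F' x b)" for k
      proof -
        have "Q k x - F' x b = (F (x + s k *\<^sub>R b) - F x - s k *\<^sub>R F' x b) /\<^sub>R s k"
          using s(1)[of k] by (simp add: Q_def scaleR_diff_right)
        then show ?thesis by (simp add: divide_inverse mult.commute)
      qed
      ultimately show "(\<lambda>k. Q k x) \<longlonglongrightarrow> F' x b"
        by (simp add: tendsto_norm_zero_iff LIM_zero_iff)
    qed
  qed measurable
  moreover have "(LINT x|lborel. Q k x) = 0" for k
  proof -
    have "(LINT x|lborel. Q k x) = ((LINT x|lborel. F (x + s k *\<^sub>R b)) - (LINT x|lborel. F x)) /\<^sub>R s k"
      unfolding Q_def using F
      by (simp add: lborel_integrable_translate)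
    then show ?thesis by (simp add: lborel_integral_translate)
  qed
  ultimately show ?thesis by (simp add: LIMSEQ_const_iff)
qed

lemma fourier_integral_derivative:
  fixes \<psi> :: "'a::euclidean_space \<Rightarrow> complex"
  assumes \<psi>: "schwartz \<psi>" and b: "b \<in> Basis"
  shows "fourier_integral (\<lambda>x. frechet_derivative \<psi> (at x) b) \<xi> = \<i> * of_real (\<xi> \<bullet> b) * fourier_integral \<psi> \<xi>"
proof -
  define \<psi>' where "\<psi>' x = frechet_derivative \<psi> (at x) b" for x
  have rd: "rapidly_decreasing \<psi>" "rapidly_decreasing \<psi>'"
    using schwartz_rapidly_decreasing[OF \<psi>] schwartz_rapidly_decreasing[OF schwartz_directional_derivative[OF \<psi> b]]
    by (simp_all add: \<psi>'_def[abs_def])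
  have [measurable]: "\<psi> \<in> borel_measurable borel" "\<psi>' \<in> borel_measurable borel"
    using rd by (auto simp: rapidly_decreasing_def)
  define F where "F x = cis (- (x \<bullet> \<xi>)) * \<psi> x" for x
  define F' where "F' x h = cis (- (x \<bullet> \<xi>)) * frechet_derivative \<psi> (at x) h
      + (- (h \<bullet> \<xi>)) *\<^sub>R (\<i> * cis (- (x \<bullet> \<xi>))) * \<psi> x" for x h
  have deriv: "(F has_derivative F' x) (at x)" for x
    unfolding F_def[abs_def] F'_def[abs_def]
    using schwartz_differentiable[OF \<psi>, of x]
    by (auto intro!: derivative_eq_intros simp: frechet_derivative_works[symmetric])
  have c1: "rapidly_decreasing (\<lambda>x. cis (- (x \<bullet> \<xi>)) * \<psi> x)" "rapidly_decreasing (\<lambda>x. cis (- (x \<bullet> \<xi>)) * \<psi>' x)"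
    by (rule rapidly_decreasing_mult_bounded[OF _ _, of _ _ 1]; simp add: rd)+
  have int: "integrable lborel (\<lambda>x. cis (- (x \<bullet> \<xi>)) * \<psi> x)" "integrable lborel (\<lambda>x. cis (- (x \<bullet> \<xi>)) * \<psi>' x)"
    by (rule rapidly_decreasing_integrable[OF c1(1)], rule rapidly_decreasing_integrable[OF c1(2)])
  have F'b: "F' x b = cis (- (x \<bullet> \<xi>)) * \<psi>' x - \<i> * of_real (\<xi> \<bullet> b) * (cis (- (x \<bullet> \<xi>)) * \<psi> x)" for x
    by (simp add: F'_def \<psi>'_def scaleR_conv_of_real inner_commute)
  have "rapidly_decreasing (\<lambda>x. F' x b)"
  proof -
    have "\<exists>C. \<forall>x. bsq x ^ N * norm (F' x b) \<le> C" for N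
    proof -
      obtain C1 where C1: "\<And>x. bsq x ^ N * norm (\<psi> x) \<le> C1" using rd(1) unfolding rapidly_decreasing_def by blast
      obtain C2 where C2: "\<And>x. bsq x ^ N * norm (\<psi>' x) \<le> C2" using rd(2) unfolding rapidly_decreasing_def by blast
      have "bsq x ^ N * norm (F' x b) \<le> C2 + \<bar>\<xi> \<bullet> b\<bar> * C1" for x
      proof -
        have "norm (F' x b) \<le> norm (\<psi>' x) + \<bar>\<xi> \<bullet> b\<bar> * norm (\<psi> x)"
          unfolding F'b by (rule order_trans[OF norm_triangle_ineq4]) (simp add: norm_mult)
        then have "bsq x ^ N * norm (F' x b) \<le> bsq x ^ N * (norm (\<psi>' x) + \<bar>\<xi> \<bullet> b\<bar> * norm (\<psi> x))"
          by (intro mult_left_mono) auto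
        also have "\<dots> = bsq x ^ N * norm (\<psi>' x) + \<bar>\<xi> \<bullet> b\<bar> * (bsq x ^ N * norm (\<psi> x))"
          by (simp add: algebra_simps)
        also have "\<dots> \<le> C2 + \<bar>\<xi> \<bullet> b\<bar> * C1"
          by (intro add_mono mult_left_mono C1 C2) auto
        finally show ?thesis .
      qed
      then show ?thesis by blast
    qed
    moreover have "(\<lambda>x. F' x b) \<in> borel_measurable borel" unfolding F'b by measurable
    ultimately show ?thesis by (simp add: rapidly_decreasing_def)
  qed
  then have "(LINT x|lborel. F' x b) = 0"
    using int(1) by (intro integral_directional_derivative_eq_0[OF deriv]) (simp_all add: F_def[abs_def])
  then show ?thesis
    unfolding F'b using int by (simp add: fourier_integral_def \<psi>'_def)
qed

text \<open>Each factor \<open>1 + |\<xi>|\<^sup>2\<close> is traded for two derivatives of the Schwartz function; the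
  induction uses that these derivatives are again Schwartz functions.\<close>

lemma fourier_integral_rapidly_decreasing:
  fixes \<psi> :: "'a::euclidean_space \<Rightarrow> complex"
  assumes "schwartz \<psi>"
  shows "rapidly_decreasing (fourier_integral \<psi>)"
proof -
  have "\<exists>C. \<forall>\<xi>. bsq \<xi> ^ N * norm (fourier_integral \<psi> \<xi>) \<le> C" for N
    using assms
  proof (induction N arbitrary: \<psi>)
    case 0
    then show ?case using norm_fourier_integral_le by auto
  next
    case (Suc N)
    define \<psi>2 where "\<psi>2 b = (\<lambda>x. frechet_derivative (\<lambda>x. frechet_derivative \<psi> (at x) b) (at x) b)" for b
    have sch: "schwartz (\<psi>2 b)" if "b \<in> Basis" for b
      unfolding \<psi>2_def by (intro schwartz_directional_derivative Suc that)
    have F2: "fourier_integral (\<psi>2 b) \<xi> = - of_real ((\<xi> \<bullet> b)\<^sup>2) * fourier_integral \<psi> \<xi>" if "b \<in> Basis" for b \<xi>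
      unfolding \<psi>2_def using that Suc.prems
      by (simp add: fourier_integral_derivative schwartz_directional_derivative power2_eq_square mult_ac
          flip: mult.assoc[of \<i> \<i>])
    obtain C0 where C0: "\<And>\<xi>. bsq \<xi> ^ N * norm (fourier_integral \<psi> \<xi>) \<le> C0"
      using Suc by blast
    have "\<forall>b\<in>Basis. \<exists>C. \<forall>\<xi>. bsq \<xi> ^ N * norm (fourier_integral (\<psi>2 b) \<xi>) \<le> C"
      using Suc.IH[OF sch] by blast
    then obtain C where C: "\<And>b \<xi>. b \<in> Basis \<Longrightarrow> bsq \<xi> ^ N * norm (fourier_integral (\<psi>2 b) \<xi>) \<le> C b"
      by (auto dest!: bchoice)
    have "bsq \<xi> ^ Suc N * norm (fourier_integral \<psi> \<xi>) \<le> C0 + (\<Sum>b\<in>Basis. C b)" for \<xi> :: 'a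
    proof -
      have n: "(norm \<xi>)\<^sup>2 = (\<Sum>b\<in>Basis. (\<xi> \<bullet> b)\<^sup>2)"
        unfolding power2_norm_eq_inner by (subst euclidean_inner) (simp add: power2_eq_square)
      have "bsq \<xi> ^ Suc N * norm (fourier_integral \<psi> \<xi>)
          = bsq \<xi> ^ N * norm (fourier_integral \<psi> \<xi>) + (\<Sum>b\<in>Basis. (\<xi> \<bullet> b)\<^sup>2) * (bsq \<xi> ^ N * norm (fourier_integral \<psi> \<xi>))"
        unfolding n[symmetric] by (simp add: algebra_simps)
      also have "\<dots> = bsq \<xi> ^ N * norm (fourier_integral \<psi> \<xi>) + (\<Sum>b\<in>Basis. bsq \<xi> ^ N * norm (fourier_integral (\<psi>2 b) \<xi>))"
        by (simp add: F2 norm_mult norm_power sum_distrib_left sum_distrib_right mult_ac)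
      also have "\<dots> \<le> C0 + (\<Sum>b\<in>Basis. C b)"
        by (intro add_mono sum_mono C0 C)
      finally show ?thesis .
    qed
    then show ?case by blast
  qed
  moreover have "\<psi> \<in> borel_measurable borel"
    using schwartz_rapidly_decreasing[OF assms] by (simp add: rapidly_decreasing_def)
  ultimately show ?thesis by (simp add: rapidly_decreasing_def)
qed

lemma real_polynomial_function_has_derivative:
  assumes "real_polynomial_function (p :: 'a::euclidean_space \<Rightarrow> real)"
  obtains p' where "\<And>x. (p has_derivative p' x) (at x)" "\<And>h. real_polynomial_function (\<lambda>x. p' x h)"
proof -
  have "\<exists>p'. (\<forall>x. (p has_derivative p' x) (at x)) \<and> (\<forall>h. real_polynomial_function (\<lambda>x. p' x h))"
    using assms
  proof (induction rule: real_polynomial_function.induct)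
    case (linear f)
    then show ?case by (intro exI[of _ "\<lambda>_. f"]) (auto intro: bounded_linear_imp_has_derivative)
  next
    case (const c)
    then show ?case by (intro exI[of _ "\<lambda>_ _. 0"]) auto
  next
    case (add f g)
    then obtain f' g' where "\<And>x. (f has_derivative f' x) (at x)" "\<And>x. (g has_derivative g' x) (at x)"
      "\<And>h. real_polynomial_function (\<lambda>x. f' x h)" "\<And>h. real_polynomial_function (\<lambda>x. g' x h)" by blast
    then show ?case
      by (intro exI[of _ "\<lambda>x h. f' x h + g' x h"]) (auto intro!: derivative_intros)
  next
    case (mult f g)
    then obtain f' g' where *: "\<And>x. (f has_derivative f' x) (at x)" "\<And>x. (g has_derivative g' x) (at x)"
      "\<And>h. real_polynomial_function (\<lambda>x. f' x h)" "\<And>h. real_polynomial_function (\<lambda>x. g' x h)" by blast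
    show ?case using mult.hyps
      by (intro exI[of _ "\<lambda>x h. f x * g' x h + f' x h * g x"])
         (auto intro!: has_derivative_mult real_polynomial_function.intros(3,4) *)
  qed
  then show ?thesis using that by blast
qed

lemma real_polynomial_function_growth:
  assumes "real_polynomial_function (p :: 'a::euclidean_space \<Rightarrow> real)"
  obtains C N where "0 \<le> C" "\<And>x. \<bar>p x\<bar> \<le> C * bsq x ^ N"
proof -
  have "\<exists>C N. 0 \<le> C \<and> (\<forall>x. \<bar>p x\<bar> \<le> C * bsq x ^ N)"
    using assms
  proof (induction rule: real_polynomial_function.induct)
    case (linear f)
    then obtain K where K: "0 \<le> K" "\<And>x. norm (f x) \<le> norm x * K"
      using bounded_linear.nonneg_bounded by blast
    have "\<bar>f x\<bar> \<le> K * bsq x ^ 1" for x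
    proof -
      have "norm x \<le> bsq x"
        using sum_squares_bound[of "norm x" 1] norm_ge_zero[of x] unfolding one_power2 mult_1_right by linarith
      then have "norm x * K \<le> bsq x * K" by (intro mult_right_mono K)
      then show ?thesis using K(2)[of x] by (simp add: mult.commute)
    qed
    then show ?case using K(1) by blast
  next
    case (const c)
    then show ?case by (intro exI[of _ "\<bar>c\<bar>"] exI[of _ 0]) auto
  next
    case (add f g)
    then obtain C1 N1 C2 N2 where *: "0 \<le> C1" "\<And>x. \<bar>f x\<bar> \<le> C1 * bsq x ^ N1" "0 \<le> C2" "\<And>x. \<bar>g x\<bar> \<le> C2 * bsq x ^ N2"
      by blast
    have "\<bar>f x + g x\<bar> \<le> (C1 + C2) * bsq x ^ (N1 + N2)" for x
    proof -
      have "C1 * bsq x ^ N1 \<le> C1 * bsq x ^ (N1 + N2)" "C2 * bsq x ^ N2 \<le> C2 * bsq x ^ (N1 + N2)"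
        using * by (auto intro!: mult_left_mono power_increasing)
      then show ?thesis
        using *(2)[of x] *(4)[of x] abs_triangle_ineq[of "f x" "g x"] by (simp add: distrib_right)
    qed
    then show ?case using * by (intro exI[of _ "C1 + C2"] exI[of _ "N1 + N2"]) auto
  next
    case (mult f g)
    then obtain C1 N1 C2 N2 where *: "0 \<le> C1" "\<And>x. \<bar>f x\<bar> \<le> C1 * bsq x ^ N1" "0 \<le> C2" "\<And>x. \<bar>g x\<bar> \<le> C2 * bsq x ^ N2"
      by blast
    have "\<bar>f x * g x\<bar> \<le> (C1 * C2) * bsq x ^ (N1 + N2)" for x
      using mult_mono[OF *(2)[of x] *(4)[of x]] *(1) by (simp add: abs_mult power_add mult_ac zero_le_power)
    then show ?case using * by (intro exI[of _ "C1 * C2"] exI[of _ "N1 + N2"]) auto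
  qed
  then show ?thesis using that by blast
qed

text \<open>Polynomials times a fixed Gaussian are closed under differentiation, which makes them a
  bisimulation for the coinductive definition of Schwartz functions. The polynomial factor is
  present only for this purpose.\<close>

lemma polynomial_heat_kernel_schwartz:
  assumes e: "0 < \<epsilon>" and p: "real_polynomial_function p"
  shows "schwartz (\<lambda>x::'a::euclidean_space. complex_of_real (p x * heat_kernel \<epsilon> (x - y)))"
proof -
  define X where "X = (\<lambda>\<psi>. \<exists>p. real_polynomial_function p \<and> \<psi> = (\<lambda>x::'a. complex_of_real (p x * heat_kernel \<epsilon> (x - y))))"
  have "X (\<lambda>x. complex_of_real (p x * heat_kernel \<epsilon> (x - y)))"
    unfolding X_def using p by blast
  then show ?thesis
  proof (rule schwartz.coinduct[of X])
    fix \<psi> assume "X \<psi>"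
    then obtain p where p: "real_polynomial_function p" and \<psi>: "\<psi> = (\<lambda>x::'a. complex_of_real (p x * heat_kernel \<epsilon> (x - y)))"
      unfolding X_def by blast
    obtain p' where p': "\<And>x. (p has_derivative p' x) (at x)" "\<And>h. real_polynomial_function (\<lambda>x. p' x h)"
      using real_polynomial_function_has_derivative[OF p] by blast
    have dk: "((\<lambda>x. heat_kernel \<epsilon> (x - y)) has_derivative (\<lambda>h. heat_kernel \<epsilon> (x - y) * (- ((x - y) \<bullet> h) / \<epsilon>))) (at x)" for x
      unfolding heat_kernel_def power2_norm_eq_inner using e
      by (auto intro!: derivative_eq_intros simp: inner_commute field_simps)
    have d: "(\<psi> has_derivative (\<lambda>h. complex_of_real ((p' x h - p x * ((x - y) \<bullet> h) / \<epsilon>) * heat_kernel \<epsilon> (x - y)))) (at x)" for x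
      unfolding \<psi>
      by (rule has_derivative_eq_rhs[OF has_derivative_of_real[OF has_derivative_mult[OF p'(1) dk]]])
         (simp add: fun_eq_iff algebra_simps diff_divide_distrib)
    have 1: "\<psi> differentiable (at x)" for x using d differentiable_def by blast
    have 2: "bounded (range (\<lambda>x. bsq x ^ N *\<^sub>R \<psi> x))" for N
    proof -
      obtain C M where CM: "0 \<le> C" "\<And>x. \<bar>p x\<bar> \<le> C * bsq x ^ M"
        using real_polynomial_function_growth[OF p] by blast
      obtain B where B: "0 < B" "\<And>x y::'a. bsq x ^ (N + M) * heat_kernel \<epsilon> (x - y) \<le> B * bsq y ^ (N + M)"
        using heat_kernel_decay[OF e] by blast
      have "norm (bsq x ^ N *\<^sub>R \<psi> x) \<le> C * (B * bsq y ^ (N + M))" for x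
      proof -
        have "norm (bsq x ^ N *\<^sub>R \<psi> x) = bsq x ^ N * (\<bar>p x\<bar> * heat_kernel \<epsilon> (x - y))"
          using e unfolding \<psi> by (simp only: norm_scaleR norm_of_real abs_mult) (simp add: abs_of_pos)
        also have "\<dots> \<le> bsq x ^ N * ((C * bsq x ^ M) * heat_kernel \<epsilon> (x - y))"
          using e by (intro mult_left_mono mult_right_mono CM) (auto simp: zero_le_power)
        also have "\<dots> = C * (bsq x ^ (N + M) * heat_kernel \<epsilon> (x - y))" by (simp add: power_add mult_ac)
        also have "\<dots> \<le> C * (B * bsq y ^ (N + M))" by (intro mult_left_mono B CM)
        finally show ?thesis .
      qed
      then show ?thesis by (auto simp: bounded_iff)
    qed
    have 3: "X (\<lambda>x. frechet_derivative \<psi> (at x) b)" for b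
    proof -
      have "(\<lambda>x. frechet_derivative \<psi> (at x) b) = (\<lambda>x. complex_of_real ((p' x b - p x * ((x - y) \<bullet> b) / \<epsilon>) * heat_kernel \<epsilon> (x - y)))"
        using frechet_derivative_at[OF d] by (metis (mono_tags, lifting))
      moreover have "real_polynomial_function (\<lambda>x. p' x b - p x * ((x - y) \<bullet> b) / \<epsilon>)"
      proof -
        have q: "real_polynomial_function (\<lambda>x. x \<bullet> b - y \<bullet> b)"
          by (intro real_polynomial_function_diff real_polynomial_function.intros(1) real_polynomial_function.intros(2) bounded_linear_inner_left)
        show ?thesis unfolding inner_diff_left
          by (rule real_polynomial_function_diff[OF p'(2) real_polynomial_function_divide[OF real_polynomial_function.intros(4)[OF p q]]])
      qed
      ultimately show ?thesis unfolding X_def by blast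
    qed
    show "\<exists>\<psi>'. \<psi> = \<psi>' \<and> (\<forall>x. \<psi>' differentiable at x) \<and> (\<forall>N. bounded (range (\<lambda>x. bsq x ^ N *\<^sub>R \<psi>' x)))
        \<and> (\<forall>b. b \<in> Basis \<longrightarrow> X (\<lambda>x. frechet_derivative \<psi>' (at x) b) \<or> schwartz (\<lambda>x. frechet_derivative \<psi>' (at x) b))"
      using 1 2 3 by blast
  qed
qed

lemma heat_kernel_schwartz:
  assumes "0 < \<epsilon>"
  shows "schwartz (\<lambda>x::'a::euclidean_space. complex_of_real (heat_kernel \<epsilon> (x - y)))"
  using polynomial_heat_kernel_schwartz[OF assms real_polynomial_function.intros(2)[of 1], of y] by simp

lemma fourier_integral_heat_kernel:
  fixes x :: "'a::euclidean_space"
  assumes e: "0 < \<epsilon>"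
  shows "fourier_integral (\<lambda>\<xi>. complex_of_real (heat_kernel \<epsilon> (\<xi> - y))) x = cis (- (x \<bullet> y)) * of_real (exp (- \<epsilon> * (norm x)\<^sup>2 / 2))"
proof -
  have "fourier_integral (\<lambda>\<xi>. complex_of_real (heat_kernel \<epsilon> (\<xi> - y))) x
      = (LINT \<xi>|lborel. cis (- ((\<xi> + y) \<bullet> x)) * complex_of_real (heat_kernel \<epsilon> (\<xi> + y - y)))"
    unfolding fourier_integral_def by (rule lborel_integral_translate[symmetric]) measurable
  also have "\<dots> = (LINT \<xi>|lborel. cis (- (x \<bullet> y)) * (cis (\<xi> \<bullet> (- x)) * complex_of_real (heat_kernel \<epsilon> \<xi>)))"
  proof (intro Bochner_Integration.integral_cong refl)
    fix \<xi> :: 'a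
    have "cis (- ((\<xi> + y) \<bullet> x)) = cis (- (x \<bullet> y)) * cis (\<xi> \<bullet> (- x))"
      unfolding cis_mult by (rule arg_cong[of _ _ cis]) (simp add: inner_add_left inner_commute[of y x])
    then show "cis (- ((\<xi> + y) \<bullet> x)) * complex_of_real (heat_kernel \<epsilon> (\<xi> + y - y))
        = cis (- (x \<bullet> y)) * (cis (\<xi> \<bullet> (- x)) * complex_of_real (heat_kernel \<epsilon> \<xi>))"
      by (simp add: mult.assoc)
  qed
  also have "\<dots> = cis (- (x \<bullet> y)) * of_real (exp (- \<epsilon> * (norm x)\<^sup>2 / 2))"
    using heat_kernel_fourier[OF e, of "- x"] by simp
  finally show ?thesis .
qed

section \<open>The distributional Fourier transform\<close>

abbreviation gaussian :: "real \<Rightarrow> 'a::euclidean_space \<Rightarrow> complex" where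
  "gaussian \<epsilon> x \<equiv> complex_of_real (exp (- \<epsilon> * (norm x)\<^sup>2 / 2))"

lemma gaussian_rapidly_decreasing:
  assumes "0 < \<epsilon>"
  shows "rapidly_decreasing (gaussian \<epsilon> :: 'a::euclidean_space \<Rightarrow> complex)"
  using exp_power_rapidly_decreasing[of 2 "\<epsilon> / 2", where 'a='a] assms by simp

lemma cis_gaussian_rapidly_decreasing:
  assumes "0 < \<epsilon>"
  shows "rapidly_decreasing (\<lambda>x::'a::euclidean_space. cis (- (x \<bullet> y)) * gaussian \<epsilon> x)"
  by (rule rapidly_decreasing_mult_bounded[OF gaussian_rapidly_decreasing[OF assms], of _ 1]) auto

text \<open>Testing with the Gaussian centred at \<open>y\<close>, whose transform is a modulated Gaussian.\<close>

lemma has_fourier_mollify: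
  assumes fg: "has_fourier f g" and e: "0 < \<epsilon>"
  shows "mollify \<epsilon> g y = (LINT x|lborel. f x * (cis (- (x \<bullet> y)) * gaussian \<epsilon> x))"
proof -
  have "(LINT \<xi>|lborel. g \<xi> * complex_of_real (heat_kernel \<epsilon> (\<xi> - y)))
      = (LINT x|lborel. f x * fourier_integral (\<lambda>\<xi>. complex_of_real (heat_kernel \<epsilon> (\<xi> - y))) x)"
    using fg heat_kernel_schwartz[OF e, of y] unfolding has_fourier_def by blast
  then show ?thesis by (simp only: mollify_def fourier_integral_heat_kernel[OF e])
qed

text \<open>Uniformity in \<open>\<epsilon>\<close> provides the majorant for removing the mollification under an integral with
  a tempered function.\<close>

lemma mollify_rapidly_decreasing_uniform:
  assumes "rapidly_decreasing (\<psi> :: 'a::euclidean_space \<Rightarrow> complex)"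
  obtains C where "\<And>\<epsilon> x. 0 < \<epsilon> \<Longrightarrow> \<epsilon> \<le> 1 \<Longrightarrow> norm (mollify \<epsilon> \<psi> x) \<le> C / bsq x ^ N"
proof -
  have [measurable]: "\<psi> \<in> borel_measurable borel" using assms by (simp add: rapidly_decreasing_def)
  obtain C where C: "0 < C" "\<And>x. norm (\<psi> x) \<le> C / bsq x ^ N"
    using rapidly_decreasing_bound[OF assms] by blast
  obtain M where M: "0 \<le> M"
    "\<And>\<epsilon>. 0 < \<epsilon> \<Longrightarrow> \<epsilon> \<le> 1 \<Longrightarrow> (\<integral>\<^sup>+z. ennreal (bsq z ^ N * heat_kernel \<epsilon> (z::'a)) \<partial>lborel) \<le> ennreal M"
    using heat_kernel_moment[of N, where 'a='a] by blast
  have "norm (mollify \<epsilon> \<psi> x) \<le> (C * 2 ^ N * M) / bsq x ^ N" if e: "0 < \<epsilon>" "\<epsilon> \<le> 1" for \<epsilon> x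
  proof -
    have "ennreal (norm (mollify \<epsilon> \<psi> x)) \<le> (\<integral>\<^sup>+y. norm (\<psi> y * of_real (heat_kernel \<epsilon> (y - x))) \<partial>lborel)"
      unfolding mollify_def by (rule norm_integral_le_nn_integral)
    also have "\<dots> \<le> (\<integral>\<^sup>+y. ennreal (C * 2 ^ N / bsq x ^ N) * ennreal (bsq (y - x) ^ N * heat_kernel \<epsilon> (y - x)) \<partial>lborel)"
    proof (intro nn_integral_mono)
      fix y :: 'a
      have "bsq x ^ N \<le> 2 ^ N * bsq y ^ N * bsq (y - x) ^ N"
        using bsq_triangle_power[of y "x - y" N] by (simp add: norm_minus_commute)
      then have "C / bsq y ^ N \<le> C * 2 ^ N / bsq x ^ N * bsq (y - x) ^ N"
        using C(1) by (simp add: field_simps)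
      then have "norm (\<psi> y) \<le> C * 2 ^ N / bsq x ^ N * bsq (y - x) ^ N"
        using C(2)[of y] by linarith
      then have "norm (\<psi> y) * heat_kernel \<epsilon> (y - x) \<le> C * 2 ^ N / bsq x ^ N * bsq (y - x) ^ N * heat_kernel \<epsilon> (y - x)"
        using e by (intro mult_right_mono) auto
      then show "ennreal (norm (\<psi> y * of_real (heat_kernel \<epsilon> (y - x)))) \<le> ennreal (C * 2 ^ N / bsq x ^ N) * ennreal (bsq (y - x) ^ N * heat_kernel \<epsilon> (y - x))"
        using e C(1) by (subst ennreal_mult[symmetric]) (auto simp: norm_mult mult_ac zero_le_power intro!: ennreal_leI)
    qed
    also have "\<dots> = ennreal (C * 2 ^ N / bsq x ^ N) * (\<integral>\<^sup>+y. ennreal (bsq (y - x) ^ N * heat_kernel \<epsilon> (y - x)) \<partial>lborel)"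
      by (intro nn_integral_cmult) measurable
    also have "(\<integral>\<^sup>+y. ennreal (bsq (y - x) ^ N * heat_kernel \<epsilon> (y - x)) \<partial>lborel) = (\<integral>\<^sup>+z. ennreal (bsq z ^ N * heat_kernel \<epsilon> (z::'a)) \<partial>lborel)"
      using lborel_nn_integral_translate[of "\<lambda>z::'a. ennreal (bsq z ^ N * heat_kernel \<epsilon> z)" "- x"] by simp
    also have "ennreal (C * 2 ^ N / bsq x ^ N) * \<dots> \<le> ennreal (C * 2 ^ N / bsq x ^ N) * ennreal M"
      by (intro mult_left_mono M e) simp
    also have "\<dots> = ennreal ((C * 2 ^ N * M) / bsq x ^ N)"
      using C(1) M(1) by (subst ennreal_mult[symmetric]) (auto simp: zero_le_power)
    finally show ?thesis
      using C(1) M(1) by (subst (asm) ennreal_le_iff) (auto simp: zero_le_power)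
  qed
  then show ?thesis using that by blast
qed

lemma mollify_adjoint:
  assumes g: "tempered g" and \<psi>: "rapidly_decreasing (\<psi> :: 'a::euclidean_space \<Rightarrow> complex)" and e: "0 < \<epsilon>"
  shows "(LINT \<xi>|lborel. g \<xi> * mollify \<epsilon> \<psi> \<xi>) = (LINT y|lborel. \<psi> y * mollify \<epsilon> g y)"
proof -
  have [measurable]: "g \<in> borel_measurable borel" "\<psi> \<in> borel_measurable borel"
    using g \<psi> by (auto simp: rapidly_decreasing_def tempered_def)
  obtain N where N: "integrable lborel (\<lambda>x. g x /\<^sub>R bsq x ^ N)" using g by (auto simp: tempered_def)
  obtain C where C: "0 < C" "\<And>x y::'a. bsq x ^ N * heat_kernel \<epsilon> (x - y) \<le> C * bsq y ^ N"
    using heat_kernel_decay[OF e] by blast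
  obtain B where B: "0 < B" "\<And>x. norm (\<psi> x) \<le> B / bsq x ^ (N + DIM('a))"
    using rapidly_decreasing_bound[OF \<psi>] by blast
  have \<psi>N: "integrable lborel (\<lambda>y. \<psi> y * complex_of_real (C * bsq y ^ N))"
  proof (rule Bochner_Integration.integrable_bound)
    show "integrable lborel (\<lambda>y::'a. (C * B) * (1 / bsq y ^ DIM('a)))"
      by (intro integrable_mult_right weight_integrable) simp
    show "AE y in lborel. norm (\<psi> y * complex_of_real (C * bsq y ^ N)) \<le> norm ((C * B) * (1 / bsq y ^ DIM('a)))"
    proof (intro AE_I2)
      fix y :: 'a
      have "norm (\<psi> y) * (C * bsq y ^ N) \<le> B / bsq y ^ (N + DIM('a)) * (C * bsq y ^ N)"
        using B(2) C(1) by (intro mult_right_mono) (auto simp: zero_le_power)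
      then show "norm (\<psi> y * complex_of_real (C * bsq y ^ N)) \<le> norm ((C * B) * (1 / bsq y ^ DIM('a)))"
        using B(1) C(1) unfolding norm_mult norm_of_real by (simp add: power_add abs_mult field_simps)
    qed
  qed measurable
  define G where "G \<xi> y = g \<xi> * (\<psi> y * complex_of_real (heat_kernel \<epsilon> (\<xi> - y)))" for \<xi> y
  have int: "integrable (lborel \<Otimes>\<^sub>M lborel) (case_prod G)"
  proof (rule Bochner_Integration.integrable_bound[OF lborel_pair.integrable_pair_mult(1)[OF N \<psi>N]])
    show "case_prod G \<in> borel_measurable (lborel \<Otimes>\<^sub>M lborel)" unfolding G_def by measurable
    have "norm (G \<xi> y) \<le> norm (g \<xi> /\<^sub>R bsq \<xi> ^ N) * norm (\<psi> y * complex_of_real (C * bsq y ^ N))" for \<xi> y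
    proof -
      have "heat_kernel \<epsilon> (\<xi> - y) \<le> (C * bsq y ^ N) / bsq \<xi> ^ N"
        using C(2)[of \<xi> y] by (simp add: field_simps)
      then have "norm (G \<xi> y) \<le> norm (g \<xi>) * (norm (\<psi> y) * ((C * bsq y ^ N) / bsq \<xi> ^ N))"
        unfolding G_def norm_mult using e by (intro mult_left_mono) auto
      also have "\<dots> = norm (g \<xi> /\<^sub>R bsq \<xi> ^ N) * norm (\<psi> y * complex_of_real (C * bsq y ^ N))"
        using C(1) unfolding norm_mult norm_of_real norm_scaleR by (simp add: abs_mult divide_inverse mult_ac)
      finally show ?thesis .
    qed
    then show "AE p in lborel \<Otimes>\<^sub>M lborel. norm (case_prod G p) \<le> norm (g (fst p) /\<^sub>R bsq (fst p) ^ N * (\<psi> (snd p) * complex_of_real (C * bsq (snd p) ^ N)))"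
      by (intro AE_I2) (auto simp only: case_prod_beta norm_mult)
  qed
  have "(LINT \<xi>|lborel. g \<xi> * mollify \<epsilon> \<psi> \<xi>) = (LINT \<xi>|lborel. LINT y|lborel. G \<xi> y)"
    unfolding mollify_def G_def heat_kernel_commute[of \<epsilon> "_ :: 'a"] by (simp add: heat_kernel_commute)
  also have "\<dots> = (LINT y|lborel. LINT \<xi>|lborel. G \<xi> y)"
    by (rule lborel_pair.Fubini_integral[OF int, symmetric])
  also have "\<dots> = (LINT y|lborel. \<psi> y * mollify \<epsilon> g y)"
    unfolding mollify_def G_def by (simp add: mult_ac flip: integral_mult_right_zero)
  finally show ?thesis .
qed

lemma fourier_multiplication_formula:
  fixes f :: "'a::euclidean_space \<Rightarrow> complex"
  assumes f: "integrable lborel f" and \<psi>: "integrable lborel \<psi>"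
  shows "(LINT \<xi>|lborel. fourier_integral f \<xi> * \<psi> \<xi>) = (LINT x|lborel. f x * fourier_integral \<psi> x)"
proof -
  have [measurable]: "f \<in> borel_measurable borel" "\<psi> \<in> borel_measurable borel"
    using f \<psi> by auto
  define G where "G x \<xi> = cis (- (x \<bullet> \<xi>)) * (f x * \<psi> \<xi>)" for x \<xi>
  have int: "integrable (lborel \<Otimes>\<^sub>M lborel) (case_prod G)"
  proof (rule Bochner_Integration.integrable_bound[OF lborel_pair.integrable_pair_mult(1)[OF f \<psi>]])
    show "case_prod G \<in> borel_measurable (lborel \<Otimes>\<^sub>M lborel)" unfolding G_def by measurable
  qed (auto simp: G_def norm_mult)
  have "(LINT \<xi>|lborel. fourier_integral f \<xi> * \<psi> \<xi>) = (LINT \<xi>|lborel. LINT x|lborel. G x \<xi>)"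
    unfolding fourier_integral_def G_def by (simp add: mult_ac flip: integral_mult_left_zero integral_mult_right_zero)
  also have "\<dots> = (LINT x|lborel. LINT \<xi>|lborel. G x \<xi>)"
    by (rule lborel_pair.Fubini_integral[OF int])
  also have "\<dots> = (LINT x|lborel. f x * fourier_integral \<psi> x)"
    unfolding fourier_integral_def G_def by (simp add: mult_ac inner_commute flip: integral_mult_left_zero integral_mult_right_zero)
  finally show ?thesis .
qed

lemma bounded_tempered:
  assumes [measurable]: "f \<in> borel_measurable borel" and "\<And>x. norm (f x) \<le> B"
  shows "tempered (f :: 'a::euclidean_space \<Rightarrow> complex)"
proof -
  have "integrable lborel (\<lambda>x. f x /\<^sub>R bsq x ^ DIM('a))"
  proof (rule Bochner_Integration.integrable_bound)
    show "integrable lborel (\<lambda>y::'a. B * (1 / bsq y ^ DIM('a)))"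
      by (intro integrable_mult_right weight_integrable) simp
    show "AE x in lborel. norm (f x /\<^sub>R bsq x ^ DIM('a)) \<le> norm (B * (1 / bsq x ^ DIM('a)))"
      using assms(2) by (auto intro!: AE_I2 simp: divide_inverse abs_mult mult_right_mono order_trans[OF _ abs_ge_self])
  qed measurable
  then show ?thesis by (auto simp: tempered_def)
qed

lemma integrable_has_fourier:
  fixes f :: "'a::euclidean_space \<Rightarrow> complex"
  assumes f: "integrable lborel f"
  shows "has_fourier f (fourier_integral f)"
proof -
  have "tempered (fourier_integral f)"
    using f by (intro bounded_tempered[OF _ norm_fourier_integral_le]) auto
  then show ?thesis
    unfolding has_fourier_def
    using f integrable_tempered fourier_multiplication_formula[OF f rapidly_decreasing_integrable[OF schwartz_rapidly_decreasing]]
    by blast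
qed

text \<open>Integrating the hypothesis against \<open>\<psi>(y)\<close> and moving the mollification over to \<open>\<psi>\<close> gives the
  defining identity with \<open>\<psi>\<close> mollified on one side and a Gaussian factor on the other; both
  disappear in the limit. So it suffices to test with translated Gaussians.\<close>

lemma has_fourierI:
  fixes f g :: "'a::euclidean_space \<Rightarrow> complex"
  assumes f: "tempered f" and g: "tempered g"
    and eq: "\<And>\<epsilon> y. 0 < \<epsilon> \<Longrightarrow> mollify \<epsilon> g y = (LINT x|lborel. f x * (cis (- (x \<bullet> y)) * gaussian \<epsilon> x))"
  shows "has_fourier f g"
  unfolding has_fourier_def
proof (intro conjI f g allI impI)
  fix \<psi> :: "'a \<Rightarrow> complex" assume \<psi>: "schwartz \<psi>"
  have rd: "rapidly_decreasing \<psi>" "rapidly_decreasing (fourier_integral \<psi>)"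
    using \<psi> by (auto intro: schwartz_rapidly_decreasing fourier_integral_rapidly_decreasing)
  have [measurable]: "f \<in> borel_measurable borel" "g \<in> borel_measurable borel" "\<psi> \<in> borel_measurable borel"
    using f g rd by (auto simp: rapidly_decreasing_def tempered_def)
  define e where "e k = inverse (real (Suc k))" for k
  have e: "0 < e k" "e k \<le> 1" "e \<longlonglongrightarrow> 0" for k
    unfolding e_def[abs_def] using LIMSEQ_inverse_real_of_nat by (auto simp: inverse_eq_divide)
  have step: "(LINT \<xi>|lborel. g \<xi> * mollify (e k) \<psi> \<xi>) = (LINT x|lborel. f x * gaussian (e k) x * fourier_integral \<psi> x)" for k
  proof -
    have fi: "integrable lborel (\<lambda>x. f x * gaussian (e k) x)"
      by (intro tempered_rapidly_decreasing_integrable f gaussian_rapidly_decreasing e)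
    have "(LINT \<xi>|lborel. g \<xi> * mollify (e k) \<psi> \<xi>) = (LINT y|lborel. \<psi> y * mollify (e k) g y)"
      by (rule mollify_adjoint[OF g rd(1) e(1)])
    also have "\<dots> = (LINT y|lborel. fourier_integral (\<lambda>x. f x * gaussian (e k) x) y * \<psi> y)"
      unfolding eq[OF e(1)] fourier_integral_def by (simp add: mult_ac)
    also have "\<dots> = (LINT x|lborel. f x * gaussian (e k) x * fourier_integral \<psi> x)"
      by (rule fourier_multiplication_formula[OF fi rapidly_decreasing_integrable[OF rd(1)]])
    finally show ?thesis .
  qed
  obtain N where N: "integrable lborel (\<lambda>x. g x /\<^sub>R bsq x ^ N)" using g by (auto simp: tempered_def)
  obtain C where C: "\<And>\<epsilon> x. 0 < \<epsilon> \<Longrightarrow> \<epsilon> \<le> 1 \<Longrightarrow> norm (mollify \<epsilon> \<psi> x) \<le> C / bsq x ^ N"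
    using mollify_rapidly_decreasing_uniform[OF rd(1)] by blast
  obtain B where B: "\<And>x. norm (\<psi> x) \<le> B"
    using rapidly_decreasing_bound[OF rd(1), of 0] by auto
  have "(\<lambda>k. LINT \<xi>|lborel. g \<xi> * mollify (e k) \<psi> \<xi>) \<longlonglongrightarrow> (LINT \<xi>|lborel. g \<xi> * \<psi> \<xi>)"
  proof (rule integral_dominated_convergence)
    show "integrable lborel (\<lambda>x. C * norm (g x /\<^sub>R bsq x ^ N))"
      using N by (intro integrable_mult_right integrable_norm)
    show "AE x in lborel. (\<lambda>k. g x * mollify (e k) \<psi> x) \<longlonglongrightarrow> g x * \<psi> x"
      by (intro AE_I2 tendsto_mult tendsto_const mollify_at_continuity_point[where B=B] e B schwartz_continuous \<psi>) measurable
    show "AE x in lborel. norm (g x * mollify (e k) \<psi> x) \<le> C * norm (g x /\<^sub>R bsq x ^ N)" for k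
    proof (intro AE_I2)
      fix x
      have "norm (g x * mollify (e k) \<psi> x) \<le> norm (g x) * (C / bsq x ^ N)"
        unfolding norm_mult by (intro mult_left_mono C e) auto
      then show "norm (g x * mollify (e k) \<psi> x) \<le> C * norm (g x /\<^sub>R bsq x ^ N)"
        by (simp add: divide_inverse mult_ac)
    qed
  qed measurable
  moreover have "(\<lambda>k. LINT x|lborel. f x * gaussian (e k) x * fourier_integral \<psi> x) \<longlonglongrightarrow> (LINT x|lborel. f x * fourier_integral \<psi> x)"
  proof (rule integral_dominated_convergence)
    show "integrable lborel (\<lambda>x. norm (f x * fourier_integral \<psi> x))"
      by (intro integrable_norm tempered_rapidly_decreasing_integrable f rd)
    show "AE x in lborel. (\<lambda>k. f x * gaussian (e k) x * fourier_integral \<psi> x) \<longlonglongrightarrow> f x * fourier_integral \<psi> x"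
    proof (intro AE_I2)
      fix x
      have "(\<lambda>k. f x * gaussian (e k) x * fourier_integral \<psi> x) \<longlonglongrightarrow> f x * gaussian 0 x * fourier_integral \<psi> x"
        by (intro tendsto_intros e) simp
      then show "(\<lambda>k. f x * gaussian (e k) x * fourier_integral \<psi> x) \<longlonglongrightarrow> f x * fourier_integral \<psi> x" by simp
    qed
    show "AE x in lborel. norm (f x * gaussian (e k) x * fourier_integral \<psi> x) \<le> norm (f x * fourier_integral \<psi> x)" for k
      using e(1)[of k, THEN less_imp_le]
      by (intro AE_I2) (auto simp: norm_mult mult_left_le intro!: mult_right_mono)
  qed measurable
  ultimately show "(LINT \<xi>|lborel. g \<xi> * \<psi> \<xi>) = (LINT x|lborel. f x * fourier_integral \<psi> x)"
    unfolding step by (rule LIMSEQ_unique)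
qed

lemma tempered_cong_AE:
  assumes "tempered f" "AE x in lborel. f x = f' x" "f' \<in> borel_measurable borel"
  shows "tempered f'"
proof -
  have [measurable]: "f \<in> borel_measurable borel" "f' \<in> borel_measurable borel"
    using assms by (auto simp: tempered_def)
  obtain N where "integrable lborel (\<lambda>x. f x /\<^sub>R bsq x ^ N)" using assms by (auto simp: tempered_def)
  moreover have "integrable lborel (\<lambda>x. f x /\<^sub>R bsq x ^ N) \<longleftrightarrow> integrable lborel (\<lambda>x. f' x /\<^sub>R bsq x ^ N)"
    by (rule integrable_cong_AE, measurable) (use assms(2) in \<open>eventually_elim, simp\<close>)
  ultimately show ?thesis by (auto simp: tempered_def)
qed

lemma has_fourier_cong_AE:
  assumes "has_fourier f g" "AE x in lborel. f x = f' x" "AE x in lborel. g x = g' x"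
    "f' \<in> borel_measurable borel" "g' \<in> borel_measurable borel"
  shows "has_fourier f' g'"
proof -
  have t: "tempered f'" "tempered g'"
    using assms tempered_cong_AE unfolding has_fourier_def by blast+
  have [measurable]: "f \<in> borel_measurable borel" "f' \<in> borel_measurable borel"
    "g \<in> borel_measurable borel" "g' \<in> borel_measurable borel"
    using assms by (auto simp: tempered_def has_fourier_def)
  have "(LINT \<xi>|lborel. g' \<xi> * \<psi> \<xi>) = (LINT x|lborel. f' x * fourier_integral \<psi> x)" if \<psi>: "schwartz \<psi>" for \<psi>
  proof -
    have [measurable]: "\<psi> \<in> borel_measurable borel"
      using schwartz_rapidly_decreasing[OF \<psi>] by (simp add: rapidly_decreasing_def)
    have "(LINT \<xi>|lborel. g' \<xi> * \<psi> \<xi>) = (LINT \<xi>|lborel. g \<xi> * \<psi> \<xi>)"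
      by (rule integral_cong_AE, measurable) (use assms(3) in \<open>eventually_elim, simp\<close>)
    also have "\<dots> = (LINT x|lborel. f x * fourier_integral \<psi> x)"
      using assms(1) \<psi> by (simp add: has_fourier_def)
    also have "\<dots> = (LINT x|lborel. f' x * fourier_integral \<psi> x)"
      by (rule integral_cong_AE, measurable) (use assms(2) in \<open>eventually_elim, simp\<close>)
    finally show ?thesis .
  qed
  then show ?thesis using t by (auto simp: has_fourier_def)
qed

text \<open>The product of \<open>f - f'\<close> with a Gaussian is integrable, and by \<open>has_fourier_mollify\<close> its transform is a mollification of
  \<open>g - g' = 0\<close>.\<close>

lemma has_fourier_unique:
  fixes f f' g g' :: "'a::euclidean_space \<Rightarrow> complex"
  assumes fg: "has_fourier f g" and fg': "has_fourier f' g'" and gg': "AE x in lborel. g x = g' x"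
  shows "AE x in lborel. f x = f' x"
proof -
  have [measurable]: "f \<in> borel_measurable borel" "f' \<in> borel_measurable borel"
    "g \<in> borel_measurable borel" "g' \<in> borel_measurable borel"
    using assms by (auto simp: tempered_def has_fourier_def)
  have int: "integrable lborel (\<lambda>x. f x * gaussian 1 x)" "integrable lborel (\<lambda>x. f' x * gaussian 1 x)"
    using fg fg' unfolding has_fourier_def
    by (intro tempered_rapidly_decreasing_integrable gaussian_rapidly_decreasing zero_less_one; blast)+
  define d where "d x = f x * gaussian 1 x - f' x * gaussian 1 x" for x
  have d: "integrable lborel d" unfolding d_def by (intro Bochner_Integration.integrable_diff int)
  have int2: "integrable lborel (\<lambda>x. f x * (cis (- (x \<bullet> y)) * gaussian 1 x))" "integrable lborel (\<lambda>x. f' x * (cis (- (x \<bullet> y)) * gaussian 1 x))" for y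
    using fg fg' unfolding has_fourier_def
    by (intro tempered_rapidly_decreasing_integrable cis_gaussian_rapidly_decreasing zero_less_one; blast)+
  have "fourier_integral d y = 0" for y
  proof -
    have "fourier_integral d y = (LINT x|lborel. f x * (cis (- (x \<bullet> y)) * gaussian 1 x) - f' x * (cis (- (x \<bullet> y)) * gaussian 1 x))"
      unfolding fourier_integral_def d_def by (simp add: algebra_simps)
    also have "\<dots> = mollify 1 g y - mollify 1 g' y"
      using int2 by (simp only: Bochner_Integration.integral_diff has_fourier_mollify[OF fg zero_less_one] has_fourier_mollify[OF fg' zero_less_one])
    also have "mollify 1 g y = mollify 1 g' y"
      unfolding mollify_def by (rule integral_cong_AE, measurable) (use gg' in \<open>eventually_elim, simp\<close>)
    finally show ?thesis by simp
  qed
  from fourier_integral_injective[OF d this] show ?thesis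
    by eventually_elim (simp add: d_def)
qed

text \<open>All mollifications of \<open>g - g'\<close> vanish, and they converge to it almost everywhere along
  a sequence.\<close>

lemma has_fourier_unique_transform:
  fixes f g g' :: "'a::euclidean_space \<Rightarrow> complex"
  assumes fg: "has_fourier f g" and fg': "has_fourier f g'"
  shows "AE x in lborel. g x = g' x"
proof -
  have t: "tempered g" "tempered g'" using assms by (auto simp: has_fourier_def)
  obtain N where N: "integrable lborel (\<lambda>x. g x /\<^sub>R bsq x ^ N)" "g \<in> borel_measurable borel" using t by (auto simp: tempered_def)
  obtain N' where N': "integrable lborel (\<lambda>x. g' x /\<^sub>R bsq x ^ N')" "g' \<in> borel_measurable borel" using t by (auto simp: tempered_def)
  have [measurable]: "g \<in> borel_measurable borel" "g' \<in> borel_measurable borel" using N N' by auto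
  have "integrable lborel (\<lambda>x. g x /\<^sub>R bsq x ^ max N N' - g' x /\<^sub>R bsq x ^ max N N')"
    by (intro Bochner_Integration.integrable_diff tempered_exponent_mono[OF N] tempered_exponent_mono[OF N']) auto
  then have td: "tempered (\<lambda>x. g x - g' x)"
    by (auto simp: tempered_def scaleR_diff_right)
  obtain e where e: "\<And>k. 0 < e k" "\<And>k. e k \<le> 1" "e \<longlonglongrightarrow> 0"
    "AE x in lborel. (\<lambda>k. mollify (e k) (\<lambda>x. g x - g' x) x) \<longlonglongrightarrow> g x - g' x"
    using mollify_AE_subsequence[OF td] by blast
  have "mollify (e k) (\<lambda>x. g x - g' x) x = 0" for k x
    using has_fourier_mollify[OF fg e(1)] has_fourier_mollify[OF fg' e(1)] by (simp add: mollify_diff t e)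
  with e(4) have "AE x in lborel. (\<lambda>k. 0) \<longlonglongrightarrow> g x - g' x" by simp
  then show ?thesis by eventually_elim (simp add: LIMSEQ_const_iff)
qed

definition inverse_fourier :: "('a::euclidean_space \<Rightarrow> complex) \<Rightarrow> 'a \<Rightarrow> complex" where
  "inverse_fourier h x = (LINT \<xi>|lborel. h \<xi> * cis (x \<bullet> \<xi>)) / of_real ((2 * pi) ^ DIM('a))"

lemma inverse_fourier_eq: "inverse_fourier h x = fourier_integral h (- x) / of_real ((2 * pi) ^ DIM('a))" for x :: "'a::euclidean_space"
  by (simp add: inverse_fourier_def fourier_integral_def inner_commute mult.commute)

text \<open>By \<open>has_fourierI\<close> this is Fourier inversion with a Gaussian convergence factor.\<close>

lemma inverse_fourier_has_fourier:
  fixes h :: "'a::euclidean_space \<Rightarrow> complex"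
  assumes h: "integrable lborel h"
  shows "has_fourier (inverse_fourier h) h"
proof (rule has_fourierI)
  have [measurable]: "h \<in> borel_measurable borel" using h by auto
  define D where "D = (2 * pi) ^ DIM('a)"
  have D: "0 < D" by (simp add: D_def)
  show "tempered (inverse_fourier h)"
  proof (rule bounded_tempered)
    show "inverse_fourier h \<in> borel_measurable borel"
      unfolding inverse_fourier_def[abs_def] by measurable
    show "norm (inverse_fourier h x) \<le> (LINT x|lborel. norm (h x)) / D" for x
      using norm_fourier_integral_le[of h "- x"] D
      unfolding inverse_fourier_eq D_def[symmetric] norm_divide norm_of_real by (simp add: divide_right_mono)
  qed
  show "tempered h" by (rule integrable_tempered[OF h])
  fix \<epsilon> :: real and y :: 'a assume e: "0 < \<epsilon>"
  have "(LINT x|lborel. inverse_fourier h x * (cis (- (x \<bullet> y)) * gaussian \<epsilon> x))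
    = (LINT x|lborel. inverse_fourier h (0 - x) * (cis (- ((0 - x) \<bullet> y)) * gaussian \<epsilon> (0 - x)))"
    unfolding inverse_fourier_def
    by (rule lborel_integral_reflect[symmetric]) measurable
  also have "\<dots> = (LINT x|lborel. fourier_integral h x * (cis (x \<bullet> y) * gaussian \<epsilon> x)) / of_real D"
    by (subst integral_divide_zero[symmetric]) (simp add: inverse_fourier_eq D_def)
  also have "\<dots> = mollify \<epsilon> h y"
    using mollify_eq_fourier[OF h e, of y] D unfolding D_def[symmetric] by (simp add: field_simps)
  finally show "mollify \<epsilon> h y = (LINT x|lborel. inverse_fourier h x * (cis (- (x \<bullet> y)) * gaussian \<epsilon> x))" ..
qed

section \<open>Weighted energies\<close>

lemma borel_measurable_fst [measurable]:
  "fst \<in> borel_measurable (borel :: ('a::second_countable_topology \<times> 'b::second_countable_topology) measure)"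
  by (intro borel_measurable_continuous_onI continuous_intros)

lemma borel_measurable_snd [measurable]:
  "snd \<in> borel_measurable (borel :: ('a::second_countable_topology \<times> 'b::second_countable_topology) measure)"
  by (intro borel_measurable_continuous_onI continuous_intros)

lemma L2_norm_le_iff:
  assumes "0 \<le> c"
  shows "L2_norm M f \<le> ennreal c \<longleftrightarrow> (\<integral>\<^sup>+z. ennreal ((norm (f z))\<^sup>2) \<partial>M) \<le> ennreal (c\<^sup>2)"
proof (cases "\<integral>\<^sup>+z. ennreal ((norm (f z))\<^sup>2) \<partial>M")
  case (real r)
  then have "L2_norm M f = ennreal (sqrt r)" by (simp add: L2_norm_def)
  moreover have "sqrt r \<le> c \<longleftrightarrow> r \<le> c\<^sup>2"
    using assms real(1) real_le_lsqrt real_sqrt_le_iff real_sqrt_abs by (metis abs_of_nonneg)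
  ultimately show ?thesis using assms real by simp
next
  case top
  then show ?thesis by (simp add: L2_norm_def top_unique)
qed

lemma L2_norm_top_iff: "L2_norm M f = \<infinity> \<longleftrightarrow> (\<integral>\<^sup>+z. ennreal ((norm (f z))\<^sup>2) \<partial>M) = \<infinity>"
  by (simp add: L2_norm_def Let_def)

text \<open>The square of the weighted norm, before the root is taken: this is additive and amenable
  to Fubini and Fatou.\<close>

definition energy :: "('a::euclidean_space \<Rightarrow> real) \<Rightarrow> (real \<times> 'a \<Rightarrow> complex) \<Rightarrow> ennreal" where
  "energy w u = (\<integral>\<^sup>+p. ennreal ((w (snd p) * norm (u p))\<^sup>2) \<partial>lborel)"

lemma energy_eq: "energy w u = sq_integral (\<lambda>p. (\<lambda>(t, x). of_real (w x) * u (t, x)) p)"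
  unfolding energy_def by (intro nn_integral_cong) (auto simp: norm_mult power_mult_distrib)

lemma weighted_L2_norm_le_iff:
  "0 \<le> c \<Longrightarrow> L2_norm lborel (\<lambda>(t, x). of_real (w x) * u (t, x)) \<le> ennreal c \<longleftrightarrow> energy w u \<le> ennreal (c\<^sup>2)"
  unfolding energy_eq by (rule L2_norm_le_iff)

lemma weighted_L2_norm_le_scaled:
  assumes "energy w' u' \<le> ennreal q * energy w u" "0 \<le> q" "energy w u < \<infinity>"
  shows "L2_norm lborel (\<lambda>(t, x). of_real (w' x) * u' (t, x)) \<le> ennreal (sqrt q) * L2_norm lborel (\<lambda>(t, x). of_real (w x) * u (t, x))"
proof -
  obtain r where r: "energy w u = ennreal r" "0 \<le> r" using assms(3) by (cases "energy w u") auto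
  then have 1: "L2_norm lborel (\<lambda>(t, x). of_real (w x) * u (t, x)) = ennreal (sqrt r)"
    unfolding energy_eq by (simp add: L2_norm_def)
  have "L2_norm lborel (\<lambda>(t, x). of_real (w' x) * u' (t, x)) \<le> ennreal (sqrt q * sqrt r)"
    using assms r by (subst weighted_L2_norm_le_iff) (simp_all add: power_mult_distrib ennreal_mult)
  then show ?thesis using assms r by (simp add: 1 ennreal_mult)
qed

lemma energy_iterated:
  assumes [measurable]: "w \<in> borel_measurable borel" "u \<in> borel_measurable borel"
  shows "energy w u = (\<integral>\<^sup>+t. \<integral>\<^sup>+x. ennreal ((w x * norm (u (t, x)))\<^sup>2) \<partial>lborel \<partial>lborel)"
proof -
  have [measurable]: "u \<in> borel_measurable (lborel \<Otimes>\<^sub>M lborel)"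
    using assms(2) by (simp add: lborel_prod)
  show ?thesis
    unfolding energy_def lborel_prod[symmetric]
    by (subst lborel.nn_integral_fst[symmetric]) auto
qed

lemma energy_iterated':
  assumes [measurable]: "w \<in> borel_measurable borel" "u \<in> borel_measurable borel"
  shows "energy w u = (\<integral>\<^sup>+x. \<integral>\<^sup>+t. ennreal ((w x * norm (u (t, x)))\<^sup>2) \<partial>lborel \<partial>lborel)"
proof -
  have [measurable]: "u \<in> borel_measurable (lborel \<Otimes>\<^sub>M lborel)"
    using assms(2) by (simp add: lborel_prod)
  show ?thesis
    unfolding energy_def lborel_prod[symmetric]
    by (subst lborel_pair.nn_integral_snd[symmetric]) auto
qed

lemma AE_lborel_ex:
  assumes "AE t in lborel. P (t::'a::euclidean_space)"
  shows "\<exists>t. P t"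
proof (rule ccontr)
  assume "\<nexists>t. P t"
  then have "AE t::'a in lborel. False" using assms by simp
  then show False
    by (simp add: trivial_limit_def[symmetric] ae_filter_eq_bot_iff)
qed

lemma AE_lborel_prodI:
  fixes P :: "real \<times> 'a::euclidean_space \<Rightarrow> bool"
  assumes "AE t in lborel. AE x in lborel. P (t, x)" "{p. P p} \<in> sets borel"
  shows "AE p in lborel. P p"
proof -
  have "AE p in lborel \<Otimes>\<^sub>M lborel. P p"
  proof (rule lborel_pair.AE_pair_measure)
    show "{p \<in> space (lborel \<Otimes>\<^sub>M lborel). P p} \<in> sets (lborel \<Otimes>\<^sub>M lborel)"
      unfolding lborel_prod using assms(2) by simp
  qed (rule assms(1))
  then show ?thesis unfolding lborel_prod .
qed

text \<open>The set of good \<open>t\<close> need not be measurable, so the substitution is made in a null set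
  containing its complement.\<close>

lemma AE_lborel_scale:
  assumes "AE t in lborel. P (t::real)" "c \<noteq> 0"
  shows "AE t in lborel. P (c * t)"
proof -
  obtain N where N: "N \<in> null_sets lborel" "\<And>t. t \<notin> N \<Longrightarrow> P t"
    using assms(1) by (auto elim!: AE_E3)
  have [measurable]: "N \<in> sets borel" using N(1) by (auto simp: null_sets_def)
  have "AE t in lborel. t \<notin> N" by (rule AE_not_in[OF N(1)])
  then have "AE t in lborel. 0 + c * t \<notin> N"
    using assms(2) by (subst AE_borel_affine) auto
  then show ?thesis using N(2) by (auto elim!: eventually_mono)
qed

section \<open>Uniqueness of evolutions and their norms\<close>

text \<open>The symbol of \<open>|D|\<^sup>s exp(i t |D|\<^sup>m)\<close>.\<close>

definition symb :: "real \<Rightarrow> real \<Rightarrow> real \<Rightarrow> 'a::euclidean_space \<Rightarrow> complex" where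
  "symb s m t \<xi> = of_real (norm \<xi> powr s) * cis (t * norm \<xi> powr m)"

lemma symb_measurable [measurable]: "(\<lambda>p. symb s m (fst p) (snd p)) \<in> borel_measurable (borel \<Otimes>\<^sub>M borel)"
  unfolding symb_def by measurable

lemma symb_measurable' [measurable]: "symb s m t \<in> borel_measurable borel"
  unfolding symb_def[abs_def] by measurable

lemma is_evolution_measurable: "is_evolution s m \<phi> u \<Longrightarrow> u \<in> borel_measurable borel"
  by (simp add: is_evolution_def)

lemma is_evolution_has_fourier:
  assumes "is_evolution s m \<phi> u"
  obtains g where "has_fourier \<phi> g"
proof -
  have "\<exists>t. has_multiplier (\<lambda>\<xi>. of_real (norm \<xi> powr s) * cis (t * norm \<xi> powr m)) \<phi> (\<lambda>x. u (t, x))"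
    using assms by (intro AE_lborel_ex) (simp add: is_evolution_def)
  then show ?thesis using that by (auto simp: has_multiplier_def)
qed

text \<open>The definition allows a different transform of \<open>\<phi>\<close> for each \<open>t\<close>; uniqueness of the
  transform lets all of them be replaced by one.\<close>

lemma is_evolution_fourier:
  assumes u: "is_evolution s m \<phi> u" and g: "has_fourier \<phi> g"
  shows "AE t in lborel. has_fourier (\<lambda>x. u (t, x)) (\<lambda>\<xi>. symb s m t \<xi> * g \<xi>)"
proof -
  have [measurable]: "u \<in> borel_measurable borel" by (rule is_evolution_measurable[OF u])
  have [measurable]: "g \<in> borel_measurable borel" using g by (auto simp: has_fourier_def tempered_def)
  have "AE t in lborel. has_multiplier (\<lambda>\<xi>. of_real (norm \<xi> powr s) * cis (t * norm \<xi> powr m)) \<phi> (\<lambda>x. u (t, x))"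
    using u by (simp add: is_evolution_def)
  then show ?thesis
  proof eventually_elim
    case (elim t)
    then obtain g' where g': "has_fourier \<phi> g'" "has_fourier (\<lambda>x. u (t, x)) (\<lambda>\<xi>. symb s m t \<xi> * g' \<xi>)"
      by (auto simp: has_multiplier_def symb_def)
    have "AE \<xi> in lborel. symb s m t \<xi> * g' \<xi> = symb s m t \<xi> * g \<xi>"
      using has_fourier_unique_transform[OF g'(1) g] by eventually_elim simp
    then show ?case
      by (intro has_fourier_cong_AE[OF g'(2)]) auto
  qed
qed

lemma is_evolutionI:
  assumes "u \<in> borel_measurable borel" "has_fourier \<phi> g"
    "AE t in lborel. has_fourier (\<lambda>x. u (t, x)) (\<lambda>\<xi>. symb s m t \<xi> * g \<xi>)"
  shows "is_evolution s m \<phi> u"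
  unfolding is_evolution_def has_multiplier_def
  using assms by (auto simp: symb_def elim!: eventually_mono)

lemma is_evolution_unique:
  assumes u: "is_evolution s m \<phi> u" and v: "is_evolution s m \<phi> v"
  shows "AE p in lborel. u p = v p"
proof -
  have [measurable]: "u \<in> borel_measurable borel" "v \<in> borel_measurable borel"
    using u v by (auto intro: is_evolution_measurable)
  obtain g where g: "has_fourier \<phi> g" using is_evolution_has_fourier[OF u] by blast
  have "AE t in lborel. AE x in lborel. u (t, x) = v (t, x)"
    using is_evolution_fourier[OF u g] is_evolution_fourier[OF v g]
    by eventually_elim (rule has_fourier_unique, auto)
  then show ?thesis by (rule AE_lborel_prodI) measurable
qed

text \<open>Evolutions agree almost everywhere, so the infimum is over a single value.\<close>

lemma evolution_norm_eq:
  assumes u: "is_evolution s m \<phi> u"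
  shows "evolution_norm w s m \<phi> = L2_norm lborel (\<lambda>(t, x). of_real (w x) * u (t, x))"
proof -
  have "L2_norm lborel (\<lambda>(t, x). of_real (w x) * v (t, x)) = L2_norm lborel (\<lambda>(t, x). of_real (w x) * u (t, x))"
    if v: "is_evolution s m \<phi> v" for v
  proof -
    have "energy w v = energy w u"
      unfolding energy_def
    proof (rule nn_integral_cong_AE)
      show "AE p in lborel. ennreal ((w (snd p) * norm (v p))\<^sup>2) = ennreal ((w (snd p) * norm (u p))\<^sup>2)"
        using is_evolution_unique[OF v u] by eventually_elim simp
    qed
    then show ?thesis unfolding L2_norm_def energy_eq[symmetric] by simp
  qed
  note eq = this
  show ?thesis
    unfolding evolution_norm_def
  proof (rule INF_eq_const)
    show "{u. is_evolution s m \<phi> u} \<noteq> {}" using u by blast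
  qed (rule eq, simp)
qed

lemma evolution_norm_no_evolution: "(\<And>u. \<not> is_evolution s m \<phi> u) \<Longrightarrow> evolution_norm w s m \<phi> = \<infinity>"
  by (simp add: evolution_norm_def)

lemma evolution_norm_mono_weight:
  assumes "AE x in lborel. \<bar>w x\<bar> \<le> \<bar>w' x\<bar>" and [measurable]: "w \<in> borel_measurable borel" "w' \<in> borel_measurable borel"
  shows "evolution_norm w s m \<phi> \<le> evolution_norm w' s m \<phi>"
proof (cases "\<exists>u. is_evolution s m \<phi> u")
  case True
  then obtain u where u: "is_evolution s m \<phi> u" ..
  have [measurable]: "u \<in> borel_measurable borel" by (rule is_evolution_measurable[OF u])
  have "energy w u \<le> energy w' u"
    unfolding energy_iterated[OF assms(2) \<open>u \<in> borel_measurable borel\<close>] energy_iterated[OF assms(3) \<open>u \<in> borel_measurable borel\<close>]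
  proof (rule nn_integral_mono, rule nn_integral_mono_AE)
    fix t
    show "AE x in lborel. ennreal ((w x * norm (u (t, x)))\<^sup>2) \<le> ennreal ((w' x * norm (u (t, x)))\<^sup>2)"
      using assms(1) by eventually_elim (auto intro!: ennreal_leI mult_right_mono simp: power_mult_distrib abs_le_square_iff)
  qed
  then show ?thesis
    unfolding evolution_norm_eq[OF u]
    by (cases "energy w' u = \<infinity>")
       (use weighted_L2_norm_le_scaled[of w u 1 w' u] L2_norm_top_iff[of lborel "\<lambda>(t, x). of_real (w' x) * u (t, x)"] in
         \<open>auto simp: energy_eq less_top\<close>)
next
  case False
  then show ?thesis by (simp add: evolution_norm_no_evolution)
qed

lemma abs_weight_measurable [measurable]: "abs_weight \<gamma> \<in> borel_measurable borel"
  unfolding abs_weight_def[abs_def] by measurable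

lemma jap_weight_measurable [measurable]: "jap_weight \<gamma> \<in> borel_measurable borel"
  unfolding jap_weight_def[abs_def] by measurable

lemma AE_lborel_nonzero: "AE x::'a::euclidean_space in lborel. x \<noteq> 0"
  using AE_lborel_singleton by blast

lemma norm_le_jap: "norm x \<le> sqrt (bsq x)"
  by (rule real_le_rsqrt) simp

lemma jap_weight_le_abs_weight:
  assumes "\<gamma> \<le> 0" "x \<noteq> 0"
  shows "jap_weight \<gamma> x \<le> abs_weight \<gamma> x"
  unfolding jap_weight_def abs_weight_def using assms norm_le_jap by (intro powr_mono2') auto

lemma jap_weight_norm_le:
  assumes "\<gamma> \<le> 0"
  shows "evolution_norm (jap_weight \<gamma>) s m (\<phi> :: 'a::euclidean_space \<Rightarrow> complex) \<le> evolution_norm (abs_weight \<gamma>) s m \<phi>"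
proof (rule evolution_norm_mono_weight)
  show "AE x::'a in lborel. \<bar>jap_weight \<gamma> x\<bar> \<le> \<bar>abs_weight \<gamma> x\<bar>"
    using AE_lborel_nonzero
  proof eventually_elim
    case (elim x)
    then show ?case
      using jap_weight_le_abs_weight[OF assms, of x] by (simp add: jap_weight_def abs_weight_def)
  qed
qed measurable

lemma abs_weight_le_jap_weight:
  assumes "0 \<le> \<gamma>"
  shows "abs_weight \<gamma> x \<le> jap_weight \<gamma> x"
  unfolding jap_weight_def abs_weight_def using assms norm_le_jap by (intro powr_mono2) auto

section \<open>Dilations\<close>

lemma tempered_dilate:
  fixes f :: "'a::euclidean_space \<Rightarrow> complex"
  assumes f: "tempered f" and l: "0 < l"
  shows "tempered (\<lambda>x. f (l *\<^sub>R x))"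
proof -
  have [measurable]: "f \<in> borel_measurable borel" by (rule tempered_measurable[OF f])
  obtain N where N: "integrable lborel (\<lambda>x. f x /\<^sub>R bsq x ^ N)" using f by (auto simp: tempered_def)
  have "integrable lborel (\<lambda>x. f (0 + l *\<^sub>R x) /\<^sub>R bsq (0 + l *\<^sub>R x) ^ N)"
    using N l by (subst lborel_integrable_affine) auto
  then have int: "integrable lborel (\<lambda>x. (1 + l\<^sup>2) ^ N *\<^sub>R (f (l *\<^sub>R x) /\<^sub>R bsq (l *\<^sub>R x) ^ N))"
    by (intro integrable_scaleR_right) simp
  have "integrable lborel (\<lambda>x. f (l *\<^sub>R x) /\<^sub>R bsq x ^ N)"
  proof (rule Bochner_Integration.integrable_bound[OF int])
    have "inverse (bsq x ^ N) \<le> (1 + l\<^sup>2) ^ N * inverse (bsq (l *\<^sub>R x) ^ N)" for x :: 'a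
    proof -
      have "bsq (l *\<^sub>R x) ^ N \<le> ((1 + l\<^sup>2) * bsq x) ^ N"
        by (intro power_mono) (auto simp: power_mult_distrib algebra_simps)
      then have *: "bsq (l *\<^sub>R x) ^ N \<le> (1 + l\<^sup>2) ^ N * bsq x ^ N"
        by (simp only: power_mult_distrib)
      have q: "inverse p \<le> c * inverse q" if "0 < p" "0 < q" "q \<le> c * p" for p q c :: real
        using that by (simp add: field_simps)
      show ?thesis by (rule q[OF bsq_power_pos bsq_power_pos *])
    qed
    then have "norm (f (l *\<^sub>R x)) * inverse (bsq x ^ N) \<le> norm (f (l *\<^sub>R x)) * ((1 + l\<^sup>2) ^ N * inverse (bsq (l *\<^sub>R x) ^ N))" for x
      by (intro mult_left_mono) auto
    moreover have "norm (z /\<^sub>R q) = norm z * inverse q" if "0 < q" for z :: complex and q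
      using that by simp
    moreover have "norm (q *\<^sub>R z) = norm z * q" if "0 < q" for z :: complex and q
      using that by simp
    moreover have "0 < (1 + l\<^sup>2) ^ N" by (simp add: add_pos_nonneg)
    ultimately show "AE x in lborel. norm (f (l *\<^sub>R x) /\<^sub>R bsq x ^ N) \<le> norm ((1 + l\<^sup>2) ^ N *\<^sub>R (f (l *\<^sub>R x) /\<^sub>R bsq (l *\<^sub>R x) ^ N))"
      by (intro AE_I2) (simp only: bsq_power_pos mult_ac)
  qed measurable
  then show ?thesis by (auto simp: tempered_def)
qed

lemma tempered_cmult: "tempered f \<Longrightarrow> tempered (\<lambda>x. c * f x)"
proof -
  assume f: "tempered f"
  then have [measurable]: "f \<in> borel_measurable borel" by (rule tempered_measurable)
  obtain N where "integrable lborel (\<lambda>x. f x /\<^sub>R bsq x ^ N)" using f by (auto simp: tempered_def)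
  then have "integrable lborel (\<lambda>x. c * (f x /\<^sub>R bsq x ^ N))" by (intro integrable_mult_right)
  then show ?thesis by (auto simp: tempered_def)
qed

lemma has_fourier_cmult: "has_fourier f g \<Longrightarrow> has_fourier (\<lambda>x. c * f x) (\<lambda>x. c * g x)"
  unfolding has_fourier_def by (auto simp: tempered_cmult mult.assoc)

text \<open>Tested with Gaussians, dilation only changes the variance.\<close>

lemma has_fourier_dilate:
  fixes f :: "'a::euclidean_space \<Rightarrow> complex"
  assumes fg: "has_fourier f g" and l: "0 < l"
  shows "has_fourier (\<lambda>x. f (l *\<^sub>R x)) (\<lambda>\<xi>. of_real (1 / l ^ DIM('a)) * g ((1 / l) *\<^sub>R \<xi>))"
proof (rule has_fourierI)
  have t: "tempered f" "tempered g" using fg by (auto simp: has_fourier_def)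
  have [measurable]: "f \<in> borel_measurable borel" "g \<in> borel_measurable borel" using t by (auto simp: tempered_measurable)
  show "tempered (\<lambda>x. f (l *\<^sub>R x))" by (rule tempered_dilate[OF t(1) l])
  show "tempered (\<lambda>\<xi>. of_real (1 / l ^ DIM('a)) * g ((1 / l) *\<^sub>R \<xi>))"
    by (intro tempered_cmult tempered_dilate t) (use l in simp)
  fix \<epsilon> :: real and y :: 'a assume e: "0 < \<epsilon>"
  define D where "D = l ^ DIM('a)"
  have D: "0 < D" using l by (simp add: D_def)
  have e': "0 < \<epsilon> / l\<^sup>2" using e l by simp
  have k: "heat_kernel \<epsilon> (l *\<^sub>R z) = heat_kernel (\<epsilon> / l\<^sup>2) z / D" for z :: 'a
  proof -
    have "1 / sqrt (2 * pi * (\<epsilon> / l\<^sup>2)) = l * (1 / sqrt (2 * pi * \<epsilon>))"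
      using l e by (simp add: real_sqrt_mult real_sqrt_divide)
    then have "(1 / sqrt (2 * pi * (\<epsilon> / l\<^sup>2))) ^ DIM('a) = D * (1 / sqrt (2 * pi * \<epsilon>)) ^ DIM('a)"
      by (simp only: D_def power_mult_distrib)
    then show ?thesis unfolding heat_kernel_def using l D by (simp add: power_mult_distrib mult.commute)
  qed
  have "mollify \<epsilon> (\<lambda>\<xi>. of_real (1 / D) * g ((1 / l) *\<^sub>R \<xi>)) y
    = \<bar>l\<bar> ^ DIM('a) *\<^sub>R (LINT \<xi>|lborel. of_real (1 / D) * g ((1 / l) *\<^sub>R (0 + l *\<^sub>R \<xi>)) * of_real (heat_kernel \<epsilon> (0 + l *\<^sub>R \<xi> - y)))"
    unfolding mollify_def using l by (intro lborel_integral_affine) auto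
  also have "\<dots> = (LINT \<xi>|lborel. g \<xi> * of_real (heat_kernel (\<epsilon> / l\<^sup>2) (\<xi> - (1 / l) *\<^sub>R y)) * of_real (1 / D))"
  proof -
    have "l *\<^sub>R \<xi> - y = l *\<^sub>R (\<xi> - (1 / l) *\<^sub>R y)" for \<xi> using l by (simp add: scaleR_diff_right)
    then show ?thesis
      using l D by (subst integral_scaleR_right[symmetric])
        (auto simp: k D_def[symmetric] scaleR_conv_of_real mult_ac intro!: Bochner_Integration.integral_cong)
  qed
  also have "\<dots> = mollify (\<epsilon> / l\<^sup>2) g ((1 / l) *\<^sub>R y) * of_real (1 / D)"
    unfolding mollify_def by simp
  also have "\<dots> = (LINT x|lborel. f x * (cis (- (x \<bullet> ((1 / l) *\<^sub>R y))) * gaussian (\<epsilon> / l\<^sup>2) x)) * of_real (1 / D)"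
    by (simp only: has_fourier_mollify[OF fg e'])
  also have "(LINT x|lborel. f x * (cis (- (x \<bullet> ((1 / l) *\<^sub>R y))) * gaussian (\<epsilon> / l\<^sup>2) x))
     = \<bar>l\<bar> ^ DIM('a) *\<^sub>R (LINT x|lborel. f (0 + l *\<^sub>R x) * (cis (- ((0 + l *\<^sub>R x) \<bullet> ((1 / l) *\<^sub>R y))) * gaussian (\<epsilon> / l\<^sup>2) (0 + l *\<^sub>R x)))"
    using l by (intro lborel_integral_affine) auto
  also have "\<dots> = (LINT x|lborel. f (l *\<^sub>R x) * (cis (- (x \<bullet> y)) * gaussian \<epsilon> x)) * of_real D"
    using l by (simp add: D_def power_mult_distrib scaleR_conv_of_real)
  finally show "mollify \<epsilon> (\<lambda>\<xi>. of_real (1 / l ^ DIM('a)) * g ((1 / l) *\<^sub>R \<xi>)) y = (LINT x|lborel. f (l *\<^sub>R x) * (cis (- (x \<bullet> y)) * gaussian \<epsilon> x))"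
    using D by (simp add: D_def[symmetric])
qed

lemma has_fourier_dilate_L2:
  fixes \<phi> :: "'a::euclidean_space \<Rightarrow> complex"
  assumes "has_fourier \<phi> g" "0 < l"
  shows "has_fourier (dilate l \<phi>) (\<lambda>\<xi>. of_real (l powr (real DIM('a) / 2) / l ^ DIM('a)) * g ((1 / l) *\<^sub>R \<xi>))"
  using has_fourier_cmult[OF has_fourier_dilate[OF assms], of "of_real (l powr (real DIM('a) / 2))"]
  unfolding dilate_def[abs_def] by simp

text \<open>The symbol is homogeneous: replacing \<open>\<xi>\<close> by \<open>\<xi>/l\<close> scales \<open>t\<close> by \<open>l powr m\<close> and the
  amplitude by \<open>l powr s\<close>.\<close>

lemma is_evolution_dilate:
  fixes \<phi> :: "'a::euclidean_space \<Rightarrow> complex"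
  assumes u: "is_evolution s m \<phi> u" and l: "0 < l"
  shows "is_evolution s m (dilate l \<phi>) (\<lambda>p. of_real (l powr (real DIM('a) / 2 + s)) * u (l powr m * fst p, l *\<^sub>R snd p))"
proof -
  have [measurable]: "u \<in> borel_measurable borel" by (rule is_evolution_measurable[OF u])
  obtain g where g: "has_fourier \<phi> g" using is_evolution_has_fourier[OF u] by blast
  show ?thesis
  proof (rule is_evolutionI[OF _ has_fourier_dilate_L2[OF g l]])
    show "(\<lambda>p. of_real (l powr (real DIM('a) / 2 + s)) * u (l powr m * fst p, l *\<^sub>R snd p)) \<in> borel_measurable borel"
      by measurable
    have "AE t in lborel. has_fourier (\<lambda>x. u (l powr m * t, x)) (\<lambda>\<xi>. symb s m (l powr m * t) \<xi> * g \<xi>)"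
      using l by (intro AE_lborel_scale is_evolution_fourier[OF u g]) simp
    then show "AE t in lborel. has_fourier (\<lambda>x. of_real (l powr (real DIM('a) / 2 + s)) * u (l powr m * fst (t, x), l *\<^sub>R snd (t, x)))
        (\<lambda>\<xi>. symb s m t \<xi> * (of_real (l powr (real DIM('a) / 2) / l ^ DIM('a)) * g ((1 / l) *\<^sub>R \<xi>)))"
    proof eventually_elim
      case (elim t)
      have "has_fourier (\<lambda>x. of_real (l powr (real DIM('a) / 2 + s)) * u (l powr m * t, l *\<^sub>R x))
        (\<lambda>\<xi>. of_real (l powr (real DIM('a) / 2 + s)) * (of_real (1 / l ^ DIM('a)) * (symb s m (l powr m * t) ((1 / l) *\<^sub>R \<xi>) * g ((1 / l) *\<^sub>R \<xi>))))"
        using has_fourier_cmult[OF has_fourier_dilate[OF elim l]] by simp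
      moreover have "(\<lambda>\<xi>. of_real (l powr (real DIM('a) / 2 + s)) * (of_real (1 / l ^ DIM('a)) * (symb s m (l powr m * t) ((1 / l) *\<^sub>R \<xi>) * g ((1 / l) *\<^sub>R \<xi>))))
         = (\<lambda>\<xi>. symb s m t \<xi> * (of_real (l powr (real DIM('a) / 2) / l ^ DIM('a)) * g ((1 / l) *\<^sub>R \<xi>)))"
      proof (rule ext)
        fix \<xi> :: 'a
        have n: "norm ((1 / l) *\<^sub>R \<xi>) powr r = norm \<xi> powr r / l powr r" for r
          using l by (simp add: powr_divide)
        have "symb s m (l powr m * t) ((1 / l) *\<^sub>R \<xi>) = of_real (1 / l powr s) * symb s m t \<xi>"
          unfolding symb_def n using l by simp
        then show "of_real (l powr (real DIM('a) / 2 + s)) * (of_real (1 / l ^ DIM('a)) * (symb s m (l powr m * t) ((1 / l) *\<^sub>R \<xi>) * g ((1 / l) *\<^sub>R \<xi>)))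
         = symb s m t \<xi> * (of_real (l powr (real DIM('a) / 2) / l ^ DIM('a)) * g ((1 / l) *\<^sub>R \<xi>))"
          using l by (simp add: powr_add)
      qed
      ultimately show ?case by (simp only: fst_conv snd_conv)
    qed
  qed
qed

lemma dilate_1: "dilate 1 \<phi> = \<phi>"
  by (auto simp: dilate_def fun_eq_iff)

text \<open>Undoing the dilation in \<open>(t, x)\<close> turns \<open>1 + |x|\<^sup>2\<close> into \<open>1 + |x/l|\<^sup>2\<close>; the powers of \<open>l\<close> from
  the weight, the amplitude and the Jacobian cancel exactly because \<open>\<gamma> = s - m/2\<close>.\<close>

lemma energy_dilate:
  fixes u :: "real \<times> 'a::euclidean_space \<Rightarrow> complex"
  assumes [measurable]: "u \<in> borel_measurable borel" and l: "0 < l" and s: "\<gamma> = s - m / 2"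
  shows "energy (jap_weight \<gamma>) (\<lambda>p. of_real (l powr (real DIM('a) / 2 + s)) * u (l powr m * fst p, l *\<^sub>R snd p))
    = energy (\<lambda>x. (l\<^sup>2 + (norm x)\<^sup>2) powr (\<gamma> / 2)) u"
proof -
  define G where "G p = ennreal (((l\<^sup>2 + (norm (snd p))\<^sup>2) powr (\<gamma> / 2) * norm (u p))\<^sup>2)" for p
  have [measurable]: "G \<in> borel_measurable borel" unfolding G_def by measurable
  \<comment> \<open>The Jacobian of \<open>(t, x) \<mapsto> (l powr m * t, l *\<^sub>R x)\<close>.\<close>
  define c where "c = l powr m * l ^ DIM('a)"
  have pt: "(jap_weight \<gamma> x * norm (of_real (l powr (real DIM('a) / 2 + s)) * u (l powr m * t, l *\<^sub>R x)))\<^sup>2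
     = c * ((l\<^sup>2 + (norm (l *\<^sub>R x))\<^sup>2) powr (\<gamma> / 2) * norm (u (l powr m * t, l *\<^sub>R x)))\<^sup>2" for t and x :: 'a
  proof -
    have "l\<^sup>2 + (norm (l *\<^sub>R x))\<^sup>2 = l\<^sup>2 * bsq x" by (simp add: power_mult_distrib algebra_simps)
    then have "(l\<^sup>2 + (norm (l *\<^sub>R x))\<^sup>2) powr (\<gamma> / 2) = l powr \<gamma> * jap_weight \<gamma> x"
      using l bsq_pos[of x]
      by (simp add: jap_weight_def powr_mult powr_half_sqrt[symmetric] powr_powr powr_numeral[symmetric] del: powr_numeral)
    moreover have "(l powr (real DIM('a) / 2 + s))\<^sup>2 = c * (l powr \<gamma>)\<^sup>2"
    proof -
      have "(l powr (real DIM('a) / 2 + s))\<^sup>2 = l powr (real DIM('a) + 2 * s)"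
        using l by (simp add: powr_power algebra_simps)
      also have "real DIM('a) + 2 * s = m + real DIM('a) + 2 * \<gamma>" by (simp add: s)
      also have "l powr (m + real DIM('a) + 2 * \<gamma>) = c * (l powr \<gamma>)\<^sup>2"
        using l by (simp add: powr_add c_def powr_realpow powr_power mult.commute)
      finally show ?thesis .
    qed
    ultimately show ?thesis using l by (simp add: norm_mult power_mult_distrib)
  qed
  have c: "0 \<le> c" using l by (simp add: c_def)
  have "energy (jap_weight \<gamma>) (\<lambda>p. of_real (l powr (real DIM('a) / 2 + s)) * u (l powr m * fst p, l *\<^sub>R snd p))
    = (\<integral>\<^sup>+t. \<integral>\<^sup>+x. ennreal (l powr m) * (ennreal (l ^ DIM('a)) * G (0 + l powr m *\<^sub>R t, 0 + l *\<^sub>R x)) \<partial>lborel \<partial>lborel)"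
    using l c by (subst energy_iterated) (auto simp: pt G_def ennreal_mult' c_def mult.assoc intro!: nn_integral_cong)
  also have "\<dots> = (\<integral>\<^sup>+t. ennreal (l powr m) * (\<integral>\<^sup>+x. G (0 + l powr m *\<^sub>R t, x) \<partial>lborel) \<partial>lborel)"
  proof (intro nn_integral_cong)
    fix t
    have "(\<integral>\<^sup>+x. ennreal (l powr m) * (ennreal (l ^ DIM('a)) * G (0 + l powr m *\<^sub>R t, 0 + l *\<^sub>R x)) \<partial>lborel)
       = ennreal (l powr m) * (ennreal (l ^ DIM('a)) * (\<integral>\<^sup>+x. G (0 + l powr m *\<^sub>R t, 0 + l *\<^sub>R x) \<partial>lborel))"
      by (subst nn_integral_cmult, measurable, subst nn_integral_cmult) auto
    then show "(\<integral>\<^sup>+x. ennreal (l powr m) * (ennreal (l ^ DIM('a)) * G (0 + l powr m *\<^sub>R t, 0 + l *\<^sub>R x)) \<partial>lborel)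
       = ennreal (l powr m) * (\<integral>\<^sup>+x. G (0 + l powr m *\<^sub>R t, x) \<partial>lborel)"
      using lborel_nn_integral_affine[of l "\<lambda>x. G (0 + l powr m *\<^sub>R t, x)" 0] l by simp
  qed
  also have "\<dots> = ennreal (l powr m) * (\<integral>\<^sup>+t. (\<integral>\<^sup>+x. G (0 + l powr m *\<^sub>R t, x) \<partial>lborel) \<partial>lborel)"
    by (intro nn_integral_cmult) measurable
  also have "\<dots> = (\<integral>\<^sup>+t. (\<integral>\<^sup>+x. G (t, x) \<partial>lborel) \<partial>lborel)"
    using lborel_nn_integral_affine[of "l powr m" "\<lambda>t. \<integral>\<^sup>+x. G (t, x) \<partial>lborel" 0] l by simp
  also have "\<dots> = energy (\<lambda>x. (l\<^sup>2 + (norm x)\<^sup>2) powr (\<gamma> / 2)) u"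
    by (subst energy_iterated) (auto simp: G_def)
  finally show ?thesis .
qed

text \<open>As \<open>l \<rightarrow> 0\<close> the weight \<open>(l\<^sup>2 + |x|\<^sup>2) powr (\<gamma>/2)\<close> of \<open>energy_dilate\<close> tends to \<open>|x| powr \<gamma>\<close>
  off the origin, and Fatou's lemma applies. No evolution of \<open>\<phi>\<close> can be missing when the
  supremum is finite, as \<open>l = 1\<close> shows.\<close>

theorem abs_weight_norm_le_SUP_dilations:
  fixes \<phi> :: "'a::euclidean_space \<Rightarrow> complex"
  assumes \<gamma>: "\<gamma> = s - m / 2"
  shows "evolution_norm (abs_weight \<gamma>) s m \<phi> \<le> (SUP l \<in> {0<..}. evolution_norm (jap_weight \<gamma>) s m (dilate l \<phi>))"
    (is "_ \<le> ?S")
proof (cases "?S")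
  case (real c)
  have le: "evolution_norm (jap_weight \<gamma>) s m (dilate l \<phi>) \<le> ennreal c" if "0 < l" for l
    using that unfolding real(2)[symmetric] by (intro SUP_upper) auto
  have "\<exists>u. is_evolution s m \<phi> u"
  proof (rule ccontr)
    assume "\<nexists>u. is_evolution s m \<phi> u"
    then have "evolution_norm (jap_weight \<gamma>) s m \<phi> = \<infinity>" by (intro evolution_norm_no_evolution) auto
    then show False using le[of 1] by (simp add: dilate_1 top_unique)
  qed
  then obtain u where u: "is_evolution s m \<phi> u" ..
  have [measurable]: "u \<in> borel_measurable borel" by (rule is_evolution_measurable[OF u])
  have bound: "energy (\<lambda>x. (l\<^sup>2 + (norm x)\<^sup>2) powr (\<gamma> / 2)) u \<le> ennreal (c\<^sup>2)" if l: "0 < l" for l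
    using le[OF l] weighted_L2_norm_le_iff[OF real(1)]
    unfolding evolution_norm_eq[OF is_evolution_dilate[OF u l]] energy_dilate[OF \<open>u \<in> borel_measurable borel\<close> l \<gamma>, symmetric]
    by blast
  have "energy (abs_weight \<gamma>) u \<le> ennreal (c\<^sup>2)"
    unfolding energy_def
  proof (rule nn_integral_le_of_AE_tendsto)
    show "(\<integral>\<^sup>+p. ennreal ((((inverse (real (Suc k)))\<^sup>2 + (norm (snd p))\<^sup>2) powr (\<gamma> / 2) * norm (u p))\<^sup>2) \<partial>lborel) \<le> ennreal (c\<^sup>2)" for k
      using bound[of "inverse (real (Suc k))"] by (simp add: energy_def)
    have "AE t::real in lborel. AE x::'a in lborel. snd (t, x) \<noteq> 0"
      unfolding snd_conv by (rule AE_I2) (rule AE_lborel_nonzero)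
    then have "AE p::real \<times> 'a in lborel. snd p \<noteq> 0"
      by (rule AE_lborel_prodI) measurable
    then show "AE p in lborel. (\<lambda>k. ennreal ((((inverse (real (Suc k)))\<^sup>2 + (norm (snd p))\<^sup>2) powr (\<gamma> / 2) * norm (u p))\<^sup>2))
       \<longlonglongrightarrow> ennreal ((abs_weight \<gamma> (snd p) * norm (u p))\<^sup>2)"
    proof eventually_elim
      case (elim p)
      have "(\<lambda>k. (((inverse (real (Suc k)))\<^sup>2 + (norm (snd p))\<^sup>2) powr (\<gamma> / 2) * norm (u p))\<^sup>2)
         \<longlonglongrightarrow> ((0\<^sup>2 + (norm (snd p))\<^sup>2) powr (\<gamma> / 2) * norm (u p))\<^sup>2"
        using elim by (intro tendsto_intros LIMSEQ_inverse_real_of_nat) auto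
      moreover have "(0\<^sup>2 + (norm (snd p))\<^sup>2) powr (\<gamma> / 2) = abs_weight \<gamma> (snd p)"
        using elim by (simp add: abs_weight_def powr_powr flip: powr_numeral)
      ultimately show ?case by (intro tendsto_ennrealI) simp
    qed
  qed measurable
  then show ?thesis
    unfolding evolution_norm_eq[OF u] real(2) by (subst weighted_L2_norm_le_iff[OF real(1)])
next
  case top
  then show ?thesis by (simp only: top_greatest)
qed

lemma L2_norm_dilate:
  fixes \<phi> :: "'a::euclidean_space \<Rightarrow> complex"
  assumes [measurable]: "\<phi> \<in> borel_measurable borel" and l: "0 < l"
  shows "L2_norm lborel (dilate l \<phi>) = L2_norm lborel \<phi>"
proof -
  have "sq_integral (\<lambda>x. dilate l \<phi> x) = ennreal (l ^ DIM('a)) * sq_integral (\<lambda>x. \<phi> (0 + l *\<^sub>R x))"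
    using l by (subst nn_integral_cmult[symmetric])
      (auto simp: dilate_def norm_mult power_mult_distrib powr_power powr_realpow ennreal_mult' intro!: nn_integral_cong)
  also have "\<dots> = sq_integral \<phi>"
    using lborel_nn_integral_affine[of l "\<lambda>x. ennreal ((norm (\<phi> x))\<^sup>2)" 0] l by simp
  finally show ?thesis by (simp add: L2_norm_def)
qed

lemma abs_D_defined_dilate:
  fixes \<phi> :: "'a::euclidean_space \<Rightarrow> complex"
  assumes "abs_D_defined s \<phi>" and l: "0 < l"
  shows "abs_D_defined s (dilate l \<phi>)"
proof -
  obtain g where g: "has_fourier \<phi> g" "tempered (\<lambda>\<xi>. of_real (norm \<xi> powr s) * g \<xi>)"
    using assms by (auto simp: abs_D_defined_def)
  define c where "c = l powr (real DIM('a) / 2) / l ^ DIM('a)"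
  have "tempered (\<lambda>\<xi>. of_real (c * l powr s) * (of_real (norm ((1 / l) *\<^sub>R \<xi>) powr s) * g ((1 / l) *\<^sub>R \<xi>)))"
    using l by (intro tempered_cmult tempered_dilate[OF g(2)]) simp
  also have "(\<lambda>\<xi>. of_real (c * l powr s) * (of_real (norm ((1 / l) *\<^sub>R \<xi>) powr s) * g ((1 / l) *\<^sub>R \<xi>)))
     = (\<lambda>\<xi>. of_real (norm \<xi> powr s) * (of_real c * g ((1 / l) *\<^sub>R \<xi>)))"
    using l by (auto simp: fun_eq_iff powr_divide)
  finally show ?thesis
    using has_fourier_dilate_L2[OF g(1) l] unfolding abs_D_defined_def c_def by blast
qed

text \<open>One inequality holds datum by datum; for the other, the dilations of an admissible datum
  are admissible.\<close>

lemma opnorm_weights_agree: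
  assumes \<gamma>: "\<gamma> = s - m / 2" "\<gamma> \<le> 0"
  shows "evolution_opnorm (jap_weight \<gamma> :: 'a::euclidean_space \<Rightarrow> real) s m = evolution_opnorm (abs_weight \<gamma> :: 'a \<Rightarrow> real) s m"
proof (rule antisym)
  show "evolution_opnorm (jap_weight \<gamma> :: 'a \<Rightarrow> real) s m \<le> evolution_opnorm (abs_weight \<gamma> :: 'a \<Rightarrow> real) s m"
    unfolding evolution_opnorm_def
  proof (rule SUP_subset_mono[OF order_refl])
    fix \<phi> :: "'a \<Rightarrow> complex"
    show "evolution_norm (jap_weight \<gamma>) s m \<phi> \<le> evolution_norm (abs_weight \<gamma>) s m \<phi>"
      by (rule jap_weight_norm_le[OF \<gamma>(2)])
  qed
  show "evolution_opnorm (abs_weight \<gamma> :: 'a \<Rightarrow> real) s m \<le> evolution_opnorm (jap_weight \<gamma> :: 'a \<Rightarrow> real) s m"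
    unfolding evolution_opnorm_def
  proof (rule SUP_least)
    fix \<phi> :: "'a \<Rightarrow> complex"
    assume \<phi>: "\<phi> \<in> {\<phi>. \<phi> \<in> borel_measurable lborel \<and> L2_norm lborel \<phi> \<le> 1 \<and> abs_D_defined s \<phi>}"
    have "evolution_norm (abs_weight \<gamma>) s m \<phi> \<le> (SUP l \<in> {0<..}. evolution_norm (jap_weight \<gamma>) s m (dilate l \<phi>))"
      by (rule abs_weight_norm_le_SUP_dilations[OF \<gamma>(1)])
    also have "\<dots> \<le> (SUP \<phi> \<in> {\<phi> :: 'a \<Rightarrow> complex. \<phi> \<in> borel_measurable lborel \<and> L2_norm lborel \<phi> \<le> 1 \<and> abs_D_defined s \<phi>}. evolution_norm (jap_weight \<gamma>) s m \<phi>)"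
    proof (rule SUP_least)
      fix l :: real assume "l \<in> {0<..}"
      then have l: "0 < l" by simp
      have [measurable]: "\<phi> \<in> borel_measurable borel" using \<phi> by simp
      have "dilate l \<phi> \<in> borel_measurable borel" unfolding dilate_def[abs_def] by measurable
      then show "evolution_norm (jap_weight \<gamma>) s m (dilate l \<phi>) \<le> (SUP \<phi> \<in> {\<phi> :: 'a \<Rightarrow> complex. \<phi> \<in> borel_measurable lborel \<and> L2_norm lborel \<phi> \<le> 1 \<and> abs_D_defined s \<phi>}. evolution_norm (jap_weight \<gamma>) s m \<phi>)"
        using \<phi> l by (intro SUP_upper) (auto simp: L2_norm_dilate abs_D_defined_dilate)
    qed
    finally show "evolution_norm (abs_weight \<gamma>) s m \<phi> \<le> (SUP \<phi> \<in> {\<phi> :: 'a \<Rightarrow> complex. \<phi> \<in> borel_measurable lborel \<and> L2_norm lborel \<phi> \<le> 1 \<and> abs_D_defined s \<phi>}. evolution_norm (jap_weight \<gamma>) s m \<phi>)" .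
  qed
qed

section \<open>Decay in time and infinite norms for growing weights\<close>

text \<open>A Gaussian of larger variance dominates those of smaller variance, uniformly over a compact
  range of variances.\<close>

lemma heat_kernel_le:
  assumes "0 < a" "a \<le> b" "b \<le> c"
  shows "heat_kernel b (z::'a::euclidean_space) \<le> (sqrt (c / a)) ^ DIM('a) * heat_kernel c z"
proof -
  have "1 / sqrt (2 * pi * b) \<le> 1 / sqrt (2 * pi * a)"
    using assms by (intro divide_left_mono) auto
  also have "\<dots> = sqrt (c / a) * (1 / sqrt (2 * pi * c))"
    using assms by (simp add: real_sqrt_mult real_sqrt_divide field_simps)
  finally have "(1 / sqrt (2 * pi * b)) ^ DIM('a) \<le> (sqrt (c / a) * (1 / sqrt (2 * pi * c))) ^ DIM('a)"
    using assms by (intro power_mono) auto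
  then have 1: "(1 / sqrt (2 * pi * b)) ^ DIM('a) \<le> (sqrt (c / a)) ^ DIM('a) * (1 / sqrt (2 * pi * c)) ^ DIM('a)"
    by (simp only: power_mult_distrib)
  have 2: "exp (- (norm z)\<^sup>2 / (2 * b)) \<le> exp (- (norm z)\<^sup>2 / (2 * c))"
    using assms by (simp add: frac_le)
  have "heat_kernel b z \<le> ((sqrt (c / a)) ^ DIM('a) * (1 / sqrt (2 * pi * c)) ^ DIM('a)) * exp (- (norm z)\<^sup>2 / (2 * c))"
    unfolding heat_kernel_def using 1 2 assms by (intro mult_mono) auto
  then show ?thesis by (simp add: heat_kernel_def mult.assoc)
qed

lemma mollify_scale_tendsto:
  fixes h :: "'a::euclidean_space \<Rightarrow> complex"
  assumes h: "tempered h" and e: "\<And>k. 0 < e k" "\<And>k. e k \<le> 1" "e \<longlonglongrightarrow> 0" and a: "0 < a"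
  shows "(\<lambda>k. mollify (a + e k) h y) \<longlonglongrightarrow> mollify a h y"
  unfolding mollify_def
proof (rule integral_dominated_convergence)
  have [measurable]: "h \<in> borel_measurable borel" by (rule tempered_measurable[OF h])
  define C where "C = (sqrt ((a + 1) / a)) ^ DIM('a)"
  have C: "0 \<le> C" using a by (simp add: C_def)
  show "integrable lborel (\<lambda>z. C * norm (h z * of_real (heat_kernel (a + 1) (z - y))))"
    using a by (intro integrable_mult_right integrable_norm mollify_integrable h) simp
  show "AE z in lborel. norm (h z * complex_of_real (heat_kernel (a + e k) (z - y))) \<le> C * norm (h z * of_real (heat_kernel (a + 1) (z - y)))" for k
  proof (intro AE_I2)
    fix z :: 'a
    have "heat_kernel (a + e k) (z - y) \<le> C * heat_kernel (a + 1) (z - y)"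
      unfolding C_def using a e(1,2)[of k] by (intro heat_kernel_le) auto
    then have "norm (h z) * heat_kernel (a + e k) (z - y) \<le> norm (h z) * (C * heat_kernel (a + 1) (z - y))"
      by (intro mult_left_mono) auto
    then show "norm (h z * complex_of_real (heat_kernel (a + e k) (z - y))) \<le> C * norm (h z * of_real (heat_kernel (a + 1) (z - y)))"
      using a e(1)[of k] by (simp add: norm_mult mult_ac)
  qed
  show "AE z in lborel. (\<lambda>k. h z * complex_of_real (heat_kernel (a + e k) (z - y))) \<longlonglongrightarrow> h z * complex_of_real (heat_kernel a (z - y))"
  proof (intro AE_I2)
    fix z :: 'a
    have "(\<lambda>k. heat_kernel (a + e k) (z - y)) \<longlonglongrightarrow> heat_kernel (a + 0) (z - y)"
      unfolding heat_kernel_def using a by (intro tendsto_intros e) auto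
    then show "(\<lambda>k. h z * complex_of_real (heat_kernel (a + e k) (z - y))) \<longlonglongrightarrow> h z * complex_of_real (heat_kernel a (z - y))"
      by (intro tendsto_mult tendsto_const tendsto_of_real) simp
  qed
  show "(\<lambda>z. h z * complex_of_real (heat_kernel a (z - y))) \<in> borel_measurable lborel" by measurable
  show "(\<lambda>z. h z * complex_of_real (heat_kernel (a + e k) (z - y))) \<in> borel_measurable lborel" for k by measurable
qed

lemma tempered_mult_bounded:
  assumes f: "tempered f" and [measurable]: "g \<in> borel_measurable borel" and g: "\<And>x. norm (g x) \<le> 1"
  shows "tempered (\<lambda>x. g x * f x)"
proof -
  have [measurable]: "f \<in> borel_measurable borel" by (rule tempered_measurable[OF f])
  obtain N where N: "integrable lborel (\<lambda>x. f x /\<^sub>R bsq x ^ N)" using f by (auto simp: tempered_def)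
  have "integrable lborel (\<lambda>x. (g x * f x) /\<^sub>R bsq x ^ N)"
  proof (rule Bochner_Integration.integrable_bound[OF N])
    show "AE x in lborel. norm ((g x * f x) /\<^sub>R bsq x ^ N) \<le> norm (f x /\<^sub>R bsq x ^ N)"
      using g by (intro AE_I2) (simp add: norm_mult mult_left_mono mult_left_le_one_le)
  qed measurable
  then show ?thesis by (auto simp: tempered_def)
qed

text \<open>For fixed \<open>\<xi>\<close> the exceptional second components form a sphere.\<close>

lemma AE_pair_norm_powr_neq:
  assumes m: "0 < m"
  shows "AE p in (lborel :: 'a::euclidean_space measure) \<Otimes>\<^sub>M (lborel :: 'a measure). norm (fst p) powr m \<noteq> norm (snd p) powr m"
proof (rule lborel_pair.AE_pair_measure)
  show "AE x in lborel. AE y::'a in lborel. norm (fst (x::'a, y)) powr m \<noteq> norm (snd (x, y)) powr m"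
  proof (rule AE_I2)
    fix x :: 'a
    have "negligible (sphere (0::'a) (norm x))" by (rule negligible_sphere)
    then have "AE y::'a in lebesgue. y \<notin> sphere 0 (norm x)"
      unfolding negligible_iff_null_sets by (rule AE_not_in)
    then have "AE y::'a in lborel. y \<notin> sphere 0 (norm x)"
      unfolding AE_completion_iff .
    then show "AE y::'a in lborel. norm (fst (x, y)) powr m \<noteq> norm (snd (x, y)) powr m"
    proof eventually_elim
      case (elim y)
      then have "norm y \<noteq> norm x" by simp
      then show ?case
        using m powr_less_mono2[of m "norm x" "norm y"] powr_less_mono2[of m "norm y" "norm x"]
        by (cases "norm x < norm y") auto
    qed
  qed
  show "{p \<in> space (lborel \<Otimes>\<^sub>M lborel). norm (fst p :: 'a) powr m \<noteq> norm (snd p :: 'a) powr m} \<in> sets (lborel \<Otimes>\<^sub>M lborel)"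
    by measurable
qed

text \<open>Wiener's lemma. The averages equal double integrals whose kernel tends to 0 wherever the
  two phases differ, that is, almost everywhere.\<close>

lemma oscillatory_average_tendsto_0:
  fixes F :: "'a::euclidean_space \<Rightarrow> complex"
  assumes F: "integrable lborel F" and m: "0 < m"
  shows "(\<lambda>k. \<integral>\<^sup>+t. ennreal (heat_kernel (real (Suc k)) t * (norm (LINT \<xi>|lborel. F \<xi> * cis (t * norm \<xi> powr m)))\<^sup>2) \<partial>lborel) \<longlonglongrightarrow> 0"
proof -
  have [measurable]: "F \<in> borel_measurable borel" using F by auto
  define G where "G p = F (fst p) * cnj (F (snd p))" for p
  define E where "E k p = exp (- real (Suc k) * (norm (norm (fst p) powr m - norm (snd p) powr m))\<^sup>2 / 2)" for k and p :: "'a \<times> 'a"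
  have G: "integrable (lborel \<Otimes>\<^sub>M lborel) G"
  proof -
    have cF: "integrable lborel (\<lambda>x. cnj (F x))"
      by (rule Bochner_Integration.integrable_bound[OF F]) auto
    show ?thesis unfolding G_def by (rule lborel_pair.integrable_pair_mult(1)[OF F cF])
  qed
  have eq: "(\<integral>\<^sup>+t. ennreal (heat_kernel (real (Suc k)) t * (norm (LINT \<xi>|lborel. F \<xi> * cis (t * norm \<xi> powr m)))\<^sup>2) \<partial>lborel)
     = ennreal (Re (LINT p|(lborel \<Otimes>\<^sub>M lborel). G p * of_real (E k p)))" for k
    using gaussian_average_oscillatory[OF lborel.sigma_finite_measure_axioms F, of "\<lambda>\<xi>. norm \<xi> powr m" "real (Suc k)"]
    by (simp add: G_def E_def)
  have "(\<lambda>k. LINT p|(lborel \<Otimes>\<^sub>M lborel). G p * of_real (E k p)) \<longlonglongrightarrow> (LINT p|((lborel :: 'a measure) \<Otimes>\<^sub>M (lborel :: 'a measure)). (0 :: complex))"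
  proof (rule integral_dominated_convergence)
    show "integrable (lborel \<Otimes>\<^sub>M lborel) (\<lambda>p. norm (G p))" using G by (rule integrable_norm)
    show "AE p in lborel \<Otimes>\<^sub>M lborel. norm (G p * of_real (E k p)) \<le> norm (G p)" for k
    proof (intro AE_I2)
      fix p :: "'a \<times> 'a"
      have "0 \<le> real (Suc k) * (norm (norm (fst p) powr m - norm (snd p) powr m))\<^sup>2" by simp
      then have "E k p \<le> 1" unfolding E_def exp_le_one_iff mult_minus_left by linarith
      moreover have "0 \<le> E k p" by (simp add: E_def)
      ultimately show "norm (G p * of_real (E k p)) \<le> norm (G p)" by (simp add: norm_mult mult_left_le)
    qed
    show "AE p in lborel \<Otimes>\<^sub>M lborel. (\<lambda>k. G p * of_real (E k p)) \<longlonglongrightarrow> 0"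
      using AE_pair_norm_powr_neq[OF m, where 'a='a]
    proof eventually_elim
      case (elim p)
      define d where "d = (norm (norm (fst p) powr m - norm (snd p) powr m))\<^sup>2 / 2"
      have d: "0 < d" using elim by (simp add: d_def)
      have "filterlim (\<lambda>k. real (Suc k) * d) at_top sequentially"
        using d by real_asymp
      then have "(\<lambda>k. exp (- (real (Suc k) * d))) \<longlonglongrightarrow> 0"
        by (intro filterlim_compose[OF exp_at_bot] filterlim_uminus_at_bot_at_top[THEN filterlim_compose])
      moreover have "E k p = exp (- (real (Suc k) * d))" for k
        by (simp add: E_def d_def del: of_nat_Suc)
      ultimately have "(\<lambda>k. E k p) \<longlonglongrightarrow> 0" by simp
      then have "(\<lambda>k. G p * of_real (E k p)) \<longlonglongrightarrow> G p * of_real 0"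
        by (intro tendsto_intros)
      then show ?case by simp
    qed
    show "(\<lambda>p. G p * of_real (E k p)) \<in> borel_measurable (lborel \<Otimes>\<^sub>M lborel)" for k
      unfolding G_def E_def by measurable
  qed measurable
  then have "(\<lambda>k. Re (LINT p|(lborel \<Otimes>\<^sub>M lborel). G p * of_real (E k p))) \<longlonglongrightarrow> Re 0"
    by (intro tendsto_Re) simp
  then have "(\<lambda>k. ennreal (Re (LINT p|(lborel \<Otimes>\<^sub>M lborel). G p * of_real (E k p)))) \<longlonglongrightarrow> ennreal 0"
    by (intro tendsto_ennrealI) simp
  then show ?thesis unfolding eq by simp
qed

text \<open>The left-hand side vanishes to order \<open>2 k \<ge> \<gamma>\<close> at the origin and is at most 1. It serves as a
  substitute for the weight that acts on the Fourier side by elementary mollifications.\<close>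

lemma one_minus_gaussian_power_le:
  assumes r: "0 \<le> (r::real)" and \<gamma>: "0 < \<gamma>" "\<gamma> \<le> 2 * real k"
  shows "(1 - exp (- r\<^sup>2 / 2)) ^ k \<le> r powr \<gamma>"
proof (cases "r \<le> 1")
  case True
  show ?thesis
  proof (cases "r = 0")
    case True
    then show ?thesis using \<gamma> by (cases k) auto
  next
    case False
    have "1 - exp (- r\<^sup>2 / 2) \<le> r\<^sup>2"
      using exp_ge_add_one_self[of "- r\<^sup>2 / 2"] zero_le_power2[of r] by linarith
    then have "(1 - exp (- r\<^sup>2 / 2)) ^ k \<le> (r\<^sup>2) ^ k"
      by (intro power_mono) auto
    also have "\<dots> = r powr (2 * real k)"
      using r False powr_realpow[of r "2 * k"] by (simp add: power_mult)
    also have "\<dots> \<le> r powr \<gamma>"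
      using \<open>r \<le> 1\<close> r False \<gamma> by (intro powr_mono') auto
    finally show ?thesis .
  qed
next
  case False
  have "(1 - exp (- r\<^sup>2 / 2)) ^ k \<le> 1"
    by (intro power_le_one) auto
  also have "1 \<le> r powr \<gamma>" using False \<gamma> by (intro ge_one_powr_ge_zero) auto
  finally show ?thesis .
qed

lemma one_minus_gaussian_power_expand:
  "(1 - exp (- r\<^sup>2 / 2)) ^ k * exp (- \<epsilon> * r\<^sup>2 / 2) = (\<Sum>j\<le>k. (- 1) ^ j * real (k choose j) * exp (- (real j + \<epsilon>) * r\<^sup>2 / 2))"
  for r :: real
proof -
  have "(1 - exp (- r\<^sup>2 / 2)) ^ k = (- exp (- r\<^sup>2 / 2) + 1) ^ k" by simp
  also have "\<dots> = (\<Sum>j\<le>k. of_nat (k choose j) * (- exp (- r\<^sup>2 / 2)) ^ j * 1 ^ (k - j))"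
    by (rule binomial_ring)
  also have "\<dots> = (\<Sum>j\<le>k. (- 1) ^ j * real (k choose j) * exp (- real j * r\<^sup>2 / 2))"
    by (intro sum.cong refl) (subst power_minus, simp add: exp_of_nat_mult[symmetric] mult_ac)
  finally have "(1 - exp (- r\<^sup>2 / 2)) ^ k * exp (- \<epsilon> * r\<^sup>2 / 2)
      = (\<Sum>j\<le>k. (- 1) ^ j * real (k choose j) * (exp (- real j * r\<^sup>2 / 2) * exp (- \<epsilon> * r\<^sup>2 / 2)))"
    by (simp add: sum_distrib_right mult.assoc)
  also have "\<dots> = (\<Sum>j\<le>k. (- 1) ^ j * real (k choose j) * exp (- (real j + \<epsilon>) * r\<^sup>2 / 2))"
    by (intro sum.cong refl) (simp add: exp_add[symmetric] algebra_simps add_divide_distrib diff_divide_distrib)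
  finally show ?thesis .
qed

text \<open>Formally \<open>(1 - K)\<^sup>k h\<close> with \<open>K\<close> the convolution with \<open>heat_kernel 1\<close>, expanded by the binomial
  theorem and the semigroup law. It is the transform of the multiplication by
  \<open>(1 - exp(- |x|\<^sup>2 / 2))\<^sup>k\<close>.\<close>

definition heat_difference :: "nat \<Rightarrow> ('a::euclidean_space \<Rightarrow> complex) \<Rightarrow> 'a \<Rightarrow> complex" where
  "heat_difference k h y = h y + (\<Sum>j\<in>{1..k}. of_real ((- 1) ^ j * real (k choose j)) * mollify (real j) h y)"

text \<open>A factor \<open>exp(- \<epsilon> |x|\<^sup>2 / 2)\<close> makes \<open>f\<close> integrable, so that \<open>plancherel_le\<close> applies; on the
  transform it adds \<open>\<epsilon>\<close> to every variance, including the variance 0 of the first term.\<close>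

lemma heat_difference_L2_bound:
  fixes f h :: "'a::euclidean_space \<Rightarrow> complex"
  assumes fh: "has_fourier f h" and \<gamma>: "0 < \<gamma>" "\<gamma> \<le> 2 * real k"
  shows "sq_integral (\<lambda>y. heat_difference k h y)
    \<le> ennreal ((2 * pi) ^ DIM('a)) * weighted_sq_integral \<gamma> f"
proof -
  have t: "tempered f" "tempered h" using fh by (auto simp: has_fourier_def)
  have [measurable]: "f \<in> borel_measurable borel" "h \<in> borel_measurable borel" using t by (auto simp: tempered_measurable)
  define c where "c j = complex_of_real ((- 1) ^ j * real (k choose j))" for j
  define b where "b x = (1 - exp (- (norm x)\<^sup>2 / 2)) ^ k" for x :: 'a
  have b: "0 \<le> b x" "b x \<le> norm x powr \<gamma>" for x
  proof -
    show "0 \<le> b x" unfolding b_def by simp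
    show "b x \<le> norm x powr \<gamma>" unfolding b_def by (rule one_minus_gaussian_power_le[OF norm_ge_zero \<gamma>])
  qed
  have bound: "sq_integral (\<lambda>y. \<Sum>j\<le>k. c j * mollify (real j + \<epsilon>) h y)
    \<le> ennreal ((2 * pi) ^ DIM('a)) * weighted_sq_integral \<gamma> f" if e: "0 < \<epsilon>" for \<epsilon>
  proof -
    define F where "F x = f x * of_real (b x * exp (- \<epsilon> * (norm x)\<^sup>2 / 2))" for x
    have je: "0 < real j + \<epsilon>" for j :: nat using e by (simp add: add_nonneg_pos)
    have int: "integrable lborel (\<lambda>x. c j * (f x * (cis (- (x \<bullet> y)) * gaussian (real j + \<epsilon>) x)))" for j y
      by (intro integrable_mult_right tempered_rapidly_decreasing_integrable cis_gaussian_rapidly_decreasing je t)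
    have expand: "cis (- (x \<bullet> y)) * F x = (\<Sum>j\<le>k. c j * (f x * (cis (- (x \<bullet> y)) * gaussian (real j + \<epsilon>) x)))" for x y
    proof -
      have "complex_of_real (b x * exp (- \<epsilon> * (norm x)\<^sup>2 / 2)) = (\<Sum>j\<le>k. c j * gaussian (real j + \<epsilon>) x)"
        unfolding b_def one_minus_gaussian_power_expand c_def by (simp only: of_real_sum of_real_mult)
      then show ?thesis unfolding F_def by (simp add: sum_distrib_left mult_ac)
    qed
    have F: "integrable lborel F"
    proof -
      have "integrable lborel (\<lambda>x. cis (- (x \<bullet> 0)) * F x)"
        unfolding expand by (intro Bochner_Integration.integrable_sum int)
      then show ?thesis by simp
    qed
    have FF: "fourier_integral F y = (\<Sum>j\<le>k. c j * mollify (real j + \<epsilon>) h y)" for y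
      unfolding fourier_integral_def expand
      by (subst Bochner_Integration.integral_sum) (use int in \<open>auto simp: has_fourier_mollify[OF fh je]\<close>)
    have "sq_integral (\<lambda>y. \<Sum>j\<le>k. c j * mollify (real j + \<epsilon>) h y)
      \<le> ennreal ((2 * pi) ^ DIM('a)) * sq_integral F"
      using plancherel_le[OF F] unfolding FF .
    also have "\<dots> \<le> ennreal ((2 * pi) ^ DIM('a)) * weighted_sq_integral \<gamma> f"
    proof (intro mult_left_mono nn_integral_mono ennreal_leI power_mono)
      fix x :: 'a
      have "b x * exp (- \<epsilon> * (norm x)\<^sup>2 / 2) \<le> b x * 1"
        using e b(1)[of x] by (intro mult_left_mono) auto
      also have "b x * 1 \<le> norm x powr \<gamma>" using b(2)[of x] by simp
      finally have "norm (f x) * (b x * exp (- \<epsilon> * (norm x)\<^sup>2 / 2)) \<le> norm (f x) * norm x powr \<gamma>"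
        by (intro mult_left_mono) auto
      then show "norm (F x) \<le> norm x powr \<gamma> * norm (f x)"
        using b(1)[of x] by (simp add: F_def norm_mult abs_mult mult.commute)
    qed auto
    finally show ?thesis .
  qed
  obtain e where e: "\<And>i. 0 < e i" "\<And>i. e i \<le> 1" "e \<longlonglongrightarrow> 0"
    "AE x in lborel. (\<lambda>i. mollify (e i) h x) \<longlonglongrightarrow> h x"
    using mollify_AE_subsequence[OF t(2)] by blast
  show ?thesis
  proof (rule nn_integral_le_of_AE_tendsto)
    show "sq_integral (\<lambda>y. \<Sum>j\<le>k. c j * mollify (real j + e i) h y)
      \<le> ennreal ((2 * pi) ^ DIM('a)) * weighted_sq_integral \<gamma> f" for i
      by (rule bound[OF e(1)])
    show "AE y in lborel. (\<lambda>i. ennreal ((norm (\<Sum>j\<le>k. c j * mollify (real j + e i) h y))\<^sup>2)) \<longlonglongrightarrow> ennreal ((norm (heat_difference k h y))\<^sup>2)"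
      using e(4)
    proof eventually_elim
      case (elim y)
      have split: "(\<Sum>j\<le>k. a j) = a 0 + (\<Sum>j\<in>{1..k}. a j)" for a :: "nat \<Rightarrow> complex"
        by (simp add: atMost_atLeast0 sum.atLeast_Suc_atMost)
      have "(\<lambda>i. \<Sum>j\<in>{1..k}. c j * mollify (real j + e i) h y) \<longlonglongrightarrow> (\<Sum>j\<in>{1..k}. c j * mollify (real j) h y)"
        by (intro tendsto_sum tendsto_mult tendsto_const mollify_scale_tendsto t e) auto
      then have "(\<lambda>i. \<Sum>j\<le>k. c j * mollify (real j + e i) h y) \<longlonglongrightarrow> heat_difference k h y"
        unfolding split heat_difference_def c_def using elim by (auto intro!: tendsto_add)
      then show ?case by (intro tendsto_ennrealI tendsto_power tendsto_norm)
    qed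
  qed measurable
qed

text \<open>At almost every frequency \<open>y\<close> the binomial difference of the transform is square integrable in
  \<open>t\<close>. In it, the leading term has modulus \<open>|h y|\<close> at all times, while the other terms
  are oscillatory integrals. Averaging over longer and longer times shows that \<open>h y = 0\<close>.\<close>

theorem growing_weight_finite_energy_imp_zero:
  fixes \<phi> g :: "'a::euclidean_space \<Rightarrow> complex"
  assumes u: "is_evolution s m \<phi> u" and g: "has_fourier \<phi> g" and m: "0 < m" and \<gamma>: "0 < \<gamma>"
    and fin: "energy (abs_weight \<gamma>) u < \<infinity>"
  shows "AE \<xi> in lborel. g \<xi> = 0"
proof -
  have [measurable]: "u \<in> borel_measurable borel" by (rule is_evolution_measurable[OF u])
  have [measurable]: "g \<in> borel_measurable borel" using g by (auto simp: has_fourier_def tempered_def)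
  obtain k :: nat where k: "\<gamma> / 2 \<le> real k" using real_arch_simple by blast
  then have k2: "\<gamma> \<le> 2 * real k" by simp
  define H where "H t \<xi> = symb s m t \<xi> * g \<xi>" for t \<xi>
  define h where "h = H 0"
  have H_eq: "H t \<xi> = h \<xi> * cis (t * norm \<xi> powr m)" for t \<xi>
    by (simp add: H_def h_def symb_def)
  have [measurable]: "h \<in> borel_measurable borel" unfolding h_def H_def by measurable
  have uH: "AE t in lborel. has_fourier (\<lambda>x. u (t, x)) (H t)"
    using is_evolution_fourier[OF u g] unfolding H_def[abs_def] .
  have h: "tempered h"
  proof -
    obtain t where "has_fourier (\<lambda>x. u (t, x)) (H t)" using AE_lborel_ex[OF uH] by blast
    then have "tempered (\<lambda>\<xi>. cis (- (t * norm \<xi> powr m)) * H t \<xi>)"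
      by (intro tempered_mult_bounded) (auto simp: has_fourier_def)
    moreover have "cis (- (t * norm \<xi> powr m)) * H t \<xi> = h \<xi>" for \<xi>
      unfolding H_eq by (simp add: cis_mult)
    ultimately show ?thesis by simp
  qed
  have H_pair [measurable]: "(\<lambda>p. H (fst p) (snd p)) \<in> borel_measurable (borel \<Otimes>\<^sub>M borel)"
    unfolding H_eq by measurable
  have mol: "mollify a (H t) y = (LINT \<xi>|lborel. (h \<xi> * of_real (heat_kernel a (\<xi> - y))) * cis (t * norm \<xi> powr m))" for a t y
    unfolding mollify_def H_eq by (simp add: mult_ac)
  have mol_meas: "(\<lambda>p. mollify a (H (fst p)) (snd p)) \<in> borel_measurable (borel \<Otimes>\<^sub>M borel)" for a
    unfolding mol by measurable
  define W where "W t y = heat_difference k (H t) y" for t y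
  have W_meas [measurable]: "(\<lambda>p. W (fst p) (snd p)) \<in> borel_measurable (borel \<Otimes>\<^sub>M borel)"
    unfolding W_def heat_difference_def using mol_meas H_pair by measurable
  have "(\<integral>\<^sup>+t. \<integral>\<^sup>+y. ennreal ((norm (W t y))\<^sup>2) \<partial>lborel \<partial>lborel)
    \<le> (\<integral>\<^sup>+t. ennreal ((2 * pi) ^ DIM('a)) * (weighted_sq_integral \<gamma> (\<lambda>x. u (t, x))) \<partial>lborel)"
  proof (rule nn_integral_mono_AE)
    show "AE t in lborel. (sq_integral (\<lambda>y. W t y))
      \<le> ennreal ((2 * pi) ^ DIM('a)) * weighted_sq_integral \<gamma> (\<lambda>x. u (t, x))"
      using uH by eventually_elim (unfold W_def, rule heat_difference_L2_bound[OF _ \<gamma> k2])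
  qed
  also have "\<dots> = ennreal ((2 * pi) ^ DIM('a)) * energy (abs_weight \<gamma>) u"
    by (subst energy_iterated) (auto simp: abs_weight_def intro!: nn_integral_cmult)
  also have "\<dots> < \<infinity>" using fin by (simp add: ennreal_mult_less_top)
  finally have "(\<integral>\<^sup>+y. \<integral>\<^sup>+t. ennreal ((norm (W t y))\<^sup>2) \<partial>lborel \<partial>lborel) < \<infinity>"
    by (subst lborel_pair.Fubini') measurable
  moreover have W_meas' [measurable]: "(\<lambda>p. W (snd p) (fst p)) \<in> borel_measurable (borel \<Otimes>\<^sub>M borel)"
    using measurable_compose[OF _ W_meas, of "\<lambda>p. (snd p, fst p)"] by simp
  have "(\<lambda>y. \<integral>\<^sup>+t. ennreal ((norm (W t y))\<^sup>2) \<partial>lborel) \<in> borel_measurable lborel" by measurable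
  ultimately have "AE y in lborel. (sq_integral (\<lambda>t. W t y)) \<noteq> \<infinity>"
    by (intro nn_integral_PInf_AE) auto
  then have "AE y in lborel. h y = 0"
  proof eventually_elim
    case (elim y)
    \<comment> \<open>The leading term is \<open>Z 0\<close> minus the sum of the other \<open>Z j\<close>.\<close>
    define Z where "Z j t = (if j = 0 then W t y else of_real ((- 1) ^ j * real (k choose j)) * mollify (real j) (H t) y)" for j t
    have [measurable]: "(\<lambda>t. W t y) \<in> borel_measurable borel"
      using measurable_compose[OF _ W_meas, of "\<lambda>t. (t, y)"] by simp
    have Z_meas [measurable]: "Z j \<in> borel_measurable borel" for j
    proof -
      have [measurable]: "(\<lambda>t. mollify (real j) (H t) y) \<in> borel_measurable borel"
        using measurable_compose[OF _ mol_meas, of "\<lambda>t. (t, y)"] by simp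
      show ?thesis unfolding Z_def[abs_def] by (cases "j = 0") simp_all
    qed
    \<comment> \<open>Averages over times of order \<open>sqrt i\<close>.\<close>
    define A where "A j i = (\<integral>\<^sup>+t. ennreal (heat_kernel (real (Suc i)) t * (norm (Z j t))\<^sup>2) \<partial>lborel)" for j i
    have A0: "A j \<longlonglongrightarrow> 0" for j
    proof (cases "j = 0")
      case True
      define I where "I = sq_integral (\<lambda>t. W t y)"
      have "A j i \<le> ennreal (1 / sqrt (real (Suc i))) * I" for i
      proof -
        have hk: "heat_kernel (real (Suc i)) t \<le> 1 / sqrt (real (Suc i))" for t :: real
        proof -
          have "1 / sqrt (2 * pi * real (Suc i)) \<le> 1 / sqrt (real (Suc i))"
            using pi_gt3 by (intro divide_left_mono) auto
          then have "(1 / sqrt (2 * pi * real (Suc i))) * exp (- (norm t)\<^sup>2 / (2 * real (Suc i))) \<le> 1 / sqrt (real (Suc i)) * 1"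
            by (intro mult_mono) auto
          then show ?thesis by (simp add: heat_kernel_def)
        qed
        have "A j i \<le> (\<integral>\<^sup>+t. ennreal (1 / sqrt (real (Suc i))) * ennreal ((norm (W t y))\<^sup>2) \<partial>lborel)"
          unfolding A_def
        proof (intro nn_integral_mono)
          fix t :: real
          have "heat_kernel (real (Suc i)) t * (norm (Z j t))\<^sup>2 \<le> 1 / sqrt (real (Suc i)) * (norm (W t y))\<^sup>2"
            using hk[of t] True unfolding Z_def by (intro mult_mono) auto
          then show "ennreal (heat_kernel (real (Suc i)) t * (norm (Z j t))\<^sup>2) \<le> ennreal (1 / sqrt (real (Suc i))) * ennreal ((norm (W t y))\<^sup>2)"
            by (subst ennreal_mult[symmetric]) (auto intro: ennreal_leI)
        qed
        also have "\<dots> = ennreal (1 / sqrt (real (Suc i))) * I"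
          unfolding I_def by (intro nn_integral_cmult) measurable
        finally show ?thesis .
      qed
      moreover have "(\<lambda>i. ennreal (1 / sqrt (real (Suc i))) * I) \<longlonglongrightarrow> 0"
      proof -
        obtain r where r: "I = ennreal r" "0 \<le> r" using elim by (cases I) (auto simp: I_def)
        have "(\<lambda>i. 1 / sqrt (real (Suc i)) * r) \<longlonglongrightarrow> 0" by real_asymp
        then have "(\<lambda>i. ennreal (1 / sqrt (real (Suc i)) * r)) \<longlonglongrightarrow> ennreal 0" by (rule tendsto_ennrealI)
        moreover have "ennreal (1 / sqrt (real (Suc i)) * r) = ennreal (1 / sqrt (real (Suc i))) * I" for i
          unfolding r(1) using r(2) by (intro ennreal_mult) auto
        ultimately show ?thesis by (simp only: ennreal_0)
      qed
      ultimately show ?thesis by (rule tendsto_zero_ennreal_le)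
    next
      case False
      define c where "c = complex_of_real ((- 1) ^ j * real (k choose j))"
      have int: "integrable lborel (\<lambda>\<xi>. h \<xi> * of_real (heat_kernel (real j) (\<xi> - y)))"
        using False by (intro mollify_integrable h) simp
      have "A j i = ennreal ((norm c)\<^sup>2) * (\<integral>\<^sup>+t. ennreal (heat_kernel (real (Suc i)) t *
           (norm (LINT \<xi>|lborel. (h \<xi> * of_real (heat_kernel (real j) (\<xi> - y))) * cis (t * norm \<xi> powr m)))\<^sup>2) \<partial>lborel)" for i
        unfolding A_def Z_def mol c_def using False
        by (subst nn_integral_cmult[symmetric]) (auto simp: norm_mult power_mult_distrib ennreal_mult'[symmetric] mult_ac intro!: nn_integral_cong)
      moreover have "(\<lambda>i. ennreal ((norm c)\<^sup>2) * (\<integral>\<^sup>+t. ennreal (heat_kernel (real (Suc i)) t *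
           (norm (LINT \<xi>|lborel. (h \<xi> * of_real (heat_kernel (real j) (\<xi> - y))) * cis (t * norm \<xi> powr m)))\<^sup>2) \<partial>lborel)) \<longlonglongrightarrow> ennreal ((norm c)\<^sup>2) * 0"
        by (intro ennreal_tendsto_cmult oscillatory_average_tendsto_0 int m) simp
      ultimately have "(\<lambda>i. A j i) \<longlonglongrightarrow> ennreal ((norm c)\<^sup>2) * 0" by (simp only:)
      then show ?thesis by simp
    qed
    have le: "ennreal ((norm (h y))\<^sup>2) \<le> ennreal (real (Suc k)) * (\<Sum>j\<le>k. A j i)" for i
    proof -
      have pt: "(norm (h y))\<^sup>2 \<le> real (Suc k) * (\<Sum>j\<le>k. (norm (Z j t))\<^sup>2)" for t
      proof -
        have "H t y = Z 0 t - (\<Sum>j\<in>{1..k}. Z j t)"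
          by (simp add: Z_def W_def heat_difference_def)
        then have "norm (H t y) \<le> norm (Z 0 t) + norm (\<Sum>j\<in>{1..k}. Z j t)"
          by (simp add: norm_triangle_ineq4)
        also have "\<dots> \<le> norm (Z 0 t) + (\<Sum>j\<in>{1..k}. norm (Z j t))"
          by (intro add_left_mono norm_sum)
        also have "\<dots> = (\<Sum>j\<le>k. norm (Z j t))"
          by (simp add: atMost_atLeast0 sum.atLeast_Suc_atMost)
        finally have "norm (h y) \<le> (\<Sum>j\<le>k. norm (Z j t))" by (simp add: H_eq norm_mult)
        then have "(norm (h y))\<^sup>2 \<le> (\<Sum>j\<le>k. norm (Z j t))\<^sup>2" by (intro power_mono) auto
        also have "\<dots> \<le> real (card {..k}) * (\<Sum>j\<le>k. (norm (Z j t))\<^sup>2)"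
          using sum_squared_le_sum_of_squares[of "\<lambda>j. norm (Z j t)" "{..k}"] by (simp add: mult.commute)
        finally show ?thesis by simp
      qed
      have "ennreal ((norm (h y))\<^sup>2) = (\<integral>\<^sup>+t. ennreal ((norm (h y))\<^sup>2) * ennreal (heat_kernel (real (Suc i)) (t::real)) \<partial>lborel)"
        by (subst nn_integral_cmult) (simp_all add: heat_kernel_nn_integral)
      also have "\<dots> \<le> (\<integral>\<^sup>+t. ennreal (real (Suc k)) * (\<Sum>j\<le>k. ennreal (heat_kernel (real (Suc i)) t * (norm (Z j t))\<^sup>2)) \<partial>lborel)"
      proof (intro nn_integral_mono)
        fix t :: real
        have "(norm (h y))\<^sup>2 * heat_kernel (real (Suc i)) t \<le> (real (Suc k) * (\<Sum>j\<le>k. (norm (Z j t))\<^sup>2)) * heat_kernel (real (Suc i)) t"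
          by (intro mult_right_mono pt) simp
        also have "\<dots> = real (Suc k) * (\<Sum>j\<le>k. heat_kernel (real (Suc i)) t * (norm (Z j t))\<^sup>2)"
          by (simp only: sum_distrib_right sum_distrib_left mult_ac)
        finally show "ennreal ((norm (h y))\<^sup>2) * ennreal (heat_kernel (real (Suc i)) t)
          \<le> ennreal (real (Suc k)) * (\<Sum>j\<le>k. ennreal (heat_kernel (real (Suc i)) t * (norm (Z j t))\<^sup>2))"
          by (subst sum_ennreal, simp, subst (1 2) ennreal_mult[symmetric]) (auto intro!: ennreal_leI sum_nonneg)
      qed
      also have "\<dots> = ennreal (real (Suc k)) * (\<Sum>j\<le>k. A j i)"
        unfolding A_def by (subst nn_integral_cmult, measurable, subst nn_integral_sum) auto
      finally show ?thesis .
    qed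
    have "(\<lambda>i. ennreal (real (Suc k)) * (\<Sum>j\<le>k. A j i)) \<longlonglongrightarrow> ennreal (real (Suc k)) * (\<Sum>j\<le>k. 0)"
      by (intro ennreal_tendsto_cmult tendsto_sum A0) simp
    then have "(\<lambda>i. ennreal (real (Suc k)) * (\<Sum>j\<le>k. A j i)) \<longlonglongrightarrow> 0" by simp
    then have "ennreal ((norm (h y))\<^sup>2) \<le> 0"
      by (rule LIMSEQ_le_const) (use le in blast)
    then show ?case by simp
  qed
  then show ?thesis
    using AE_lborel_nonzero by eventually_elim (simp add: h_def H_def symb_def)
qed

lemma heat_kernel_1_le_1: "heat_kernel 1 (x::'a::euclidean_space) \<le> 1"
proof -
  have "1 \<le> sqrt (2 * pi * 1)" using pi_gt3 by (intro real_le_rsqrt) simp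
  then have "(1 / sqrt (2 * pi * 1)) ^ DIM('a) \<le> 1"
    by (intro power_le_one) auto
  then show ?thesis unfolding heat_kernel_def by (intro mult_le_one) auto
qed

text \<open>The standard Gaussian is an admissible datum: it is at most 1 and has integral 1, so its
  \<open>L\<^sup>2\<close> norm is at most 1. Its transform vanishes nowhere.\<close>

theorem growing_weight_opnorm_infinite:
  assumes \<gamma>: "0 < \<gamma>" and m: "0 < m" and s: "0 < s"
  shows "evolution_opnorm (abs_weight \<gamma> :: 'a::euclidean_space \<Rightarrow> real) s m = \<infinity>"
proof -
  define \<phi> where "\<phi> x = complex_of_real (heat_kernel 1 (x::'a))" for x
  have [measurable]: "\<phi> \<in> borel_measurable borel" unfolding \<phi>_def[abs_def] by measurable
  have "integrable lborel \<phi>" unfolding \<phi>_def[abs_def] by (intro integrable_of_real heat_kernel_integrable) simp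
  then have "has_fourier \<phi> (fourier_integral \<phi>)" by (rule integrable_has_fourier)
  moreover have "fourier_integral \<phi> = gaussian 1"
    using fourier_integral_heat_kernel[of 1 "0::'a"] by (auto simp: fun_eq_iff \<phi>_def[abs_def])
  ultimately have g: "has_fourier \<phi> (gaussian 1)" by simp
  have "L2_norm lborel \<phi> \<le> ennreal 1"
  proof (subst L2_norm_le_iff)
    have "sq_integral \<phi> \<le> (\<integral>\<^sup>+x. ennreal (heat_kernel 1 (x::'a)) \<partial>lborel)"
      unfolding \<phi>_def by (intro nn_integral_mono ennreal_leI) (simp add: power2_eq_square mult_left_le heat_kernel_1_le_1)
    also have "\<dots> = ennreal (1\<^sup>2)" by (simp add: heat_kernel_nn_integral)
    finally show "sq_integral \<phi> \<le> ennreal (1\<^sup>2)" .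
  qed simp
  moreover have "abs_D_defined s \<phi>"
  proof -
    obtain N :: nat where N: "s \<le> real N" using real_arch_simple by blast
    obtain C where C: "0 < C" "\<And>x::'a. norm (gaussian 1 x) \<le> C / bsq x ^ N"
      using rapidly_decreasing_bound[OF gaussian_rapidly_decreasing[of 1]] by (metis zero_less_one)
    have "norm (of_real (norm \<xi> powr s) * gaussian 1 \<xi>) \<le> C" for \<xi> :: 'a
    proof -
      have "norm \<xi> powr s \<le> sqrt (bsq \<xi>) powr s" using s norm_le_jap by (intro powr_mono2) auto
      also have "\<dots> \<le> sqrt (bsq \<xi>) powr (2 * real N)" using N s by (intro powr_mono) auto
      also have "\<dots> = bsq \<xi> ^ N"
        using bsq_pos[of \<xi>] by (simp add: powr_half_sqrt[symmetric] powr_powr powr_realpow)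
      finally have "norm \<xi> powr s * norm (gaussian 1 \<xi>) \<le> bsq \<xi> ^ N * (C / bsq \<xi> ^ N)"
        using C(2)[of \<xi>] by (intro mult_mono) auto
      then show ?thesis by (simp add: norm_mult)
    qed
    then have "tempered (\<lambda>\<xi>::'a. of_real (norm \<xi> powr s) * gaussian 1 \<xi>)"
      by (intro bounded_tempered) measurable
    then show ?thesis using g by (auto simp: abs_D_defined_def)
  qed
  moreover have "evolution_norm (abs_weight \<gamma>) s m \<phi> = \<infinity>"
  proof (cases "\<exists>u. is_evolution s m \<phi> u")
    case True
    then obtain u where u: "is_evolution s m \<phi> u" ..
    have "energy (abs_weight \<gamma>) u = \<infinity>"
    proof (rule ccontr)
      assume "energy (abs_weight \<gamma>) u \<noteq> \<infinity>"
      then have "AE \<xi>::'a in lborel. gaussian 1 \<xi> = 0"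
        by (intro growing_weight_finite_energy_imp_zero[OF u g m \<gamma>]) (simp add: less_top)
      then show False using AE_lborel_ex by fastforce
    qed
    then show ?thesis unfolding evolution_norm_eq[OF u] L2_norm_top_iff energy_eq[symmetric] .
  qed (simp add: evolution_norm_no_evolution)
  ultimately have "\<infinity> \<le> evolution_opnorm (abs_weight \<gamma> :: 'a \<Rightarrow> real) s m"
    unfolding evolution_opnorm_def by (intro SUP_upper2[of \<phi>]) auto
  then show ?thesis by (simp add: top_unique)
qed

section \<open>Radial push-forward and the Plancherel theorem in the frequency radius\<close>

lemma emeasure_distr_density:
  assumes [measurable]: "f \<in> borel_measurable M" "g \<in> borel_measurable M" "A \<in> sets borel"
  shows "emeasure (distr (density M f) borel g) A = (\<integral>\<^sup>+x. f x * indicator A (g x) \<partial>M)"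
proof -
  have "emeasure (distr (density M f) borel g) A = (\<integral>\<^sup>+y. indicator A y \<partial>distr (density M f) borel g)"
    by (rule nn_integral_indicator[symmetric]) simp
  also have "\<dots> = (\<integral>\<^sup>+x. indicator A (g x) \<partial>density M f)"
    by (rule nn_integral_distr) auto
  also have "\<dots> = (\<integral>\<^sup>+x. f x * indicator A (g x) \<partial>M)"
    by (rule nn_integral_density) auto
  finally show ?thesis .
qed

text \<open>The integral \<open>I\<close> in question is computed from each of its dilates. Averaging over dilations by \<open>r\<close> in \<open>{1..2}\<close> and
  exchanging the integrals, for every fixed direction one integrates over a null set of radii.
  This replaces polar coordinates.\<close>

lemma AE_norm_notin_null_set:
  assumes N: "N \<in> null_sets (lborel :: real measure)"
  shows "AE \<xi>::'a::euclidean_space in lborel. norm \<xi> \<notin> N"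
proof -
  have [measurable]: "N \<in> sets borel" using N by (auto simp: null_sets_def)
  define I where "I = (\<integral>\<^sup>+\<xi>. indicator N (norm (\<xi>::'a)) \<partial>lborel :: ennreal)"
  define K where "K r \<eta> = (indicator {1..2} r * ennreal (r ^ DIM('a)) * indicator N (r * norm (\<eta>::'a)) :: ennreal)" for r \<eta>
  have scaled: "(\<integral>\<^sup>+\<eta>. K r \<eta> \<partial>lborel) = indicator {1..2} r * I" for r
  proof (cases "r \<in> {1..2}")
    case True
    then have r: "0 < r" by simp
    have "I = ennreal (\<bar>r\<bar> ^ DIM('a)) * (\<integral>\<^sup>+\<eta>. indicator N (norm (0 + r *\<^sub>R (\<eta>::'a))) \<partial>lborel)"
      unfolding I_def using r by (intro lborel_nn_integral_affine) auto
    also have "\<dots> = (\<integral>\<^sup>+\<eta>. K r \<eta> \<partial>lborel)"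
      using r True by (simp add: K_def nn_integral_cmult)
    finally show ?thesis using True by simp
  qed (simp add: K_def)
  have "I = (\<integral>\<^sup>+r. indicator {1..2} (r::real) * I \<partial>lborel)"
    by (subst nn_integral_multc) auto
  also have "\<dots> = (\<integral>\<^sup>+r. \<integral>\<^sup>+\<eta>. K r \<eta> \<partial>lborel \<partial>lborel)"
    by (simp only: scaled)
  also have "\<dots> = (\<integral>\<^sup>+\<eta>. \<integral>\<^sup>+r. K r \<eta> \<partial>lborel \<partial>lborel)"
    unfolding K_def by (rule lborel_pair.Fubini'[symmetric]) measurable
  also have "\<dots> = (\<integral>\<^sup>+(\<eta>::'a). 0 \<partial>lborel)"
  proof (rule nn_integral_cong_AE)
    show "AE \<eta>::'a in lborel. (\<integral>\<^sup>+r. K r \<eta> \<partial>lborel) = 0"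
      using AE_lborel_nonzero
    proof eventually_elim
      case (elim \<eta>)
      have "AE r in lborel. norm \<eta> * r \<notin> N"
        using elim by (intro AE_lborel_scale AE_not_in N) simp
      then have "AE r in lborel. K r \<eta> = 0"
        by eventually_elim (simp add: K_def mult.commute)
      then have "(\<integral>\<^sup>+r. K r \<eta> \<partial>lborel) = (\<integral>\<^sup>+(r::real). 0 \<partial>lborel)"
        by (rule nn_integral_cong_AE)
      then show ?case by simp
    qed
  qed
  finally have "I = 0" by simp
  then have "AE \<xi>::'a in lborel. (indicator N (norm \<xi>) :: ennreal) = 0"
    unfolding I_def by (subst (asm) nn_integral_0_iff_AE) auto
  then show ?thesis by eventually_elim (simp add: indicator_def split: if_splits)
qed

text \<open>The image under the norm of the measure with density \<open>F\<close> is absolutely continuous by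
  \<open>AE_norm_notin_null_set\<close>; \<open>f\<close> is its Radon-Nikodym density.\<close>

lemma radial_density_nonneg:
  fixes F :: "'a::euclidean_space \<Rightarrow> real"
  assumes F: "integrable lborel F" "\<And>\<xi>. 0 \<le> F \<xi>"
  shows "\<exists>f :: real \<Rightarrow> real. f \<in> borel_measurable borel \<and>
    (\<forall>\<Phi> :: real \<Rightarrow> complex. \<Phi> \<in> borel_measurable borel \<longrightarrow> integrable lborel (\<lambda>\<xi>. \<Phi> (norm \<xi>) * of_real (F \<xi>)) \<longrightarrow>
      integrable lborel (\<lambda>r. \<Phi> r * of_real (f r)) \<and>
      (LINT \<xi>|lborel. \<Phi> (norm \<xi>) * of_real (F \<xi>)) = (LINT r|lborel. \<Phi> r * of_real (f r)))"
proof -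
  have [measurable]: "F \<in> borel_measurable borel" using F by auto
  define \<nu> where "\<nu> = distr (density lborel F) borel (norm :: 'a \<Rightarrow> real)"
  have sets: "sets \<nu> = sets borel" by (simp add: \<nu>_def)
  have em: "emeasure \<nu> A = (\<integral>\<^sup>+\<xi>. ennreal (F \<xi>) * indicator A (norm \<xi>) \<partial>lborel)" if [measurable]: "A \<in> sets borel" for A
    unfolding \<nu>_def by (rule emeasure_distr_density) auto
  have ac: "absolutely_continuous lborel \<nu>"
    unfolding absolutely_continuous_def
  proof
    fix N :: "real set" assume N: "N \<in> null_sets lborel"
    then have [measurable]: "N \<in> sets borel" by (auto simp: null_sets_def)
    have "AE \<xi> in lborel. ennreal (F \<xi>) * indicator N (norm \<xi>) = 0"
      using AE_norm_notin_null_set[OF N] by eventually_elim simp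
    then have "emeasure \<nu> N = (\<integral>\<^sup>+(\<xi>::'a). 0 \<partial>lborel)"
      unfolding em[OF \<open>N \<in> sets borel\<close>] by (rule nn_integral_cong_AE)
    then show "N \<in> null_sets \<nu>" by (simp add: null_sets_def sets)
  qed
  obtain f0 where f0: "f0 \<in> borel_measurable lborel" "density lborel f0 = \<nu>"
    using sigma_finite_measure.Radon_Nikodym[OF lborel.sigma_finite_measure_axioms ac] sets by auto
  then have [measurable]: "f0 \<in> borel_measurable borel" by simp
  have "(\<integral>\<^sup>+r. f0 r \<partial>lborel) = emeasure \<nu> UNIV"
    unfolding f0(2)[symmetric] by (subst emeasure_density) auto
  also have "\<dots> < \<infinity>"
    using F by (simp add: em nn_integral_eq_integral)
  finally have "AE r in lborel. f0 r \<noteq> \<infinity>"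
    by (intro nn_integral_PInf_AE) auto
  then have "AE r in lborel. f0 r = ennreal (enn2real (f0 r))"
    by eventually_elim (simp add: less_top)
  then have dens: "density lborel (\<lambda>r. ennreal (enn2real (f0 r))) = \<nu>"
    unfolding f0(2)[symmetric] by (intro density_cong) (auto elim: eventually_mono)
  define f where "f r = enn2real (f0 r)" for r
  have [measurable]: "f \<in> borel_measurable borel" unfolding f_def by measurable
  have f: "0 \<le> f r" for r by (simp add: f_def)
  show ?thesis
  proof (intro exI[of _ f] conjI allI impI)
    fix \<Phi> :: "real \<Rightarrow> complex"
    assume [measurable]: "\<Phi> \<in> borel_measurable borel" and int: "integrable lborel (\<lambda>\<xi>. \<Phi> (norm \<xi>) * of_real (F \<xi>))"
    have "integrable \<nu> \<Phi> \<longleftrightarrow> integrable (density lborel F) (\<lambda>\<xi>. \<Phi> (norm \<xi>))"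
      unfolding \<nu>_def by (rule integrable_distr_eq) auto
    also have "\<dots> \<longleftrightarrow> integrable lborel (\<lambda>\<xi>. F \<xi> *\<^sub>R \<Phi> (norm \<xi>))"
      using F by (intro integrable_density) auto
    finally have i: "integrable \<nu> \<Phi>" using int by (simp add: scaleR_conv_of_real mult.commute)
    then show "integrable lborel (\<lambda>r. \<Phi> r * of_real (f r))"
      unfolding dens[symmetric] f_def[symmetric] using f
      by (subst (asm) integrable_density) (auto simp: scaleR_conv_of_real mult.commute)
    have "(LINT \<xi>|lborel. \<Phi> (norm \<xi>) * of_real (F \<xi>)) = (LINT \<xi>|lborel. F \<xi> *\<^sub>R \<Phi> (norm \<xi>))"
      by (simp add: scaleR_conv_of_real mult.commute)
    also have "\<dots> = (LINT \<xi>|density lborel F. \<Phi> (norm \<xi>))"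
      using F by (intro integral_density[symmetric]) auto
    also have "\<dots> = (LINT r|\<nu>. \<Phi> r)"
      unfolding \<nu>_def by (intro integral_distr[symmetric]) auto
    also have "\<dots> = (LINT r|lborel. f r *\<^sub>R \<Phi> r)"
      unfolding dens[symmetric] f_def[symmetric] using f by (intro integral_density) auto
    finally show "(LINT \<xi>|lborel. \<Phi> (norm \<xi>) * of_real (F \<xi>)) = (LINT r|lborel. \<Phi> r * of_real (f r))"
      by (simp add: scaleR_conv_of_real mult.commute)
  qed simp
qed

text \<open>The function \<open>f(r)\<close> plays the role of the integral of \<open>F\<close> over the sphere of radius \<open>r\<close>. A complex \<open>F\<close> is the combination of four
  nonnegative functions.\<close>

lemma radial_density:
  fixes F :: "'a::euclidean_space \<Rightarrow> complex"
  assumes F: "integrable lborel F"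
  obtains f :: "real \<Rightarrow> complex" where "f \<in> borel_measurable borel"
    "\<And>\<Phi>. \<Phi> \<in> borel_measurable borel \<Longrightarrow> integrable lborel (\<lambda>\<xi>. \<Phi> (norm \<xi>) * F \<xi>) \<Longrightarrow>
      integrable lborel (\<lambda>r. \<Phi> r * f r) \<and> (LINT \<xi>|lborel. \<Phi> (norm \<xi>) * F \<xi>) = (LINT r|lborel. \<Phi> r * f r)"
proof -
  have [measurable]: "F \<in> borel_measurable borel" using F by auto
  define P :: "complex \<Rightarrow> 'a \<Rightarrow> real" where "P c \<xi> = max 0 (Re (c * F \<xi>))" for c \<xi>
  have [measurable]: "P c \<in> borel_measurable borel" for c unfolding P_def by measurable
  have P0: "0 \<le> P c \<xi>" for c \<xi> by (simp add: P_def)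
  have PF: "P c \<xi> \<le> norm (F \<xi>)" if "norm c = 1" for c \<xi>
    using complex_Re_le_cmod[of "c * F \<xi>"] that by (simp add: P_def norm_mult)
  have Pint: "integrable lborel (P c)" if "norm c = 1" for c
    by (rule Bochner_Integration.integrable_bound[OF integrable_norm[OF F]])
       (use P0[of c] PF[OF that] in auto)
  define C :: "complex set" where "C = {1, -1, \<i>, -\<i>}"
  have C: "norm c = 1" if "c \<in> C" for c using that by (auto simp: C_def)
  have "\<forall>c\<in>C. \<exists>f :: real \<Rightarrow> real. f \<in> borel_measurable borel \<and>
    (\<forall>\<Phi> :: real \<Rightarrow> complex. \<Phi> \<in> borel_measurable borel \<longrightarrow> integrable lborel (\<lambda>\<xi>. \<Phi> (norm \<xi>) * of_real (P c \<xi>)) \<longrightarrow>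
      integrable lborel (\<lambda>r. \<Phi> r * of_real (f r)) \<and>
      (LINT \<xi>|lborel. \<Phi> (norm \<xi>) * of_real (P c \<xi>)) = (LINT r|lborel. \<Phi> r * of_real (f r)))"
    using radial_density_nonneg[OF Pint[OF C] P0] by blast
  then obtain f where f: "\<And>c. c \<in> C \<Longrightarrow> f c \<in> borel_measurable borel"
    "\<And>c \<Phi>. c \<in> C \<Longrightarrow> \<Phi> \<in> borel_measurable borel \<Longrightarrow> integrable lborel (\<lambda>\<xi>. \<Phi> (norm \<xi>) * of_real (P c \<xi>)) \<Longrightarrow>
      integrable lborel (\<lambda>r. \<Phi> r * complex_of_real (f c r))"
    "\<And>c \<Phi>. c \<in> C \<Longrightarrow> \<Phi> \<in> borel_measurable borel \<Longrightarrow> integrable lborel (\<lambda>\<xi>. \<Phi> (norm \<xi>) * of_real (P c \<xi>)) \<Longrightarrow>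
      (LINT \<xi>|lborel. \<Phi> (norm \<xi>) * of_real (P c \<xi>)) = (LINT r|lborel. \<Phi> r * complex_of_real (f c r))"
    by (auto dest!: bchoice)
  have finC: "finite C" by (simp add: C_def)
  have F_eq: "F \<xi> = (\<Sum>c\<in>C. cnj c * of_real (P c \<xi>))" for \<xi>
    by (simp add: C_def P_def complex_eq_iff max_def)
  define f' where "f' r = (\<Sum>c\<in>C. cnj c * complex_of_real (f c r))" for r
  show ?thesis
  proof (rule that[of f'])
    show "f' \<in> borel_measurable borel"
      unfolding f'_def using f(1) by (intro borel_measurable_sum borel_measurable_times) auto
    fix \<Phi> :: "real \<Rightarrow> complex"
    assume [measurable]: "\<Phi> \<in> borel_measurable borel" and int: "integrable lborel (\<lambda>\<xi>. \<Phi> (norm \<xi>) * F \<xi>)"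
    have intc: "integrable lborel (\<lambda>\<xi>. \<Phi> (norm \<xi>) * of_real (P c \<xi>))" if c: "c \<in> C" for c
      by (rule Bochner_Integration.integrable_bound[OF int])
         (use P0[of c] PF[OF C[OF c]] in \<open>auto simp: norm_mult intro!: mult_left_mono\<close>)
    have e1: "\<Phi> r * f' r = (\<Sum>c\<in>C. cnj c * (\<Phi> r * complex_of_real (f c r)))" for r
      by (simp add: f'_def sum_distrib_left mult_ac)
    have e2: "\<Phi> (norm \<xi>) * F \<xi> = (\<Sum>c\<in>C. cnj c * (\<Phi> (norm \<xi>) * of_real (P c \<xi>)))" for \<xi>
      by (subst F_eq) (simp add: sum_distrib_left mult_ac)
    have i2: "integrable lborel (\<lambda>r. cnj c * (\<Phi> r * complex_of_real (f c r)))" if "c \<in> C" for c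
      by (intro integrable_mult_right f(2) that intc) simp
    have "integrable lborel (\<lambda>r. \<Phi> r * f' r)"
      unfolding e1 by (intro Bochner_Integration.integrable_sum i2)
    moreover have "(LINT \<xi>|lborel. \<Phi> (norm \<xi>) * F \<xi>) = (\<Sum>c\<in>C. cnj c * (LINT \<xi>|lborel. \<Phi> (norm \<xi>) * of_real (P c \<xi>)))"
      unfolding e2 by (subst Bochner_Integration.integral_sum) (auto intro!: integrable_mult_right intc)
    moreover have "\<dots> = (LINT r|lborel. \<Phi> r * f' r)"
      unfolding e1 by (subst Bochner_Integration.integral_sum) (auto intro!: i2 sum.cong simp: f(3) intc)
    ultimately show "integrable lborel (\<lambda>r. \<Phi> r * f' r) \<and> (LINT \<xi>|lborel. \<Phi> (norm \<xi>) * F \<xi>) = (LINT r|lborel. \<Phi> r * f' r)"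
      by simp
  qed
qed

text \<open>The substitution rule for compact intervals, extended to the half line by exhaustion with the
  intervals \<open>J k\<close>.\<close>

lemma powr_substitution_measure:
  assumes m: "0 < (m::real)"
  shows "distr (density lborel (\<lambda>r. ennreal (indicator {0<..} r * (m * r powr (m - 1))))) borel (\<lambda>r. r powr m)
    = density lborel (\<lambda>\<tau>. ennreal (indicator {0<..} \<tau>))" (is "?M2 = ?M1")
proof (rule measure_eqI)
  show "sets ?M2 = sets ?M1" by simp
  fix A assume "A \<in> sets ?M2"
  then have [measurable]: "A \<in> sets borel" by simp
  define J where "J k = {(1 / real (Suc k)) powr m .. real (Suc k) powr m}" for k
  have J_mono: "incseq J"
  proof (intro incseq_SucI)
    fix k show "J k \<subseteq> J (Suc k)"
      unfolding J_def using m by (intro atLeastatMost_subset_iff[THEN iffD2]) (auto intro!: powr_mono2 simp: frac_le)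
  qed
  have J_Un: "(\<Union>k. J k) = {0<..}"
  proof (intro set_eqI iffI)
    fix \<tau> assume "\<tau> \<in> (\<Union>k. J k)"
    then obtain k where "(1 / real (Suc k)) powr m \<le> \<tau>" by (auto simp: J_def)
    moreover have "0 < (1 / real (Suc k)) powr m" by simp
    ultimately show "\<tau> \<in> {0<..}" unfolding greaterThan_iff by linarith
  next
    fix \<tau> :: real assume "\<tau> \<in> {0<..}"
    then have \<tau>: "0 < \<tau>" by simp
    define r where "r = \<tau> powr (1 / m)"
    have r: "0 < r" "r powr m = \<tau>" using \<tau> m by (auto simp: r_def powr_powr)
    obtain k :: nat where k: "max r (1 / r) \<le> real k" using real_arch_simple by blast
    have "1 / real (Suc k) \<le> r" "r \<le> real (Suc k)" using k r(1) by (auto simp: field_simps)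
    then have "\<tau> \<in> J k" unfolding J_def r(2)[symmetric] using m r(1) by (auto intro!: powr_mono2)
    then show "\<tau> \<in> (\<Union>k. J k)" by blast
  qed
  have emM1: "emeasure ?M1 B = (\<integral>\<^sup>+\<tau>. ennreal (indicator {0<..} \<tau>) * indicator B \<tau> \<partial>lborel)" if "B \<in> sets borel" for B
    using that by (subst emeasure_density) auto
  have emM2: "emeasure ?M2 B = (\<integral>\<^sup>+r. ennreal (indicator {0<..} r * (m * r powr (m - 1))) * indicator B (r powr m) \<partial>lborel)" if [measurable]: "B \<in> sets borel" for B
    by (rule emeasure_distr_density) measurable
  have eqk: "emeasure ?M1 (A \<inter> J k) = emeasure ?M2 (A \<inter> J k)" for k
  proof -
    define a b where "a = 1 / real (Suc k)" and "b = real (Suc k)"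
    have ab: "0 < a" "a \<le> b" by (auto simp: a_def b_def field_simps)
    have Jk: "J k = {a powr m .. b powr m}" by (simp add: J_def a_def b_def)
    have Jiff: "r powr m \<in> {a powr m .. b powr m} \<longleftrightarrow> r \<in> {a..b}" if "0 < r" for r
    proof -
      have le: "x powr m \<le> y powr m \<longleftrightarrow> x \<le> y" if "0 < x" "0 < y" for x y :: real
        using that m powr_less_mono2[of m y x] powr_mono2[of m x y] by (cases "x \<le> y") auto
      show ?thesis using that ab le[of a r] le[of r b] by simp
    qed
    have [measurable]: "J k \<in> sets borel" by (simp add: J_def)
    have "emeasure ?M1 (A \<inter> J k) = (\<integral>\<^sup>+\<tau>. ennreal (indicator A \<tau>) * indicator {a powr m .. b powr m} \<tau> \<partial>lborel)"
    proof (subst emM1, measurable, intro nn_integral_cong)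
      fix \<tau> :: real
      have "a powr m \<le> \<tau> \<Longrightarrow> 0 < \<tau>" using ab by (rule_tac less_le_trans[of 0 "a powr m"]) auto
      then show "ennreal (indicator {0<..} \<tau>) * indicator (A \<inter> J k) \<tau> = ennreal (indicator A \<tau>) * indicator {a powr m .. b powr m} \<tau>"
        unfolding Jk by (auto simp: indicator_def)
    qed
    also have "\<dots> = (\<integral>\<^sup>+\<tau>. ennreal (indicator A \<tau> * indicator {a powr m .. b powr m} \<tau>) \<partial>lborel)"
      by (intro nn_integral_cong) (auto simp: indicator_def)
    also have "\<dots> = (\<integral>\<^sup>+r. ennreal (indicator A (r powr m) * (m * r powr (m - 1)) * indicator {a..b} r) \<partial>lborel)"
    proof (rule nn_integral_substitution)
      show "((\<lambda>r. r powr m) has_real_derivative m * r powr (m - 1)) (at r)" if "r \<in> {a..b}" for r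
        using that ab by (intro has_real_derivative_powr) auto
      show "continuous_on {a..b} (\<lambda>r. m * r powr (m - 1))"
        using ab by (intro continuous_intros) auto
    qed (use m ab in \<open>auto simp: set_borel_measurable_def\<close>)
    also have "\<dots> = emeasure ?M2 (A \<inter> J k)"
    proof (subst emM2, measurable, intro nn_integral_cong)
      fix r :: real
      show "ennreal (indicator A (r powr m) * (m * r powr (m - 1)) * indicator {a..b} r)
        = ennreal (indicator {0<..} r * (m * r powr (m - 1))) * indicator (A \<inter> J k) (r powr m)"
        unfolding Jk using Jiff[of r] ab by (cases "0 < r") (auto simp: indicator_def)
    qed
    finally show ?thesis .
  qed
  have AJ: "incseq (\<lambda>k. A \<inter> J k)"
    using J_mono unfolding incseq_def by (blast intro: Int_mono)
  have [measurable]: "J k \<in> sets borel" for k by (simp add: J_def)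
  have lim1: "(\<lambda>k. emeasure ?M1 (A \<inter> J k)) \<longlonglongrightarrow> emeasure ?M1 (\<Union>k. A \<inter> J k)"
    by (rule Lim_emeasure_incseq[OF _ AJ]) auto
  have lim2: "(\<lambda>k. emeasure ?M2 (A \<inter> J k)) \<longlonglongrightarrow> emeasure ?M2 (\<Union>k. A \<inter> J k)"
    by (rule Lim_emeasure_incseq[OF _ AJ]) auto
  have Un: "(\<Union>k. A \<inter> J k) = A \<inter> {0<..}" using J_Un by auto
  have "emeasure ?M1 (A \<inter> {0<..}) = emeasure ?M2 (A \<inter> {0<..})"
    using LIMSEQ_unique[OF lim1 lim2[folded eqk]] unfolding Un .
  moreover have "emeasure ?M1 (A \<inter> {0<..}) = emeasure ?M1 A"
    by (subst (1 2) emM1) (auto intro!: nn_integral_cong simp: indicator_def)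
  moreover have "emeasure ?M2 (A \<inter> {0<..}) = emeasure ?M2 A"
    by (subst (1 2) emM2) (auto intro!: nn_integral_cong simp: indicator_def)
  ultimately show "emeasure ?M2 A = emeasure ?M1 A" by simp
qed

text \<open>In the variable \<open>\<tau> = r powr m\<close> the integral over \<open>r\<close> is a Fourier integral.\<close>

lemma half_line_plancherel:
  fixes A :: "real \<Rightarrow> complex"
  assumes m: "0 < m" and A: "integrable lborel (\<lambda>r. indicator {0<..} r * A r)" and [measurable]: "A \<in> borel_measurable borel"
  shows "sq_integral (\<lambda>t. LINT r|lborel. indicator {0<..} r * A r * cis (t * r powr m))
    = ennreal (2 * pi / m) * (\<integral>\<^sup>+r. indicator {0<..} r * ennreal ((norm (A r))\<^sup>2 * r powr (1 - m)) \<partial>lborel)"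
proof -
  \<comment> \<open>The amplitude in the variable \<open>\<tau>\<close>, divided by the Jacobian.\<close>
  define c where "c \<tau> = A (\<tau> powr (1 / m)) / of_real (m * (\<tau> powr (1 / m)) powr (m - 1))" for \<tau>
  have [measurable]: "c \<in> borel_measurable borel" unfolding c_def by measurable
  define d where "d r = indicator {0<..} r * (m * r powr (m - 1))" for r :: real
  have d0: "0 \<le> d r" for r using m by (simp add: d_def)
  have [measurable]: "d \<in> borel_measurable borel" unfolding d_def by measurable
  define M1 where "M1 = density lborel (\<lambda>\<tau>. ennreal (indicator {0<..} (\<tau>::real)))"
  have M: "M1 = distr (density lborel (\<lambda>r. ennreal (d r))) borel (\<lambda>r. r powr m)"
    unfolding M1_def d_def using powr_substitution_measure[OF m] by simp
  have Ac: "d r *\<^sub>R (c (r powr m) * z) = indicator {0<..} r * A r * z" for r z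
    using m by (cases "0 < r") (auto simp: d_def c_def powr_powr scaleR_conv_of_real)
  have cM: "integrable M1 c"
    unfolding M using Ac[of _ 1] A d0 by (simp add: integrable_distr_eq integrable_density)
  define C where "C \<tau> = indicator {0<..} \<tau> * c \<tau>" for \<tau>
  have [measurable]: "C \<in> borel_measurable borel" unfolding C_def by measurable
  have C: "integrable lborel C"
  proof -
    have "integrable lborel (\<lambda>\<tau>. indicator {0<..} \<tau> *\<^sub>R c \<tau>)"
      using cM unfolding M1_def by (subst (asm) integrable_density) auto
    moreover have "C = (\<lambda>\<tau>. indicator {0<..} \<tau> *\<^sub>R c \<tau>)"
      by (auto simp: C_def fun_eq_iff indicator_def)
    ultimately show ?thesis by simp
  qed
  have B: "(LINT r|lborel. indicator {0<..} r * A r * cis (t * r powr m)) = fourier_integral C (0 - t)" for t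
  proof -
    have "(LINT r|lborel. indicator {0<..} r * A r * cis (t * r powr m)) = (LINT r|lborel. d r *\<^sub>R (c (r powr m) * cis (t * r powr m)))"
      by (simp only: Ac)
    also have "\<dots> = (LINT \<tau>|M1. c \<tau> * cis (t * \<tau>))"
      unfolding M by (simp add: integral_distr integral_density d0)
    also have "\<dots> = (LINT \<tau>|lborel. indicator {0<..} \<tau> *\<^sub>R (c \<tau> * cis (t * \<tau>)))"
      unfolding M1_def by (subst integral_density) auto
    also have "\<dots> = fourier_integral C (0 - t)"
      unfolding fourier_integral_def C_def
      by (intro Bochner_Integration.integral_cong) (auto simp: indicator_def mult_ac)
    finally show ?thesis .
  qed
  have "sq_integral (\<lambda>t. LINT r|lborel. indicator {0<..} r * A r * cis (t * r powr m))
    = sq_integral (fourier_integral C)"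
    unfolding B by (rule lborel_nn_integral_reflect[of "\<lambda>t. ennreal ((norm (fourier_integral C t))\<^sup>2)"]) measurable
  also have "\<dots> = ennreal (2 * pi) * sq_integral C"
    using plancherel[OF C] by simp
  also have "sq_integral C = (\<integral>\<^sup>+\<tau>. ennreal ((norm (c \<tau>))\<^sup>2) \<partial>M1)"
    unfolding M1_def by (subst nn_integral_density) (auto simp: C_def indicator_def intro!: nn_integral_cong)
  also have "\<dots> = (\<integral>\<^sup>+r. ennreal (d r) * ennreal ((norm (c (r powr m)))\<^sup>2) \<partial>lborel)"
    unfolding M by (simp add: nn_integral_distr nn_integral_density)
  also have "\<dots> = (\<integral>\<^sup>+r. ennreal (1 / m) * (indicator {0<..} r * ennreal ((norm (A r))\<^sup>2 * r powr (1 - m))) \<partial>lborel)"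
  proof (intro nn_integral_cong)
    fix r :: real
    show "ennreal (d r) * ennreal ((norm (c (r powr m)))\<^sup>2) = ennreal (1 / m) * (indicator {0<..} r * ennreal ((norm (A r))\<^sup>2 * r powr (1 - m)))"
    proof (cases "0 < r")
      case True
      have "norm (c (r powr m)) = norm (A r) / (m * r powr (m - 1))"
        using m True by (simp add: c_def powr_powr norm_divide norm_mult)
      then have "d r * (norm (c (r powr m)))\<^sup>2 = (m * r powr (m - 1)) * ((norm (A r))\<^sup>2 / (m * r powr (m - 1))\<^sup>2)"
        using True by (simp add: d_def power_divide)
      also have "\<dots> = 1 / m * ((norm (A r))\<^sup>2 * (1 / r powr (m - 1)))"
        using m True by (simp add: power2_eq_square field_simps)
      also have "1 / r powr (m - 1) = r powr (1 - m)"
        using powr_minus_divide[of r "m - 1"] by simp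
      finally show ?thesis using True m d0[of r]
        by (simp add: ennreal_mult[symmetric])
    qed (simp add: d_def)
  qed
  also have "\<dots> = ennreal (1 / m) * (\<integral>\<^sup>+r. (indicator {0<..} r * ennreal ((norm (A r))\<^sup>2 * r powr (1 - m))) \<partial>lborel)"
    by (intro nn_integral_cmult) measurable
  finally show ?thesis
    using m by (simp add: mult.assoc[symmetric] ennreal_mult[symmetric])
qed

text \<open>The density \<open>q\<close> depends on neither the order \<open>m\<close> nor the multiplier \<open>a\<close>, which is what makes evolutions of
  different orders comparable. It is the squared modulus of the radial density of \<open>F\<close>.\<close>

theorem radial_plancherel:
  fixes F :: "'a::euclidean_space \<Rightarrow> complex"
  assumes F: "integrable lborel F"
  obtains q :: "real \<Rightarrow> ennreal" where "q \<in> borel_measurable borel"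
    "\<And>(a :: real \<Rightarrow> real) m. a \<in> borel_measurable borel \<Longrightarrow> 0 < m \<Longrightarrow> integrable lborel (\<lambda>\<xi>. of_real (a (norm \<xi>)) * F \<xi>) \<Longrightarrow>
      (sq_integral (\<lambda>t. LINT \<xi>|lborel. of_real (a (norm \<xi>)) * F \<xi> * cis (t * norm \<xi> powr m)))
      = ennreal (2 * pi / m) * (\<integral>\<^sup>+r. indicator {0<..} r * ennreal ((a r)\<^sup>2 * r powr (1 - m)) * q r \<partial>lborel)"
proof -
  obtain f :: "real \<Rightarrow> complex" where [measurable]: "f \<in> borel_measurable borel"
    and f: "\<And>\<Phi>. \<Phi> \<in> borel_measurable borel \<Longrightarrow> integrable lborel (\<lambda>\<xi>. \<Phi> (norm \<xi>) * F \<xi>) \<Longrightarrow>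
      integrable lborel (\<lambda>r. \<Phi> r * f r) \<and> (LINT \<xi>|lborel. \<Phi> (norm \<xi>) * F \<xi>) = (LINT r|lborel. \<Phi> r * f r)"
    using radial_density[OF F] by blast
  have [measurable]: "F \<in> borel_measurable borel" using F by auto
  show ?thesis
  proof (rule that[of "\<lambda>r. ennreal ((norm (f r))\<^sup>2)"])
    fix a :: "real \<Rightarrow> real" and m :: real
    assume [measurable]: "a \<in> borel_measurable borel" and m: "0 < m"
      and int: "integrable lborel (\<lambda>\<xi>. of_real (a (norm \<xi>)) * F \<xi>)"
    define \<Phi> where "\<Phi> t r = indicator {0<..} r * complex_of_real (a r) * cis (t * r powr m)" for t r
    have [measurable]: "\<Phi> t \<in> borel_measurable borel" for t unfolding \<Phi>_def by measurable
    have [measurable]: "(\<lambda>\<xi>::'a. \<Phi> t (norm \<xi>)) \<in> borel_measurable borel" for t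
      using measurable_compose[of norm borel borel "\<Phi> t" borel] by simp
    have ae: "AE \<xi> in lborel. \<Phi> t (norm \<xi>) * F \<xi> = of_real (a (norm \<xi>)) * F \<xi> * cis (t * norm \<xi> powr m)" for t
      using AE_lborel_nonzero by eventually_elim (simp add: \<Phi>_def mult_ac)
    have \<Phi>i: "integrable lborel (\<lambda>\<xi>. \<Phi> t (norm \<xi>) * F \<xi>)" for t
      by (rule Bochner_Integration.integrable_bound[OF int]) (auto simp: \<Phi>_def norm_mult indicator_def intro!: AE_I2 mult_right_mono)
    have A: "integrable lborel (\<lambda>r. indicator {0<..} r * (complex_of_real (a r) * f r))"
      using f[OF _ \<Phi>i[of 0]] by (simp add: \<Phi>_def mult.assoc)
    have B: "(LINT \<xi>|lborel. of_real (a (norm \<xi>)) * F \<xi> * cis (t * norm \<xi> powr m))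
       = (LINT r|lborel. indicator {0<..} r * (complex_of_real (a r) * f r) * cis (t * r powr m))" for t
    proof -
      have "(LINT \<xi>|lborel. of_real (a (norm \<xi>)) * F \<xi> * cis (t * norm \<xi> powr m)) = (LINT \<xi>|lborel. \<Phi> t (norm \<xi>) * F \<xi>)"
      proof (rule integral_cong_AE)
        show "(\<lambda>\<xi>. of_real (a (norm \<xi>)) * F \<xi> * cis (t * norm \<xi> powr m)) \<in> borel_measurable lborel"
          using borel_measurable_integrable[OF int] by (intro borel_measurable_times) auto
        show "(\<lambda>\<xi>. \<Phi> t (norm \<xi>) * F \<xi>) \<in> borel_measurable lborel"
          by (rule borel_measurable_integrable[OF \<Phi>i])
        show "AE \<xi> in lborel. of_real (a (norm \<xi>)) * F \<xi> * cis (t * norm \<xi> powr m) = \<Phi> t (norm \<xi>) * F \<xi>"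
          using ae[of t] by eventually_elim (rule sym)
      qed
      also have "\<dots> = (LINT r|lborel. \<Phi> t r * f r)" using f[OF _ \<Phi>i[of t]] by simp
      finally show ?thesis by (simp add: \<Phi>_def mult_ac)
    qed
    have "sq_integral (\<lambda>t. LINT \<xi>|lborel. of_real (a (norm \<xi>)) * F \<xi> * cis (t * norm \<xi> powr m))
      = ennreal (2 * pi / m) * (\<integral>\<^sup>+r. indicator {0<..} r * ennreal ((norm (complex_of_real (a r) * f r))\<^sup>2 * r powr (1 - m)) \<partial>lborel)"
      unfolding B by (rule half_line_plancherel[OF m A]) measurable
    also have "(\<integral>\<^sup>+r. indicator {0<..} r * ennreal ((norm (complex_of_real (a r) * f r))\<^sup>2 * r powr (1 - m)) \<partial>lborel)
       = (\<integral>\<^sup>+r. indicator {0<..} r * ennreal ((a r)\<^sup>2 * r powr (1 - m)) * ennreal ((norm (f r))\<^sup>2) \<partial>lborel)"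
      by (intro nn_integral_cong) (auto simp: indicator_def norm_mult power_mult_distrib ennreal_mult[symmetric] mult_ac)
    finally show "sq_integral (\<lambda>t. LINT \<xi>|lborel. of_real (a (norm \<xi>)) * F \<xi> * cis (t * norm \<xi> powr m))
      = ennreal (2 * pi / m) * (\<integral>\<^sup>+r. indicator {0<..} r * ennreal ((a r)\<^sup>2 * r powr (1 - m)) * ennreal ((norm (f r))\<^sup>2) \<partial>lborel)" .
  qed measurable
qed

section \<open>Comparison of regularized evolutions\<close>

lemma energy_iterated_time:
  assumes [measurable]: "w \<in> borel_measurable borel" "u \<in> borel_measurable borel"
  shows "energy w u = (\<integral>\<^sup>+x. ennreal ((w x)\<^sup>2) * (sq_integral (\<lambda>t. u (t, x))) \<partial>lborel)"
proof -
  have "(\<integral>\<^sup>+t. ennreal ((w x * norm (u (t, x)))\<^sup>2) \<partial>lborel) = ennreal ((w x)\<^sup>2) * sq_integral (\<lambda>t. u (t, x))" for x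
    by (subst nn_integral_cmult[symmetric]) (auto simp: power_mult_distrib ennreal_mult)
  then show ?thesis by (subst energy_iterated') auto
qed

definition cutoff :: "real \<Rightarrow> real \<Rightarrow> real \<Rightarrow> real" where
  "cutoff \<kappa> e r = exp (- e * r powr \<kappa> / 2)"

lemma cutoff_measurable [measurable]: "cutoff \<kappa> e \<in> borel_measurable borel"
  unfolding cutoff_def[abs_def] by measurable

lemma cutoff_nonneg [simp]: "0 \<le> cutoff \<kappa> e r"
  by (simp add: cutoff_def)

lemma cutoff_le_1: "0 \<le> e \<Longrightarrow> cutoff \<kappa> e r \<le> 1"
  by (simp add: cutoff_def)

lemma cutoff_add: "cutoff \<kappa> (e + d) r = cutoff \<kappa> e r * cutoff \<kappa> d r"
  by (simp add: cutoff_def exp_add[symmetric] algebra_simps add_divide_distrib diff_divide_distrib)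

lemma cutoff_rapidly_decreasing:
  assumes "0 < \<kappa>" "0 < e"
  shows "rapidly_decreasing (\<lambda>\<xi>::'a::euclidean_space. complex_of_real (cutoff \<kappa> e (norm \<xi>)))"
  using exp_power_rapidly_decreasing[of \<kappa> "e / 2", where 'a='a] assms by (simp add: cutoff_def)

text \<open>The evolution with transform multiplied by the radial functions \<open>cutoff \<kappa> e\<close> and \<open>b\<close>. The
  cutoff ensures convergence. The bounded factor \<open>b\<close> makes room for a second regularization and for the
  difference of two regularizations.\<close>

definition smoothed :: "real \<Rightarrow> real \<Rightarrow> (real \<Rightarrow> real) \<Rightarrow> real \<Rightarrow> real \<Rightarrow> ('a::euclidean_space \<Rightarrow> complex) \<Rightarrow> real \<times> 'a \<Rightarrow> complex" where
  "smoothed \<kappa> e b s m g p = inverse_fourier (\<lambda>\<xi>. of_real (b (norm \<xi>) * cutoff \<kappa> e (norm \<xi>)) * (symb s m (fst p) \<xi> * g \<xi>)) (snd p)"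

lemma smoothed_integrable:
  fixes g :: "'a::euclidean_space \<Rightarrow> complex"
  assumes g: "tempered (\<lambda>\<xi>. of_real (norm \<xi> powr s) * g \<xi>)" and [measurable]: "g \<in> borel_measurable borel"
    and [measurable]: "b \<in> borel_measurable borel" and b: "\<And>r. \<bar>b r\<bar> \<le> 1" and e: "0 < \<kappa>" "0 < e"
  shows "integrable lborel (\<lambda>\<xi>. of_real (b (norm \<xi>) * cutoff \<kappa> e (norm \<xi>)) * (symb s m t \<xi> * g \<xi>))"
proof (rule Bochner_Integration.integrable_bound)
  show "integrable lborel (\<lambda>\<xi>. of_real (norm \<xi> powr s) * g \<xi> * of_real (cutoff \<kappa> e (norm \<xi>)))"
    by (intro tempered_rapidly_decreasing_integrable g cutoff_rapidly_decreasing e)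
  show "AE \<xi> in lborel. norm (of_real (b (norm \<xi>) * cutoff \<kappa> e (norm \<xi>)) * (symb s m t \<xi> * g \<xi>))
    \<le> norm (of_real (norm \<xi> powr s) * g \<xi> * of_real (cutoff \<kappa> e (norm \<xi>)))"
  proof (intro AE_I2)
    fix \<xi> :: 'a
    have "norm (of_real (b (norm \<xi>) * cutoff \<kappa> e (norm \<xi>)) * (symb s m t \<xi> * g \<xi>))
        = \<bar>b (norm \<xi>)\<bar> * norm (of_real (norm \<xi> powr s) * g \<xi> * of_real (cutoff \<kappa> e (norm \<xi>)))"
      by (simp add: norm_mult symb_def abs_mult)
    also have "\<dots> \<le> norm (of_real (norm \<xi> powr s) * g \<xi> * of_real (cutoff \<kappa> e (norm \<xi>)))"
      by (intro mult_left_le_one_le) (auto simp: b)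
    finally show "norm (of_real (b (norm \<xi>) * cutoff \<kappa> e (norm \<xi>)) * (symb s m t \<xi> * g \<xi>))
    \<le> norm (of_real (norm \<xi> powr s) * g \<xi> * of_real (cutoff \<kappa> e (norm \<xi>)))" .
  qed
qed measurable

lemma smoothed_measurable [measurable]:
  fixes g :: "'a::euclidean_space \<Rightarrow> complex"
  assumes [measurable]: "g \<in> borel_measurable borel" "b \<in> borel_measurable borel"
  shows "smoothed \<kappa> e b s m g \<in> borel_measurable borel"
proof -
  have "(\<lambda>p. smoothed \<kappa> e b s m g p) \<in> borel_measurable ((borel :: real measure) \<Otimes>\<^sub>M (borel :: 'a measure))"
    unfolding smoothed_def inverse_fourier_def symb_def by measurable
  then show ?thesis by (simp add: borel_prod)
qed

text \<open>The first identity of the theorem at a single point \<open>x\<close>. The functional \<open>J\<close> is quadratic in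
  \<open>b\<close> and the same for both evolutions; its monotonicity gives the third property.\<close>

lemma radial_isometry:
  fixes g :: "'a::euclidean_space \<Rightarrow> complex" and x :: 'a
  assumes m: "0 < m" "0 < m'" and \<gamma>: "s - m / 2 = s' - m' / 2"
    and g: "tempered (\<lambda>\<xi>. of_real (norm \<xi> powr s) * g \<xi>)" "tempered (\<lambda>\<xi>. of_real (norm \<xi> powr s') * g \<xi>)"
    and [measurable]: "g \<in> borel_measurable borel" and e: "0 < \<kappa>" "0 < e"
  obtains J :: "(real \<Rightarrow> real) \<Rightarrow> ennreal" where
    "\<And>b. b \<in> borel_measurable borel \<Longrightarrow> (\<And>r. \<bar>b r\<bar> \<le> 1) \<Longrightarrow>
      (sq_integral (\<lambda>t. smoothed \<kappa> e b s m g (t, x))) = ennreal (1 / m) * J b"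
    "\<And>b. b \<in> borel_measurable borel \<Longrightarrow> (\<And>r. \<bar>b r\<bar> \<le> 1) \<Longrightarrow>
      (sq_integral (\<lambda>t. smoothed \<kappa> e b s' m' g (t, x))) = ennreal (1 / m') * J b"
    "\<And>b c. b \<in> borel_measurable borel \<Longrightarrow> c \<in> borel_measurable borel \<Longrightarrow> (\<And>r. (b r)\<^sup>2 + (c r)\<^sup>2 \<le> 1) \<Longrightarrow> J b + J c \<le> J (\<lambda>_. 1)"
proof -
  define F where "F \<xi> = of_real (cutoff \<kappa> e (norm \<xi>)) * (of_real (norm \<xi> powr s) * g \<xi>) * cis (x \<bullet> \<xi>)" for \<xi>
  have F: "integrable lborel F"
  proof (rule Bochner_Integration.integrable_bound)
    show "integrable lborel (\<lambda>\<xi>. of_real (norm \<xi> powr s) * g \<xi> * of_real (cutoff \<kappa> e (norm \<xi>)))"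
      by (intro tempered_rapidly_decreasing_integrable g cutoff_rapidly_decreasing e)
    show "F \<in> borel_measurable lborel" unfolding F_def by measurable
  qed (simp add: F_def norm_mult)
  obtain q :: "real \<Rightarrow> ennreal" where [measurable]: "q \<in> borel_measurable borel"
    and q: "\<And>(a :: real \<Rightarrow> real) m. a \<in> borel_measurable borel \<Longrightarrow> 0 < m \<Longrightarrow> integrable lborel (\<lambda>\<xi>. of_real (a (norm \<xi>)) * F \<xi>) \<Longrightarrow>
      (sq_integral (\<lambda>t. LINT \<xi>|lborel. of_real (a (norm \<xi>)) * F \<xi> * cis (t * norm \<xi> powr m)))
      = ennreal (2 * pi / m) * (\<integral>\<^sup>+r. indicator {0<..} r * ennreal ((a r)\<^sup>2 * r powr (1 - m)) * q r \<partial>lborel)"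
    using radial_plancherel[OF F] by blast
  define D where "D = (2 * pi) ^ DIM('a)"
  have D: "0 < D" by (simp add: D_def)
  define J where "J b = ennreal (2 * pi / D\<^sup>2) * (\<integral>\<^sup>+r. indicator {0<..} r * ennreal ((b r)\<^sup>2 * r powr (1 - m)) * q r \<partial>lborel)" for b :: "real \<Rightarrow> real"
  have main: "sq_integral (\<lambda>t. smoothed \<kappa> e b \<sigma> \<mu> g (t, x)) = ennreal (1 / \<mu>) * J b"
    if [measurable]: "b \<in> borel_measurable borel" and b: "\<And>r. \<bar>b r\<bar> \<le> 1" and \<mu>: "0 < \<mu>" "s - m / 2 = \<sigma> - \<mu> / 2"
      and tg: "tempered (\<lambda>\<xi>. of_real (norm \<xi> powr \<sigma>) * g \<xi>)" for b \<sigma> \<mu>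
  proof -
    \<comment> \<open>\<open>F\<close> already contains \<open>norm \<xi> powr s\<close>, so the other evolution differs by this multiplier.\<close>
    define a where "a r = b r * r powr (\<sigma> - s)" for r
    have [measurable]: "a \<in> borel_measurable borel" unfolding a_def by measurable
    have pw: "complex_of_real (norm \<xi> powr (\<sigma> - s)) * of_real (norm \<xi> powr s) = of_real (norm \<xi> powr \<sigma>)" for \<xi> :: 'a
      by (simp flip: of_real_mult powr_add)
    have aF: "of_real (a (norm \<xi>)) * F \<xi> * cis (t * norm \<xi> powr \<mu>)
       = of_real (b (norm \<xi>) * cutoff \<kappa> e (norm \<xi>)) * (symb \<sigma> \<mu> t \<xi> * g \<xi>) * cis (x \<bullet> \<xi>)" for t \<xi>
      unfolding a_def F_def symb_def pw[of \<xi>, symmetric] by (simp add: mult_ac)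
    have i0: "integrable lborel (\<lambda>\<xi>. of_real (b (norm \<xi>) * cutoff \<kappa> e (norm \<xi>)) * (symb \<sigma> \<mu> 0 \<xi> * g \<xi>))"
      by (rule smoothed_integrable[OF tg _ _ b e]) auto
    have int: "integrable lborel (\<lambda>\<xi>. of_real (a (norm \<xi>)) * F \<xi>)"
    proof (rule Bochner_Integration.integrable_bound[OF i0])
      show "(\<lambda>\<xi>. of_real (a (norm \<xi>)) * F \<xi>) \<in> borel_measurable lborel" unfolding F_def by measurable
      show "AE \<xi> in lborel. norm (of_real (a (norm \<xi>)) * F \<xi>) \<le> norm (of_real (b (norm \<xi>) * cutoff \<kappa> e (norm \<xi>)) * (symb \<sigma> \<mu> 0 \<xi> * g \<xi>))"
        using aF[of _ 0] by (auto intro!: AE_I2 simp: norm_mult)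
    qed
    have sm: "smoothed \<kappa> e b \<sigma> \<mu> g (t, x) = (LINT \<xi>|lborel. of_real (a (norm \<xi>)) * F \<xi> * cis (t * norm \<xi> powr \<mu>)) / of_real D" for t
      unfolding smoothed_def inverse_fourier_def aF D_def by simp
    have "sq_integral (\<lambda>t. smoothed \<kappa> e b \<sigma> \<mu> g (t, x))
      = (\<integral>\<^sup>+t. ennreal (1 / D\<^sup>2) * ennreal ((norm (LINT \<xi>|lborel. of_real (a (norm \<xi>)) * F \<xi> * cis (t * norm \<xi> powr \<mu>)))\<^sup>2) \<partial>lborel)"
      using D by (intro nn_integral_cong) (simp add: sm norm_divide power_divide ennreal_mult'[symmetric] ennreal_mult''[symmetric])
    also have "\<dots> = ennreal (1 / D\<^sup>2) * sq_integral (\<lambda>t. LINT \<xi>|lborel. of_real (a (norm \<xi>)) * F \<xi> * cis (t * norm \<xi> powr \<mu>))"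
      unfolding F_def by (intro nn_integral_cmult) measurable
    also have "\<dots> = ennreal (1 / D\<^sup>2) * (ennreal (2 * pi / \<mu>) * (\<integral>\<^sup>+r. indicator {0<..} r * ennreal ((a r)\<^sup>2 * r powr (1 - \<mu>)) * q r \<partial>lborel))"
      by (subst q[OF _ \<mu>(1) int]) auto
    also have "(\<integral>\<^sup>+r. indicator {0<..} r * ennreal ((a r)\<^sup>2 * r powr (1 - \<mu>)) * q r \<partial>lborel)
      = (\<integral>\<^sup>+r. indicator {0<..} r * ennreal ((b r)\<^sup>2 * r powr (1 - m)) * q r \<partial>lborel)"
    proof (intro nn_integral_cong)
      fix r :: real
      show "indicator {0<..} r * ennreal ((a r)\<^sup>2 * r powr (1 - \<mu>)) * q r = indicator {0<..} r * ennreal ((b r)\<^sup>2 * r powr (1 - m)) * q r"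
      proof (cases "0 < r")
        case True
        have "(a r)\<^sup>2 * r powr (1 - \<mu>) = (b r)\<^sup>2 * (r powr (2 * (\<sigma> - s)) * r powr (1 - \<mu>))"
          using True by (simp add: a_def power_mult_distrib powr_power mult_ac)
        also have "r powr (2 * (\<sigma> - s)) * r powr (1 - \<mu>) = r powr (2 * (\<sigma> - s) + (1 - \<mu>))"
          by (simp only: powr_add)
        \<comment> \<open>The exponents agree because \<open>s - m/2 = \<sigma> - \<mu>/2\<close>.\<close>
        also have "2 * (\<sigma> - s) + (1 - \<mu>) = 1 - m" using \<mu>(2) by (simp add: field_simps)
        finally show ?thesis by simp
      qed simp
    qed
    also have "ennreal (1 / D\<^sup>2) * (ennreal (2 * pi / \<mu>) * (\<integral>\<^sup>+r. indicator {0<..} r * ennreal ((b r)\<^sup>2 * r powr (1 - m)) * q r \<partial>lborel))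
      = ennreal (1 / \<mu>) * J b"
    proof -
      have "ennreal (1 / D\<^sup>2) * ennreal (2 * pi / \<mu>) = ennreal (1 / \<mu>) * ennreal (2 * pi / D\<^sup>2)"
        using D \<mu>(1) by (simp add: ennreal_mult[symmetric])
      then show ?thesis unfolding J_def by (simp only: mult.assoc[symmetric])
    qed
    finally show ?thesis .
  qed
  show ?thesis
  proof (rule that[of J])
    fix b c :: "real \<Rightarrow> real" assume [measurable]: "b \<in> borel_measurable borel" "c \<in> borel_measurable borel" and bc: "\<And>r. (b r)\<^sup>2 + (c r)\<^sup>2 \<le> 1"
    have "J b + J c = ennreal (2 * pi / D\<^sup>2) * (\<integral>\<^sup>+r. indicator {0<..} r * ennreal ((b r)\<^sup>2 * r powr (1 - m)) * q r + indicator {0<..} r * ennreal ((c r)\<^sup>2 * r powr (1 - m)) * q r \<partial>lborel)"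
      unfolding J_def distrib_left[symmetric] by (subst nn_integral_add) auto
    also have "\<dots> \<le> J (\<lambda>_. 1)"
      unfolding J_def
    proof (intro mult_left_mono nn_integral_mono)
      fix r :: real
      have "((b r)\<^sup>2 + (c r)\<^sup>2) * r powr (1 - m) \<le> 1 * r powr (1 - m)"
        by (intro mult_right_mono bc) simp
      then have "ennreal ((b r)\<^sup>2 * r powr (1 - m)) + ennreal ((c r)\<^sup>2 * r powr (1 - m)) \<le> ennreal (1\<^sup>2 * r powr (1 - m))"
        by (subst ennreal_plus[symmetric]) (auto intro!: ennreal_leI simp: distrib_right simp del: ennreal_plus)
      then show "indicator {0<..} r * ennreal ((b r)\<^sup>2 * r powr (1 - m)) * q r + indicator {0<..} r * ennreal ((c r)\<^sup>2 * r powr (1 - m)) * q r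
         \<le> indicator {0<..} r * ennreal (1\<^sup>2 * r powr (1 - m)) * q r"
        unfolding distrib_right[symmetric] distrib_left[symmetric] by (intro mult_right_mono mult_left_mono) auto
    qed simp
    finally show "J b + J c \<le> J (\<lambda>_. 1)" .
  qed (rule main; use m \<gamma> g in simp)+
qed

abbreviation regularized :: "real \<Rightarrow> real \<Rightarrow> real \<Rightarrow> real \<Rightarrow> ('a::euclidean_space \<Rightarrow> complex) \<Rightarrow> real \<times> 'a \<Rightarrow> complex" where
  "regularized \<kappa> e s m g \<equiv> smoothed \<kappa> e (\<lambda>_. 1) s m g"

text \<open>Relative to the weaker regularization \<open>e\<close>, the stronger one and the difference of the two are
  given by bounded radial multipliers, so \<open>radial_isometry\<close> with the cutoff \<open>e\<close> covers all of them.\<close>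

lemma
  fixes g :: "'a::euclidean_space \<Rightarrow> complex"
  assumes g: "tempered (\<lambda>\<xi>. of_real (norm \<xi> powr s) * g \<xi>)" and [measurable]: "g \<in> borel_measurable borel"
    and e: "0 < \<kappa>" "0 < e" "e \<le> d"
  shows regularized_eq_smoothed: "regularized \<kappa> d s m g p = smoothed \<kappa> e (cutoff \<kappa> (d - e)) s m g p"
    and regularized_diff_eq_smoothed: "regularized \<kappa> e s m g p - regularized \<kappa> d s m g p = smoothed \<kappa> e (\<lambda>r. 1 - cutoff \<kappa> (d - e) r) s m g p"
proof -
  have cd: "cutoff \<kappa> d r = cutoff \<kappa> (d - e) r * cutoff \<kappa> e r" for r
    using cutoff_add[of \<kappa> "d - e" e r] by simp
  show 1: "regularized \<kappa> d s m g p = smoothed \<kappa> e (cutoff \<kappa> (d - e)) s m g p"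
    unfolding smoothed_def by (simp add: cd)
  have b: "\<bar>cutoff \<kappa> (d - e) r\<bar> \<le> 1" for r
    using cutoff_le_1[of "d - e" \<kappa> r] e by simp
  have cisi: "integrable lborel (\<lambda>\<xi>. f \<xi> * cis (y \<bullet> \<xi>))" if "integrable lborel f" for f and y :: 'a
    by (rule Bochner_Integration.integrable_bound[OF that]) (use that in \<open>auto simp: norm_mult\<close>)
  have i1: "integrable lborel (\<lambda>\<xi>. of_real (1 * cutoff \<kappa> e (norm \<xi>)) * (symb s m (fst p) \<xi> * g \<xi>))"
    using smoothed_integrable[OF g _ _ _ e(1,2), of "\<lambda>_. 1"] by simp
  have i2: "integrable lborel (\<lambda>\<xi>. of_real (cutoff \<kappa> (d - e) (norm \<xi>) * cutoff \<kappa> e (norm \<xi>)) * (symb s m (fst p) \<xi> * g \<xi>))"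
    by (rule smoothed_integrable[OF g _ _ b e(1,2)]) auto
  show "regularized \<kappa> e s m g p - regularized \<kappa> d s m g p = smoothed \<kappa> e (\<lambda>r. 1 - cutoff \<kappa> (d - e) r) s m g p"
    unfolding 1 unfolding smoothed_def inverse_fourier_def diff_divide_distrib[symmetric]
    unfolding Bochner_Integration.integral_diff[OF cisi[OF i1] cisi[OF i2], symmetric]
    by (simp add: algebra_simps)
qed

context
  fixes m m' s s' \<gamma> \<kappa> :: real and g :: "'a::euclidean_space \<Rightarrow> complex"
  assumes m: "0 < m" "0 < m'" and \<gamma>: "s - m / 2 = s' - m' / 2" and \<kappa>: "0 < \<kappa>"
    and g: "tempered (\<lambda>\<xi>. of_real (norm \<xi> powr s) * g \<xi>)" "tempered (\<lambda>\<xi>. of_real (norm \<xi> powr s') * g \<xi>)"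
    and g_meas [measurable]: "g \<in> borel_measurable borel"
begin

private lemma ratio: "ennreal (m / m') * (W * (ennreal (1 / m) * J)) = W * (ennreal (1 / m') * J)"
proof -
  have "ennreal (m / m') * (W * (ennreal (1 / m) * J)) = W * ((ennreal (m / m') * ennreal (1 / m)) * J)"
    by (simp only: mult_ac)
  also have "ennreal (m / m') * ennreal (1 / m) = ennreal (1 / m')"
    using m by (simp add: ennreal_mult[symmetric])
  finally show ?thesis .
qed

lemma regularized_energy:
  assumes e: "0 < e" and [measurable]: "w \<in> borel_measurable borel"
  shows "energy w (regularized \<kappa> e s' m' g) = ennreal (m / m') * energy w (regularized \<kappa> e s m g)"
proof -
  have "ennreal ((w x)\<^sup>2) * sq_integral (\<lambda>t. regularized \<kappa> e s' m' g (t, x))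
    = ennreal (m / m') * (ennreal ((w x)\<^sup>2) * sq_integral (\<lambda>t. regularized \<kappa> e s m g (t, x)))" for x
  proof (rule radial_isometry[OF m \<gamma> g g_meas \<kappa> e, of x])
    fix J :: "(real \<Rightarrow> real) \<Rightarrow> ennreal"
    assume J: "\<And>b. b \<in> borel_measurable borel \<Longrightarrow> (\<And>r. \<bar>b r\<bar> \<le> 1) \<Longrightarrow>
      (sq_integral (\<lambda>t. smoothed \<kappa> e b s m g (t, x))) = ennreal (1 / m) * J b"
    "\<And>b. b \<in> borel_measurable borel \<Longrightarrow> (\<And>r. \<bar>b r\<bar> \<le> 1) \<Longrightarrow>
      (sq_integral (\<lambda>t. smoothed \<kappa> e b s' m' g (t, x))) = ennreal (1 / m') * J b"
    show ?thesis
      using J(1)[of "\<lambda>_. 1"] J(2)[of "\<lambda>_. 1"] by (simp add: ratio)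
  qed
  then show ?thesis
    by (subst (1 2) energy_iterated_time) (auto simp: nn_integral_cmult)
qed

lemma regularized_diff_energy:
  assumes e: "0 < e" "e \<le> d" and [measurable]: "w \<in> borel_measurable borel"
  shows "energy w (\<lambda>p. regularized \<kappa> e s' m' g p - regularized \<kappa> d s' m' g p)
      = ennreal (m / m') * energy w (\<lambda>p. regularized \<kappa> e s m g p - regularized \<kappa> d s m g p)"
proof -
  define b where "b r = 1 - cutoff \<kappa> (d - e) r" for r
  have [measurable]: "b \<in> borel_measurable borel" unfolding b_def by measurable
  have b: "\<bar>b r\<bar> \<le> 1" for r using cutoff_le_1[of "d - e" \<kappa> r] e by (simp add: b_def)
  have "ennreal ((w x)\<^sup>2) * sq_integral (\<lambda>t. smoothed \<kappa> e b s' m' g (t, x))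
    = ennreal (m / m') * (ennreal ((w x)\<^sup>2) * sq_integral (\<lambda>t. smoothed \<kappa> e b s m g (t, x)))" for x
  proof (rule radial_isometry[OF m \<gamma> g g_meas \<kappa> e(1), of x])
    fix J :: "(real \<Rightarrow> real) \<Rightarrow> ennreal"
    assume J: "\<And>b. b \<in> borel_measurable borel \<Longrightarrow> (\<And>r. \<bar>b r\<bar> \<le> 1) \<Longrightarrow>
      (sq_integral (\<lambda>t. smoothed \<kappa> e b s m g (t, x))) = ennreal (1 / m) * J b"
    "\<And>b. b \<in> borel_measurable borel \<Longrightarrow> (\<And>r. \<bar>b r\<bar> \<le> 1) \<Longrightarrow>
      (sq_integral (\<lambda>t. smoothed \<kappa> e b s' m' g (t, x))) = ennreal (1 / m') * J b"
    show ?thesis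
      using J(1)[of b] J(2)[of b] b by (simp add: ratio)
  qed
  then have "energy w (smoothed \<kappa> e b s' m' g) = ennreal (m / m') * energy w (smoothed \<kappa> e b s m g)"
    by (subst (1 2) energy_iterated_time) (auto simp: nn_integral_cmult)
  then show ?thesis
    using regularized_diff_eq_smoothed[OF g(1) g_meas \<kappa> e, of m] regularized_diff_eq_smoothed[OF g(2) g_meas \<kappa> e, of m']
    unfolding b_def by simp
qed

text \<open>The multipliers \<open>c\<close> of the stronger regularization and \<open>1 - c\<close> of the difference satisfy
  \<open>(1 - c)\<^sup>2 + c\<^sup>2 \<le> 1\<close>. Together with a bound on the energies this makes the regularizations a
  Cauchy family as \<open>e \<rightarrow> 0\<close>.\<close>

lemma regularized_energy_superadditive:
  assumes e: "0 < e" "e \<le> d" and [measurable]: "w \<in> borel_measurable borel"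
  shows "energy w (\<lambda>p. regularized \<kappa> e s m g p - regularized \<kappa> d s m g p) + energy w (regularized \<kappa> d s m g)
    \<le> energy w (regularized \<kappa> e s m g)"
proof -
  define c where "c = cutoff \<kappa> (d - e)"
  define b where "b r = 1 - c r" for r
  have [measurable]: "b \<in> borel_measurable borel" "c \<in> borel_measurable borel" unfolding b_def c_def by measurable
  have c: "0 \<le> c r" "c r \<le> 1" for r using cutoff_le_1[of "d - e" \<kappa> r] e by (simp_all add: c_def)
  have b: "\<bar>b r\<bar> \<le> 1" for r using c[of r] by (simp add: b_def)
  have bc: "(b r)\<^sup>2 + (c r)\<^sup>2 \<le> 1" for r
  proof -
    have "(b r)\<^sup>2 + (c r)\<^sup>2 = 1 - 2 * (c r * (1 - c r))" by (simp add: b_def power2_eq_square algebra_simps)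
    moreover have "0 \<le> c r * (1 - c r)" using c[of r] by (intro mult_nonneg_nonneg) auto
    ultimately show ?thesis by linarith
  qed
  have "ennreal ((w x)\<^sup>2) * sq_integral (\<lambda>t. smoothed \<kappa> e b s m g (t, x))
      + ennreal ((w x)\<^sup>2) * sq_integral (\<lambda>t. smoothed \<kappa> e c s m g (t, x))
    \<le> ennreal ((w x)\<^sup>2) * sq_integral (\<lambda>t. regularized \<kappa> e s m g (t, x))" for x
  proof (rule radial_isometry[OF m \<gamma> g g_meas \<kappa> e(1), of x])
    fix J :: "(real \<Rightarrow> real) \<Rightarrow> ennreal"
    assume J: "\<And>b. b \<in> borel_measurable borel \<Longrightarrow> (\<And>r. \<bar>b r\<bar> \<le> 1) \<Longrightarrow>
      (sq_integral (\<lambda>t. smoothed \<kappa> e b s m g (t, x))) = ennreal (1 / m) * J b"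
      and J2: "\<And>b c. b \<in> borel_measurable borel \<Longrightarrow> c \<in> borel_measurable borel \<Longrightarrow> (\<And>r. (b r)\<^sup>2 + (c r)\<^sup>2 \<le> 1) \<Longrightarrow> J b + J c \<le> J (\<lambda>_. 1)"
    have "ennreal ((w x)\<^sup>2) * (ennreal (1 / m) * (J b + J c)) \<le> ennreal ((w x)\<^sup>2) * (ennreal (1 / m) * J (\<lambda>_. 1))"
      by (intro mult_left_mono J2 bc) auto
    then show ?thesis
      using J[of b] J[of c] J[of "\<lambda>_. 1"] b c by (simp add: distrib_left)
  qed
  then have "energy w (smoothed \<kappa> e b s m g) + energy w (smoothed \<kappa> e c s m g) \<le> energy w (regularized \<kappa> e s m g)"
    by (subst (1 2 3) energy_iterated_time, simp_all, subst nn_integral_add[symmetric]) (auto intro!: nn_integral_mono)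
  moreover have "regularized \<kappa> d s m g = smoothed \<kappa> e c s m g"
    unfolding c_def by (rule ext) (rule regularized_eq_smoothed[OF g(1) g_meas \<kappa> e])
  moreover have "(\<lambda>p. regularized \<kappa> e s m g p - regularized \<kappa> d s m g p) = smoothed \<kappa> e b s m g"
    unfolding b_def c_def by (rule ext) (rule regularized_diff_eq_smoothed[OF g(1) g_meas \<kappa> e])
  ultimately show ?thesis by simp
qed

end

section \<open>Weighted spaces and mollification in time\<close>

text \<open>Jensen's inequality for the probability density \<open>heat_kernel e\<close>, from the positivity of the
  variance.\<close>

lemma mollify_jensen:
  fixes f :: "'a::euclidean_space \<Rightarrow> complex"
  assumes [measurable]: "f \<in> borel_measurable borel" and e: "0 < e"
  shows "ennreal ((norm (mollify e f t))\<^sup>2) \<le> (\<integral>\<^sup>+y. ennreal (heat_kernel e (y - t) * (norm (f y))\<^sup>2) \<partial>lborel)"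
    (is "_ \<le> ?R")
proof (cases "?R = \<infinity>")
  case False
  define K where "K y = heat_kernel e (y - t)" for y
  have [measurable]: "K \<in> borel_measurable borel" unfolding K_def by measurable
  have K0: "0 \<le> K y" for y using e by (simp add: K_def)
  have K: "integrable lborel K"
    unfolding K_def[abs_def] using lborel_integrable_translate[of "heat_kernel e :: 'a \<Rightarrow> real" "- t"] heat_kernel_integrable[OF e, where 'a='a] by simp
  have K1: "(LINT y|lborel. K y) = 1"
    unfolding K_def using lborel_integral_translate[of "heat_kernel e :: 'a \<Rightarrow> real" "- t"] heat_kernel_integral[OF e, where 'a='a] by simp
  have A: "integrable lborel (\<lambda>y. K y * (norm (f y))\<^sup>2)"
    using False K0 by (intro integrableI_nonneg) (auto simp: K_def less_top)
  have B: "integrable lborel (\<lambda>y. K y * norm (f y))"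
  proof (rule Bochner_Integration.integrable_bound)
    show "integrable lborel (\<lambda>y. K y + K y * (norm (f y))\<^sup>2)" by (intro Bochner_Integration.integrable_add K A)
    show "AE y in lborel. norm (K y * norm (f y)) \<le> norm (K y + K y * (norm (f y))\<^sup>2)"
    proof (intro AE_I2)
      fix y
      have "norm (f y) \<le> 1 + (norm (f y))\<^sup>2"
        using sum_squares_bound[of "norm (f y)" 1] norm_ge_zero[of "f y"] unfolding one_power2 mult_1_right by linarith
      then have "K y * norm (f y) \<le> K y * (1 + (norm (f y))\<^sup>2)" by (intro mult_left_mono K0)
      then show "norm (K y * norm (f y)) \<le> norm (K y + K y * (norm (f y))\<^sup>2)"
        using K0[of y] by (simp add: distrib_left)
    qed
  qed measurable
  define c where "c = (LINT y|lborel. K y * norm (f y))"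
  have c0: "0 \<le> c" unfolding c_def using K0 by (intro Bochner_Integration.integral_nonneg) auto
  have "0 \<le> (LINT y|lborel. K y * (norm (f y) - c)\<^sup>2)"
    using K0 by (intro Bochner_Integration.integral_nonneg) auto
  also have "\<dots> = (LINT y|lborel. K y * (norm (f y))\<^sup>2 - 2 * c * (K y * norm (f y)) + c\<^sup>2 * K y)"
    by (simp add: power2_eq_square algebra_simps)
  also have "\<dots> = (LINT y|lborel. K y * (norm (f y))\<^sup>2) - 2 * c * c + c\<^sup>2 * 1"
    using A B K by (simp add: K1 c_def)
  finally have "c\<^sup>2 \<le> (LINT y|lborel. K y * (norm (f y))\<^sup>2)" by (simp add: power2_eq_square)
  moreover have "norm (mollify e f t) \<le> c"
  proof -
    have "norm (mollify e f t) \<le> (LINT y|lborel. norm (f y * of_real (heat_kernel e (y - t))))"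
      unfolding mollify_def by (rule integral_norm_bound)
    then show ?thesis using e by (simp add: c_def K_def norm_mult mult.commute)
  qed
  ultimately have "(norm (mollify e f t))\<^sup>2 \<le> (LINT y|lborel. K y * (norm (f y))\<^sup>2)"
    using power_mono[of "norm (mollify e f t)" c 2] by simp
  then have "ennreal ((norm (mollify e f t))\<^sup>2) \<le> ennreal (LINT y|lborel. K y * (norm (f y))\<^sup>2)" by (rule ennreal_leI)
  also have "\<dots> = ?R"
    using A K0 by (subst nn_integral_eq_integral[symmetric]) (auto simp: K_def)
  finally show ?thesis .
qed simp

lemma mollify_L2_contraction:
  fixes f :: "'a::euclidean_space \<Rightarrow> complex"
  assumes [measurable]: "f \<in> borel_measurable borel" and e: "0 < e"
  shows "sq_integral (\<lambda>t. mollify e f t) \<le> sq_integral f"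
proof -
  have "sq_integral (\<lambda>t. mollify e f t) \<le> (\<integral>\<^sup>+t. \<integral>\<^sup>+y. ennreal (heat_kernel e (y - t) * (norm (f y))\<^sup>2) \<partial>lborel \<partial>lborel)"
    by (intro nn_integral_mono mollify_jensen e) measurable
  also have "\<dots> = (\<integral>\<^sup>+y. \<integral>\<^sup>+t. ennreal (heat_kernel e (y - t) * (norm (f y))\<^sup>2) \<partial>lborel \<partial>lborel)"
    by (rule lborel_pair.Fubini'[symmetric]) measurable
  also have "\<dots> = (\<integral>\<^sup>+y. \<integral>\<^sup>+t. ennreal (heat_kernel e (y - t)) * ennreal ((norm (f y))\<^sup>2) \<partial>lborel \<partial>lborel)"
    using e by (simp add: ennreal_mult)
  also have "\<dots> = sq_integral f"
    using e by (subst nn_integral_multc) (auto simp: heat_kernel_nn_integral_shift)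
  finally show ?thesis .
qed

lemma weighted_AM_GM:
  fixes a b :: complex
  assumes "(x::'a::euclidean_space) \<noteq> 0" "0 < c"
  shows "norm a * norm b \<le> c * (norm x powr \<gamma> * norm a)\<^sup>2 + 1 / c * (norm x powr - \<gamma> * norm b)\<^sup>2"
proof -
  define A B where "A = norm x powr \<gamma> * norm a" and "B = norm x powr - \<gamma> * norm b"
  have "norm x powr \<gamma> * norm x powr - \<gamma> = 1"
    using assms(1) by (simp flip: powr_add)
  then have AB: "norm a * norm b = A * B" by (simp add: A_def B_def mult_ac)
  have "0 \<le> (sqrt c * A - B / sqrt c)\<^sup>2" by simp
  also have "\<dots> = c * A\<^sup>2 - 2 * (A * B) + 1 / c * B\<^sup>2"
    using assms(2) by (simp add: power2_diff power_mult_distrib power_divide)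
  finally have "2 * (A * B) \<le> c * A\<^sup>2 + 1 / c * B\<^sup>2" by simp
  moreover have "0 \<le> A * B" unfolding A_def B_def by simp
  ultimately show ?thesis unfolding AB A_def[symmetric] B_def[symmetric] by linarith
qed

text \<open>The weight with exponent \<open>- \<gamma> \<ge> 0\<close> grows polynomially, and \<open>G\<close> decays fast enough to absorb
  it. The corresponding weight with negative exponent could fail to be integrable at the origin,
  which is why \<open>\<gamma> \<le> 0\<close> is assumed.\<close>

lemma dual_weight_finite:
  fixes G :: "'a::euclidean_space \<Rightarrow> complex"
  assumes \<gamma>: "\<gamma> \<le> 0" and M: "- \<gamma> \<le> real M" and [measurable]: "G \<in> borel_measurable borel"
    and C: "\<And>x. norm (G x) \<le> C / bsq x ^ (M + DIM('a))"
  shows "weighted_sq_integral (- \<gamma>) G < \<infinity>"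
proof -
  have C0: "0 \<le> C"
    using order_trans[OF norm_ge_zero C[of 0]] by simp
  have "(norm x powr - \<gamma> * norm (G x))\<^sup>2 \<le> C\<^sup>2 * (1 / bsq x ^ DIM('a))" for x :: 'a
  proof -
    have "norm x powr - \<gamma> \<le> bsq x powr - \<gamma>"
    proof (rule powr_mono2)
      show "norm x \<le> bsq x"
        using sum_squares_bound[of "norm x" 1] norm_ge_zero[of x] unfolding one_power2 mult_1_right by linarith
    qed (use \<gamma> in auto)
    also have "\<dots> \<le> bsq x powr real M" using M by (intro powr_mono) auto
    also have "\<dots> = bsq x ^ M" by (simp add: powr_realpow)
    finally have "norm x powr - \<gamma> * norm (G x) \<le> bsq x ^ M * (C / bsq x ^ (M + DIM('a)))"
      using C[of x] by (intro mult_mono) auto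
    also have "\<dots> = C / bsq x ^ DIM('a)" by (simp add: power_add)
    finally have "(norm x powr - \<gamma> * norm (G x))\<^sup>2 \<le> (C / bsq x ^ DIM('a))\<^sup>2" by (intro power_mono) auto
    also have "\<dots> \<le> C\<^sup>2 * (1 / bsq x ^ DIM('a))"
    proof -
      have "1 / (bsq x ^ DIM('a))\<^sup>2 \<le> 1 / bsq x ^ DIM('a)"
      proof -
        have "1 / z\<^sup>2 \<le> 1 / z" if "1 \<le> z" for z :: real
          using that by (simp add: field_simps power2_eq_square)
        from this[OF bsq_power_ge_1] show ?thesis .
      qed
      then have "C\<^sup>2 * (1 / (bsq x ^ DIM('a))\<^sup>2) \<le> C\<^sup>2 * (1 / bsq x ^ DIM('a))" by (intro mult_left_mono) auto
      then show ?thesis by (simp add: power_divide)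
    qed
    finally show ?thesis .
  qed
  then have "weighted_sq_integral (- \<gamma>) G \<le> (\<integral>\<^sup>+(x::'a). ennreal (C\<^sup>2 * (1 / bsq x ^ DIM('a))) \<partial>lborel)"
    by (intro nn_integral_mono ennreal_leI)
  also have "\<dots> < \<infinity>"
  proof -
    have "integrable lborel (\<lambda>x::'a. C\<^sup>2 * (1 / bsq x ^ DIM('a)))"
      by (intro integrable_mult_right weight_integrable) simp
    then show ?thesis by (subst nn_integral_eq_integral) auto
  qed
  finally show ?thesis .
qed

text \<open>The free parameter \<open>c\<close> balances the two terms when the norm of \<open>f\<close> is small and that of \<open>G\<close> merely finite.\<close>

lemma weighted_L2_pairing:
  fixes f G :: "'a::euclidean_space \<Rightarrow> complex"
  assumes [measurable]: "f \<in> borel_measurable borel" "G \<in> borel_measurable borel" and c: "0 < c"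
  shows "(\<integral>\<^sup>+x. ennreal (norm (f x * G x)) \<partial>lborel)
    \<le> ennreal c * weighted_sq_integral \<gamma> f
      + ennreal (1 / c) * weighted_sq_integral (- \<gamma>) G"
proof -
  have "(\<integral>\<^sup>+x. ennreal (norm (f x * G x)) \<partial>lborel)
    \<le> (\<integral>\<^sup>+x. ennreal c * ennreal ((norm x powr \<gamma> * norm (f x))\<^sup>2) + ennreal (1 / c) * ennreal ((norm x powr - \<gamma> * norm (G x))\<^sup>2) \<partial>lborel)"
  proof (rule nn_integral_mono_AE)
    show "AE x in lborel. ennreal (norm (f x * G x)) \<le> ennreal c * ennreal ((norm x powr \<gamma> * norm (f x))\<^sup>2) + ennreal (1 / c) * ennreal ((norm x powr - \<gamma> * norm (G x))\<^sup>2)"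
      using AE_lborel_nonzero
    proof eventually_elim
      case (elim x)
      have "ennreal (norm (f x * G x)) \<le> ennreal (c * (norm x powr \<gamma> * norm (f x))\<^sup>2 + 1 / c * (norm x powr - \<gamma> * norm (G x))\<^sup>2)"
        unfolding norm_mult by (intro ennreal_leI weighted_AM_GM elim c)
      also have "\<dots> = ennreal (c * (norm x powr \<gamma> * norm (f x))\<^sup>2) + ennreal (1 / c * (norm x powr - \<gamma> * norm (G x))\<^sup>2)"
        using c by (intro ennreal_plus) auto
      also have "ennreal (c * (norm x powr \<gamma> * norm (f x))\<^sup>2) = ennreal c * ennreal ((norm x powr \<gamma> * norm (f x))\<^sup>2)"
        using c by (intro ennreal_mult) auto
      also have "ennreal (1 / c * (norm x powr - \<gamma> * norm (G x))\<^sup>2) = ennreal (1 / c) * ennreal ((norm x powr - \<gamma> * norm (G x))\<^sup>2)"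
        using c by (intro ennreal_mult) auto
      finally show ?case .
    qed
  qed
  also have "\<dots> = ennreal c * weighted_sq_integral \<gamma> f
      + ennreal (1 / c) * weighted_sq_integral (- \<gamma>) G"
    by (subst nn_integral_add) (auto simp: nn_integral_cmult)
  finally show ?thesis .
qed

lemma weighted_L2_tempered:
  fixes f :: "'a::euclidean_space \<Rightarrow> complex"
  assumes [measurable]: "f \<in> borel_measurable borel" and \<gamma>: "\<gamma> \<le> 0"
    and fin: "weighted_sq_integral \<gamma> f < \<infinity>"
  shows "tempered f"
proof -
  obtain M :: nat where M: "- \<gamma> \<le> real M" using real_arch_simple by blast
  define G where "G x = complex_of_real (1 / bsq x ^ (M + DIM('a)))" for x :: 'a
  have [measurable]: "G \<in> borel_measurable borel" unfolding G_def by measurable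
  have G: "norm (G x) \<le> 1 / bsq x ^ (M + DIM('a))" for x :: 'a
    unfolding G_def by (simp only: norm_of_real) (simp add: abs_of_pos)
  have "(\<integral>\<^sup>+x. ennreal (norm (f x * G x)) \<partial>lborel) < \<infinity>"
    using weighted_L2_pairing[of f G 1 \<gamma>] fin dual_weight_finite[OF \<gamma> M _ G] by (auto simp: less_top elim!: le_less_trans)
  then have "integrable lborel (\<lambda>x. f x * G x)" by (intro integrableI_bounded) auto
  moreover have "f x * G x = f x /\<^sub>R bsq x ^ (M + DIM('a))" for x
    by (simp add: G_def scaleR_conv_of_real divide_inverse mult.commute)
  ultimately show ?thesis by (auto simp: tempered_def)
qed

lemma heat_kernel_le_center:
  fixes z :: "'a::euclidean_space"
  assumes "0 < e"
  shows "heat_kernel e z \<le> heat_kernel e (0::'a)"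
  using assms unfolding heat_kernel_def by (intro mult_left_mono) auto

lemma heat_kernel_time_fourier:
  fixes t \<tau> :: real
  assumes "0 < e"
  shows "(LINT t'|lborel. cis (t' * \<tau>) * complex_of_real (heat_kernel e (t' - t))) = cis (t * \<tau>) * of_real (exp (- e * \<tau>\<^sup>2 / 2))"
  using fourier_integral_heat_kernel[OF assms, of t "- \<tau>"] by (simp add: fourier_integral_def mult.commute)

text \<open>Averaging \<open>cis (t' * norm \<xi> powr m)\<close> over \<open>t'\<close> against the Gaussian of variance \<open>e\<close> centred at
  \<open>t\<close> multiplies it by \<open>exp(- e (norm \<xi> powr m)\<^sup>2 / 2)\<close>, which is the cutoff of exponent \<open>2 m\<close>. Finite
  energy makes the average in \<open>x\<close>-space a tempered function and justifies exchanging it with the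
  pairing against Gaussians.\<close>

lemma time_mollified_evolution:
  fixes \<phi> g :: "'a::euclidean_space \<Rightarrow> complex"
  assumes u: "is_evolution s m \<phi> u" and g: "has_fourier \<phi> g" and tg: "tempered (\<lambda>\<xi>. of_real (norm \<xi> powr s) * g \<xi>)"
    and m: "0 < m" and \<gamma>: "\<gamma> \<le> 0" and fin: "energy (abs_weight \<gamma>) u < \<infinity>" and e: "0 < e"
  shows "AE x in lborel. mollify e (\<lambda>t'. u (t', x)) t = regularized (2 * m) e s m g (t, x)"
proof -
  have [measurable]: "u \<in> borel_measurable borel" by (rule is_evolution_measurable[OF u])
  have u_pair [measurable]: "u \<in> borel_measurable (borel \<Otimes>\<^sub>M borel)" by (simp add: borel_prod)
  have [measurable]: "g \<in> borel_measurable borel" using g by (auto simp: has_fourier_def tempered_def)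
  define w where "w x = mollify e (\<lambda>t'. u (t', x)) t" for x
  have [measurable]: "w \<in> borel_measurable borel" unfolding w_def mollify_def by measurable
  define H where "H \<xi> = of_real (1 * cutoff (2 * m) e (norm \<xi>)) * (symb s m t \<xi> * g \<xi>)" for \<xi>
  have H: "integrable lborel H"
    unfolding H_def by (rule smoothed_integrable[OF tg]) (use m e in auto)
  define K0 where "K0 = heat_kernel e (0::real)"
  have K0: "0 \<le> K0" using e by (simp add: K0_def)
  have wfin: "weighted_sq_integral \<gamma> w < \<infinity>"
  proof -
    have "weighted_sq_integral \<gamma> w \<le> (\<integral>\<^sup>+x. ennreal K0 * (\<integral>\<^sup>+t'. ennreal ((abs_weight \<gamma> x * norm (u (t', x)))\<^sup>2) \<partial>lborel) \<partial>lborel)"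
    proof (intro nn_integral_mono)
      fix x :: 'a
      have "ennreal ((norm x powr \<gamma> * norm (w x))\<^sup>2) = ennreal ((abs_weight \<gamma> x)\<^sup>2) * ennreal ((norm (w x))\<^sup>2)"
        by (simp add: abs_weight_def power_mult_distrib ennreal_mult)
      also have "\<dots> \<le> ennreal ((abs_weight \<gamma> x)\<^sup>2) * (\<integral>\<^sup>+t'. ennreal (heat_kernel e (t' - t) * (norm (u (t', x)))\<^sup>2) \<partial>lborel)"
        unfolding w_def by (intro mult_left_mono mollify_jensen e) auto
      also have "\<dots> \<le> ennreal ((abs_weight \<gamma> x)\<^sup>2) * (\<integral>\<^sup>+t'. ennreal K0 * ennreal ((norm (u (t', x)))\<^sup>2) \<partial>lborel)"
      proof (intro mult_left_mono nn_integral_mono)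
        fix t'
        have "heat_kernel e (t' - t) * (norm (u (t', x)))\<^sup>2 \<le> K0 * (norm (u (t', x)))\<^sup>2"
          unfolding K0_def by (intro mult_right_mono heat_kernel_le_center e) auto
        then show "ennreal (heat_kernel e (t' - t) * (norm (u (t', x)))\<^sup>2) \<le> ennreal K0 * ennreal ((norm (u (t', x)))\<^sup>2)"
          using K0 by (subst ennreal_mult[symmetric]) (auto intro: ennreal_leI)
      qed auto
      also have "\<dots> = ennreal K0 * (\<integral>\<^sup>+t'. ennreal ((abs_weight \<gamma> x)\<^sup>2) * ennreal ((norm (u (t', x)))\<^sup>2) \<partial>lborel)"
        by (simp add: nn_integral_cmult mult_ac)
      finally show "ennreal ((norm x powr \<gamma> * norm (w x))\<^sup>2) \<le> ennreal K0 * (\<integral>\<^sup>+t'. ennreal ((abs_weight \<gamma> x * norm (u (t', x)))\<^sup>2) \<partial>lborel)"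
        by (simp add: power_mult_distrib ennreal_mult)
    qed
    also have "\<dots> = ennreal K0 * energy (abs_weight \<gamma>) u"
      by (subst energy_iterated') (auto intro!: nn_integral_cmult)
    also have "\<dots> < \<infinity>" using fin by (simp add: ennreal_mult_less_top)
    finally show ?thesis .
  qed
  have "has_fourier w H"
  proof (rule has_fourierI)
    show "tempered w" by (rule weighted_L2_tempered[OF _ \<gamma> wfin]) simp
    show "tempered H" by (rule integrable_tempered[OF H])
    fix \<delta> :: real and y :: 'a assume \<delta>: "0 < \<delta>"
    define G where "G x = cis (- (x \<bullet> y)) * gaussian \<delta> x" for x
    have G: "rapidly_decreasing G" unfolding G_def[abs_def] by (rule cis_gaussian_rapidly_decreasing[OF \<delta>])
    have [measurable]: "G \<in> borel_measurable borel" using G by (simp add: rapidly_decreasing_def)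
    obtain M :: nat where M: "- \<gamma> \<le> real M" using real_arch_simple by blast
    obtain C where C: "0 < C" "\<And>x. norm (G x) \<le> C / bsq x ^ (M + DIM('a))" using rapidly_decreasing_bound[OF G] by blast
    define IG where "IG = weighted_sq_integral (- \<gamma>) G"
    have IG: "IG < \<infinity>" unfolding IG_def by (rule dual_weight_finite[OF \<gamma> M _ C(2)]) simp
    define Q where "Q t' x = u (t', x) * (complex_of_real (heat_kernel e (t' - t)) * G x)" for t' x
    have Q_meas [measurable]: "case_prod Q \<in> borel_measurable (lborel \<Otimes>\<^sub>M lborel)" unfolding Q_def by measurable
    \<comment> \<open>Split \<open>u\<close> from the rest by the AM-GM inequality; one factor of the time kernel is bounded by its
    maximum \<open>K0\<close>.\<close>
    have intQ: "integrable (lborel \<Otimes>\<^sub>M lborel) (case_prod Q)"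
    proof (rule integrableI_bounded)
      have "(\<integral>\<^sup>+p. ennreal (norm (case_prod Q p)) \<partial>(lborel \<Otimes>\<^sub>M lborel)) = (\<integral>\<^sup>+t'. \<integral>\<^sup>+x. ennreal (norm (u (t', x) * (complex_of_real (heat_kernel e (t' - t)) * G x))) \<partial>lborel \<partial>lborel)"
        by (subst lborel.nn_integral_fst[symmetric]) (auto simp: Q_def)
      also have "\<dots> \<le> (\<integral>\<^sup>+t'. (weighted_sq_integral \<gamma> (\<lambda>x. u (t', x))) + ennreal (heat_kernel e (t' - t)) * (ennreal K0 * IG) \<partial>lborel)"
      proof (intro nn_integral_mono)
        fix t' :: real
        have "(\<integral>\<^sup>+x. ennreal (norm (u (t', x) * (complex_of_real (heat_kernel e (t' - t)) * G x))) \<partial>lborel)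
          \<le> ennreal 1 * weighted_sq_integral \<gamma> (\<lambda>x. u (t', x))
            + ennreal (1 / 1) * weighted_sq_integral (- \<gamma>) (\<lambda>x. complex_of_real (heat_kernel e (t' - t)) * G x)"
          by (rule weighted_L2_pairing) auto
        also have "weighted_sq_integral (- \<gamma>) (\<lambda>x. complex_of_real (heat_kernel e (t' - t)) * G x)
            = ennreal ((heat_kernel e (t' - t))\<^sup>2) * IG"
          unfolding IG_def by (subst nn_integral_cmult[symmetric])
            (auto simp: norm_mult power_mult_distrib ennreal_mult'[symmetric] mult_ac intro!: nn_integral_cong)
        also have "ennreal ((heat_kernel e (t' - t))\<^sup>2) \<le> ennreal (heat_kernel e (t' - t)) * ennreal K0"
          using heat_kernel_le_center[OF e, of "t' - t"] K0 e
          by (subst ennreal_mult[symmetric]) (auto simp: power2_eq_square K0_def intro!: ennreal_leI mult_left_mono)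
        finally show "(\<integral>\<^sup>+x. ennreal (norm (u (t', x) * (complex_of_real (heat_kernel e (t' - t)) * G x))) \<partial>lborel)
          \<le> weighted_sq_integral \<gamma> (\<lambda>x. u (t', x)) + ennreal (heat_kernel e (t' - t)) * (ennreal K0 * IG)"
          by (simp add: add_left_mono mult_right_mono mult.assoc)
      qed
      also have "\<dots> = energy (abs_weight \<gamma>) u + ennreal K0 * IG"
        using e by (subst nn_integral_add) (auto simp: energy_iterated abs_weight_def nn_integral_multc heat_kernel_nn_integral_shift)
      also have "\<dots> < \<infinity>" using fin IG by (simp add: ennreal_mult_less_top)
      finally show "(\<integral>\<^sup>+p. ennreal (norm (case_prod Q p)) \<partial>(lborel \<Otimes>\<^sub>M lborel)) < \<infinity>" .
    qed measurable
    define h where "h \<xi> = of_real (norm \<xi> powr s) * g \<xi> * of_real (heat_kernel \<delta> (\<xi> - y))" for \<xi>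
    have h: "integrable lborel h" unfolding h_def by (rule mollify_integrable[OF tg \<delta>])
    have [measurable]: "h \<in> borel_measurable borel" using h by auto
    define k where "k t' = complex_of_real (heat_kernel e (t' - t))" for t'
    have k: "integrable lborel k"
      unfolding k_def[abs_def] using lborel_integrable_translate[of "heat_kernel e :: real \<Rightarrow> real" "- t"] heat_kernel_integrable[OF e, where 'a=real]
      by (intro integrable_of_real) simp
    have [measurable]: "k \<in> borel_measurable borel" unfolding k_def by measurable
    define P where "P t' \<xi> = k t' * h \<xi> * cis (t' * norm \<xi> powr m)" for t' \<xi>
    have intP: "integrable (lborel \<Otimes>\<^sub>M lborel) (case_prod P)"
    proof (rule Bochner_Integration.integrable_bound[OF lborel_pair.integrable_pair_mult(1)[OF k h]])
      show "case_prod P \<in> borel_measurable (lborel \<Otimes>\<^sub>M lborel)" unfolding P_def by measurable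
    qed (auto simp: P_def norm_mult)
    have "(LINT x|lborel. w x * G x) = (LINT x|lborel. LINT t'|lborel. Q t' x)"
      unfolding w_def mollify_def Q_def by (simp add: mult.assoc[symmetric])
    also have "\<dots> = (LINT t'|lborel. LINT x|lborel. Q t' x)"
      by (rule lborel_pair.Fubini_integral[OF intQ])
    also have "\<dots> = (LINT t'|lborel. LINT \<xi>|lborel. P t' \<xi>)"
    proof (rule integral_cong_AE)
      show "(\<lambda>t'. LINT x|lborel. Q t' x) \<in> borel_measurable lborel" by measurable
      show "(\<lambda>t'. LINT \<xi>|lborel. P t' \<xi>) \<in> borel_measurable lborel" unfolding P_def by measurable
      show "AE t' in lborel. (LINT x|lborel. Q t' x) = (LINT \<xi>|lborel. P t' \<xi>)"
        using is_evolution_fourier[OF u g]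
      proof eventually_elim
        case (elim t')
        have "(LINT x|lborel. Q t' x) = k t' * (LINT x|lborel. u (t', x) * (cis (- (x \<bullet> y)) * gaussian \<delta> x))"
          unfolding Q_def k_def G_def by (subst integral_mult_right_zero[symmetric]) (simp add: mult_ac)
        also have "\<dots> = k t' * mollify \<delta> (\<lambda>\<xi>. symb s m t' \<xi> * g \<xi>) y"
          by (simp only: has_fourier_mollify[OF elim \<delta>])
        also have "\<dots> = (LINT \<xi>|lborel. P t' \<xi>)"
          unfolding mollify_def P_def h_def symb_def by (subst integral_mult_right_zero[symmetric]) (simp add: mult_ac)
        finally show ?case .
      qed
    qed
    also have "\<dots> = (LINT \<xi>|lborel. LINT t'|lborel. P t' \<xi>)"
      by (rule lborel_pair.Fubini_integral[OF intP, symmetric])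
    also have "\<dots> = mollify \<delta> H y"
      unfolding mollify_def
    proof (intro Bochner_Integration.integral_cong refl)
      fix \<xi> :: 'a
      have "(LINT t'|lborel. P t' \<xi>) = h \<xi> * (LINT t'|lborel. cis (t' * norm \<xi> powr m) * k t')"
        unfolding P_def by (subst integral_mult_right_zero[symmetric]) (simp add: mult_ac)
      also have "\<dots> = h \<xi> * (cis (t * norm \<xi> powr m) * of_real (exp (- e * (norm \<xi> powr m)\<^sup>2 / 2)))"
        unfolding k_def by (simp only: heat_kernel_time_fourier[OF e])
      also have "(norm \<xi> powr m)\<^sup>2 = norm \<xi> powr (2 * m)"
        by (simp only: mult_2 powr_add power2_eq_square)
      finally show "(LINT t'|lborel. P t' \<xi>) = H \<xi> * complex_of_real (heat_kernel \<delta> (\<xi> - y))"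
        by (simp add: h_def H_def symb_def cutoff_def mult_ac)
    qed
    finally show "mollify \<delta> H y = (LINT x|lborel. w x * (cis (- (x \<bullet> y)) * gaussian \<delta> x))"
      by (simp add: G_def)
  qed
  moreover have "has_fourier (inverse_fourier H) H" by (rule inverse_fourier_has_fourier[OF H])
  ultimately have "AE x in lborel. w x = inverse_fourier H x"
    by (rule has_fourier_unique) simp
  then show ?thesis
    by eventually_elim (simp add: w_def H_def[abs_def] smoothed_def)
qed

lemma regularized_energy_le:
  fixes \<phi> g :: "'a::euclidean_space \<Rightarrow> complex"
  assumes u: "is_evolution s m \<phi> u" and g: "has_fourier \<phi> g" and tg: "tempered (\<lambda>\<xi>. of_real (norm \<xi> powr s) * g \<xi>)"
    and m: "0 < m" and \<gamma>: "\<gamma> \<le> 0" and fin: "energy (abs_weight \<gamma>) u < \<infinity>" and e: "0 < e"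
  shows "energy (abs_weight \<gamma>) (regularized (2 * m) e s m g) \<le> energy (abs_weight \<gamma>) u"
proof -
  have [measurable]: "u \<in> borel_measurable borel" by (rule is_evolution_measurable[OF u])
  have u_pair [measurable]: "u \<in> borel_measurable (borel \<Otimes>\<^sub>M borel)" by (simp add: borel_prod)
  have [measurable]: "g \<in> borel_measurable borel" using g by (auto simp: has_fourier_def tempered_def)
  define w where "w p = mollify e (\<lambda>t'. u (t', snd p)) (fst p)" for p
  have "(\<lambda>p. w p) \<in> borel_measurable ((borel :: real measure) \<Otimes>\<^sub>M (borel :: 'a measure))"
    unfolding w_def mollify_def by measurable
  then have [measurable]: "w \<in> borel_measurable borel" by (simp add: borel_prod)
  have "AE p in lborel. w p = regularized (2 * m) e s m g p"
  proof (rule AE_lborel_prodI)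
    show "AE t in lborel. AE x in lborel. w (t, x) = regularized (2 * m) e s m g (t, x)"
      using time_mollified_evolution[OF assms] by (simp add: w_def)
  qed measurable
  then have "energy (abs_weight \<gamma>) (regularized (2 * m) e s m g) = energy (abs_weight \<gamma>) w"
    unfolding energy_def by (intro nn_integral_cong_AE) (auto elim: eventually_mono)
  also have "\<dots> \<le> energy (abs_weight \<gamma>) u"
  proof (subst (1 2) energy_iterated_time)
    show "(\<integral>\<^sup>+x. ennreal ((abs_weight \<gamma> x)\<^sup>2) * (sq_integral (\<lambda>t. w (t, x))) \<partial>lborel)
      \<le> (\<integral>\<^sup>+x. ennreal ((abs_weight \<gamma> x)\<^sup>2) * (sq_integral (\<lambda>t. u (t, x))) \<partial>lborel)"
      unfolding w_def fst_conv snd_conv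
      by (intro nn_integral_mono mult_left_mono mollify_L2_contraction e) auto
  qed measurable
  finally show ?thesis .
qed

section \<open>Removing the regularization\<close>

text \<open>The increments are at most \<open>sqrt \<sigma> / 2 ^ k\<close>.\<close>

lemma geometric_increments_converge:
  fixes z :: "nat \<Rightarrow> complex"
  assumes \<sigma>: "\<And>k. 4 ^ k * (norm (z (Suc k) - z k))\<^sup>2 \<le> \<sigma>"
  shows "z \<longlonglongrightarrow> lim z" and "(norm (lim z - z k))\<^sup>2 \<le> 4 * (1 / 4) ^ k * \<sigma>"
proof -
  have \<sigma>0: "0 \<le> \<sigma>" using order_trans[OF _ \<sigma>[of 0]] by simp
  have step: "norm (z (Suc k) - z k) \<le> sqrt \<sigma> * (1 / 2) ^ k" for k
  proof -
    have "(2 ^ k * norm (z (Suc k) - z k))\<^sup>2 \<le> \<sigma>"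
    proof -
      have "((2::real) ^ k)\<^sup>2 = 4 ^ k" by (simp add: power2_eq_square flip: power_mult_distrib)
      then show ?thesis using \<sigma>[of k] by (simp only: power_mult_distrib)
    qed
    then have "2 ^ k * norm (z (Suc k) - z k) \<le> sqrt \<sigma>"
      by (rule real_le_rsqrt)
    then show ?thesis by (simp add: field_simps power_one_over)
  qed
  have bound: "norm (z (k + n) - z k) \<le> 2 * sqrt \<sigma> * (1 / 2) ^ k * (1 - (1 / 2) ^ n)" for k n
  proof (induction n)
    case (Suc n)
    have "norm (z (k + Suc n) - z k) \<le> norm (z (Suc (k + n)) - z (k + n)) + norm (z (k + n) - z k)"
      using norm_triangle_ineq[of "z (Suc (k + n)) - z (k + n)" "z (k + n) - z k"] by simp
    also have "\<dots> \<le> sqrt \<sigma> * (1 / 2) ^ (k + n) + 2 * sqrt \<sigma> * (1 / 2) ^ k * (1 - (1 / 2) ^ n)"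
      by (intro add_mono step Suc)
    also have "\<dots> = 2 * sqrt \<sigma> * (1 / 2) ^ k * (1 - (1 / 2) ^ Suc n)"
      by (simp add: power_add algebra_simps)
    finally show ?case .
  qed simp
  have bound': "norm (z (k + n) - z k) \<le> 2 * sqrt \<sigma> * (1 / 2) ^ k" for k n
  proof -
    have "2 * sqrt \<sigma> * (1 / 2) ^ k * (1 - (1 / 2) ^ n) \<le> 2 * sqrt \<sigma> * (1 / 2) ^ k * 1"
      using \<sigma>0 by (intro mult_left_mono) auto
    then show ?thesis using bound[of k n] by simp
  qed
  have lim0: "(\<lambda>k. 2 * sqrt \<sigma> * (1 / 2) ^ k) \<longlonglongrightarrow> 0"
    using tendsto_mult[OF tendsto_const[of "2 * sqrt \<sigma>"] LIMSEQ_power_zero[of "1 / 2 :: real"]] by simp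
  have "Cauchy z"
  proof (rule metric_CauchyI)
    fix r :: real assume r: "0 < r"
    then obtain M where M: "2 * sqrt \<sigma> * (1 / 2) ^ M < r / 2"
      using order_tendstoD(2)[OF lim0, of "r / 2"] by (auto simp: eventually_sequentially)
    have "dist (z i) (z j) < r" if "M \<le> i" "M \<le> j" for i j
    proof -
      have "norm (z i - z M) < r / 2" "norm (z j - z M) < r / 2"
        using bound'[of M "i - M"] bound'[of M "j - M"] M that by simp_all
      then show ?thesis
        using norm_triangle_ineq4[of "z i - z M" "z j - z M"] by (simp add: dist_norm)
    qed
    then show "\<exists>M. \<forall>m\<ge>M. \<forall>n\<ge>M. dist (z m) (z n) < r" by blast
  qed
  then show L: "z \<longlonglongrightarrow> lim z"
    using Cauchy_convergent convergent_LIMSEQ_iff by blast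
  have "(\<lambda>n. norm (z (n + k) - z k)) \<longlonglongrightarrow> norm (lim z - z k)"
    using LIMSEQ_ignore_initial_segment[OF L, of k] by (intro tendsto_intros)
  then have "norm (lim z - z k) \<le> 2 * sqrt \<sigma> * (1 / 2) ^ k"
    by (rule LIMSEQ_le_const2) (use bound'[of k] in \<open>auto simp: add.commute\<close>)
  then have "(norm (lim z - z k))\<^sup>2 \<le> (2 * sqrt \<sigma> * (1 / 2) ^ k)\<^sup>2"
    by (intro power_mono) auto
  also have "\<dots> = 4 * (1 / 4) ^ k * \<sigma>"
  proof -
    have "((1 / 2 :: real) ^ k)\<^sup>2 = (1 / 4) ^ k"
      by (simp add: power2_eq_square power_mult_distrib[symmetric])
    then show ?thesis using \<sigma>0 by (simp add: power_mult_distrib)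
  qed
  finally show "(norm (lim z - z k))\<^sup>2 \<le> 4 * (1 / 4) ^ k * \<sigma>" .
qed

text \<open>The regularized evolutions for \<open>(s', m')\<close> are Cauchy in the weighted space because those for
  \<open>(s, m)\<close> are. Along scales with geometrically decreasing increments they converge almost
  everywhere, with an error controlled by one function \<open>S\<close> of finite weighted integral. For almost
  every \<open>t\<close> the pairings with Gaussians then converge as well, and identify the transform of the
  limit.\<close>

theorem evolution_transfer_nonincreasing_weight:
  fixes \<phi> g :: "'a::euclidean_space \<Rightarrow> complex"
  assumes u: "is_evolution s m \<phi> u" and g: "has_fourier \<phi> g"
    and tg: "tempered (\<lambda>\<xi>. of_real (norm \<xi> powr s) * g \<xi>)" "tempered (\<lambda>\<xi>. of_real (norm \<xi> powr s') * g \<xi>)"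
    and m: "0 < m" "0 < m'" and sm: "s - m / 2 = s' - m' / 2" and \<gamma>: "\<gamma> \<le> 0" and fin: "energy (abs_weight \<gamma>) u < \<infinity>"
  shows "\<exists>v. is_evolution s' m' \<phi> v \<and> energy (abs_weight \<gamma>) v \<le> ennreal (m / m') * energy (abs_weight \<gamma>) u"
proof -
  define W :: "'a \<Rightarrow> real" where "W = abs_weight \<gamma>"
  have [measurable]: "W \<in> borel_measurable borel" unfolding W_def by measurable
  have g_meas [measurable]: "g \<in> borel_measurable borel" using g by (auto simp: has_fourier_def tempered_def)
  define \<kappa> where "\<kappa> = 2 * m"
  have \<kappa>: "0 < \<kappa>" using m by (simp add: \<kappa>_def)
  define V where "V e = regularized \<kappa> e s m g" for e
  define V' where "V' e = regularized \<kappa> e s' m' g" for e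
  have [measurable]: "V e \<in> borel_measurable borel" "V' e \<in> borel_measurable borel" for e
    unfolding V_def V'_def by measurable
  define p where "p = m / m'"
  have p: "0 < p" using m by (simp add: p_def)
  define E where "E = enn2real (energy W u)"
  have E: "energy W u = ennreal E" "0 \<le> E" using fin by (auto simp: E_def W_def less_top)
  define N where "N e = enn2real (energy W (V e))" for e
  have V_le: "energy W (V e) \<le> ennreal E" if "0 < e" for e
    using regularized_energy_le[OF u g tg(1) m(1) \<gamma> fin that] E(1) by (simp add: V_def W_def \<kappa>_def)
  have N: "energy W (V e) = ennreal (N e)" "0 \<le> N e" "N e \<le> E" if "0 < e" for e
  proof -
    have "energy W (V e) < \<infinity>" using V_le[OF that] by (simp add: le_less_trans)
    then show eq: "energy W (V e) = ennreal (N e)" by (simp add: N_def less_top)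
    show "0 \<le> N e" by (simp add: N_def)
    show "N e \<le> E" using V_le[OF that] E(2) unfolding eq by simp
  qed
  have V'_energy: "energy W (V' e) \<le> ennreal (p * E)" if "0 < e" for e
    using regularized_energy[OF m sm \<kappa> tg g_meas that, of W] N[OF that] p E(2)
    by (simp add: V_def[symmetric] V'_def[symmetric] p_def[symmetric] ennreal_mult[symmetric] ennreal_leI mult_left_mono)
  have diff: "energy W (\<lambda>q. V e q - V d q) \<le> ennreal (N e - N d)" if "0 < e" "e \<le> d" for e d
  proof -
    have d: "0 < d" using that by simp
    have sup: "energy W (\<lambda>q. V e q - V d q) + ennreal (N d) \<le> ennreal (N e)"
      using regularized_energy_superadditive[OF m sm \<kappa> tg g_meas that, of W] N(1)[OF that(1)] N(1)[OF d]
      by (simp add: V_def)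
    then obtain x where x: "energy W (\<lambda>q. V e q - V d q) = ennreal x" "0 \<le> x"
      by (cases "energy W (\<lambda>q. V e q - V d q)") (auto simp: top_unique)
    have "x + N d \<le> N e"
      using sup x N(2)[OF that(1)] N(2)[OF d] by (simp add: ennreal_plus[symmetric] del: ennreal_plus)
    then show ?thesis unfolding x(1) by (intro ennreal_leI) simp
  qed
  \<comment> \<open>The energies increase to a limit as the scale decreases to 0.\<close>
  define a where "a j = N (1 / real (Suc j))" for j
  have a_mono: "incseq a"
  proof (rule incseq_SucI)
    fix j
    have "energy W (\<lambda>q. V (1 / real (Suc (Suc j))) q - V (1 / real (Suc j)) q) + energy W (V (1 / real (Suc j))) \<le> energy W (V (1 / real (Suc (Suc j))))"
      using regularized_energy_superadditive[OF m sm \<kappa> tg g_meas, of "1 / real (Suc (Suc j))" "1 / real (Suc j)" W]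
      by (simp add: V_def frac_le)
    then have "energy W (V (1 / real (Suc j))) \<le> energy W (V (1 / real (Suc (Suc j))))"
      by (rule order_trans[rotated]) simp
    then show "a j \<le> a (Suc j)" using N[of "1 / real (Suc j)"] N[of "1 / real (Suc (Suc j))"] by (simp add: a_def)
  qed
  have a_bdd: "a j \<le> E" for j unfolding a_def by (rule N(3)) simp
  obtain L where L: "a \<longlonglongrightarrow> L" "\<And>j. a j \<le> L"
    using incseq_convergent[OF a_mono, of E] a_bdd by blast
  have "\<forall>k. \<exists>M. L - a M < (1 / 16) ^ k"
  proof
    fix k :: nat
    have "eventually (\<lambda>j. L - (1 / 16) ^ k < a j) sequentially"
      by (rule order_tendstoD(1)[OF L(1)]) simp
    then obtain M where "L - (1 / 16) ^ k < a M" by (auto simp: eventually_sequentially)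
    then show "\<exists>M. L - a M < (1 / 16) ^ k" by (intro exI[of _ M]) linarith
  qed
  then obtain M where M: "\<And>k. L - a (M k) < (1 / 16) ^ k" by metis
  \<comment> \<open>The sum makes \<open>r\<close> monotone and at least \<open>M k\<close>, the summand \<open>k\<close> makes it unbounded.\<close>
  define r where "r k = k + (\<Sum>j\<le>k. M j)" for k
  have r: "M k \<le> r k" "k \<le> r k" "r k \<le> r (Suc k)" for k
    by (auto simp: r_def member_le_sum intro!: trans_le_add2)
  define e where "e k = 1 / real (Suc (r k))" for k
  have e: "0 < e k" "e (Suc k) \<le> e k" for k
    using r(3)[of k] by (auto simp: e_def frac_le)
  have e_lim: "e \<longlonglongrightarrow> 0"
  proof (rule tendsto_sandwich[OF _ _ tendsto_const LIMSEQ_inverse_real_of_nat])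
    show "\<forall>\<^sub>F k in sequentially. 0 \<le> e k" using e(1) by (intro always_eventually allI less_imp_le)
    show "\<forall>\<^sub>F k in sequentially. e k \<le> inverse (real (Suc k))"
      using r(2) by (intro always_eventually allI) (simp add: e_def inverse_eq_divide frac_le)
  qed
  define D where "D k q = V' (e (Suc k)) q - V' (e k) q" for k q
  have [measurable]: "D k \<in> borel_measurable borel" for k unfolding D_def by measurable
  have D_energy: "energy W (D k) \<le> ennreal (p * (1 / 16) ^ k)" for k
  proof -
    have "energy W (D k) = ennreal p * energy W (\<lambda>q. V (e (Suc k)) q - V (e k) q)"
      using regularized_diff_energy[OF m sm \<kappa> tg g_meas e(1)[of "Suc k"] e(2)[of k], of W]
      by (simp add: D_def[abs_def] V_def V'_def p_def)
    also have "\<dots> \<le> ennreal p * ennreal (N (e (Suc k)) - N (e k))"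
      by (intro mult_left_mono diff e) auto
    also have "\<dots> \<le> ennreal p * ennreal ((1 / 16) ^ k)"
    proof (intro mult_left_mono ennreal_leI)
      have "L - a (r k) < (1 / 16) ^ k"
        using M[of k] incseqD[OF a_mono r(1)[of k]] by linarith
      then show "N (e (Suc k)) - N (e k) \<le> (1 / 16) ^ k"
        using L(2)[of "r (Suc k)"] by (simp add: a_def e_def)
    qed simp
    finally show ?thesis using p by (simp add: ennreal_mult)
  qed
  \<comment> \<open>The increments have energies of order \<open>(1 / 16) ^ k\<close>, so they remain summable with the weights
    \<open>4 ^ k\<close>, which in turn bound them pointwise by multiples of \<open>(1 / 2) ^ k\<close>.\<close>
  define S where "S q = (\<Sum>k. ennreal (4 ^ k * (norm (D k q))\<^sup>2))" for q
  have [measurable]: "S \<in> borel_measurable borel" unfolding S_def by measurable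
  have S_fin: "(\<integral>\<^sup>+q. ennreal ((W (snd q))\<^sup>2) * S q \<partial>lborel) < \<infinity>"
  proof -
    have "(\<integral>\<^sup>+q. ennreal ((W (snd q))\<^sup>2) * S q \<partial>lborel) = (\<integral>\<^sup>+q. (\<Sum>k. ennreal (4 ^ k) * ennreal ((W (snd q) * norm (D k q))\<^sup>2)) \<partial>lborel)"
      unfolding S_def ennreal_suminf_cmult[symmetric]
      by (intro nn_integral_cong suminf_cong) (simp add: power_mult_distrib ennreal_mult'[symmetric] mult_ac)
    also have "\<dots> = (\<Sum>k. \<integral>\<^sup>+q. ennreal (4 ^ k) * ennreal ((W (snd q) * norm (D k q))\<^sup>2) \<partial>lborel)"
      by (intro nn_integral_suminf) measurable
    also have "\<dots> = (\<Sum>k. ennreal (4 ^ k) * energy W (D k))"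
      unfolding energy_def by (intro suminf_cong nn_integral_cmult) measurable
    also have "\<dots> \<le> (\<Sum>k. ennreal (p * (1 / 4) ^ k))"
    proof (intro suminf_le summableI)
      fix k
      have "ennreal (4 ^ k) * energy W (D k) \<le> ennreal (4 ^ k) * ennreal (p * (1 / 16) ^ k)"
        by (intro mult_left_mono D_energy) auto
      also have "\<dots> = ennreal (p * (1 / 4) ^ k)"
      proof -
        have "(4::real) ^ k * (1 / 16) ^ k = (1 / 4) ^ k" by (simp flip: power_mult_distrib)
        then show ?thesis using p by (simp add: ennreal_mult[symmetric] mult.left_commute[of "4 ^ k"])
      qed
      finally show "ennreal (4 ^ k) * energy W (D k) \<le> ennreal (p * (1 / 4) ^ k)" .
    qed
    also have "\<dots> = ennreal (\<Sum>k. p * (1 / 4) ^ k)"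
      using p by (intro suminf_ennreal2) (auto intro!: summable_mult summable_geometric)
    also have "\<dots> < \<infinity>" by simp
    finally show ?thesis .
  qed
  define v where "v q = lim (\<lambda>k. V' (e k) q)" for q
  have [measurable]: "v \<in> borel_measurable borel" unfolding v_def by measurable
  have conv: "(\<lambda>k. V' (e k) q) \<longlonglongrightarrow> v q" "\<And>k. ennreal ((norm (v q - V' (e k) q))\<^sup>2) \<le> ennreal (4 * (1 / 4) ^ k) * S q" if "S q < \<infinity>" for q
  proof -
    define \<sigma> where "\<sigma> = enn2real (S q)"
    have \<sigma>: "S q = ennreal \<sigma>" "0 \<le> \<sigma>" using that by (auto simp: \<sigma>_def less_top)
    have inc: "4 ^ k * (norm (V' (e (Suc k)) q - V' (e k) q))\<^sup>2 \<le> \<sigma>" for k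
    proof -
      have "(\<Sum>i\<in>{k}. ennreal (4 ^ i * (norm (D i q))\<^sup>2)) \<le> S q"
        unfolding S_def by (rule sum_le_suminf) (auto intro: summableI)
      then have "ennreal (4 ^ k * (norm (D k q))\<^sup>2) \<le> ennreal \<sigma>" unfolding \<sigma>(1) by simp
      then have "4 ^ k * (norm (D k q))\<^sup>2 \<le> \<sigma>" using \<sigma>(2) by (subst (asm) ennreal_le_iff) auto
      then show ?thesis unfolding D_def .
    qed
    show "(\<lambda>k. V' (e k) q) \<longlonglongrightarrow> v q"
      unfolding v_def by (rule geometric_increments_converge(1)[of "\<lambda>k. V' (e k) q" \<sigma>, OF inc])
    fix k
    have "(norm (v q - V' (e k) q))\<^sup>2 \<le> 4 * (1 / 4) ^ k * \<sigma>"
      unfolding v_def by (rule geometric_increments_converge(2)[of "\<lambda>k. V' (e k) q" \<sigma>, OF inc])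
    then show "ennreal ((norm (v q - V' (e k) q))\<^sup>2) \<le> ennreal (4 * (1 / 4) ^ k) * S q"
      unfolding \<sigma>(1) using \<sigma>(2) by (subst ennreal_mult[symmetric]) (auto intro: ennreal_leI)
  qed
  have W_pos: "0 < W x" if "x \<noteq> 0" for x using that by (simp add: W_def abs_weight_def)
  have pair_fin: "AE t in lborel. (\<integral>\<^sup>+x. ennreal ((W x)\<^sup>2) * S (t, x) \<partial>lborel) < \<infinity>"
  proof -
    have [measurable]: "S \<in> borel_measurable (borel \<Otimes>\<^sub>M borel)" by (simp add: borel_prod)
    have "(\<integral>\<^sup>+q. ennreal ((W (snd q))\<^sup>2) * S q \<partial>lborel) = (\<integral>\<^sup>+t. \<integral>\<^sup>+x. ennreal ((W x)\<^sup>2) * S (t, x) \<partial>lborel \<partial>lborel)"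
      unfolding lborel_prod[symmetric] by (subst lborel.nn_integral_fst[symmetric]) auto
    then have "(\<integral>\<^sup>+t. \<integral>\<^sup>+x. ennreal ((W x)\<^sup>2) * S (t, x) \<partial>lborel \<partial>lborel) \<noteq> \<infinity>" using S_fin by simp
    then have "AE t in lborel. (\<integral>\<^sup>+x. ennreal ((W x)\<^sup>2) * S (t, x) \<partial>lborel) \<noteq> \<infinity>"
      by (intro nn_integral_PInf_AE) measurable
    then show ?thesis by eventually_elim (simp add: less_top)
  qed
  have S_AE: "AE x in lborel. S (t, x) < \<infinity>" if "(\<integral>\<^sup>+x. ennreal ((W x)\<^sup>2) * S (t, x) \<partial>lborel) < \<infinity>" for t
  proof -
    have "AE x in lborel. ennreal ((W x)\<^sup>2) * S (t, x) \<noteq> \<infinity>"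
      using that by (intro nn_integral_PInf_AE) auto
    then show ?thesis
      using AE_lborel_nonzero
    proof eventually_elim
      case (elim x)
      then show ?case using W_pos[of x] by (auto simp: ennreal_mult_eq_top_iff less_top)
    qed
  qed
  have v_energy: "energy W v \<le> ennreal (p * E)"
    unfolding energy_def
  proof (rule nn_integral_le_of_AE_tendsto)
    show "(\<integral>\<^sup>+q. ennreal ((W (snd q) * norm (V' (e k) q))\<^sup>2) \<partial>lborel) \<le> ennreal (p * E)" for k
      using V'_energy[OF e(1)] by (simp add: energy_def)
    have "AE q in lborel. S q < \<infinity>"
    proof (rule AE_lborel_prodI)
      show "AE t in lborel. AE x in lborel. S (t, x) < \<infinity>"
        using pair_fin by eventually_elim (rule S_AE)
    qed measurable
    then show "AE q in lborel. (\<lambda>k. ennreal ((W (snd q) * norm (V' (e k) q))\<^sup>2)) \<longlonglongrightarrow> ennreal ((W (snd q) * norm (v q))\<^sup>2)"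
      by eventually_elim (intro tendsto_ennrealI tendsto_intros conv(1))
  qed measurable
  have v_fin: "AE t in lborel. (weighted_sq_integral \<gamma> (\<lambda>x. v (t, x))) < \<infinity>"
  proof -
    have [measurable]: "v \<in> borel_measurable (borel \<Otimes>\<^sub>M borel)" by (simp add: borel_prod)
    have "(\<integral>\<^sup>+t. \<integral>\<^sup>+x. ennreal ((W x * norm (v (t, x)))\<^sup>2) \<partial>lborel \<partial>lborel) \<noteq> \<infinity>"
      using v_energy by (subst (asm) energy_iterated) (auto simp: top_unique)
    then have "AE t in lborel. (\<integral>\<^sup>+x. ennreal ((W x * norm (v (t, x)))\<^sup>2) \<partial>lborel) \<noteq> \<infinity>"
      by (intro nn_integral_PInf_AE) measurable
    then show ?thesis by eventually_elim (simp add: less_top W_def abs_weight_def)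
  qed
  have "AE t in lborel. has_fourier (\<lambda>x. v (t, x)) (\<lambda>\<xi>. symb s' m' t \<xi> * g \<xi>)"
    using pair_fin v_fin
  proof eventually_elim
    case (elim t)
    define h where "h \<xi> = symb s' m' t \<xi> * g \<xi>" for \<xi>
    have th: "tempered h"
    proof -
      have "tempered (\<lambda>\<xi>. cis (t * norm \<xi> powr m') * (of_real (norm \<xi> powr s') * g \<xi>))"
        by (rule tempered_mult_bounded[OF tg(2)]) auto
      then show ?thesis by (simp add: h_def[abs_def] symb_def mult_ac)
    qed
    have [measurable]: "h \<in> borel_measurable borel" by (rule tempered_measurable[OF th])
    define H where "H k \<xi> = of_real (1 * cutoff \<kappa> (e k) (norm \<xi>)) * h \<xi>" for k \<xi>
    have H: "integrable lborel (H k)" for k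
      unfolding H_def h_def by (rule smoothed_integrable[OF tg(2)]) (use \<kappa> e in auto)
    have HV: "has_fourier (\<lambda>x. V' (e k) (t, x)) (H k)" for k
      using inverse_fourier_has_fourier[OF H[of k]] by (simp add: V'_def smoothed_def H_def[abs_def] h_def)
    have tv: "tempered (\<lambda>x. v (t, x))"
      by (rule weighted_L2_tempered[OF _ \<gamma> elim(2)]) measurable
    have "has_fourier (\<lambda>x. v (t, x)) h"
    proof (rule has_fourierI[OF tv th])
      fix \<delta> :: real and y :: 'a assume \<delta>: "0 < \<delta>"
      define G where "G x = cis (- (x \<bullet> y)) * gaussian \<delta> x" for x
      have G: "rapidly_decreasing G" unfolding G_def[abs_def] by (rule cis_gaussian_rapidly_decreasing[OF \<delta>])
      have [measurable]: "G \<in> borel_measurable borel" using G by (simp add: rapidly_decreasing_def)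
      obtain M :: nat where M: "- \<gamma> \<le> real M" using real_arch_simple by blast
      obtain C where C: "0 < C" "\<And>x. norm (G x) \<le> C / bsq x ^ (M + DIM('a))" using rapidly_decreasing_bound[OF G] by blast
      define IG where "IG = weighted_sq_integral (- \<gamma>) G"
      have IG: "IG < \<infinity>" unfolding IG_def by (rule dual_weight_finite[OF \<gamma> M _ C(2)]) simp
      define IS where "IS = (\<integral>\<^sup>+x. ennreal ((W x)\<^sup>2) * S (t, x) \<partial>lborel)"
      have IS: "IS < \<infinity>" using elim(1) by (simp add: IS_def)
      have lhs: "(\<lambda>k. mollify \<delta> (H k) y) \<longlonglongrightarrow> mollify \<delta> h y"
        unfolding mollify_def
      proof (rule integral_dominated_convergence)
        show "integrable lborel (\<lambda>\<xi>. norm (h \<xi> * of_real (heat_kernel \<delta> (\<xi> - y))))"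
          by (intro integrable_norm mollify_integrable th \<delta>)
        show "AE \<xi> in lborel. norm (H k \<xi> * of_real (heat_kernel \<delta> (\<xi> - y))) \<le> norm (h \<xi> * of_real (heat_kernel \<delta> (\<xi> - y)))" for k
        proof (intro AE_I2)
          fix \<xi> :: 'a
          have "norm (H k \<xi>) \<le> norm (h \<xi>)"
            using cutoff_le_1[of "e k" \<kappa> "norm \<xi>"] e(1)[of k] by (simp add: H_def norm_mult mult_left_le_one_le)
          then show "norm (H k \<xi> * of_real (heat_kernel \<delta> (\<xi> - y))) \<le> norm (h \<xi> * of_real (heat_kernel \<delta> (\<xi> - y)))"
            unfolding norm_mult by (intro mult_right_mono) auto
        qed
        show "AE \<xi> in lborel. (\<lambda>k. H k \<xi> * of_real (heat_kernel \<delta> (\<xi> - y))) \<longlonglongrightarrow> h \<xi> * of_real (heat_kernel \<delta> (\<xi> - y))"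
        proof (intro AE_I2 tendsto_mult tendsto_const)
          fix \<xi> :: 'a
          have "(\<lambda>k. H k \<xi>) \<longlonglongrightarrow> of_real (1 * cutoff \<kappa> 0 (norm \<xi>)) * h \<xi>"
            unfolding H_def cutoff_def by (intro tendsto_intros e_lim) simp
          then show "(\<lambda>k. H k \<xi>) \<longlonglongrightarrow> h \<xi>" by (simp add: cutoff_def)
        qed
        show "(\<lambda>\<xi>. H k \<xi> * of_real (heat_kernel \<delta> (\<xi> - y))) \<in> borel_measurable lborel" for k
          unfolding H_def by measurable
      qed measurable
      have rhs: "(\<lambda>k. LINT x|lborel. V' (e k) (t, x) * G x) \<longlonglongrightarrow> (LINT x|lborel. v (t, x) * G x)"
      proof -
        have int: "integrable lborel (\<lambda>x. v (t, x) * G x)" "integrable lborel (\<lambda>x. V' (e k) (t, x) * G x)" for k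
          using tv HV[of k] G by (auto intro!: tempered_rapidly_decreasing_integrable simp: has_fourier_def)
        have le: "ennreal (norm ((LINT x|lborel. v (t, x) * G x) - (LINT x|lborel. V' (e k) (t, x) * G x))) \<le> ennreal ((1 / 2) ^ k) * (ennreal 4 * IS + IG)" for k
        proof -
          have "(LINT x|lborel. v (t, x) * G x) - (LINT x|lborel. V' (e k) (t, x) * G x) = (LINT x|lborel. (v (t, x) - V' (e k) (t, x)) * G x)"
            by (simp only: Bochner_Integration.integral_diff[OF int, symmetric] left_diff_distrib)
          then have "ennreal (norm ((LINT x|lborel. v (t, x) * G x) - (LINT x|lborel. V' (e k) (t, x) * G x)))
              \<le> (\<integral>\<^sup>+x. ennreal (norm ((v (t, x) - V' (e k) (t, x)) * G x)) \<partial>lborel)"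
            using norm_integral_le_nn_integral[of lborel "\<lambda>x. (v (t, x) - V' (e k) (t, x)) * G x"] by (simp only:)
          \<comment> \<open>The squared error is of order \<open>(1 / 4) ^ k\<close>; the parameter \<open>2 ^ k\<close> of the pairing balances the two
            terms at \<open>(1 / 2) ^ k\<close>.\<close>
          also have "\<dots> \<le> ennreal (2 ^ k) * weighted_sq_integral \<gamma> (\<lambda>x. v (t, x) - V' (e k) (t, x)) + ennreal (1 / 2 ^ k) * IG"
            unfolding IG_def by (rule weighted_L2_pairing) auto
          also have "weighted_sq_integral \<gamma> (\<lambda>x. v (t, x) - V' (e k) (t, x)) \<le> (\<integral>\<^sup>+x. ennreal (4 * (1 / 4) ^ k) * (ennreal ((W x)\<^sup>2) * S (t, x)) \<partial>lborel)"
          proof (rule nn_integral_mono_AE)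
            show "AE x in lborel. ennreal ((norm x powr \<gamma> * norm (v (t, x) - V' (e k) (t, x)))\<^sup>2) \<le> ennreal (4 * (1 / 4) ^ k) * (ennreal ((W x)\<^sup>2) * S (t, x))"
              using S_AE[OF elim(1)]
            proof eventually_elim
              case (elim x)
              have "ennreal ((norm x powr \<gamma> * norm (v (t, x) - V' (e k) (t, x)))\<^sup>2) = ennreal ((W x)\<^sup>2) * ennreal ((norm (v (t, x) - V' (e k) (t, x)))\<^sup>2)"
                by (simp add: W_def abs_weight_def power_mult_distrib ennreal_mult)
              also have "\<dots> \<le> ennreal ((W x)\<^sup>2) * (ennreal (4 * (1 / 4) ^ k) * S (t, x))"
                by (intro mult_left_mono conv(2) elim) auto
              finally show ?case by (simp only: mult_ac)
            qed
          qed
          also have "\<dots> = ennreal (4 * (1 / 4) ^ k) * IS"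
            unfolding IS_def by (intro nn_integral_cmult) measurable
          also have "ennreal (2 ^ k) * (ennreal (4 * (1 / 4) ^ k) * IS) + ennreal (1 / 2 ^ k) * IG = ennreal ((1 / 2) ^ k) * (ennreal 4 * IS + IG)"
          proof -
            have "(2::real) ^ k * (4 * (1 / 4) ^ k) = (1 / 2) ^ k * 4"
              by (simp add: mult.left_commute[of "2 ^ k"] mult.commute flip: power_mult_distrib)
            then have "ennreal (2 ^ k) * ennreal (4 * (1 / 4) ^ k) = ennreal ((1 / 2) ^ k) * ennreal 4"
              by (simp only: ennreal_mult''[symmetric] ennreal_mult'[symmetric]) (simp add: ennreal_mult[symmetric])
            then have "ennreal (2 ^ k) * (ennreal (4 * (1 / 4) ^ k) * IS) = ennreal ((1 / 2) ^ k) * (ennreal 4 * IS)"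
              by (simp only: mult.assoc[symmetric])
            then show ?thesis by (simp only: distrib_left power_one_over)
          qed
          finally show ?thesis by (simp add: add_mono mult_left_mono)
        qed
        obtain B where B: "ennreal 4 * IS + IG = ennreal B" "0 \<le> B"
          using IS IG by (cases "ennreal 4 * IS + IG") (auto simp: ennreal_mult_eq_top_iff)
        have bnd: "norm ((LINT x|lborel. v (t, x) * G x) - (LINT x|lborel. V' (e k) (t, x) * G x)) \<le> (1 / 2) ^ k * B" for k
          using le[of k] B by (simp add: ennreal_mult[symmetric])
        have lim_B: "(\<lambda>k. (1 / 2) ^ k * B) \<longlonglongrightarrow> 0"
          using tendsto_mult[OF LIMSEQ_power_zero[of "1 / 2 :: real"] tendsto_const[of B]] by simp
        have "(\<lambda>k. (LINT x|lborel. v (t, x) * G x) - (LINT x|lborel. V' (e k) (t, x) * G x)) \<longlonglongrightarrow> 0"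
          by (rule Lim_null_comparison[OF _ lim_B]) (intro always_eventually allI bnd)
        then have "(\<lambda>k. (LINT x|lborel. v (t, x) * G x) - ((LINT x|lborel. v (t, x) * G x) - (LINT x|lborel. V' (e k) (t, x) * G x))) \<longlonglongrightarrow> (LINT x|lborel. v (t, x) * G x) - 0"
          by (intro tendsto_diff tendsto_const)
        then show ?thesis by simp
      qed
      have "mollify \<delta> (H k) y = (LINT x|lborel. V' (e k) (t, x) * G x)" for k
        unfolding G_def by (rule has_fourier_mollify[OF HV \<delta>])
      then show "mollify \<delta> h y = (LINT x|lborel. v (t, x) * (cis (- (x \<bullet> y)) * gaussian \<delta> x))"
        using LIMSEQ_unique[OF lhs] rhs unfolding G_def by simp
    qed
    then show ?case by (simp add: h_def[abs_def])
  qed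
  then have "is_evolution s' m' \<phi> v" by (intro is_evolutionI[OF _ g]) measurable
  moreover have "energy W v \<le> ennreal (m / m') * energy W u"
    using v_energy p E by (simp add: p_def[symmetric] ennreal_mult)
  ultimately show ?thesis unfolding W_def by blast
qed

section \<open>Comparison of the weighted norms\<close>

lemma abs_D_defined_tempered:
  assumes "abs_D_defined s \<phi>" "has_fourier \<phi> g"
  shows "tempered (\<lambda>\<xi>. of_real (norm \<xi> powr s) * g \<xi>)"
proof -
  obtain g' where g': "has_fourier \<phi> g'" "tempered (\<lambda>\<xi>. of_real (norm \<xi> powr s) * g' \<xi>)"
    using assms(1) by (auto simp: abs_D_defined_def)
  have [measurable]: "g \<in> borel_measurable borel" using assms(2) by (auto simp: has_fourier_def tempered_def)
  show ?thesis
  proof (rule tempered_cong_AE[OF g'(2)])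
    show "AE \<xi> in lborel. of_real (norm \<xi> powr s) * g' \<xi> = of_real (norm \<xi> powr s) * g \<xi>"
      using has_fourier_unique_transform[OF g'(1) assms(2)] by eventually_elim simp
  qed measurable
qed

lemma zero_is_evolution:
  fixes \<phi> g :: "'a::euclidean_space \<Rightarrow> complex"
  assumes g: "has_fourier \<phi> g" and z: "AE \<xi> in lborel. g \<xi> = 0"
  shows "is_evolution s m \<phi> (\<lambda>_. 0)"
proof -
  have [measurable]: "g \<in> borel_measurable borel" using g by (auto simp: has_fourier_def tempered_def)
  have "has_fourier (\<lambda>x::'a. 0) (fourier_integral (\<lambda>x::'a. 0))" by (rule integrable_has_fourier) simp
  then have 0: "has_fourier (\<lambda>x::'a. 0) (\<lambda>\<xi>::'a. 0)" by (simp add: fourier_integral_def[abs_def])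
  have "has_fourier (\<lambda>x::'a. 0) (\<lambda>\<xi>. symb s m t \<xi> * g \<xi>)" for t
  proof (rule has_fourier_cong_AE[OF 0])
    show "AE \<xi> in lborel. 0 = symb s m t \<xi> * g \<xi>" using z by eventually_elim simp
  qed auto
  then show ?thesis by (intro is_evolutionI[OF _ g]) auto
qed

text \<open>For \<open>\<gamma> > 0\<close> the datum vanishes, and the zero evolution serves for all parameters.\<close>

theorem evolution_transfer:
  fixes \<phi> :: "'a::euclidean_space \<Rightarrow> complex"
  assumes u: "is_evolution s m \<phi> u" and D: "abs_D_defined s \<phi>" "abs_D_defined s' \<phi>"
    and m: "0 < m" "0 < m'" and sm: "s - m / 2 = s' - m' / 2" and fin: "energy (abs_weight \<gamma>) u < \<infinity>"
  shows "\<exists>v. is_evolution s' m' \<phi> v \<and> energy (abs_weight \<gamma>) v \<le> ennreal (m / m') * energy (abs_weight \<gamma>) u"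
proof -
  obtain g where g: "has_fourier \<phi> g" using is_evolution_has_fourier[OF u] by blast
  show ?thesis
  proof (cases "0 < \<gamma>")
    case True
    have "is_evolution s' m' \<phi> (\<lambda>_. 0)"
      by (rule zero_is_evolution[OF g growing_weight_finite_energy_imp_zero[OF u g m(1) True fin]])
    then show ?thesis by (intro exI[of _ "\<lambda>_. 0"]) (simp add: energy_def)
  next
    case False
    then show ?thesis
      by (intro evolution_transfer_nonincreasing_weight[OF u g abs_D_defined_tempered[OF D(1) g]
            abs_D_defined_tempered[OF D(2) g] m sm _ fin]) simp
  qed
qed

lemma evolution_norm_transfer_le:
  fixes \<phi> :: "'a::euclidean_space \<Rightarrow> complex"
  assumes D: "abs_D_defined s \<phi>" "abs_D_defined s' \<phi>" and m: "0 < m" "0 < m'" and sm: "s - m / 2 = s' - m' / 2"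
  shows "evolution_norm (abs_weight \<gamma>) s' m' \<phi> \<le> ennreal (sqrt (m / m')) * evolution_norm (abs_weight \<gamma>) s m \<phi>"
proof (cases "evolution_norm (abs_weight \<gamma>) s m \<phi> = \<infinity>")
  case True
  then show ?thesis using m by (simp add: ennreal_mult_top)
next
  case False
  then obtain u where u: "is_evolution s m \<phi> u" using evolution_norm_no_evolution by blast
  have fin: "energy (abs_weight \<gamma>) u < \<infinity>"
    using False unfolding evolution_norm_eq[OF u] L2_norm_top_iff energy_eq[symmetric] by (simp add: less_top)
  obtain v where v: "is_evolution s' m' \<phi> v" "energy (abs_weight \<gamma>) v \<le> ennreal (m / m') * energy (abs_weight \<gamma>) u"
    using evolution_transfer[OF u D m sm fin] by blast
  show ?thesis
    unfolding evolution_norm_eq[OF u] evolution_norm_eq[OF v(1)]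
    by (rule weighted_L2_norm_le_scaled[OF v(2) _ fin]) (use m in simp)
qed

theorem evolution_norm_transfer:
  fixes \<phi> :: "'a::euclidean_space \<Rightarrow> complex"
  assumes D: "abs_D_defined s \<phi>" "abs_D_defined s' \<phi>" and m: "0 < m" "0 < m'" and sm: "s - m / 2 = s' - m' / 2"
  shows "evolution_norm (abs_weight \<gamma>) s' m' \<phi> = ennreal (sqrt (m / m')) * evolution_norm (abs_weight \<gamma>) s m \<phi>"
proof (rule antisym)
  show "evolution_norm (abs_weight \<gamma>) s' m' \<phi> \<le> ennreal (sqrt (m / m')) * evolution_norm (abs_weight \<gamma>) s m \<phi>"
    by (rule evolution_norm_transfer_le[OF D m sm])
  have "ennreal (sqrt (m / m')) * evolution_norm (abs_weight \<gamma>) s m \<phi>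
      \<le> ennreal (sqrt (m / m')) * (ennreal (sqrt (m' / m)) * evolution_norm (abs_weight \<gamma>) s' m' \<phi>)"
    by (intro mult_left_mono evolution_norm_transfer_le D m sm[symmetric]) simp
  also have "\<dots> = evolution_norm (abs_weight \<gamma>) s' m' \<phi>"
  proof -
    have "sqrt (m / m') * sqrt (m' / m) = 1" using m by (simp flip: real_sqrt_mult)
    then have "ennreal (sqrt (m / m')) * ennreal (sqrt (m' / m)) = 1"
      using m by (simp add: ennreal_mult[symmetric] del: real_sqrt_divide)
    then show ?thesis by (simp add: mult.assoc[symmetric])
  qed
  finally show "ennreal (sqrt (m / m')) * evolution_norm (abs_weight \<gamma>) s m \<phi> \<le> evolution_norm (abs_weight \<gamma>) s' m' \<phi>" .
qed

text \<open>For \<open>\<alpha> > m/2\<close> both sides are infinite, since \<open>\<langle>x\<rangle> powr \<gamma> \<ge> |x| powr \<gamma>\<close> for \<open>\<gamma> \<ge> 0\<close>.\<close>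

lemma opnorms_agree:
  assumes m: "0 < m"
  shows "evolution_opnorm (jap_weight (\<alpha> - m / 2) :: 'a::euclidean_space \<Rightarrow> real) \<alpha> m
    = evolution_opnorm (abs_weight (\<alpha> - m / 2) :: 'a \<Rightarrow> real) \<alpha> m"
proof (cases "\<alpha> \<le> m / 2")
  case True
  then show ?thesis by (intro opnorm_weights_agree) auto
next
  case False
  define \<gamma> where "\<gamma> = \<alpha> - m / 2"
  have \<gamma>: "0 < \<gamma>" using False by (simp add: \<gamma>_def)
  have "evolution_opnorm (abs_weight \<gamma> :: 'a \<Rightarrow> real) \<alpha> m = \<infinity>"
    using False m by (intro growing_weight_opnorm_infinite \<gamma>) auto
  moreover have "evolution_opnorm (abs_weight \<gamma> :: 'a \<Rightarrow> real) \<alpha> m \<le> evolution_opnorm (jap_weight \<gamma> :: 'a \<Rightarrow> real) \<alpha> m"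
    unfolding evolution_opnorm_def
  proof (rule SUP_subset_mono[OF order_refl])
    fix \<phi> :: "'a \<Rightarrow> complex"
    show "evolution_norm (abs_weight \<gamma>) \<alpha> m \<phi> \<le> evolution_norm (jap_weight \<gamma>) \<alpha> m \<phi>"
    proof (rule evolution_norm_mono_weight)
      show "AE x::'a in lborel. \<bar>abs_weight \<gamma> x\<bar> \<le> \<bar>jap_weight \<gamma> x\<bar>"
      proof (rule AE_I2)
        fix x :: 'a
        show "\<bar>abs_weight \<gamma> x\<bar> \<le> \<bar>jap_weight \<gamma> x\<bar>"
          using abs_weight_le_jap_weight[of \<gamma> x] \<gamma> by (simp add: jap_weight_def abs_weight_def)
      qed
    qed measurable
  qed
  ultimately show ?thesis unfolding \<gamma>_def by (simp add: top_unique)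
qed

theorem theorem3p2:
  fixes m \<alpha> \<beta> :: real and \<phi> :: "'a::euclidean_space \<Rightarrow> complex"
  assumes "m > 0"
  shows
    "(abs_D_defined \<beta> \<phi> \<and> abs_D_defined (m / 2 + \<beta> - 1) \<phi> \<longrightarrow>
        evolution_norm (abs_weight (\<beta> - 1)) \<beta> 2 \<phi> =
          ennreal (sqrt (m / 2)) * evolution_norm (abs_weight (\<beta> - 1)) (m / 2 + \<beta> - 1) m \<phi> \<and>
        (evolution_norm (abs_weight (\<beta> - 1)) \<beta> 2 \<phi> < \<infinity> \<longleftrightarrow>
          evolution_norm (abs_weight (\<beta> - 1)) (m / 2 + \<beta> - 1) m \<phi> < \<infinity>)) \<and>
     (\<alpha> \<le> m / 2 \<longrightarrow>
        evolution_norm (jap_weight (\<alpha> - m / 2)) \<alpha> m \<phi> \<le>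
          evolution_norm (abs_weight (\<alpha> - m / 2)) \<alpha> m \<phi> \<and>
        evolution_norm (abs_weight (\<alpha> - m / 2)) \<alpha> m \<phi> \<le>
          (SUP l \<in> {0<..}. evolution_norm (jap_weight (\<alpha> - m / 2)) \<alpha> m (dilate l \<phi>))) \<and>
     evolution_opnorm (jap_weight (\<alpha> - m / 2) :: 'a \<Rightarrow> real) \<alpha> m =
       evolution_opnorm (abs_weight (\<alpha> - m / 2) :: 'a \<Rightarrow> real) \<alpha> m"
proof (intro conjI impI)
  assume D: "abs_D_defined \<beta> \<phi> \<and> abs_D_defined (m / 2 + \<beta> - 1) \<phi>"
  show eq: "evolution_norm (abs_weight (\<beta> - 1)) \<beta> 2 \<phi> =
      ennreal (sqrt (m / 2)) * evolution_norm (abs_weight (\<beta> - 1)) (m / 2 + \<beta> - 1) m \<phi>"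
    using D assms by (intro evolution_norm_transfer) auto
  show "evolution_norm (abs_weight (\<beta> - 1)) \<beta> 2 \<phi> < \<infinity> \<longleftrightarrow>
      evolution_norm (abs_weight (\<beta> - 1)) (m / 2 + \<beta> - 1) m \<phi> < \<infinity>"
    using assms unfolding eq by (auto simp: ennreal_mult_less_top)
next
  assume "\<alpha> \<le> m / 2"
  then show "evolution_norm (jap_weight (\<alpha> - m / 2)) \<alpha> m \<phi> \<le> evolution_norm (abs_weight (\<alpha> - m / 2)) \<alpha> m \<phi>"
    by (intro jap_weight_norm_le) simp
  show "evolution_norm (abs_weight (\<alpha> - m / 2)) \<alpha> m \<phi> \<le>
      (SUP l \<in> {0<..}. evolution_norm (jap_weight (\<alpha> - m / 2)) \<alpha> m (dilate l \<phi>))"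
    by (rule abs_weight_norm_le_SUP_dilations) simp
next
  show "evolution_opnorm (jap_weight (\<alpha> - m / 2) :: 'a \<Rightarrow> real) \<alpha> m =
       evolution_opnorm (abs_weight (\<alpha> - m / 2) :: 'a \<Rightarrow> real) \<alpha> m"
    by (rule opnorms_agree[OF assms])
qed

end
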